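(* Let $p$ be a monic hyperbolic polynomial of degree $d\ge 2$ with connected Julia set, all of whose critical points are simple. Then there exists $\epsilon_T\in(0,R]$ such that for every $a$ with $|a|<\epsilon_T$ and every critical point $c$ of $p$: the primary horizontal component $H_{c,a}$ of the critical locus $\mathscr C_a$ is (conformally) a punctured disk, and the map $\varphi_{a,+}$ extends holomorphically from $H_{c,a}\cap V_+$ to a biholomorphism $\varphi_{a,+}\colon H_{c,a}\to\mathbb C\setminus\overline{\mathbb D}$.
   Context: $\mathbb D_\rho=\{|z|<\rho\}$, $\mathbb D=\mathbb D_1$. Let $p(x)=x^d+q(x)$ with $d\ge2$, $\deg q<d$, and for $a\in\mathbb C$ let $f_a(x,y)=(p(x)-ay,x)$ on $\mathbb C^2$. Fix $R>0$, $0<r<1$ and $\alpha>0$ such that $|q(y)/y^d|+(R+1)/|y|^{d-1}<r$ and $|p(y)|>(2R+1)|y|$ whenever $|y|\ge\alpha$. Put $V_+=\{|x|>|y|,\ |x|>\alpha\}$, $V_-=\{|y|>|x|,\ |y|>\alpha\}$; for $a\in\mathbb D_R$ one has $f_a(V_+)\subset V_+$, and $f_a^{-1}(V_-)\subset V_-$ if $a\neq0$. Write $(x_n,y_n)=f_a^{n}(x,y)$. For $a\in\mathbb D_R$ (principal logarithms): $\varphi_{a,+}(x,y)=x\exp\big(\sum_{k\ge1}d^{-k}\log(x_k/x_{k-1}^d)\big)$ on $V_+$, and $\varphi_{a,-}(x,y)=y\exp\big(\sum_{k\ge1}d^{-k}\log(a\,y_{-k}/y_{-(k-1)}^d)\big)$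 on $V_-$, where each $a\,y_{-k}/y_{-(k-1)}^d$ extends holomorphically to $a=0$. They are holomorphic in $(x,y,a)$, with $\varphi_{a,+}\circ f_a=\varphi_{a,+}^d$ and $a\,\varphi_{a,-}\circ f_a^{-1}=\varphi_{a,-}^d$ ($a\ne0$). $K_a^{+}$ (resp. $K_a^-$, $a\neq 0$) is the set of points with bounded forward (resp. backward) orbit, $K_0^-=C(p)=\{x=p(y)\}$, and $U_a^\pm=\mathbb C^2\setminus K_a^\pm$. By the functional equations, $\varphi_{a,\pm}$ extend to $U_a^\pm$ up to multiplication by $d^n$-th roots of unity ($\varphi_{a,+}(z)^{d^n}=\varphi_{a,+}(f_a^n z)$ when $f_a^nz\in V_+$; $\varphi_{a,-}(z)^{d^n}=a^{1+d+\dots+d^{n-1}}\varphi_{a,-}(f_a^{-n}z)$ when $f_a^{-n}z\in V_-$, $a\ne0$; $\varphi_{0,-}^d=p(y)-x$). The holomorphic foliations $\mathcal F_a^\pm$ of $U_a^\pm$ are those whose leaves are locally the level sets of $\varphi_{a,\pm}$. The critical locus $\mathscr C_a\subset U_a^+\cap U_a^-$ is the zero variety (with multiplicity) of $w_a$, where $d\log\varphi_{a,+}\wedge d\log\varphi_{a,-}=w_a\,dx\wedge dy$; it is the tangency locus of $\mathcal F_a^+$ and $\mathcal F_a^-$. With $u=1/x$, the functions $\varphi_{a,+}^{-1}$ and $\varphi_{a,-}^{-d}$ extend holomorphically in $(u,y,a)$ across $\{u=0\}$, and $d\varphi_{+}^{-1}\wedge d\varphi_{-}^{-d}\wedge da=u^2\,\tilde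 w(u,y,a)\,du\wedge dy\wedge da$ with $\tilde w$ holomorphic; $\mathscr C_a$ is extended across $\{u=0\}$ as the zero variety of $\tilde w(\cdot,\cdot,a)$. For each simple critical point $c$ of $p$ the extended $\mathscr C_a$ passes through $(x,y)=(\infty,c)$ and is smooth there. The primary horizontal component $H_{c,a}$ is the component of $\mathscr C_a$ asymptotic to $y=c$ as $|x|\to\infty$, i.e. the one whose extension contains $(\infty,c)$. *)

theory Defs
  imports "HOL-Complex_Analysis.Complex_Analysis"
begin

section \<open>Polynomial dynamics in one variable\<close>

definition filled_julia :: "complex poly \<Rightarrow> complex set" where
  "filled_julia p = {z. bounded (range (\<lambda>n. (poly p ^^ n) z))}"

definition julia :: "complex poly \<Rightarrow> complex set" where
  "julia p = frontier (filled_julia p)"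

text \<open>Hyperbolicity is uniform expansion on the Julia set.\<close>

definition hyperbolic_poly :: "complex poly \<Rightarrow> bool" where
  "hyperbolic_poly p \<longleftrightarrow>
     (\<exists>C>0. \<exists>l>1. \<forall>n. \<forall>z\<in>julia p. norm (deriv (poly p ^^ n) z) \<ge> C * l ^ n)"

definition critical_point :: "complex poly \<Rightarrow> complex \<Rightarrow> bool" where
  "critical_point p c \<longleftrightarrow> poly (pderiv p) c = 0"

definition simple_critical_point :: "complex poly \<Rightarrow> complex \<Rightarrow> bool" where
  "simple_critical_point p c \<longleftrightarrow> poly (pderiv p) c = 0 \<and> poly (pderiv (pderiv p)) c \<noteq> 0"


section \<open>Holomorphic functions and analytic sets in two complex variables\<close>

definition hol2_on :: "(complex \<times> complex \<Rightarrow> complex) \<Rightarrow> (complex \<times> complex) set \<Rightarrow> bool" where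
  "hol2_on F W \<longleftrightarrow>
     (\<forall>z\<in>W. \<exists>A B. (F has_derivative (\<lambda>h. A * fst h + B * snd h)) (at z))"

definition d1 :: "(complex \<times> complex \<Rightarrow> complex) \<Rightarrow> complex \<times> complex \<Rightarrow> complex" where
  "d1 F z = deriv (\<lambda>t. F (t, snd z)) (fst z)"

definition d2 :: "(complex \<times> complex \<Rightarrow> complex) \<Rightarrow> complex \<times> complex \<Rightarrow> complex" where
  "d2 F z = deriv (\<lambda>t. F (fst z, t)) (snd z)"

text \<open>The coefficient of \<open>dF \<and> dG\<close> with respect to the coordinate two-form, and likewise
  for \<open>d log F \<and> d log G\<close>; here \<open>d log F = dF / F\<close>.\<close>

definition wedge :: "(complex \<times> complex \<Rightarrow> complex) \<Rightarrow> (complex \<times> complex \<Rightarrow> complex)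
    \<Rightarrow> complex \<times> complex \<Rightarrow> complex" where
  "wedge F G z = d1 F z * d2 G z - d2 F z * d1 G z"

definition dlog_wedge :: "(complex \<times> complex \<Rightarrow> complex) \<Rightarrow> (complex \<times> complex \<Rightarrow> complex)
    \<Rightarrow> complex \<times> complex \<Rightarrow> complex" where
  "dlog_wedge F G z = (d1 F z / F z) * (d2 G z / G z) - (d2 F z / F z) * (d1 G z / G z)"

definition analytic_subset :: "(complex \<times> complex) set \<Rightarrow> (complex \<times> complex) set \<Rightarrow> bool" where
  "analytic_subset D A \<longleftrightarrow> A \<subseteq> D \<and>
     (\<forall>z\<in>D. \<exists>W Fs. open W \<and> z \<in> W \<and> W \<subseteq> D \<and> finite Fs \<and> (\<forall>F\<in>Fs. hol2_on F W) \<and>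
        A \<inter> W = {z' \<in> W. \<forall>F\<in>Fs. F z' = 0})"

definition irreducible_analytic :: "(complex \<times> complex) set \<Rightarrow> (complex \<times> complex) set \<Rightarrow> bool" where
  "irreducible_analytic D A \<longleftrightarrow> analytic_subset D A \<and> A \<noteq> {} \<and>
     (\<forall>B C. analytic_subset D B \<longrightarrow> analytic_subset D C \<longrightarrow> A = B \<union> C \<longrightarrow> A = B \<or> A = C)"

definition irreducible_component ::
  "(complex \<times> complex) set \<Rightarrow> (complex \<times> complex) set \<Rightarrow> (complex \<times> complex) set \<Rightarrow> bool" where
  "irreducible_component D A H \<longleftrightarrow> irreducible_analytic D H \<and> H \<subseteq> A \<and>
     (\<forall>H'. irreducible_analytic D H' \<longrightarrow> H \<subseteq> H' \<longrightarrow> H' \<subseteq> A \<longrightarrow> H' = H)"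

definition smooth_curve :: "(complex \<times> complex) set \<Rightarrow> bool" where
  "smooth_curve H \<longleftrightarrow>
     (\<forall>z\<in>H. \<exists>W F. open W \<and> z \<in> W \<and> hol2_on F W \<and> (d1 F z \<noteq> 0 \<or> d2 F z \<noteq> 0) \<and>
        H \<inter> W = {z' \<in> W. F z' = 0})"

text \<open>Holomorphy on an embedded curve means being locally the restriction of a holomorphic
  function of the ambient space.\<close>

definition curve_holomorphic :: "(complex \<times> complex \<Rightarrow> complex) \<Rightarrow> (complex \<times> complex) set \<Rightarrow> bool" where
  "curve_holomorphic \<Phi> H \<longleftrightarrow>
     (\<forall>z\<in>H. \<exists>W F. open W \<and> z \<in> W \<and> hol2_on F W \<and> (\<forall>z'\<in>H \<inter> W. F z' = \<Phi> z'))"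

definition biholomorphism ::
  "(complex \<times> complex) set \<Rightarrow> complex set \<Rightarrow> (complex \<times> complex \<Rightarrow> complex) \<Rightarrow> bool" where
  "biholomorphism H T \<Phi> \<longleftrightarrow> smooth_curve H \<and> open T \<and> bij_betw \<Phi> H T \<and> curve_holomorphic \<Phi> H \<and>
     (\<lambda>t. fst (inv_into H \<Phi> t)) holomorphic_on T \<and>
     (\<lambda>t. snd (inv_into H \<Phi> t)) holomorphic_on T"

definition conformally_punctured_disk :: "(complex \<times> complex) set \<Rightarrow> bool" where
  "conformally_punctured_disk H \<longleftrightarrow> (\<exists>\<psi>. biholomorphism H (ball 0 1 - {0}) \<psi>)"


section \<open>The maps and their escaping sets\<close>

definition henon :: "complex poly \<Rightarrow> complex \<Rightarrow> complex \<times> complex \<Rightarrow> complex \<times> complex" where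
  "henon p a z = (poly p (fst z) - a * snd z, fst z)"

text \<open>The inverse of \<^term>\<open>henon p a\<close>, meaningful only for \<open>a \<noteq> 0\<close>.\<close>

definition henon_inv :: "complex poly \<Rightarrow> complex \<Rightarrow> complex \<times> complex \<Rightarrow> complex \<times> complex" where
  "henon_inv p a z = (snd z, (poly p (snd z) - fst z) / a)"

definition V_plus :: "real \<Rightarrow> (complex \<times> complex) set" where
  "V_plus \<alpha> = {(x, y). norm x > norm y \<and> norm x > \<alpha>}"

definition V_minus :: "real \<Rightarrow> (complex \<times> complex) set" where
  "V_minus \<alpha> = {(x, y). norm y > norm x \<and> norm y > \<alpha>}"

definition K_plus :: "complex poly \<Rightarrow> complex \<Rightarrow> (complex \<times> complex) set" where
  "K_plus p a = {z. bounded (range (\<lambda>n. (henon p a ^^ n) z))}"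

definition K_minus :: "complex poly \<Rightarrow> complex \<Rightarrow> (complex \<times> complex) set" where
  "K_minus p a = (if a = 0 then {(x, y). x = poly p y}
                  else {z. bounded (range (\<lambda>n. (henon_inv p a ^^ n) z))})"

definition U_plus :: "complex poly \<Rightarrow> complex \<Rightarrow> (complex \<times> complex) set" where
  "U_plus p a = - K_plus p a"

definition U_minus :: "complex poly \<Rightarrow> complex \<Rightarrow> (complex \<times> complex) set" where
  "U_minus p a = - K_minus p a"


section \<open>The Boettcher-type functions\<close>

definition x_fwd :: "complex poly \<Rightarrow> complex \<Rightarrow> complex \<times> complex \<Rightarrow> nat \<Rightarrow> complex" where
  "x_fwd p a z k = fst ((henon p a ^^ k) z)"

definition y_bwd :: "complex poly \<Rightarrow> complex \<Rightarrow> complex \<times> complex \<Rightarrow> nat \<Rightarrow> complex" where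
  "y_bwd p a z k = snd ((henon_inv p a ^^ k) z)"

text \<open>The sums over \<open>k \<ge> 1\<close> are shifted to start at \<open>k = 0\<close>.\<close>

definition phi_plus :: "complex poly \<Rightarrow> complex \<Rightarrow> complex \<times> complex \<Rightarrow> complex" where
  "phi_plus p a z = fst z * exp (\<Sum>k.
     Ln (x_fwd p a z (Suc k) / x_fwd p a z k ^ degree p) / of_nat (degree p) ^ Suc k)"

text \<open>The value at \<open>a = 0\<close> of the holomorphic extension is the limit.\<close>

definition minus_quot :: "complex poly \<Rightarrow> complex \<Rightarrow> complex \<times> complex \<Rightarrow> nat \<Rightarrow> complex" where
  "minus_quot p a z k =
     (let h = (\<lambda>b. b * y_bwd p b z (Suc k) / y_bwd p b z k ^ degree p)
      in if a = 0 then Lim (at 0) h else h a)"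

definition phi_minus :: "complex poly \<Rightarrow> complex \<Rightarrow> complex \<times> complex \<Rightarrow> complex" where
  "phi_minus p a z = snd z * exp (\<Sum>k. Ln (minus_quot p a z k) / of_nat (degree p) ^ Suc k)"

text \<open>The functions above are meaningful on \<^term>\<open>V_plus \<alpha>\<close> and \<^term>\<open>V_minus \<alpha>\<close>.  On the
  escaping sets they extend only up to roots of unity; the following predicates describe
  holomorphic local branches of these extensions on an open set \<open>W\<close>.\<close>

definition plus_branch :: "complex poly \<Rightarrow> real \<Rightarrow> complex \<Rightarrow> (complex \<times> complex) set
    \<Rightarrow> (complex \<times> complex \<Rightarrow> complex) \<Rightarrow> bool" where
  "plus_branch p \<alpha> a W \<phi> \<longleftrightarrow> open W \<and> W \<subseteq> U_plus p a \<and> hol2_on \<phi> W \<and>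
     (\<exists>n. \<forall>z\<in>W. (henon p a ^^ n) z \<in> V_plus \<alpha> \<and>
        \<phi> z ^ (degree p ^ n) = phi_plus p a ((henon p a ^^ n) z))"

definition minus_branch :: "complex poly \<Rightarrow> real \<Rightarrow> complex \<Rightarrow> (complex \<times> complex) set
    \<Rightarrow> (complex \<times> complex \<Rightarrow> complex) \<Rightarrow> bool" where
  "minus_branch p \<alpha> a W \<phi> \<longleftrightarrow> open W \<and> W \<subseteq> U_minus p a \<and> hol2_on \<phi> W \<and>
     (if a = 0 then \<forall>z\<in>W. \<phi> z ^ degree p = poly p (snd z) - fst z
      else \<exists>n. \<forall>z\<in>W. (henon_inv p a ^^ n) z \<in> V_minus \<alpha> \<and>
        \<phi> z ^ (degree p ^ n) =
          a ^ (\<Sum>i<n. degree p ^ i) * phi_minus p a ((henon_inv p a ^^ n) z))"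


section \<open>The critical locus and its primary horizontal components\<close>

text \<open>The logarithmic differentials do not depend on the choice of the branches.\<close>

definition w_crit :: "complex poly \<Rightarrow> real \<Rightarrow> complex \<Rightarrow> complex \<times> complex \<Rightarrow> complex" where
  "w_crit p \<alpha> a z = (THE w. \<exists>W \<phi> \<psi>. z \<in> W \<and> plus_branch p \<alpha> a W \<phi> \<and> minus_branch p \<alpha> a W \<psi> \<and>
     w = dlog_wedge \<phi> \<psi> z)"

text \<open>The underlying set of the zero variety; multiplicities play no role below.\<close>

definition crit_locus :: "complex poly \<Rightarrow> real \<Rightarrow> complex \<Rightarrow> (complex \<times> complex) set" where
  "crit_locus p \<alpha> a = {z \<in> U_plus p a \<inter> U_minus p a. w_crit p \<alpha> a z = 0}"

text \<open>Near \<open>x = \<infinity>\<close> the power \<open>\<phi>\<^sub>-\<^sup>d\<close> is single valued: it is \<open>a \<phi>\<^sub>- \<circ> f\<^sup>-\<^sup>1\<close> for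
  \<open>a \<noteq> 0\<close>, since there \<open>f\<^sup>-\<^sup>1\<close> takes values in \<open>V\<^sub>-\<close>, and \<open>p(y) - x\<close> for \<open>a = 0\<close>.\<close>

definition phi_minus_pow :: "complex poly \<Rightarrow> complex \<Rightarrow> complex \<times> complex \<Rightarrow> complex" where
  "phi_minus_pow p a z =
     (if a = 0 then poly p (snd z) - fst z else a * phi_minus p a (henon_inv p a z))"

text \<open>In the coordinates \<open>(u, y)\<close> with \<open>u = 1/x\<close>; only \<open>u\<close> near \<open>0\<close> is relevant, and the value of
  the holomorphic extension at \<open>u = 0\<close> is the limit.\<close>

definition w_tilde :: "complex poly \<Rightarrow> complex \<Rightarrow> complex \<Rightarrow> complex \<Rightarrow> complex" where
  "w_tilde p a u y =
     (let h = (\<lambda>v. wedge (\<lambda>(s, t). inverse (phi_plus p a (1 / s, t)))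
                         (\<lambda>(s, t). inverse (phi_minus_pow p a (1 / s, t))) (v, y) / v\<^sup>2)
      in if u = 0 then Lim (at 0) h else h u)"

text \<open>The extended critical locus in the chart \<open>(u, y)\<close>; for small \<open>u \<noteq> 0\<close> the zeros of
  \<open>w_tilde\<close> are those of \<open>w_crit\<close>.\<close>

definition crit_locus_ext :: "complex poly \<Rightarrow> real \<Rightarrow> complex \<Rightarrow> (complex \<times> complex) set" where
  "crit_locus_ext p \<alpha> a =
     {(u, y). if u = 0 then w_tilde p a 0 y = 0 else (1 / u, y) \<in> crit_locus p \<alpha> a}"

text \<open>The extension of a component of the critical locus is its closure in the extended locus.\<close>

definition component_ext :: "complex poly \<Rightarrow> real \<Rightarrow> complex \<Rightarrow> (complex \<times> complex) set
    \<Rightarrow> (complex \<times> complex) set" where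
  "component_ext p \<alpha> a H = crit_locus_ext p \<alpha> a \<inter> closure {(u, y). u \<noteq> 0 \<and> (1 / u, y) \<in> H}"

definition is_primary_component :: "complex poly \<Rightarrow> real \<Rightarrow> complex \<Rightarrow> complex
    \<Rightarrow> (complex \<times> complex) set \<Rightarrow> bool" where
  "is_primary_component p \<alpha> a c H \<longleftrightarrow>
     irreducible_component (U_plus p a \<inter> U_minus p a) (crit_locus p \<alpha> a) H \<and>
     (0, c) \<in> component_ext p \<alpha> a H"

definition primary_component :: "complex poly \<Rightarrow> real \<Rightarrow> complex \<Rightarrow> complex
    \<Rightarrow> (complex \<times> complex) set" where
  "primary_component p \<alpha> a c = (THE H. is_primary_component p \<alpha> a c H)"

end

theory Submission
  imports Defs "HOL-Computational_Algebra.Fundamental_Theorem_Algebra"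
begin

text \<open>Hyperbolicity and connectedness put every critical value of \<open>p\<close> in the interior of a trapped
  compact set \<open>L\<close> of bounded orbits, away from which \<open>p'\<close> is bounded below.  For small \<open>a\<close> a point of
  \<open>U\<^sup>+\<close> in the strip \<open>|y| < \<alpha>\<close> has an orbit with first coordinates outside \<open>L\<close>, so the leaves of
  \<open>\<F>\<^sup>+\<close> stay almost vertical there: an invariant cone field gives
  \<open>|\<partial>\<^sub>y\<phi>\<^sub>+| \<le> C |a| |\<partial>\<^sub>x\<phi>\<^sub>+|\<close>.  Hence \<open>(\<phi>\<^sub>+ \<circ> f\<^sup>n, y)\<close> is a covering
  of (complement of a disk) times (disk), and lifting the exponential map through these coverings
  continues \<open>\<phi>\<^sub>+\<close> to a single-valued \<open>\<Phi>\<close> on the strip, which maps each horizontal slice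
  bijectively onto \<open>|t| > 1\<close>.  In the coordinates \<open>(\<Phi>, y)\<close> the tangency condition near \<open>y = c\<close>
  reads \<open>p'(y) + e(t, y) = 0\<close> with \<open>e = O(a)\<close>; since \<open>c\<close> is a simple zero of \<open>p'\<close>, it has exactly
  one solution \<open>y = Y(t)\<close> near \<open>c\<close> for every \<open>t\<close>, holomorphic in \<open>t\<close>.  This graph over
  \<open>|t| > 1\<close> is open and closed in the critical locus, is irreducible, and is asymptotic to \<open>y = c\<close>,
  so it is the primary component and \<open>\<Phi>\<close> is its uniformization.\<close>

section \<open>Holomorphic functions of two variables\<close>

text \<open>The obstacle is that phi_+ continues to the escaping set only up to roots of unity, and
  nothing forces single-valuedness once orbits may meet critical points. The strip |y| < \<alpha> is
  the right domain because f copies the first coordinate into the second: an orbit starting there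
  stays in the bidisc of radius \<alpha> until it enters V_+, so lower bounds on |p'| at the first
  coordinates are all that the cone field needs. Connectedness enters through the complement of K:
  on the sphere it is a disc, p acts on it as a multiple of w^d, hence no finite critical point
  escapes. The constant \<kappa> comes from p(c) being interior to L while x stays outside L; it
  keeps the component away from p(y) = x, where phi_-^d vanishes for a = 0, so that a = 0 and a != 0
  share one perturbation argument. Irreducibility is handled without local structure theory: an open
  and closed part of an analytic set is again analytic, and a connected parametrized curve obeys the
  identity theorem. None of \<open>C0\<close>, \<kappa>, m, \<delta> depends on a, which makes the
  threshold uniform.\<close>

lemma deriv_bound_ball:
  fixes f :: "complex \<Rightarrow> complex"
  assumes hol: "f holomorphic_on ball z r" and "r > 0" and B: "\<And>w. w \<in> ball z r \<Longrightarrow> norm (f w) \<le> B"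
  shows "norm (deriv f z) \<le> B / r"
proof -
  have B0: "B \<ge> 0"
    using B[of z] \<open>r > 0\<close> norm_ge_zero[of "f z"] by (simp del: norm_ge_zero)
  \<comment> \<open>f need not extend continuously to the boundary, so Cauchy's inequality is used
    on smaller discs and s then tends to r.\<close>
  have *: "norm (deriv f z) * s \<le> B" if "0 < s" "s < r" for s
  proof -
    have "norm ((deriv ^^ 1) f z) \<le> fact 1 * B / s ^ 1"
    proof (rule Cauchy_inequality)
      show "f holomorphic_on ball z s"
        using hol by (rule holomorphic_on_subset) (use that in auto)
      show "continuous_on (cball z s) f"
        by (rule holomorphic_on_imp_continuous_on, rule holomorphic_on_subset[OF hol]) (use that in auto)
      show "norm (f x) \<le> B" if "norm (z - x) = s" for x
        using that \<open>s < r\<close> by (intro B) (simp add: dist_norm)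
    qed (use that in auto)
    then show ?thesis using that by (simp add: field_simps)
  qed
  show ?thesis
  proof (rule ccontr)
    assume "\<not> ?thesis"
    then have c: "norm (deriv f z) * r > B" using \<open>r > 0\<close> by (simp add: field_simps)
    then have pos: "norm (deriv f z) > 0" using B0 \<open>r > 0\<close> by (metis less_eq_real_def mult_zero_left norm_ge_zero not_le)
    then have "B / norm (deriv f z) < r" using c by (simp add: field_simps)
    then obtain s where s: "B / norm (deriv f z) < s" "s < r" using dense by blast
    moreover have "s > 0" using s(1) B0 pos by (meson divide_nonneg_pos le_less_trans)
    ultimately show False using *[of s] pos by (simp add: field_simps)
  qed
qed

lemma polydisc_in_open:
  fixes W :: "(complex \<times> complex) set"
  assumes "open W" "(x, y) \<in> W"
  obtains r where "r > 0" "cball x r \<times> cball y r \<subseteq> W"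
proof -
  obtain A B where AB: "open A" "open B" "x \<in> A" "y \<in> B" "A \<times> B \<subseteq> W"
    using assms open_prod_elim[of W "(x,y)"] by (metis mem_Times_iff fst_conv snd_conv)
  obtain r1 where r1: "r1 > 0" "cball x r1 \<subseteq> A" using AB open_contains_cball by blast
  obtain r2 where r2: "r2 > 0" "cball y r2 \<subseteq> B" using AB open_contains_cball by blast
  show ?thesis
    by (rule that[of "min r1 r2"]) (use r1 r2 AB(5) in \<open>force+\<close>)
qed

text \<open>Prepares Cauchy estimates in the first variable: two nearby slices are close on a whole
  disc, so their derivatives are close on the half disc.\<close>

lemma slice_diff_small:
  fixes F :: "complex \<times> complex \<Rightarrow> complex"
  assumes "continuous_on W F" and r: "r > 0" "cball x0 r \<times> cball y0 r \<subseteq> W" and "e > 0"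
  obtains s where "0 < s" "s \<le> r"
    "\<And>x y. x \<in> cball x0 r \<Longrightarrow> y \<in> cball y0 s \<Longrightarrow> norm (F (x, y) - F (x, y0)) < e"
proof -
  have "uniformly_continuous_on (cball x0 r \<times> cball y0 r) F"
    using assms by (intro compact_uniformly_continuous compact_Times compact_cball) (auto intro: continuous_on_subset)
  then obtain d where d: "d > 0" "\<And>z z'. z \<in> cball x0 r \<times> cball y0 r \<Longrightarrow> z' \<in> cball x0 r \<times> cball y0 r \<Longrightarrow>
      dist z' z < d \<Longrightarrow> dist (F z') (F z) < e"
    unfolding uniformly_continuous_on_def using \<open>e > 0\<close> by metis
  show ?thesis
  proof (rule that[of "min r (d/2)"])
    fix x y assume xy: "x \<in> cball x0 r" "y \<in> cball y0 (min r (d/2))"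
    have "dist (x, y) (x, y0) < d" using xy d(1) by (auto simp: dist_Pair_Pair dist_commute)
    then show "norm (F (x, y) - F (x, y0)) < e"
      using d(2)[of "(x,y0)" "(x,y)"] xy r by (auto simp: dist_norm)
  qed (use r d in auto)
qed

text \<open>Osgood's lemma: continuity and separate holomorphy give total differentiability. It is
  how limits and derivatives of holomorphic functions are recognized as holomorphic below.\<close>

lemma hol2_onI:
  assumes W: "open W" and cont: "continuous_on W F"
    and h1: "\<And>x y. (x, y) \<in> W \<Longrightarrow> (\<lambda>t. F (t, y)) field_differentiable (at x)"
    and h2: "\<And>x y. (x, y) \<in> W \<Longrightarrow> (\<lambda>t. F (x, t)) field_differentiable (at y)"
  shows "hol2_on F W"
  unfolding hol2_on_def
proof clarify
  fix x0 y0 assume z0: "(x0, y0) \<in> W"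
  obtain r where r: "r > 0" "cball x0 r \<times> cball y0 r \<subseteq> W" using polydisc_in_open[OF W z0] .
  define A where "A = deriv (\<lambda>t. F (t, y0)) x0"
  define B where "B = deriv (\<lambda>t. F (x0, t)) y0"
  define D where "D = (\<lambda>z. (F (fst z, snd z) - F (fst z, y0)) - (F (x0, snd z) - F (x0, y0)))"
  have A: "((\<lambda>t. F (t, y0)) has_field_derivative A) (at x0)"
    unfolding A_def using h1[OF z0] by (simp add: DERIV_deriv_iff_field_differentiable)
  have B: "((\<lambda>t. F (x0, t)) has_field_derivative B) (at y0)"
    unfolding B_def using h2[OF z0] by (simp add: DERIV_deriv_iff_field_differentiable)
  have FA: "((\<lambda>z. F (fst z, y0)) has_derivative (\<lambda>h. A * fst h)) (at (x0, y0))"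
    using diff_chain_at[of fst fst "(x0,y0)" "\<lambda>t. F (t, y0)" "(*) A"] A
    by (simp add: has_field_derivative_def o_def bounded_linear_imp_has_derivative bounded_linear_fst)
  have FB: "((\<lambda>z. F (x0, snd z)) has_derivative (\<lambda>h. B * snd h)) (at (x0, y0))"
    using diff_chain_at[of snd snd "(x0,y0)" "\<lambda>t. F (x0, t)" "(*) B"] B
    by (simp add: has_field_derivative_def o_def bounded_linear_imp_has_derivative bounded_linear_snd)
  \<comment> \<open>D is the mixed second difference that remains once both slice increments are
    removed. It is an increment of g in the first variable, and Cauchy bounds the derivative of g by
    e.\<close>
  have "(D has_derivative (\<lambda>h. 0)) (at (x0, y0))"
    unfolding has_derivative_at_alt
  proof (intro conjI allI impI)
    fix e :: real assume "e > 0"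
    obtain s where s: "0 < s" "s \<le> r"
      and sb: "\<And>x y. x \<in> cball x0 r \<Longrightarrow> y \<in> cball y0 s \<Longrightarrow> norm (F (x, y) - F (x, y0)) < e * (r/2)"
      using slice_diff_small[OF cont r, of "e * (r/2)"] \<open>e > 0\<close> r(1) by auto
    show "\<exists>d>0. \<forall>z'. norm (z' - (x0, y0)) < d \<longrightarrow> norm (D z' - D (x0, y0) - 0) \<le> e * norm (z' - (x0, y0))"
    proof (intro exI[of _ "min s (r/2)"] conjI allI impI)
      fix z' assume z': "norm (z' - (x0, y0)) < min s (r/2)"
      obtain x y where [simp]: "z' = (x, y)" by (cases z')
      have x: "norm (x - x0) < r/2" and y: "norm (y - y0) < s"
        using z' norm_fst_le[of "x - x0" "y - y0"] norm_snd_le[of "y - y0" "x - x0"] by auto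
      define g where "g = (\<lambda>t. F (t, y) - F (t, y0))"
      have yr: "y \<in> cball y0 r" "y \<in> cball y0 s" using y s by (auto simp: dist_norm norm_minus_commute)
      have gd: "g field_differentiable at t" if "t \<in> ball x0 r" for t
        unfolding g_def using that r yr by (intro field_differentiable_diff h1) auto
      then have gh: "g holomorphic_on ball x0 r"
        by (metis holomorphic_onI field_differentiable_at_within)
      have db: "norm (deriv g t) \<le> e" if "t \<in> ball x0 (r/2)" for t
      proof -
        have sub: "ball t (r/2) \<subseteq> ball x0 r"
        proof
          fix w assume "w \<in> ball t (r/2)"
          then show "w \<in> ball x0 r" using that dist_triangle[of x0 w t] by auto
        qed
        have "norm (deriv g t) \<le> (e * (r/2)) / (r/2)"
        proof (rule deriv_bound_ball)
          show "g holomorphic_on ball t (r/2)" by (rule holomorphic_on_subset[OF gh sub])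
          show "norm (g w) \<le> e * (r/2)" if "w \<in> ball t (r/2)" for w
          proof -
            have "w \<in> cball x0 r" using subsetD[OF sub that] by simp
            from sb[OF this yr(2)] show ?thesis unfolding g_def by simp
          qed
        qed (use r in auto)
        then show ?thesis using r by simp
      qed
      have "norm (g x - g x0) \<le> e * norm (x - x0)"
      proof (rule field_differentiable_bound[of "ball x0 (r/2)" g "deriv g"])
        show "(g has_field_derivative deriv g t) (at t within ball x0 (r/2))" if "t \<in> ball x0 (r/2)" for t
          by (rule has_field_derivative_at_within, rule field_differentiable_derivI, rule gd) (use that r in auto)

        show "x \<in> ball x0 (r/2)" "x0 \<in> ball x0 (r/2)" using x r by (auto simp: dist_norm norm_minus_commute)
      qed (simp_all add: db convex_ball del: mem_ball)
      also have "\<dots> \<le> e * norm (z' - (x0, y0))"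
        using \<open>e > 0\<close> norm_fst_le[of "x - x0" "y - y0"] by (intro mult_left_mono) auto
      also have "g x - g x0 = D z' - D (x0, y0) - 0" unfolding g_def D_def by (simp only: \<open>z' = (x, y)\<close> fst_conv snd_conv diff_0_right diff_self)
      finally show "norm (D z' - D (x0, y0) - 0) \<le> e * norm (z' - (x0, y0))" .
    qed (use s r in auto)
  qed auto
  from has_derivative_add[OF has_derivative_add[OF has_derivative_add[OF this FA] FB] has_derivative_const[of "- F (x0,y0)"]]
  have "((\<lambda>z. D z + F (fst z, y0) + F (x0, snd z) + - F (x0, y0)) has_derivative (\<lambda>h. A * fst h + B * snd h)) (at (x0, y0))"
    unfolding add_0_left add_0_right .
  also have "(\<lambda>z. D z + F (fst z, y0) + F (x0, snd z) + - F (x0, y0)) = F"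
    by (rule ext) (simp add: D_def)
  finally show "\<exists>A B. (F has_derivative (\<lambda>h. A * fst h + B * snd h)) (at (x0, y0))" by blast
qed

lemma hol2_slices:
  assumes "hol2_on F W" "(x, y) \<in> W"
  shows hol2_d1: "((\<lambda>t. F (t, y)) has_field_derivative d1 F (x, y)) (at x)"
    and hol2_d2: "((\<lambda>t. F (x, t)) has_field_derivative d2 F (x, y)) (at y)"
    and hol2_has_derivative: "(F has_derivative (\<lambda>h. d1 F (x, y) * fst h + d2 F (x, y) * snd h)) (at (x, y))"
proof -
  obtain A B where AB: "(F has_derivative (\<lambda>h. A * fst h + B * snd h)) (at (x, y))"
    using assms unfolding hol2_on_def by blast
  have p1: "((\<lambda>t. (t, y)) has_derivative (\<lambda>h. (h, 0))) (at x)"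
    and p2: "((\<lambda>t. (x, t)) has_derivative (\<lambda>h. (0, h))) (at y)"
    by (auto intro!: derivative_eq_intros)
  have D1: "((\<lambda>t. F (t, y)) has_field_derivative A) (at x)"
    using diff_chain_at[OF p1 AB] by (simp add: has_field_derivative_def o_def)
  have D2: "((\<lambda>t. F (x, t)) has_field_derivative B) (at y)"
    using diff_chain_at[OF p2 AB] by (simp add: has_field_derivative_def o_def)
  have "d1 F (x, y) = A" "d2 F (x, y) = B"
    using D1 D2 by (simp_all add: d1_def d2_def DERIV_imp_deriv)
  then show "((\<lambda>t. F (t, y)) has_field_derivative d1 F (x, y)) (at x)"
    "((\<lambda>t. F (x, t)) has_field_derivative d2 F (x, y)) (at y)"
    "(F has_derivative (\<lambda>h. d1 F (x, y) * fst h + d2 F (x, y) * snd h)) (at (x, y))"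
    using AB D1 D2 by simp_all
qed

lemma d1_eqI: "((\<lambda>t. F (t, y)) has_field_derivative A) (at x) \<Longrightarrow> d1 F (x, y) = A"
  and d2_eqI: "((\<lambda>t. F (x, t)) has_field_derivative B) (at y) \<Longrightarrow> d2 F (x, y) = B"
  by (simp_all add: d1_def d2_def DERIV_imp_deriv)

lemma d12_eqI:
  assumes "(F has_derivative (\<lambda>h. A * fst h + B * snd h)) (at (x, y))"
  shows "d1 F (x, y) = A" "d2 F (x, y) = B"
proof -
  have h: "hol2_on F {(x,y)}" using assms unfolding hol2_on_def by blast
  have "(\<lambda>h. A * fst h + B * snd h) = (\<lambda>h. d1 F (x, y) * fst h + d2 F (x, y) * snd h)"
    using has_derivative_unique[OF assms hol2_has_derivative[OF h]] by simp
  from fun_cong[OF this, of "(1,0)"] fun_cong[OF this, of "(0,1)"]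
  show "d1 F (x, y) = A" "d2 F (x, y) = B" by auto
qed

lemma hol2_on_subset: "hol2_on F W \<Longrightarrow> V \<subseteq> W \<Longrightarrow> hol2_on F V"
  unfolding hol2_on_def by blast

lemma hol2_imp_continuous_on: "hol2_on F W \<Longrightarrow> continuous_on W F"
  unfolding hol2_on_def continuous_on_eq_continuous_within
  by (metis continuous_at_imp_continuous_at_within has_derivative_continuous)

lemma hol2_imp_isCont: "hol2_on F W \<Longrightarrow> z \<in> W \<Longrightarrow> isCont F z"
  unfolding hol2_on_def by (metis has_derivative_continuous)

lemma hol2_cong:
  assumes "hol2_on F W" "open W" "\<And>z. z \<in> W \<Longrightarrow> F z = G z"
  shows "hol2_on G W"
  unfolding hol2_on_def
proof
  fix z assume z: "z \<in> W"
  then obtain A B where "(F has_derivative (\<lambda>h. A * fst h + B * snd h)) (at z)"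
    using assms(1) unfolding hol2_on_def by blast
  then have "(G has_derivative (\<lambda>h. A * fst h + B * snd h)) (at z)"
    by (rule has_derivative_transform_within_open[OF _ assms(2) z]) (use assms in auto)
  then show "\<exists>A B. (G has_derivative (\<lambda>h. A * fst h + B * snd h)) (at z)" by blast
qed

lemma d12_cong_open:
  assumes "open W" "z \<in> W" "\<And>z. z \<in> W \<Longrightarrow> F z = G z"
  shows "d1 F z = d1 G z" "d2 F z = d2 G z"
proof -
  obtain x y where [simp]: "z = (x, y)" by (cases z)
  have "open ((\<lambda>t. (t, y)) -` W)" "open ((\<lambda>t. (x, t)) -` W)"
    using assms(1) by (auto intro!: continuous_open_vimage continuous_intros)
  then have "eventually (\<lambda>t. t \<in> (\<lambda>t. (t, y)) -` W) (nhds x)" "eventually (\<lambda>t. t \<in> (\<lambda>t. (x, t)) -` W) (nhds y)"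
    using assms(2) by (intro eventually_nhds_in_open; simp)+
  then have "eventually (\<lambda>t. F (t, y) = G (t, y)) (nhds x)" "eventually (\<lambda>t. F (x, t) = G (x, t)) (nhds y)"
    by (auto elim!: eventually_mono simp: assms)
  then show "d1 F z = d1 G z" "d2 F z = d2 G z"
    by (simp_all add: d1_def d2_def deriv_cong_ev)
qed

lemma hol2_const: "hol2_on (\<lambda>_. c) W"
  unfolding hol2_on_def by (intro ballI exI[of _ 0]) (simp add: has_derivative_const)

lemma hol2_fst: "hol2_on fst W"
  unfolding hol2_on_def
  by (intro ballI exI[of _ 1] exI[of _ 0]) (simp add: bounded_linear_imp_has_derivative bounded_linear_fst)

lemma hol2_snd: "hol2_on snd W"
  unfolding hol2_on_def
  by (intro ballI exI[of _ 0] exI[of _ 1]) (simp add: bounded_linear_imp_has_derivative bounded_linear_snd)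

lemma chain2:
  assumes F: "hol2_on F V" and G: "hol2_on G W" and H: "hol2_on H W" and z: "z \<in> W" "(G z, H z) \<in> V"
  shows "((\<lambda>z. F (G z, H z)) has_derivative (\<lambda>h. (d1 F (G z, H z) * d1 G z + d2 F (G z, H z) * d1 H z) * fst h
      + (d1 F (G z, H z) * d2 G z + d2 F (G z, H z) * d2 H z) * snd h)) (at z)"
proof -
  obtain x y where [simp]: "z = (x, y)" by (cases z)
  have "((\<lambda>z. (G z, H z)) has_derivative (\<lambda>h. (d1 G z * fst h + d2 G z * snd h, d1 H z * fst h + d2 H z * snd h))) (at z)"
    using has_derivative_Pair[OF hol2_has_derivative[OF G, of x y] hol2_has_derivative[OF H, of x y]] z by simp
  from diff_chain_at[OF this hol2_has_derivative[OF F z(2)]]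
  show ?thesis by (simp add: o_def algebra_simps)
qed

lemma hol2_compose2:
  assumes "hol2_on F V" "hol2_on G W" "hol2_on H W" "\<And>z. z \<in> W \<Longrightarrow> (G z, H z) \<in> V"
  shows "hol2_on (\<lambda>z. F (G z, H z)) W"
  using chain2[OF assms(1-3)] assms(4) unfolding hol2_on_def by blast

lemma d12_compose2:
  assumes "hol2_on F V" "hol2_on G W" "hol2_on H W" "z \<in> W" "(G z, H z) \<in> V"
  shows "d1 (\<lambda>z. F (G z, H z)) z = d1 F (G z, H z) * d1 G z + d2 F (G z, H z) * d1 H z"
    and "d2 (\<lambda>z. F (G z, H z)) z = d1 F (G z, H z) * d2 G z + d2 F (G z, H z) * d2 H z"
  using d12_eqI[of "\<lambda>z. F (G z, H z)" _ _ "fst z" "snd z"] chain2[OF assms] by auto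

lemma chain1:
  assumes f: "(f has_field_derivative D) (at (G z))" and G: "hol2_on G W" and z: "z \<in> W"
  shows "((\<lambda>z. f (G z)) has_derivative (\<lambda>h. (D * d1 G z) * fst h + (D * d2 G z) * snd h)) (at z)"
proof -
  obtain x y where [simp]: "z = (x, y)" by (cases z)
  from diff_chain_at[OF hol2_has_derivative[OF G, of x y], of f "(*) D"] f z
  show ?thesis by (simp add: o_def has_field_derivative_def algebra_simps)
qed

lemma hol2_compose1:
  assumes "f holomorphic_on S" "open S" "hol2_on G W" "\<And>z. z \<in> W \<Longrightarrow> G z \<in> S"
  shows "hol2_on (\<lambda>z. f (G z)) W"
  using chain1[OF holomorphic_derivI[OF assms(1,2)] assms(3)] assms(4) unfolding hol2_on_def by blast

lemma d12_compose1:
  assumes "(f has_field_derivative D) (at (G z))" "hol2_on G W" "z \<in> W"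
  shows "d1 (\<lambda>z. f (G z)) z = D * d1 G z" "d2 (\<lambda>z. f (G z)) z = D * d2 G z"
  using d12_eqI[of "\<lambda>z. f (G z)" _ _ "fst z" "snd z"] chain1[OF assms] by auto

lemma hol2_compose_curve:
  assumes "hol2_on F V" "g holomorphic_on S" "h holomorphic_on S" "open S" "\<And>t. t \<in> S \<Longrightarrow> (g t, h t) \<in> V"
  shows "(\<lambda>t. F (g t, h t)) holomorphic_on S"
  unfolding holomorphic_on_open[OF \<open>open S\<close>]
proof
  fix t assume t: "t \<in> S"
  have "((\<lambda>t. (g t, h t)) has_derivative (\<lambda>k. (deriv g t * k, deriv h t * k))) (at t)"
    using holomorphic_derivI[OF assms(2,4) t] holomorphic_derivI[OF assms(3,4) t]
    by (auto simp: has_field_derivative_def intro!: has_derivative_Pair)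
  from diff_chain_at[OF this hol2_has_derivative[OF assms(1) assms(5)[OF t]], unfolded o_def]
  have "((\<lambda>t. F (g t, h t)) has_field_derivative (d1 F (g t, h t) * deriv g t + d2 F (g t, h t) * deriv h t)) (at t)"
    by (rule has_derivative_imp_has_field_derivative) (simp add: algebra_simps)
  then show "\<exists>f'. ((\<lambda>t. F (g t, h t)) has_field_derivative f') (at t)" by blast
qed

lemma hol2_add: "hol2_on F W \<Longrightarrow> hol2_on G W \<Longrightarrow> hol2_on (\<lambda>z. F z + G z) W"
  and hol2_mult: "hol2_on F W \<Longrightarrow> hol2_on G W \<Longrightarrow> hol2_on (\<lambda>z. F z * G z) W"
proof -
  have *: "hol2_on (\<lambda>z. fst z + snd z) UNIV" "hol2_on (\<lambda>z. fst z * snd z) UNIV"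
    by (rule hol2_onI; auto intro!: continuous_intros derivative_intros)+
  show "hol2_on F W \<Longrightarrow> hol2_on G W \<Longrightarrow> hol2_on (\<lambda>z. F z + G z) W"
    "hol2_on F W \<Longrightarrow> hol2_on G W \<Longrightarrow> hol2_on (\<lambda>z. F z * G z) W"
    using hol2_compose2[OF *(1), of F W G] hol2_compose2[OF *(2), of F W G] by auto
qed

lemma hol2_uminus: "hol2_on F W \<Longrightarrow> hol2_on (\<lambda>z. - F z) W"
  using hol2_mult[OF hol2_const[of "-1"]] by fastforce

lemma hol2_diff: "hol2_on F W \<Longrightarrow> hol2_on G W \<Longrightarrow> hol2_on (\<lambda>z. F z - G z) W"
  using hol2_add[of F W "\<lambda>z. - G z"] hol2_uminus by auto

lemma hol2_inverse: "hol2_on F W \<Longrightarrow> (\<And>z. z \<in> W \<Longrightarrow> F z \<noteq> 0) \<Longrightarrow> hol2_on (\<lambda>z. inverse (F z)) W"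
  by (rule hol2_compose1[of inverse "- {0}"]) (auto intro!: holomorphic_intros)

lemma hol2_divide: "hol2_on F W \<Longrightarrow> hol2_on G W \<Longrightarrow> (\<And>z. z \<in> W \<Longrightarrow> G z \<noteq> 0) \<Longrightarrow> hol2_on (\<lambda>z. F z / G z) W"
  unfolding divide_inverse by (intro hol2_mult hol2_inverse)

lemma hol2_power: "hol2_on F W \<Longrightarrow> hol2_on (\<lambda>z. F z ^ n) W"
  by (rule hol2_compose1[of "\<lambda>z. z ^ n" UNIV]) (auto intro!: holomorphic_intros)

lemma hol2_poly: "hol2_on F W \<Longrightarrow> hol2_on (\<lambda>z. poly p (F z)) W"
  by (rule hol2_compose1[of "poly p" UNIV]) (auto intro!: holomorphic_intros)

lemma hol2_exp: "hol2_on F W \<Longrightarrow> hol2_on (\<lambda>z. exp (F z)) W"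
  by (rule hol2_compose1[of exp UNIV]) (auto intro!: holomorphic_intros)

lemmas hol2_intros = hol2_const hol2_fst hol2_snd hol2_add hol2_mult hol2_uminus hol2_diff
  hol2_inverse hol2_divide hol2_power hol2_poly hol2_exp

lemma hol2_holomorphic1:
  assumes "hol2_on F W" "\<And>t. t \<in> S \<Longrightarrow> (t, y) \<in> W"
  shows "(\<lambda>t. F (t, y)) holomorphic_on S"
  unfolding holomorphic_on_def using hol2_d1[OF assms(1) assms(2)]
  by (meson field_differentiable_at_within field_differentiable_def)

lemma hol2_holomorphic2:
  assumes "hol2_on F W" "\<And>t. t \<in> S \<Longrightarrow> (x, t) \<in> W"
  shows "(\<lambda>t. F (x, t)) holomorphic_on S"
  unfolding holomorphic_on_def using hol2_d2[OF assms(1) assms(2)]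
  by (meson field_differentiable_at_within field_differentiable_def)

lemma hol2_swap:
  assumes "hol2_on F W"
  shows "hol2_on (\<lambda>z. F (snd z, fst z)) (prod.swap -` W)"
  by (rule hol2_compose2[OF assms]) (auto intro: hol2_intros)

text \<open>Along the base slice this is one-variable theory; between slices the derivatives are
  compared by Cauchy on a disc of radius r/2 about the moving point.\<close>

lemma hol2_d1_continuous:
  assumes F: "hol2_on F W" and W: "open W"
  shows "continuous_on W (d1 F)"
  unfolding continuous_on_eq_continuous_at[OF W]
proof clarify
  fix x0 y0 assume z0: "(x0, y0) \<in> W"
  obtain r where r: "r > 0" "cball x0 r \<times> cball y0 r \<subseteq> W" using polydisc_in_open[OF W z0] .
  have h: "(\<lambda>t. F (t, y)) holomorphic_on ball x0 r" if "y \<in> cball y0 r" for y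
    by (rule hol2_holomorphic1[OF F]) (use that r in auto)
  have "(\<lambda>t. d1 F (t, y0)) holomorphic_on ball x0 r"
    using holomorphic_deriv[OF h[of y0]] r by (simp add: d1_def)
  then have c0: "isCont (\<lambda>t. d1 F (t, y0)) x0"
    using r by (metis centre_in_ball continuous_on_eq_continuous_at holomorphic_on_imp_continuous_on open_ball)
  show "isCont (d1 F) (x0, y0)"
    unfolding continuous_at_eps_delta
  proof (intro allI impI)
    fix e :: real assume "e > 0"
    obtain d where d: "d > 0" "\<And>x. dist x x0 < d \<Longrightarrow> dist (d1 F (x, y0)) (d1 F (x0, y0)) < e/2"
      using c0 \<open>e > 0\<close> unfolding continuous_at_eps_delta by (metis half_gt_zero)
    obtain s where s: "0 < s" "s \<le> r"
      and sb: "\<And>x y. x \<in> cball x0 r \<Longrightarrow> y \<in> cball y0 s \<Longrightarrow> norm (F (x, y) - F (x, y0)) < e/2 * (r/2)"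
      using slice_diff_small[OF hol2_imp_continuous_on[OF F] r, of "e/2 * (r/2)"] \<open>e > 0\<close> r(1) by auto
    show "\<exists>d>0. \<forall>z. dist z (x0, y0) < d \<longrightarrow> dist (d1 F z) (d1 F (x0, y0)) < e"
    proof (intro exI[of _ "min (min s d) (r/2)"] conjI allI impI)
      fix z assume z: "dist z (x0, y0) < min (min s d) (r/2)"
      obtain x y where [simp]: "z = (x, y)" by (cases z)
      have x: "dist x x0 < r/2" "dist x x0 < d" and y: "dist y y0 < s"
        using z dist_fst_le[of z "(x0,y0)"] dist_snd_le[of z "(x0,y0)"] by auto
      have yr: "y \<in> cball y0 r" "y \<in> cball y0 s" using y s by (auto simp: dist_commute)
      have sub: "ball x (r/2) \<subseteq> ball x0 r"
      proof
        fix w assume "w \<in> ball x (r/2)"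
        then show "w \<in> ball x0 r" using x dist_triangle[of x0 w x] by (auto simp: dist_commute)
      qed
      have xr: "x \<in> ball x0 r" using x r by (auto simp: dist_commute)
      define g where "g = (\<lambda>t. F (t, y) - F (t, y0))"
      have "norm (deriv g x) \<le> (e/2 * (r/2)) / (r/2)"
      proof (rule deriv_bound_ball)
        show "g holomorphic_on ball x (r/2)" unfolding g_def
          using holomorphic_on_subset[OF h sub] yr r by (intro holomorphic_on_diff) auto
        show "norm (g w) \<le> e/2 * (r/2)" if "w \<in> ball x (r/2)" for w
        proof -
          have "w \<in> cball x0 r" using subsetD[OF sub that] by simp
          from sb[OF this yr(2)] show ?thesis unfolding g_def by simp
        qed
      qed (use r in auto)
      moreover have "deriv g x = d1 F (x, y) - d1 F (x, y0)"
      proof -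
        have "(x, y) \<in> W" "(x, y0) \<in> W" using r xr yr by auto
        then show ?thesis unfolding g_def
          by (intro DERIV_imp_deriv DERIV_diff hol2_d1[OF F])
      qed
      ultimately have "dist (d1 F z) (d1 F (x, y0)) \<le> e/2" using r by (simp add: dist_norm)
      with d(2)[OF x(2)] show "dist (d1 F z) (d1 F (x0, y0)) < e"
        using dist_triangle[of "d1 F z" "d1 F (x0,y0)" "d1 F (x, y0)"] by linarith
    qed (use s d r in auto)
  qed
qed

lemma hol2_d1_hol2:
  assumes F: "hol2_on F W" and W: "open W"
  shows "hol2_on (d1 F) W"
proof (rule hol2_onI[OF W hol2_d1_continuous[OF assms]])
  fix x0 y0 assume z0: "(x0, y0) \<in> W"
  obtain r where r: "r > 0" "cball x0 r \<times> cball y0 r \<subseteq> W" using polydisc_in_open[OF W z0] .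
  have "(\<lambda>t. F (t, y0)) holomorphic_on ball x0 r"
    by (rule hol2_holomorphic1[OF F]) (use r in auto)
  then have "(\<lambda>t. d1 F (t, y0)) holomorphic_on ball x0 r"
    by (simp add: d1_def holomorphic_deriv)
  then show "(\<lambda>t. d1 F (t, y0)) field_differentiable at x0"
    using r by (simp add: holomorphic_on_imp_differentiable_at)
  have uc: "uniformly_continuous_on (cball x0 r \<times> cball y0 r) (d1 F)"
    using hol2_d1_continuous[OF assms] r(2)
    by (intro compact_uniformly_continuous compact_Times compact_cball) (auto intro: continuous_on_subset)
  \<comment> \<open>Difference quotients in the first variable are holomorphic in the second;
    uniform continuity of \<open>d1 F\<close> makes them converge uniformly, so the limit is
    holomorphic there too.\<close>
  define Q where "Q = (\<lambda>n y. (F (x0 + of_real (r / Suc n), y) - F (x0, y)) / of_real (r / Suc n))"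
  have xn: "x0 + of_real (r / Suc n) \<in> cball x0 r" for n
    using r by (simp add: dist_norm norm_divide divide_le_eq del: of_nat_Suc)
  have "(\<lambda>t. d1 F (x0, t)) holomorphic_on ball y0 r"
  proof (rule holomorphic_uniform_sequence[of _ Q])
    show "Q n holomorphic_on ball y0 r" for n
      unfolding Q_def
      by (intro holomorphic_intros hol2_holomorphic2[OF F]) (use r xn in auto)
    fix y1 assume y1: "y1 \<in> ball y0 r"
    then obtain d where d: "d > 0" "cball y1 d \<subseteq> ball y0 r" using open_contains_cball open_ball by blast
    have "uniform_limit (cball y1 d) Q (\<lambda>t. d1 F (x0, t)) sequentially"
      unfolding uniform_limit_sequentially_iff
    proof (intro allI impI)
      fix e :: real assume "e > 0"
      obtain s where s: "s > 0" "\<And>z z'. z \<in> cball x0 r \<times> cball y0 r \<Longrightarrow> z' \<in> cball x0 r \<times> cball y0 r \<Longrightarrow>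
          dist z' z < s \<Longrightarrow> dist (d1 F z') (d1 F z) < e/2"
        using uc \<open>e > 0\<close> unfolding uniformly_continuous_on_def by (metis half_gt_zero)
      obtain N :: nat where N: "r / Suc N < s"
      proof -
        obtain N :: nat where "r / s < real N" using reals_Archimedean2 by blast
        then have "r / s < real (Suc N)" by simp
        then have "r / Suc N < s" using s r by (simp add: field_simps del: of_nat_Suc)
        then show thesis by (rule that)
      qed
      show "\<exists>N. \<forall>n\<ge>N. \<forall>x\<in>cball y1 d. dist (Q n x) (d1 F (x0, x)) < e"
      proof (intro exI[of _ N] allI impI ballI)
        fix n y assume n: "n \<ge> N" and y: "y \<in> cball y1 d"
        define h where "h = r / Suc n"
        have h: "h > 0" "h < s" "h \<le> r"
        proof -
          show "h > 0" using r by (simp add: h_def)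
          have "h \<le> r / Suc N" unfolding h_def using n r by (intro divide_left_mono) auto
          then show "h < s" using N by simp
          show "h \<le> r" unfolding h_def using r by (simp add: divide_le_eq)
        qed
        have yr: "y \<in> cball y0 r" using y d by auto
        define g where "g = (\<lambda>t. F (t, y) - t * d1 F (x0, y))"
        have "norm (g (x0 + of_real h) - g x0) \<le> e/2 * norm (x0 + of_real h - x0)"
        proof (rule field_differentiable_bound[of "cball x0 h" g "\<lambda>t. d1 F (t, y) - d1 F (x0, y)"])
          show "(g has_field_derivative d1 F (t, y) - d1 F (x0, y)) (at t within cball x0 h)" if "t \<in> cball x0 h" for t
          proof -
            have "(t, y) \<in> W" using that h r yr by auto
            then show ?thesis unfolding g_def
              by (auto intro!: derivative_eq_intros hol2_d1[OF F] DERIV_subset[OF hol2_d1[OF F]])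
          qed
          show "norm (d1 F (t, y) - d1 F (x0, y)) \<le> e/2" if "t \<in> cball x0 h" for t
            using s(2)[of "(x0,y)" "(t,y)"] that h yr r by (auto simp: dist_norm dist_Pair_Pair norm_minus_commute intro!: less_imp_le)
        qed (use h in \<open>auto simp: dist_norm\<close>)
        moreover have "Q n y = (F (x0 + of_real h, y) - F (x0, y)) / of_real h"
          unfolding Q_def h_def ..
        then have "g (x0 + of_real h) - g x0 = of_real h * (Q n y - d1 F (x0, y))"
          using h by (simp add: g_def field_simps)
        ultimately have "norm (Q n y - d1 F (x0, y)) \<le> e/2"
          using h by (simp add: norm_mult)
        then show "dist (Q n y) (d1 F (x0, y)) < e" using \<open>e > 0\<close> by (simp add: dist_norm)
      qed
    qed
    with d show "\<exists>d>0. cball y1 d \<subseteq> ball y0 r \<and> uniform_limit (cball y1 d) Q (\<lambda>t. d1 F (x0, t)) sequentially"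
      by blast
  qed simp
  then show "(\<lambda>t. d1 F (x0, t)) field_differentiable at y0"
    using r by (simp add: holomorphic_on_imp_differentiable_at)
qed

lemma open_swap: "open W \<Longrightarrow> open (prod.swap -` W)" for W :: "(complex \<times> complex) set"
  by (intro continuous_open_vimage) (auto simp: prod.swap_def intro!: continuous_intros)

lemma hol2_d2_hol2:
  assumes F: "hol2_on F W" and W: "open W"
  shows "hol2_on (d2 F) W"
proof -
  have "hol2_on (d1 (\<lambda>z. F (snd z, fst z))) (prod.swap -` W)"
    by (rule hol2_d1_hol2[OF hol2_swap[OF F] open_swap[OF W]])
  from hol2_swap[OF this] show ?thesis
    by (simp add: d1_def d2_def[abs_def] vimage_def)
qed

lemma hol2_uniform_limit:
  assumes W: "open W" and F: "\<And>n. hol2_on (F n) W" and u: "uniform_limit W F f sequentially"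
  shows "hol2_on f W"
proof (rule hol2_onI[OF W])
  show "continuous_on W f"
    by (rule uniform_limit_theorem[OF _ u]) (auto intro!: always_eventually hol2_imp_continuous_on[OF F])
  fix x0 y0 assume z0: "(x0, y0) \<in> W"
  obtain r where r: "r > 0" "cball x0 r \<times> cball y0 r \<subseteq> W" using polydisc_in_open[OF W z0] .
  have "(\<lambda>t. f (t, y0)) holomorphic_on ball x0 r"
  proof (rule holomorphic_uniform_sequence[of _ "\<lambda>n t. F n (t, y0)"])
    show "(\<lambda>t. F n (t, y0)) holomorphic_on ball x0 r" for n
      by (rule hol2_holomorphic1[OF F]) (use r in auto)
    fix x assume "x \<in> ball x0 r"
    then obtain d where d: "d > 0" "cball x d \<subseteq> ball x0 r" using open_contains_cball open_ball by blast
    have "uniform_limit (cball x d) (\<lambda>n t. F n (t, y0)) (\<lambda>t. f (t, y0)) sequentially"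
    proof (rule uniform_limit_compose'[OF u])
      show "(\<lambda>t. (t, y0)) \<in> cball x d \<rightarrow> W"
        using subset_trans[OF d(2) ball_subset_cball] r by fastforce
    qed
    with d show "\<exists>d>0. cball x d \<subseteq> ball x0 r \<and> uniform_limit (cball x d) (\<lambda>n t. F n (t, y0)) (\<lambda>t. f (t, y0)) sequentially"
      by blast
  qed simp
  then show "(\<lambda>t. f (t, y0)) field_differentiable at x0"
    using r by (simp add: holomorphic_on_imp_differentiable_at)
  have "(\<lambda>t. f (x0, t)) holomorphic_on ball y0 r"
  proof (rule holomorphic_uniform_sequence[of _ "\<lambda>n t. F n (x0, t)"])
    show "(\<lambda>t. F n (x0, t)) holomorphic_on ball y0 r" for n
      by (rule hol2_holomorphic2[OF F]) (use r in auto)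
    fix x assume "x \<in> ball y0 r"
    then obtain d where d: "d > 0" "cball x d \<subseteq> ball y0 r" using open_contains_cball open_ball by blast
    have "uniform_limit (cball x d) (\<lambda>n t. F n (x0, t)) (\<lambda>t. f (x0, t)) sequentially"
    proof (rule uniform_limit_compose'[OF u])
      show "Pair x0 \<in> cball x d \<rightarrow> W"
        using subset_trans[OF d(2) ball_subset_cball] r by fastforce
    qed
    with d show "\<exists>d>0. cball x d \<subseteq> ball y0 r \<and> uniform_limit (cball x d) (\<lambda>n t. F n (x0, t)) (\<lambda>t. f (x0, t)) sequentially"
      by blast
  qed simp
  then show "(\<lambda>t. f (x0, t)) field_differentiable at y0"
    using r by (simp add: holomorphic_on_imp_differentiable_at)
qed

section \<open>Polynomials with connected Julia set\<close>

text \<open>The bound holds near the unit circle only up to e, so the maximum principle is applied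
  on a circle of radius t close to 1 and e is removed at the end.\<close>

lemma bound_imp_norm_le_1_ball:
  fixes k :: "complex \<Rightarrow> complex"
  assumes hol: "k holomorphic_on ball 0 1" and "w \<in> ball 0 1"
    and near: "\<And>e. e > 0 \<Longrightarrow> \<exists>s<1. \<forall>w. s < norm w \<and> norm w < 1 \<longrightarrow> norm (k w) \<le> 1 + e"
  shows "norm (k w) \<le> 1"
proof (rule field_le_epsilon)
  fix e :: real assume "e > 0"
  then obtain s where s: "s < 1" "\<And>w. s < norm w \<Longrightarrow> norm w < 1 \<Longrightarrow> norm (k w) \<le> 1 + e" using near by blast
  obtain t where t: "max s (norm w) < t" "t < 1" using dense[of "max s (norm w)" 1] s assms(2) by auto
  have tp: "t > 0" using t norm_ge_zero[of w] by linarith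
  show "norm (k w) \<le> 1 + e"
  proof (rule maximum_modulus_frontier[of k "cball 0 t"])
    show "k holomorphic_on interior (cball 0 t)"
      by (rule holomorphic_on_subset[OF hol]) (use t in auto)
    show "continuous_on (closure (cball 0 t)) k"
      by (rule holomorphic_on_imp_continuous_on, rule holomorphic_on_subset[OF hol]) (use t in auto)
    show "norm (k z) \<le> 1 + e" if "z \<in> frontier (cball 0 t)" for z
      using that t tp by (intro s(2)) auto
  qed (use t in auto)
qed

lemma compact_in_unit_ball:
  fixes T :: "complex set"
  assumes "compact T" "T \<subseteq> ball 0 1"
  obtains s where "s < 1" "T \<subseteq> cball 0 s"
proof (cases "T = {}")
  case False
  obtain x where "x \<in> T" "\<And>y. y \<in> T \<Longrightarrow> norm y \<le> norm x"
    using continuous_attains_sup[OF assms(1) False, of norm] by (auto intro: continuous_intros)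
  then show ?thesis using assms(2) by (intro that[of "norm x"]) auto
qed (use that[of 0] in auto)

section \<open>One-variable dynamics of p: the filled Julia set and its complement\<close>

locale escape_data =
  fixes p q :: "complex poly" and d :: nat and R r \<alpha> :: real
  assumes d2: "d \<ge> 2" and p_eq: "p = monom 1 d + q" and deg_q: "degree q < d"
    and R_pos: "R > 0" and r_pos: "0 < r" and r_less_1: "r < 1" and alpha_pos: "\<alpha> > 0"
    and small: "\<And>y::complex. norm y \<ge> \<alpha> \<Longrightarrow>
           norm (poly q y / y ^ d) + (R + 1) / norm y ^ (d - 1) < r"
    and large: "\<And>y::complex. norm y \<ge> \<alpha> \<Longrightarrow> norm (poly p y) > (2 * R + 1) * norm y"
begin

abbreviation "K \<equiv> filled_julia p"
abbreviation "J \<equiv> julia p"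
abbreviation "iter n \<equiv> (poly p ^^ n)"

lemma degree_p: "degree p = d"
  unfolding p_eq using deg_q by (simp add: degree_add_eq_left degree_monom_eq)

lemma lead_coeff_p: "coeff p d = 1"
  unfolding p_eq using deg_q by (simp add: coeff_eq_0)

lemma poly_p: "poly p x = x ^ d + poly q x"
  unfolding p_eq by (simp add: poly_monom)

lemma p_nonconst: "\<not> (poly p) constant_on S" if "open S" "S \<noteq> {}"
proof
  assume "(poly p) constant_on S"
  then obtain c where c: "\<And>x. x \<in> S \<Longrightarrow> poly p x = c" unfolding constant_on_def by blast
  have "infinite S" using that by (meson finite_imp_not_open)
  moreover have "S \<subseteq> {x. poly (p - [:c:]) x = 0}" using c by auto
  moreover have "p - [:c:] \<noteq> 0"
    using degree_p d2 by (metis degree_pCons_0 eq_iff_diff_eq_0 not_numeral_le_zero)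
  ultimately show False using poly_roots_finite finite_subset by metis
qed

lemma iter_hol: "iter n holomorphic_on S"
proof (induction n arbitrary: S)
  case 0
  then show ?case by (simp add: id_def)
next
  case (Suc n)
  have "(poly p \<circ> iter n) holomorphic_on S"
    by (rule holomorphic_on_compose[OF Suc]) (intro holomorphic_intros)
  then show ?case by (simp add: comp_def)
qed

lemma iter_cont: "continuous_on S (iter n)"
  by (rule holomorphic_on_imp_continuous_on[OF iter_hol])

lemma norm_step_ge: "norm z \<ge> \<alpha> \<Longrightarrow> norm (poly p z) \<ge> (2 * R + 1) * norm z"
  using large[of z] by simp

lemma norm_iter_ge:
  assumes "norm z \<ge> \<alpha>"
  shows "norm (iter n z) \<ge> (2 * R + 1) ^ n * norm z"
proof (induction n)
  case (Suc n)
  have "(1::real) \<le> (2 * R + 1) ^ n" using R_pos by (intro one_le_power) auto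
  then have "norm z \<le> (2 * R + 1) ^ n * norm z" using mult_right_mono[of 1 _ "norm z"] by simp
  then have "norm (iter n z) \<ge> \<alpha>" using Suc assms by linarith
  from norm_step_ge[OF this] have "(2 * R + 1) * norm (iter n z) \<le> norm (iter (Suc n) z)" by simp
  moreover have "(2 * R + 1) * ((2 * R + 1) ^ n * norm z) \<le> (2 * R + 1) * norm (iter n z)"
    using Suc R_pos by (intro mult_left_mono) auto
  ultimately show ?case by (simp add: mult.assoc)
qed simp

lemma escape_unbounded:
  assumes "norm (iter m z) \<ge> \<alpha>"
  shows "z \<notin> K"
proof
  assume "z \<in> K"
  then obtain B where B: "\<And>n. norm (iter n z) \<le> B"
    unfolding filled_julia_def bounded_iff by auto
  obtain n where "B / \<alpha> < (2 * R + 1) ^ n" using real_arch_pow[of "2 * R + 1"] R_pos by auto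
  then have "B < (2 * R + 1) ^ n * \<alpha>" using alpha_pos by (simp add: field_simps)
  also have "\<dots> \<le> (2 * R + 1) ^ n * norm (iter m z)" using assms R_pos by (intro mult_left_mono) auto
  also have "\<dots> \<le> norm (iter n (iter m z))" by (rule norm_iter_ge[OF assms])
  also have "\<dots> = norm (iter (n + m) z)" by (simp add: funpow_add)
  finally show False using B[of "n + m"] by simp
qed

lemma K_eq: "K = {z. \<forall>n. norm (iter n z) \<le> \<alpha>}"
proof (rule set_eqI, rule iffI)
  fix z assume "z \<in> K"
  then have "norm (iter n z) < \<alpha>" for n using escape_unbounded[of n z] by force
  then show "z \<in> {z. \<forall>n. norm (iter n z) \<le> \<alpha>}" by (auto intro: less_imp_le)
next
  fix z assume "z \<in> {z. \<forall>n. norm (iter n z) \<le> \<alpha>}"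
  then show "z \<in> K" unfolding filled_julia_def bounded_iff by auto
qed

lemma K_iter_less: "z \<in> K \<Longrightarrow> norm (iter n z) < \<alpha>"
  using escape_unbounded[of n z] by force

lemma K_less: "z \<in> K \<Longrightarrow> norm z < \<alpha>"
  using K_iter_less[of z 0] by simp

lemma closed_K: "closed K"
proof -
  have "K = (\<Inter>n. {z. norm (iter n z) \<le> \<alpha>})" unfolding K_eq by auto
  then show ?thesis
    by (simp, intro closed_INT ballI closed_Collect_le continuous_intros iter_cont)
qed

lemma bounded_K: "bounded K"
  by (rule bounded_subset[of "ball 0 \<alpha>"]) (use K_less in auto)

lemma compact_K: "compact K"
  using closed_K bounded_K by (simp add: compact_eq_bounded_closed)

lemma p_in_K_iff: "poly p z \<in> K \<longleftrightarrow> z \<in> K"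
proof
  assume "z \<in> K"
  then have "norm (iter (Suc n) z) \<le> \<alpha>" for n unfolding K_eq by blast
  then show "poly p z \<in> K" unfolding K_eq by (simp add: funpow_swap1)
next
  assume a: "poly p z \<in> K"
  show "z \<in> K"
  proof (rule ccontr)
    assume "z \<notin> K"
    then obtain n where n: "norm (iter n z) > \<alpha>" unfolding K_eq by (auto simp: not_le)
    have "norm (iter (Suc n) z) \<ge> (2 * R + 1) * norm (iter n z)" using norm_step_ge[of "iter n z"] n by simp
    moreover have "(2 * R + 1) * norm (iter n z) \<ge> 1 * norm (iter n z)"
      using R_pos by (intro mult_right_mono) auto
    ultimately have "norm (iter n (poly p z)) \<ge> \<alpha>" using n by (simp add: funpow_swap1)
    then show False using escape_unbounded a by blast
  qed
qed

lemma iter_in_K_iff: "iter n z \<in> K \<longleftrightarrow> z \<in> K"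
  by (induction n) (auto simp: p_in_K_iff)

lemma fixed_point_ex: "\<exists>z. poly p z = z"
proof -
  obtain e where e: "d = Suc (Suc e)" using d2 by (metis add_2_eq_Suc le_Suc_ex)
  have "coeff (p - [:0, 1:]) d = 1" using lead_coeff_p by (simp add: e)
  then have "degree (p - [:0, 1:]) \<noteq> 0"
    using le_degree[of "p - [:0, 1:]" d] d2 by (metis le_zero_eq not_numeral_le_zero zero_neq_one)
  then obtain z where "poly (p - [:0, 1:]) z = 0" using alg_closed_imp_poly_has_root[of "p - [:0, 1:]"] by auto
  then show ?thesis by auto
qed

lemma K_nonempty: "K \<noteq> {}"
proof -
  obtain z where z: "poly p z = z" using fixed_point_ex by blast
  have "iter n z = z" for n by (induction n) (auto simp: z)
  then have "z \<in> K" by (simp add: filled_julia_def)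
  then show ?thesis by blast
qed

lemma J_eq: "J = K - interior K"
  unfolding julia_def frontier_def using closed_K by simp

lemma J_sub_K: "J \<subseteq> K" by (auto simp: J_eq)

lemma compact_J: "compact J"
  unfolding julia_def using compact_K by (rule compact_frontier)

lemma J_nonempty: "J \<noteq> {}"
proof -
  have "K \<noteq> UNIV" using bounded_K not_bounded_UNIV by metis
  then show ?thesis unfolding julia_def using K_nonempty frontier_eq_empty by blast
qed

lemma p_interior_K: "z \<in> interior K \<Longrightarrow> poly p z \<in> interior K"
proof -
  assume z: "z \<in> interior K"
  have "open (poly p ` interior K)"
  proof (rule open_mapping_thm[of "poly p" UNIV])
    show "\<not> (poly p) constant_on UNIV" using p_nonconst by auto
  qed (auto intro!: holomorphic_intros)
  moreover have "poly p ` interior K \<subseteq> K" using interior_subset p_in_K_iff by blast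
  ultimately show ?thesis using z interior_maximal by blast
qed

lemma iter_interior_K: "z \<in> interior K \<Longrightarrow> iter n z \<in> interior K"
  by (induction n) (auto intro: p_interior_K)

lemma J_backward: "poly p z \<in> J \<Longrightarrow> z \<in> J"
  unfolding J_eq using p_in_K_iff p_interior_K by blast

lemma iter_J_backward: "iter n z \<in> J \<Longrightarrow> z \<in> J"
  by (induction n) (auto intro: J_backward)

text \<open>On a bounded component, whose frontier lies in K, the maximum principle would bound
  every iterate by \<alpha>. So all components are unbounded, and the complement of a bounded planar
  set has only one of those.\<close>

lemma connected_compl_K: "connected (- K)"
proof -
  have unb: "\<not> bounded C" if C: "C \<in> components (- K)" for C
  proof
    assume bC: "bounded C"
    have Cne: "C \<noteq> {}" and CK: "C \<subseteq> - K" using in_components_nonempty[OF C] in_components_subset[OF C] by blast+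
    have oC: "open C" using C closed_K open_components by (metis open_Compl)
    have fr: "frontier C \<subseteq> K"
    proof -
      have "frontier C \<subseteq> frontier (- K)" using C frontier_of_components_subset by blast
      then show ?thesis using frontier_complement[of K] frontier_subset_closed[OF closed_K] by blast
    qed
    obtain z where z: "z \<in> C" using Cne by blast
    have "norm (iter n z) \<le> \<alpha>" for n
    proof (rule maximum_modulus_frontier[of "iter n" C])
      show "norm (iter n x) \<le> \<alpha>" if "x \<in> frontier C" for x
        using that fr unfolding K_eq by auto
    qed (use bC z oC in \<open>auto intro: iter_hol iter_cont\<close>)
    then have "z \<in> K" unfolding K_eq by auto
    then show False using z CK by auto
  qed
  show ?thesis
    unfolding connected_eq_connected_components_eq
  proof (intro ballI)
    show "C = C'" if "C \<in> components (- K)" "C' \<in> components (- K)" for C C'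
      using cobounded_unique_unbounded_components[of "- K" C C'] unb that bounded_K by auto
  qed
qed

text \<open>If K splits into two closed pieces, the connected J lies in one of them. The other one
  is then the interior of K minus a closed set, hence open and closed in the plane.\<close>

lemma connected_K: "connected J \<Longrightarrow> connected K"
proof (rule ccontr)
  assume cJ: "connected J" and "\<not> connected K"
  then obtain A B where AB: "closedin (top_of_set K) A" "closedin (top_of_set K) B" "A \<union> B = K" "A \<inter> B = {}" "A \<noteq> {}" "B \<noteq> {}"
    unfolding connected_closedin_eq by blast
  have cl: "closed A" "closed B" using AB(1,2) closed_K closedin_closed_trans by blast+
  have *: False if J: "J \<subseteq> A" and "closed A" "closed B" "A \<union> B = K" "A \<inter> B = {}" "B \<noteq> {}" for A B
  proof -
    have "B \<subseteq> interior K" using that J_eq by blast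
    have "B = interior K \<inter> - A" using that interior_subset[of K] \<open>B \<subseteq> interior K\<close> by blast
    then have "open B" using \<open>closed A\<close> by (simp add: open_Int open_Compl)
    then have "B = UNIV" using \<open>closed B\<close> \<open>B \<noteq> {}\<close> clopen by blast
    then show False using that bounded_K not_bounded_UNIV bounded_subset by (metis Un_upper2)
  qed
  have "J \<subseteq> A \<or> J \<subseteq> B"
  proof (rule ccontr)
    assume "\<not> ?thesis"
    then have "J \<inter> A \<noteq> {}" "J \<inter> B \<noteq> {}" "J \<subseteq> A \<union> B" using J_sub_K AB(3) by auto
    then show False using cJ cl AB(4) unfolding connected_closed by blast
  qed
  then show False
    using *[of A B] *[of B A] AB cl by (auto simp: Un_commute Int_commute)
qed


text \<open>Suppose c escapes. The complement of K on the sphere is simply connected, and in a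
  Riemann coordinate that sends infinity to 0 the map p becomes a proper self-map of the disc whose
  only zero is 0, of order d. Such a map is \<kappa> w^d and has no critical point besides 0,
  contradicting c.\<close>

lemma J_subset_imp_crit_in_K:
  assumes cJ: "connected J" and nc: "\<And>z. z \<in> J \<Longrightarrow> poly (pderiv p) z \<noteq> 0"
    and crit: "poly (pderiv p) c = 0"
  shows "c \<in> K"
proof (rule ccontr)
  assume cK: "c \<notin> K"
  obtain z0 where z0: "z0 \<in> K" using K_nonempty by blast
  \<comment> \<open>The complement of K in the coordinate u = 1/(z - z0), with u = 0 standing for
    infinity; z0 in K keeps A inside the finite plane.\<close>
  define A where "A = {u. u = 0 \<or> z0 + 1 / u \<notin> K}"
  define M where "M = \<alpha> + norm z0"
  have M: "M > 0" using alpha_pos by (simp add: M_def add_pos_nonneg)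
  have KM: "norm (z - z0) < M" if "z \<in> K" for z
    using K_less[OF that] norm_triangle_ineq4[of z z0] by (simp add: M_def)
  have ballA: "ball 0 (1 / M) \<subseteq> A"
  proof
    fix u :: complex assume u: "u \<in> ball 0 (1 / M)"
    show "u \<in> A"
    proof (cases "u = 0")
      case False
      then have "norm (1 / u) > M" using u M by (simp add: norm_divide field_simps)
      then show ?thesis using KM[of "z0 + 1 / u"] by (auto simp: A_def)
    qed (simp add: A_def)
  qed
  have A_eq: "A = ball 0 (1 / M) \<union> (\<lambda>z. 1 / (z - z0)) ` (- K)"
  proof
    show "A \<subseteq> ball 0 (1 / M) \<union> (\<lambda>z. 1 / (z - z0)) ` (- K)"
    proof
      fix u assume "u \<in> A"
      then consider "u = 0" | "u \<noteq> 0" "z0 + 1 / u \<in> - K" by (auto simp: A_def)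
      then show "u \<in> ball 0 (1 / M) \<union> (\<lambda>z. 1 / (z - z0)) ` (- K)"
      proof cases
        case 2
        then have "u = (\<lambda>z. 1 / (z - z0)) (z0 + 1 / u)" by simp
        then show ?thesis using 2 by blast
      qed (use M in auto)
    qed
    show "ball 0 (1 / M) \<union> (\<lambda>z. 1 / (z - z0)) ` (- K) \<subseteq> A"
      using ballA by (auto simp: A_def)
  qed
  have openA: "open A"
  proof -
    have "A = ball 0 (1 / M) \<union> {u \<in> - {0}. z0 + 1 / u \<in> - K}"
      using ballA by (auto simp: A_def M)
    moreover have "open {u \<in> - {0}. z0 + 1 / u \<in> - K}"
    proof -
      have "continuous_on (- {0}) (\<lambda>u. z0 + 1 / u :: complex)" by (intro continuous_intros) auto
      then have "open ((\<lambda>u. z0 + 1 / u) -` (- K) \<inter> - {0})"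
        using closed_K by (subst (asm) continuous_on_open_vimage) auto
      then show ?thesis by (simp add: vimage_def Int_def conj_commute)
    qed
    ultimately show ?thesis by auto
  qed
  have conA: "connected A"
    unfolding A_eq
  proof (rule connected_Un)
    show "connected ((\<lambda>z. 1 / (z - z0)) ` (- K))"
      by (intro connected_continuous_image connected_compl_K continuous_intros) (use z0 in auto)
    define z where "z = z0 + of_real (2 * M)"
    have "norm (z - z0) = 2 * M" using M by (simp add: z_def norm_mult)
    then have "z \<notin> K" "norm (1 / (z - z0)) < 1 / M"
      using KM[of z] M by (auto simp: norm_divide field_simps)
    then show "ball 0 (1 / M) \<inter> (\<lambda>z. 1 / (z - z0)) ` (- K) \<noteq> {}" by fastforce
  qed auto
  \<comment> \<open>A bounded component of the complement of A lies, by Sura-Bura, in a compact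
    relatively open Q. Back in the z-plane Q becomes a nonempty clopen part of K without z0 (the
    point u = infinity), against connectedness of K.\<close>
  have unb: "\<not> bounded C" if C: "C \<in> components (- A)" for C
  proof
    assume bC: "bounded C"
    have clA: "closed (- A)" using openA by (simp add: closed_def)
    have "closed C" by (rule closed_components[OF clA C])
    then have cC: "compact C" using bC by (simp add: compact_eq_bounded_closed)
    obtain Q where Q: "openin (top_of_set (- A)) Q" "compact Q" "C \<subseteq> Q"
      using Sura_Bura_clopen_subset[OF closed_imp_locally_compact[OF clA] C cC, of UNIV] by auto
    have QA: "Q \<subseteq> - A" using Q(1) openin_imp_subset by blast
    have Q0: "u \<noteq> 0" "z0 + 1 / u \<in> K" if "u \<in> Q" for u using QA that by (auto simp: A_def)
    obtain T where T: "open T" "Q = - A \<inter> T" using Q(1) by (auto simp: openin_open)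
    define Q' where "Q' = (\<lambda>u. z0 + 1 / u) ` Q"
    have "compact Q'" unfolding Q'_def
      by (intro compact_continuous_image continuous_intros Q(2)) (use Q0 in auto)
    then have "closedin (top_of_set K) Q'"
      using Q0 by (intro closed_subset compact_imp_closed) (auto simp: Q'_def)
    moreover have "Q' = K \<inter> ((\<lambda>z. 1 / (z - z0)) -` T \<inter> - {z0})"
    proof
      show "Q' \<subseteq> K \<inter> ((\<lambda>z. 1 / (z - z0)) -` T \<inter> - {z0})" using Q0 T(2) by (auto simp: Q'_def)
      show "K \<inter> ((\<lambda>z. 1 / (z - z0)) -` T \<inter> - {z0}) \<subseteq> Q'"
      proof
        fix z assume z: "z \<in> K \<inter> ((\<lambda>z. 1 / (z - z0)) -` T \<inter> - {z0})"
        then have "1 / (z - z0) \<in> Q" unfolding T(2) by (auto simp: A_def)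
        moreover have "z = z0 + 1 / (1 / (z - z0))" by simp
        ultimately show "z \<in> Q'" unfolding Q'_def by blast
      qed
    qed
    moreover have "open ((\<lambda>z. 1 / (z - z0)) -` T \<inter> - {z0})"
    proof -
      have "continuous_on (- {z0}) (\<lambda>z. 1 / (z - z0))" by (intro continuous_intros) auto
      then show ?thesis using T(1) by (subst (asm) continuous_on_open_vimage) auto
    qed
    ultimately have "closedin (top_of_set K) Q'" "openin (top_of_set K) Q'"
      by (auto simp: openin_open)
    then have "Q' = {} \<or> Q' = K" using connected_K[OF cJ] unfolding connected_clopen by blast
    moreover have "Q' \<noteq> {}" using Q(3) in_components_nonempty[OF C] by (auto simp: Q'_def)
    moreover have "z0 \<notin> Q'" using Q0(1) by (auto simp: Q'_def)
    ultimately show False using z0 by blast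
  qed
  have scA: "simply_connected A"
    using simply_connected_eq_unbounded_complement_components[OF openA] conA unb by blast
  \<comment> \<open>If K were {z0}, then every root of p - z0 would be z0. As d >= 2, z0 would be a
    critical point, and it lies on J.\<close>
  have zK: "\<exists>z\<in>K. z \<noteq> z0"
  proof (rule ccontr)
    assume "\<not> (\<exists>z\<in>K. z \<noteq> z0)"
    then have K1: "K = {z0}" using z0 by blast
    then have "J = {z0}" using J_eq by simp
    then have n0: "poly (pderiv p) z0 \<noteq> 0" using nc by blast
    have pz: "poly p z0 = z0" using K1 p_in_K_iff[of z0] by simp
    define g where "g = p - [:z0:]"
    have "coeff g d = 1" using lead_coeff_p d2 by (simp add: g_def coeff_pCons split: nat.split)
    then have "d \<le> degree g" "g \<noteq> 0" by (auto intro: le_degree)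
    moreover have "degree g \<le> d" unfolding g_def by (rule degree_diff_le) (auto simp: degree_p)
    ultimately have dg: "degree g = d" "g \<noteq> 0" by auto
    have "poly g z0 = 0" using pz by (simp add: g_def)
    then obtain h where h: "g = [:- z0, 1:] * h" using poly_eq_0_iff_dvd by (metis dvdE)
    have "h \<noteq> 0" using h dg(2) by auto
    then have "degree g = degree [:- z0, 1:] + degree h" unfolding h by (intro degree_mult_eq) auto
    then have "degree h = d - 1" using dg(1) by simp
    then have "degree h > 0" using d2 by simp
    then obtain z1 where z1: "poly h z1 = 0" using alg_closed_imp_poly_has_root[of h] by blast
    have "poly p z1 = z0" using z1 arg_cong[OF h, of "\<lambda>f. poly f z1"] by (simp add: g_def)
    then have "z1 = z0" using p_in_K_iff[of z1] K1 by simp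
    moreover have "pderiv p = pderiv g" by (simp add: g_def pderiv_diff pderiv_pCons)
    moreover have "pderiv g = [:- z0, 1:] * pderiv h + h * pderiv [:- z0, 1:]" unfolding h by (rule pderiv_mult)
    ultimately have "poly (pderiv p) z0 = 0" using z1 by (simp add: pderiv_pCons)
    then show False using n0 by simp
  qed
  then have "A \<noteq> UNIV" "A \<noteq> {}"
  proof -
    obtain z where "z \<in> K" "z \<noteq> z0" using zK by blast
    then have "1 / (z - z0) \<notin> A" by (simp add: A_def)
    then show "A \<noteq> UNIV" by auto
    show "A \<noteq> {}" by (auto simp: A_def)
  qed
  then obtain f g where fg: "f holomorphic_on A" "g holomorphic_on ball 0 1"
      "\<And>z. z \<in> A \<Longrightarrow> f z \<in> ball 0 1 \<and> g (f z) = z" "\<And>z. z \<in> ball 0 1 \<Longrightarrow> g z \<in> A \<and> f (g z) = z"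
    using Riemann_mapping_theorem[of A] openA scA by blast
  have A0: "0 \<in> A" by (simp add: A_def)
  \<comment> \<open>A disc automorphism moves the image of u = 0 to the origin, so that the
    conjugated map fixes 0.\<close>
  obtain f' g' where fg': "f' (f 0) = 0" "f' holomorphic_on ball 0 1" "f' ` ball 0 1 \<subseteq> ball 0 1"
      "g' holomorphic_on ball 0 1" "g' ` ball 0 1 \<subseteq> ball 0 1"
      "\<And>z. z \<in> ball 0 1 \<Longrightarrow> f' (g' z) = z" "\<And>z. z \<in> ball 0 1 \<Longrightarrow> g' (f' z) = z"
    using ball_biholomorphism_exists[of "f 0"] fg(3)[OF A0] by blast
  define \<beta> where "\<beta> = f' \<circ> f"
  define \<gamma> where "\<gamma> = g \<circ> g'"
  have \<beta>hol: "\<beta> holomorphic_on A" unfolding \<beta>_def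
    by (rule holomorphic_on_compose[OF fg(1)], rule holomorphic_on_subset[OF fg'(2)]) (use fg(3) in auto)
  have \<gamma>hol: "\<gamma> holomorphic_on ball 0 1" unfolding \<gamma>_def
    by (rule holomorphic_on_compose[OF fg'(4)], rule holomorphic_on_subset[OF fg(2)]) (use fg'(5) in auto)
  have \<beta>\<gamma>: "\<beta> (\<gamma> w) = w" "\<gamma> w \<in> A" if "w \<in> ball 0 1" for w
  proof -
    have "g' w \<in> ball 0 1" using fg'(5) that by blast
    then show "\<beta> (\<gamma> w) = w" "\<gamma> w \<in> A" using fg(4)[of "g' w"] fg'(6)[OF that] by (auto simp: \<beta>_def \<gamma>_def)
  qed
  have \<gamma>\<beta>: "\<gamma> (\<beta> u) = u" "\<beta> u \<in> ball 0 1" if "u \<in> A" for u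
  proof -
    have f: "f u \<in> ball 0 1" "g (f u) = u" using fg(3)[OF that] by auto
    show "\<gamma> (\<beta> u) = u" using f fg'(7)[OF f(1)] by (simp add: \<beta>_def \<gamma>_def)
    show "\<beta> u \<in> ball 0 1" using subsetD[OF fg'(3) imageI[OF f(1)]] by (simp add: \<beta>_def)
  qed
  have \<beta>0: "\<beta> 0 = 0" using fg'(1) by (simp add: \<beta>_def)
  have \<gamma>0: "\<gamma> 0 = 0" using \<gamma>\<beta>(1)[OF A0] \<beta>0 by simp
  have D0: "deriv \<beta> 0 * deriv \<gamma> 0 = 1"
  proof -
    have "((\<lambda>w. \<beta> (\<gamma> w)) has_field_derivative deriv \<beta> (\<gamma> 0) * deriv \<gamma> 0) (at 0)"
      using DERIV_chain2[OF holomorphic_derivI[OF \<beta>hol openA \<beta>\<gamma>(2)[of 0]] holomorphic_derivI[OF \<gamma>hol]] by simp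
    moreover have "((\<lambda>w. \<beta> (\<gamma> w)) has_field_derivative 1) (at 0)"
      by (rule has_field_derivative_transform_within_open[of "\<lambda>w. w" _ _ "ball 0 1"]) (use \<beta>\<gamma> in auto)
    ultimately show ?thesis using DERIV_unique \<gamma>0 by metis
  qed
  \<comment> \<open>Reflecting the polynomial p(z0 + x) - z0 writes p in the u-coordinate as
    u^d/\<rho>(u) with \<rho>(0) = 1, so the superattracting point at infinity needs no separate
    treatment.\<close>
  define g0 where "g0 = pcompose p [:z0, 1:] - [:z0:]"
  define \<rho> where "\<rho> = poly (reflect_poly g0)"
  have deg1: "degree (pcompose p [:z0, 1:]) = d" by (simp add: degree_pcompose degree_p)
  have lc1: "coeff (pcompose p [:z0, 1:]) d = 1"
    using lead_coeff_comp[of "[:z0, 1:]" p] deg1 lead_coeff_p degree_p by simp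
  have lc: "coeff g0 d = 1" using lc1 d2 by (simp add: g0_def coeff_pCons split: nat.split)
  have dg0: "degree g0 = d"
  proof (rule antisym)
    show "degree g0 \<le> d" unfolding g0_def by (rule degree_diff_le) (auto simp: deg1)
    show "d \<le> degree g0" using lc by (intro le_degree) simp
  qed
  have \<rho>0: "\<rho> 0 = 1" unfolding \<rho>_def using lc dg0 by simp
  have \<rho>nz: "\<rho> u = u ^ d * (poly p (z0 + 1 / u) - z0)" if "u \<noteq> 0" for u
    unfolding \<rho>_def using poly_reflect_poly_nz[OF that, of g0] dg0 by (simp add: g0_def poly_pcompose inverse_eq_divide)
  define ps where "ps = (\<lambda>u. u ^ d / \<rho> u)"
  have psnz: "ps u = 1 / (poly p (z0 + 1 / u) - z0)" if "u \<noteq> 0" for u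
    using \<rho>nz[OF that] that by (simp add: ps_def)
  have \<rho>A: "\<rho> u \<noteq> 0" if "u \<in> A" for u
  proof (cases "u = 0")
    case False
    then have "poly p (z0 + 1 / u) \<noteq> z0" using that z0 p_in_K_iff[of "z0 + 1 / u"] by (auto simp: A_def)
    then show ?thesis using \<rho>nz[OF False] False by simp
  qed (simp add: \<rho>0)
  have psA: "ps u \<in> A" if "u \<in> A" for u
  proof (cases "u = 0")
    case True
    then show ?thesis using d2 by (simp add: ps_def A_def)
  next
    case False
    then have "poly p (z0 + 1 / u) \<notin> K" using that p_in_K_iff[of "z0 + 1 / u"] by (auto simp: A_def)
    then show ?thesis using psnz[OF False] by (simp add: A_def)
  qed
  have pshol: "ps holomorphic_on A" unfolding ps_def \<rho>_def[symmetric]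
    by (intro holomorphic_intros) (use \<rho>A in \<open>auto simp: \<rho>_def intro!: holomorphic_intros\<close>)
  \<comment> \<open>Dividing out the zeros of \<beta> and \<gamma> at 0 leaves nonvanishing
    holomorphic factors; they expose B as w^d times a nonvanishing k.\<close>
  define \<beta>1 where "\<beta>1 = (\<lambda>z. if z = 0 then deriv \<beta> 0 else (\<beta> z - \<beta> 0) / (z - 0))"
  define \<gamma>1 where "\<gamma>1 = (\<lambda>z. if z = 0 then deriv \<gamma> 0 else (\<gamma> z - \<gamma> 0) / (z - 0))"
  have \<beta>1hol: "\<beta>1 holomorphic_on A" unfolding \<beta>1_def
    by (rule pole_lemma[OF \<beta>hol]) (use A0 openA in \<open>simp add: interior_open\<close>)
  have \<gamma>1hol: "\<gamma>1 holomorphic_on ball 0 1" unfolding \<gamma>1_def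
    by (rule pole_lemma[OF \<gamma>hol]) (simp add: interior_open)
  have \<beta>1: "\<beta> u = u * \<beta>1 u" for u by (simp add: \<beta>1_def \<beta>0)
  have \<gamma>1: "\<gamma> w = w * \<gamma>1 w" for w by (simp add: \<gamma>1_def \<gamma>0)
  have \<beta>1nz: "\<beta>1 u \<noteq> 0" if "u \<in> A" for u
  proof (cases "u = 0")
    case True then show ?thesis using D0 by (auto simp: \<beta>1_def)
  next
    case False
    then have "\<beta> u \<noteq> 0" using \<gamma>\<beta>(1)[OF that] \<gamma>0 by metis
    then show ?thesis using \<beta>1[of u] by auto
  qed
  have \<gamma>1nz: "\<gamma>1 w \<noteq> 0" if "w \<in> ball 0 1" for w
  proof (cases "w = 0")
    case True then show ?thesis using D0 by (auto simp: \<gamma>1_def)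
  next
    case False
    then have "\<gamma> w \<noteq> 0" using \<beta>\<gamma>(1)[OF that] \<beta>0 by metis
    then show ?thesis using \<gamma>1[of w] by auto
  qed
  define B where "B = (\<lambda>w. \<beta> (ps (\<gamma> w)))"
  define k where "k = (\<lambda>w. \<gamma>1 w ^ d * \<beta>1 (ps (\<gamma> w)) / \<rho> (\<gamma> w))"
  have Bk: "B w = w ^ d * k w" for w
    unfolding B_def k_def \<beta>1[of "ps (\<gamma> w)"] by (simp add: ps_def \<gamma>1[of w] power_mult_distrib)
  have psg: "(\<lambda>w. ps (\<gamma> w)) holomorphic_on ball 0 1"
    using holomorphic_on_compose[OF \<gamma>hol holomorphic_on_subset[OF pshol]] \<beta>\<gamma>(2) by (force simp: o_def)
  have "(\<lambda>w. \<beta>1 (ps (\<gamma> w))) holomorphic_on ball 0 1"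
    using holomorphic_on_compose[OF psg holomorphic_on_subset[OF \<beta>1hol]] \<beta>\<gamma>(2) psA by (force simp: o_def)
  moreover have "(\<lambda>w. \<rho> (\<gamma> w)) holomorphic_on ball 0 1"
    unfolding \<rho>_def by (intro holomorphic_intros \<gamma>hol)
  ultimately have khol: "k holomorphic_on ball 0 1"
    unfolding k_def using \<rho>A \<beta>\<gamma>(2) by (intro holomorphic_intros \<gamma>1hol) auto
  have knz: "k w \<noteq> 0" if "w \<in> ball 0 1" for w
    unfolding k_def using \<gamma>1nz[OF that] \<beta>1nz[OF psA] \<rho>A \<beta>\<gamma>(2)[OF that] by simp
  have B1: "norm (B w) < 1" if "w \<in> ball 0 1" for w
    using \<gamma>\<beta>(2)[OF psA[OF \<beta>\<gamma>(2)[OF that]]] by (simp add: B_def)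
  have tend: "((\<lambda>s::real. s ^ d) \<longlongrightarrow> 1) (at_left 1)"
    by (auto intro!: tendsto_eq_intros)
  \<comment> \<open>Schwarz-type argument: |B| < 1 and |w|^d -> 1 near the circle, so |k| is at most
    1 + e there.\<close>
  have k1: "norm (k w) \<le> 1" if "w \<in> ball 0 1" for w
  proof (rule bound_imp_norm_le_1_ball[OF khol that])
    fix e :: real assume "e > 0"
    then have "1 / (1 + e) < 1" by simp
    from order_tendstoD(1)[OF tend this]
    obtain s where s: "s < 1" "\<And>y. s < y \<Longrightarrow> y < 1 \<Longrightarrow> 1 / (1 + e) < y ^ d"
      unfolding eventually_at_left_field by blast
    show "\<exists>s<1. \<forall>w. s < norm w \<and> norm w < 1 \<longrightarrow> norm (k w) \<le> 1 + e"
    proof (intro exI[of _ "max s 0"] conjI allI impI)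
      fix w :: complex assume w: "max s 0 < norm w \<and> norm w < 1"
      have "norm w ^ d * norm (k w) < 1" using B1[of w] w by (simp add: Bk norm_mult norm_power)
      moreover have "1 / (1 + e) * norm (k w) \<le> norm w ^ d * norm (k w)"
        using s(2)[of "norm w"] w by (intro mult_right_mono) auto
      ultimately have "1 / (1 + e) * norm (k w) < 1" by linarith
      then show "norm (k w) \<le> 1 + e" using \<open>e > 0\<close> by (simp add: divide_less_eq)
    qed (use s in auto)
  qed
  \<comment> \<open>Properness of B, that is |B| -> 1 at the circle. It yields the reverse estimate
    for 1/k.\<close>
  have proper: "\<exists>s<1. \<forall>w. s < norm w \<and> norm w < 1 \<longrightarrow> norm (B w) > \<eta>" if \<eta>: "\<eta> < 1" for \<eta>
  proof -
    define Q where "Q = \<gamma> ` cball 0 \<eta>"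
    have cQ: "compact Q" unfolding Q_def
      by (intro compact_continuous_image compact_cball holomorphic_on_imp_continuous_on holomorphic_on_subset[OF \<gamma>hol]) (use \<eta> in auto)
    have QA: "Q \<subseteq> A" unfolding Q_def using \<beta>\<gamma>(2) \<eta> by auto
    obtain L where L: "L > 0" "\<And>v. v \<in> Q \<Longrightarrow> norm v \<le> L"
      using compact_imp_bounded[OF cQ] unfolding bounded_pos by blast
    define S where "S = - ball z0 (1 / L)"
    have cS: "closed (S \<inter> (\<lambda>\<zeta>. 1 / (\<zeta> - z0)) -` Q)"
    proof (rule continuous_closed_preimage)
      show "continuous_on S (\<lambda>\<zeta>. 1 / (\<zeta> - z0))"
        unfolding S_def using L by (intro continuous_intros) auto
    qed (use cQ in \<open>auto simp: S_def compact_imp_closed\<close>)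
    define Q' where "Q' = S \<inter> (\<lambda>\<zeta>. 1 / (\<zeta> - z0)) -` Q"
    \<comment> \<open>The preimage of Q is covered by two compact sets: \<open>T1\<close> handles
      |u| <= \<delta> in the u-chart, \<open>T2'\<close> the remaining points in the z-chart, where
      |z - z0| <= 1/\<delta>.\<close>
    obtain \<delta> where \<delta>: "\<delta> > 0" "cball 0 \<delta> \<subseteq> A" using openA A0 open_contains_cball by blast
    define T1 where "T1 = cball 0 \<delta> \<inter> ps -` Q"
    define T2' where "T2' = cball z0 (1 / \<delta>) \<inter> poly p -` Q'"
    have cT1: "compact T1"
    proof -
      have "closed T1" unfolding T1_def
        by (rule continuous_closed_preimage)
          (use \<delta> cQ in \<open>auto intro: compact_imp_closed holomorphic_on_imp_continuous_on holomorphic_on_subset[OF pshol]\<close>)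
      moreover have "bounded T1" unfolding T1_def by (meson bounded_cball bounded_Int)
      ultimately show ?thesis by (simp add: compact_eq_bounded_closed)
    qed
    have cT2: "compact T2'"
    proof -
      have "closed T2'" unfolding T2'_def Q'_def
        by (rule continuous_closed_preimage) (use cS in \<open>auto intro!: continuous_intros\<close>)
      moreover have "bounded T2'" unfolding T2'_def by (meson bounded_cball bounded_Int)
      ultimately show ?thesis by (simp add: compact_eq_bounded_closed)
    qed
    have T2K: "z \<notin> K" if "z \<in> T2'" for z
    proof -
      have a: "poly p z \<in> S" "1 / (poly p z - z0) \<in> A" using that QA unfolding T2'_def Q'_def by auto
      have "poly p z \<noteq> z0" using a(1) L unfolding S_def by auto
      then have "poly p z \<notin> K" using a(2) by (auto simp: A_def)
      then show ?thesis using p_in_K_iff[of z] by simp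
    qed
    then have T2z: "z \<noteq> z0" if "z \<in> T2'" for z using that z0 by metis
    have "continuous_on T2' (\<lambda>z. 1 / (z - z0))"
      by (rule continuous_on_divide) (auto intro!: continuous_on_const continuous_on_diff continuous_on_id simp: T2z)
    then have cT: "compact (T1 \<union> (\<lambda>z. 1 / (z - z0)) ` T2')"
      by (rule compact_Un[OF cT1 compact_continuous_image[OF _ cT2]])
    have TA: "T1 \<union> (\<lambda>z. 1 / (z - z0)) ` T2' \<subseteq> A"
      using \<delta> T2K by (auto simp: T1_def A_def)
    have "compact (\<beta> ` (T1 \<union> (\<lambda>z. 1 / (z - z0)) ` T2'))"
      using cT by (intro compact_continuous_image holomorphic_on_imp_continuous_on holomorphic_on_subset[OF \<beta>hol TA])
    moreover have "\<beta> ` (T1 \<union> (\<lambda>z. 1 / (z - z0)) ` T2') \<subseteq> ball 0 1" using TA \<gamma>\<beta>(2) by blast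
    ultimately obtain s where s: "s < 1" "\<beta> ` (T1 \<union> (\<lambda>z. 1 / (z - z0)) ` T2') \<subseteq> cball 0 s"
      by (rule compact_in_unit_ball)
    show ?thesis
    proof (intro exI[of _ s] conjI allI impI s(1))
      fix w :: complex assume w: "s < norm w \<and> norm w < 1"
      show "norm (B w) > \<eta>"
      proof (rule ccontr)
        assume "\<not> ?thesis"
        then have "B w \<in> cball 0 \<eta>" by simp
        define u where "u = \<gamma> w"
        have uA: "u \<in> A" using \<beta>\<gamma>(2)[of w] w by (simp add: u_def)
        have "ps u = \<gamma> (B w)" unfolding B_def u_def[symmetric] using \<gamma>\<beta>(1)[OF psA[OF uA]] by simp
        then have psQ: "ps u \<in> Q" using \<open>B w \<in> cball 0 \<eta>\<close> by (auto simp: Q_def)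
        have "u \<in> T1 \<union> (\<lambda>z. 1 / (z - z0)) ` T2'"
        proof (cases "norm u \<le> \<delta>")
          case True then show ?thesis using psQ by (simp add: T1_def)
        next
          case False
          then have u0: "u \<noteq> 0" using \<delta> by auto
          define z where "z = z0 + 1 / u"
          have uz: "u = 1 / (z - z0)" by (simp add: z_def)
          have "z \<in> cball z0 (1 / \<delta>)" using False \<delta>(1) u0 by (simp add: z_def dist_norm norm_divide field_simps)
          moreover have "1 / (poly p z - z0) \<in> Q" using psQ psnz[OF u0] by (simp add: z_def)
          moreover have "poly p z \<in> S"
          proof -
            have "poly p z \<noteq> z0" using uA u0 p_in_K_iff[of z] z0 by (auto simp: A_def z_def)
            moreover have "norm (1 / (poly p z - z0)) \<le> L" by (rule L(2)) fact
            ultimately show ?thesis using L(1) by (simp add: S_def dist_norm norm_divide norm_minus_commute field_simps)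
          qed
          ultimately have "z \<in> T2'" by (simp add: T2'_def Q'_def)
          then show ?thesis using uz by blast
        qed
        then have "\<beta> u \<in> cball 0 s" using s(2) by blast
        moreover have "\<beta> u = w" using \<beta>\<gamma>(1)[of w] w by (simp add: u_def)
        ultimately show False using w by simp
      qed
    qed
  qed
  have k2: "norm (1 / k w) \<le> 1" if "w \<in> ball 0 1" for w
  proof (rule bound_imp_norm_le_1_ball[OF _ that])
    show "(\<lambda>w. 1 / k w) holomorphic_on ball 0 1"
      by (intro holomorphic_intros khol) (use knz in auto)
    fix e :: real assume "e > 0"
    then have "1 / (1 + e) < 1" by simp
    from proper[OF this] obtain s where s: "s < 1" "\<And>w. s < norm w \<Longrightarrow> norm w < 1 \<Longrightarrow> norm (B w) > 1 / (1 + e)" by blast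
    show "\<exists>s<1. \<forall>w. s < norm w \<and> norm w < 1 \<longrightarrow> norm (1 / k w) \<le> 1 + e"
    proof (intro exI[of _ s] conjI allI impI s(1))
      fix w :: complex assume w: "s < norm w \<and> norm w < 1"
      have "1 / (1 + e) < norm w ^ d * norm (k w)" using s(2)[of w] w by (simp add: Bk norm_mult norm_power)
      also have "\<dots> \<le> 1 * norm (k w)" using w by (intro mult_right_mono power_le_one) auto
      finally have *: "1 / (1 + e) < norm (k w)" by simp
      moreover have "norm (k w) > 0" using * \<open>e > 0\<close> by (meson less_trans zero_less_divide_1_iff add_pos_pos zero_less_one)
      ultimately show "norm (1 / k w) \<le> 1 + e" using \<open>e > 0\<close> by (simp add: norm_divide field_simps)
    qed
  qed
  have kn: "norm (k w) = 1" if "w \<in> ball 0 1" for w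
    using k1[OF that] k2[OF that] knz[OF that] by (simp add: norm_divide divide_le_eq)
  \<comment> \<open>Both estimates give |k| = 1, so k is a constant \<kappa>. The nonzero point w
    corresponding to c would then have to be critical for \<kappa> w^d.\<close>
  have "k constant_on ball 0 1"
  proof (rule maximum_modulus_principle[OF khol, of "ball 0 1" 0])
    show "norm (k z) \<le> norm (k 0)" if "z \<in> ball 0 1" for z using kn[OF that] kn[of 0] by simp
  qed auto
  then obtain \<kappa> where \<kappa>: "\<And>w. w \<in> ball 0 1 \<Longrightarrow> k w = \<kappa>" unfolding constant_on_def by blast
  have \<kappa>nz: "\<kappa> \<noteq> 0" using knz[of 0] \<kappa>[of 0] by simp
  define u where "u = 1 / (c - z0)"
  have cz: "c \<noteq> z0" using cK z0 by blast
  have uA: "u \<in> A" "u \<noteq> 0" using cK cz by (auto simp: u_def A_def)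
  define w where "w = \<beta> u"
  have w: "w \<in> ball 0 1" "\<gamma> w = u" using \<gamma>\<beta>[OF uA(1)] by (auto simp: w_def)
  have w0: "w \<noteq> 0" using w(2) uA(2) \<gamma>0 by metis
  have dps: "(ps has_field_derivative 0) (at u)"
  proof (rule has_field_derivative_transform_within_open[of "\<lambda>u. 1 / (poly p (z0 + 1 / u) - z0)" _ _ "- {0}"])
    have "poly p c \<noteq> z0" using cK z0 p_in_K_iff[of c] by metis
    moreover have zc: "z0 + 1 / u = c" by (simp add: u_def)
    ultimately show "((\<lambda>u. 1 / (poly p (z0 + 1 / u) - z0)) has_field_derivative 0) (at u)"
      using uA(2) crit by (auto intro!: derivative_eq_intros DERIV_chain2[OF poly_DERIV] simp: zc)
  qed (use uA psnz in auto)
  have "(\<gamma> has_field_derivative deriv \<gamma> w) (at w)" using holomorphic_derivI[OF \<gamma>hol _ w(1)] by simp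
  then have "((\<lambda>w. ps (\<gamma> w)) has_field_derivative 0) (at w)"
    using DERIV_chain2[of ps 0 \<gamma> w] dps w(2) by fastforce
  moreover have "(\<beta> has_field_derivative deriv \<beta> (ps (\<gamma> w))) (at (ps (\<gamma> w)))"
    using holomorphic_derivI[OF \<beta>hol openA psA] w uA by simp
  ultimately have "(B has_field_derivative 0) (at w)"
    unfolding B_def using DERIV_chain2[of \<beta> _ "\<lambda>w. ps (\<gamma> w)" w 0 UNIV] by fastforce
  moreover have "(B has_field_derivative \<kappa> * (of_nat d * w ^ (d - 1))) (at w)"
  proof (rule has_field_derivative_transform_within_open[of "\<lambda>w. \<kappa> * w ^ d" _ _ "ball 0 1"])
    show "((\<lambda>w. \<kappa> * w ^ d) has_field_derivative \<kappa> * (of_nat d * w ^ (d - 1))) (at w)"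
      by (auto intro!: derivative_eq_intros)
  qed (use w Bk \<kappa> in auto)
  ultimately have "\<kappa> * (of_nat d * w ^ (d - 1)) = 0" using DERIV_unique by blast
  then show False using \<kappa>nz w0 d2 by simp
qed

text \<open>Some iterate g expands near J so much that g(ball z s) contains the ball of radius 2s
  about g(z). A point of J within 2s of g(z) therefore has a preimage within s of z, and J is
  backward invariant.\<close>

lemma hyperbolic_expansion:
  assumes hyp: "hyperbolic_poly p"
  obtains N r1 where "N \<ge> 1" "r1 > 0"
    "\<And>s z. 0 < s \<Longrightarrow> s < r1 \<Longrightarrow> infdist z J < r1 \<Longrightarrow> infdist (iter N z) J < 2 * s \<Longrightarrow> infdist z J < s"
proof -
  obtain C l where C: "C > 0" "l > 1" "\<And>n z. z \<in> J \<Longrightarrow> norm (deriv (iter n) z) \<ge> C * l ^ n"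
    using hyp unfolding hyperbolic_poly_def by metis
  \<comment> \<open>Derivative 8 on J leaves 7 at z and an increment of at least 6s on the circle of
    radius s, more than the 2s that is claimed.\<close>
  obtain n where n: "8 / C < l ^ n" using real_arch_pow[OF C(2)] by blast
  define N where "N = Suc n"
  define g where "g = iter N"
  have ghol: "g holomorphic_on S" for S unfolding g_def by (rule iter_hol)
  have gder: "(g has_field_derivative deriv g z) (at z)" for z
    by (rule holomorphic_derivI[OF ghol[of UNIV]]) auto
  have gJ: "norm (deriv g z) \<ge> 8" if "z \<in> J" for z
  proof -
    have "8 \<le> C * l ^ n" using n C(1) by (simp add: field_simps)
    also have "\<dots> \<le> C * l ^ N" unfolding N_def using C by (intro mult_left_mono power_increasing) auto
    finally show ?thesis using C(3)[OF that, of N] by (simp add: g_def)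
  qed
  have "uniformly_continuous_on (cball 0 (\<alpha> + 3)) (deriv g)"
    by (intro compact_uniformly_continuous holomorphic_on_imp_continuous_on compact_cball
        holomorphic_on_subset[OF holomorphic_deriv[OF ghol[of UNIV]]]) auto
  then obtain \<delta> where \<delta>: "\<delta> > 0" "\<And>u v. u \<in> cball 0 (\<alpha> + 3) \<Longrightarrow> v \<in> cball 0 (\<alpha> + 3) \<Longrightarrow> dist v u < \<delta> \<Longrightarrow>
      dist (deriv g v) (deriv g u) < 1"
    unfolding uniformly_continuous_on_def by (metis zero_less_one)
  define r1 where "r1 = min 1 \<delta>"
  have r1: "r1 > 0" "r1 \<le> 1" "r1 \<le> \<delta>" using \<delta> by (auto simp: r1_def)
  show ?thesis
  proof (rule that[of N r1])
    fix s :: real and z :: complex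
    assume s: "0 < s" "s < r1" and z: "infdist z J < r1" and gz: "infdist (iter N z) J < 2 * s"
    obtain z' where z': "z' \<in> J" "infdist z J = dist z z'"
      using infdist_attains_inf[OF compact_imp_closed[OF compact_J] J_nonempty] by metis
    have zz': "dist z z' < r1" using z z' by simp
    have nz': "norm z' < \<alpha>" using K_less z'(1) J_sub_K by blast
    have nz: "norm z < \<alpha> + 1"
      using zz' nz' r1(2) norm_triangle_ineq2[of z z'] by (simp add: dist_norm)
    have ball: "w \<in> cball 0 (\<alpha> + 3)" if "dist z w \<le> 1" for w
      using that nz norm_triangle_ineq2[of w z] by (simp add: dist_norm norm_minus_commute)
    have "dist (deriv g z) (deriv g z') < 1"
      by (rule \<delta>(2)) (use zz' nz' nz r1 in auto)
    then have dz: "norm (deriv g z) \<ge> 7"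
      using gJ[OF z'(1)] norm_triangle_ineq2[of "deriv g z'" "deriv g z"] by (simp add: dist_norm norm_minus_commute)
    have sphere: "2 * s \<le> norm (g w - g z)" if w: "dist z w = s" for w
    proof -
      define h where "h = (\<lambda>t. g t - t * deriv g z)"
      have "norm (h w - h z) \<le> 1 * norm (w - z)"
      proof (rule field_differentiable_bound[of "cball z s" h "\<lambda>t. deriv g t - deriv g z"])
        show "(h has_field_derivative deriv g t - deriv g z) (at t within cball z s)" for t
        proof -
          have "(h has_field_derivative deriv g t - deriv g z) (at t)"
            unfolding h_def by (auto intro!: derivative_eq_intros gder)
          then show ?thesis by (rule has_field_derivative_at_within)
        qed
        show "norm (deriv g t - deriv g z) \<le> 1" if "t \<in> cball z s" for t
        proof -
          have "dist (deriv g t) (deriv g z) < 1"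
            by (rule \<delta>(2)) (use that s r1 ball[of t] ball[of z] in \<open>auto simp: dist_commute\<close>)
          then show ?thesis by (simp add: dist_norm)
        qed
      qed (use w s in auto)
      moreover have "h w - h z = (g w - g z) - (w - z) * deriv g z" by (simp add: h_def algebra_simps)
      moreover have "norm ((w - z) * deriv g z) \<ge> 7 * norm (w - z)"
        using mult_left_mono[OF dz, of "norm (w - z)"] by (simp add: norm_mult mult.commute)
      moreover have "norm (w - z) = s" using w by (simp add: dist_norm norm_minus_commute)
      ultimately show ?thesis
        using norm_triangle_ineq2[of "(w - z) * deriv g z" "g w - g z"] s(1) by (simp add: norm_minus_commute)
    qed
    have gnc: "\<not> g constant_on ball z s"
    proof
      assume "g constant_on ball z s"
      then obtain k where "\<And>w. w \<in> ball z s \<Longrightarrow> g w = k" unfolding constant_on_def by blast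
      then have "(g has_field_derivative 0) (at z)"
        by (intro has_field_derivative_transform_within_open[of "\<lambda>_. k" 0 z "ball z s" g]) (use s in auto)
      then have "deriv g z = 0" by (rule DERIV_imp_deriv)
      then show False using dz by simp
    qed
    have "ball (g z) (2 * s) \<subseteq> g ` ball z s"
    proof (rule ball_subset_open_map_image)
      show "continuous_on (closure (ball z s)) g" by (rule holomorphic_on_imp_continuous_on[OF ghol])
      show "open (g ` interior (ball z s))"
        using open_mapping_thm[OF ghol[of "ball z s"], of "ball z s"] gnc by (simp add: interior_open)
      show "2 * s \<le> norm (g w - g z)" if "w \<in> frontier (ball z s)" for w
        using that s by (intro sphere) (simp add: frontier_ball)
    qed (use s in auto)
    moreover obtain w where w: "w \<in> J" "infdist (g z) J = dist (g z) w"
      using infdist_attains_inf[OF compact_imp_closed[OF compact_J] J_nonempty] by metis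
    ultimately obtain \<zeta> where \<zeta>: "\<zeta> \<in> ball z s" "w = g \<zeta>" using gz unfolding g_def by (auto simp: subset_iff)
    then have "\<zeta> \<in> J" using w(1) iter_J_backward by (simp add: g_def)
    then have "infdist z J \<le> dist z \<zeta>" by (rule infdist_le)
    then show "infdist z J < s" using \<zeta>(1) by simp
  qed (use r1 in \<open>auto simp: N_def\<close>)
qed

lemma interior_K_infdist:
  assumes "compact T" "T \<subseteq> interior K"
  obtains e where "e > 0" "\<And>z. z \<in> T \<Longrightarrow> e \<le> infdist z J"
proof -
  have cJ: "closed J" by (rule compact_imp_closed[OF compact_J])
  have "T \<inter> J = {}" using assms(2) J_eq by blast
  then obtain e where e: "e > 0" "\<And>x y. x \<in> T \<Longrightarrow> y \<in> J \<Longrightarrow> e \<le> dist x y"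
    using separate_compact_closed[OF assms(1) cJ] by blast
  show ?thesis
  proof (rule that[OF e(1)])
    fix z assume "z \<in> T"
    then show "e \<le> infdist z J" using infdist_attains_inf[OF cJ J_nonempty, of z] e(2) by metis
  qed
qed

text \<open>L consists of the points of K at distance at least e from J. Between distances e and r1
  the expansion doubles e; beyond r1 the image of a compact part of the interior keeps a fixed
  distance e1 > e.\<close>

lemma trapping_set:
  assumes hyp: "hyperbolic_poly p" and T: "compact T" "T \<subseteq> interior K"
  obtains L N where "compact L" "L \<subseteq> K" "T \<subseteq> interior L" "N \<ge> 1" "iter N ` L \<subseteq> interior L"
proof -
  obtain N r1 where N: "N \<ge> 1" "r1 > 0"
    "\<And>s z. 0 < s \<Longrightarrow> s < r1 \<Longrightarrow> infdist z J < r1 \<Longrightarrow> infdist (iter N z) J < 2 * s \<Longrightarrow> infdist z J < s"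
    using hyperbolic_expansion[OF hyp] by metis
  define L where "L = (\<lambda>e. K \<inter> {z. e \<le> infdist z J})"
  have cL: "compact (L e)" for e unfolding L_def
    by (intro compact_Int_closed compact_K closed_Collect_le continuous_intros)
  have Lint: "L e \<subseteq> interior K" if "e > 0" for e
  proof
    fix x assume x: "x \<in> L e"
    then have "x \<notin> J" using that infdist_zero[of x J] by (auto simp: L_def)
    then show "x \<in> interior K" using x J_eq by (auto simp: L_def)
  qed
  obtain e1 where e1: "e1 > 0" "\<And>z. z \<in> iter N ` L r1 \<Longrightarrow> e1 \<le> infdist z J"
  proof (rule interior_K_infdist[of "iter N ` L r1"])
    show "compact (iter N ` L r1)" by (intro compact_continuous_image iter_cont cL)
    show "iter N ` L r1 \<subseteq> interior K" using Lint[OF N(2)] iter_interior_K by blast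
  qed (use that in blast)
  obtain e2 where e2: "e2 > 0" "\<And>z. z \<in> T \<Longrightarrow> e2 \<le> infdist z J"
    using interior_K_infdist[OF T] by metis
  define e where "e = min r1 (min e1 e2) / 2"
  have e: "e > 0" "e < r1" "e < e1" "e < e2" using N(2) e1(1) e2(1) by (auto simp: e_def)
  have int: "z \<in> interior (L e)" if "z \<in> K" "e < infdist z J" for z
  proof -
    have "open (interior K \<inter> {z. e < infdist z J})"
      by (intro open_Int open_interior open_Collect_less continuous_intros)
    moreover have "interior K \<inter> {z. e < infdist z J} \<subseteq> L e"
      using interior_subset[of K] by (auto simp: L_def)
    moreover have "z \<in> interior K" using Lint[OF e(1)] that by (auto simp: L_def)
    ultimately show ?thesis using that interior_maximal by blast
  qed
  show ?thesis
  proof (rule that[OF cL[of e] _ _ N(1)])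
    show "L e \<subseteq> K" by (auto simp: L_def)
    show "T \<subseteq> interior (L e)"
    proof
      fix z assume "z \<in> T"
      then show "z \<in> interior (L e)" using e2(2)[of z] e(4) T(2) interior_subset[of K] by (intro int) auto
    qed
    show "iter N ` L e \<subseteq> interior (L e)"
    proof
      fix w assume "w \<in> iter N ` L e"
      then obtain z where z: "z \<in> K" "e \<le> infdist z J" "w = iter N z" by (auto simp: L_def)
      have "e < infdist w J"
      proof (cases "infdist z J < r1")
        case True
        then have "\<not> infdist (iter N z) J < 2 * e" using N(3)[OF e(1,2) True] z(2) by linarith
        then show ?thesis using z(3) e(1) by simp
      next
        case False
        then have "e1 \<le> infdist w J" using e1(2)[of w] z by (auto simp: L_def)
        then show ?thesis using e(3) by simp
      qed
      then show "w \<in> interior (L e)" using z by (intro int) (auto simp: iter_in_K_iff)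
    qed
  qed
qed

text \<open>The trap is built around the critical points, which gives the lower bound for p' off L,
  and around the critical values, which is what later separates p(y) from x near y = c.\<close>

lemma hyperbolic_trap:
  assumes hyp: "hyperbolic_poly p" and cJ: "connected J"
  obtains L N m where "compact L" "L \<subseteq> K" "N \<ge> 1" "iter N ` L \<subseteq> interior L" "m > 0"
    "\<And>x. x \<notin> L \<Longrightarrow> m \<le> norm (poly (pderiv p) x)"
    "\<And>c. poly (pderiv p) c = 0 \<Longrightarrow> poly p c \<in> interior L"
proof -
  obtain C l where C: "C > 0" "l > 1" "\<And>n z. z \<in> J \<Longrightarrow> norm (deriv (iter n) z) \<ge> C * l ^ n"
    using hyp unfolding hyperbolic_poly_def by metis
  have nc: "poly (pderiv p) z \<noteq> 0" if "z \<in> J" for z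
  proof -
    have "deriv (iter 1) z = poly (pderiv p) z" by (simp add: DERIV_imp_deriv[OF poly_DERIV])
    moreover have "norm (deriv (iter 1) z) \<ge> C * l" using C(3)[OF that, of 1] by simp
    moreover have "C * l > 0" using C(1,2) by simp
    ultimately show ?thesis by auto
  qed
  have degp: "degree (pderiv p) = d - 1" by (simp add: degree_pderiv degree_p)
  have pd0: "pderiv p \<noteq> 0" using degp d2 by auto
  define Z where "Z = {c. poly (pderiv p) c = 0}"
  have fZ: "finite Z" unfolding Z_def using poly_roots_finite[OF pd0] .
  have ZK: "Z \<subseteq> interior K"
    using J_subset_imp_crit_in_K[OF cJ nc] nc J_eq by (auto simp: Z_def)
  have T: "compact (Z \<union> poly p ` Z)" using fZ by (intro finite_imp_compact) auto
  have TK: "Z \<union> poly p ` Z \<subseteq> interior K" using ZK p_interior_K by blast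
  obtain L N where LN: "compact L" "L \<subseteq> K" "Z \<union> poly p ` Z \<subseteq> interior L" "N \<ge> 1" "iter N ` L \<subseteq> interior L"
    using trapping_set[OF hyp T TK] by metis
  obtain a h where ah: "pderiv p = pCons a h" by (cases "pderiv p")
  have h0: "h \<noteq> 0" using ah degp d2 by auto
  obtain B where B: "\<And>z. B \<le> norm z \<Longrightarrow> 1 \<le> norm (poly (pderiv p) z)"
    unfolding ah using poly_infinity[OF h0, of 1 a] by blast
  \<comment> \<open>The compact region where p' could be small: outside radius B growth of p' gives
    1, inside the interior of L nothing is claimed.\<close>
  define S where "S = cball 0 B - interior L"
  have "\<exists>m>0. \<forall>x\<in>S. m \<le> norm (poly (pderiv p) x)"
  proof (cases "S = {}")
    case False
    have "compact S" unfolding S_def by (intro compact_diff compact_cball open_interior)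
    then obtain x where x: "x \<in> S" "\<And>y. y \<in> S \<Longrightarrow> norm (poly (pderiv p) x) \<le> norm (poly (pderiv p) y)"
      using continuous_attains_inf[OF _ False, of "\<lambda>x. norm (poly (pderiv p) x)"]
        continuous_on_norm[OF continuous_on_poly[OF continuous_on_id]] by blast
    have "x \<notin> Z" using x(1) LN(3) by (auto simp: S_def)
    then have "norm (poly (pderiv p) x) > 0" by (simp add: Z_def)
    then show ?thesis using x(2) by blast
  qed (auto intro: exI[of _ 1])
  then obtain m where m: "m > 0" "\<And>x. x \<in> S \<Longrightarrow> m \<le> norm (poly (pderiv p) x)" by blast
  show ?thesis
  proof (rule that[OF LN(1,2,4,5), of "min m 1"])
    fix x assume "x \<notin> L"
    then have "x \<notin> interior L" using interior_subset by blast
    then show "min m 1 \<le> norm (poly (pderiv p) x)"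
      using m(2)[of x] B[of x] by (cases "B \<le> norm x") (auto simp: S_def min_le_iff_disj)
  qed (use m LN(3) in \<open>auto simp: Z_def\<close>)
qed

end

section \<open>Boettcher series and escaping sets\<close>

lemma norm_Ln_1p_le:
  assumes "norm w \<le> s" "s < 1"
  shows "norm (Ln (1 + w)) \<le> norm w / (1 - s)"
proof -
  have nz: "1 + t \<notin> \<real>\<^sub>\<le>\<^sub>0" "norm (1 + t) \<ge> 1 - s" if "norm t \<le> s" for t :: complex
  proof -
    have "\<bar>Re t\<bar> < 1" using abs_Re_le_cmod[of t] that assms(2) by linarith
    then show "1 + t \<notin> \<real>\<^sub>\<le>\<^sub>0" by (auto simp: complex_nonpos_Reals_iff)
    show "norm (1 + t) \<ge> 1 - s" using norm_triangle_ineq2[of 1 "- t"] that by simp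
  qed
  have "norm (Ln (1 + w) - Ln (1 + 0)) \<le> (1 / (1 - s)) * norm (w - 0)"
  proof (rule field_differentiable_bound[of "cball 0 s" "\<lambda>t. Ln (1 + t)" "\<lambda>t. 1 / (1 + t)"])
    show "((\<lambda>t. Ln (1 + t)) has_field_derivative 1 / (1 + t)) (at t within cball 0 s)" if "t \<in> cball 0 s" for t
    proof -
      have "((\<lambda>t. Ln (1 + t)) has_field_derivative 1 / (1 + t)) (at t)"
        using nz(1)[of t] that by (auto intro!: derivative_eq_intros simp: divide_inverse)
      then show ?thesis by (rule has_field_derivative_at_within)
    qed
    show "norm (1 / (1 + t)) \<le> 1 / (1 - s)" if "t \<in> cball 0 s" for t :: complex
      using nz(2)[of t] that assms(2) by (auto simp: norm_divide intro!: divide_left_mono mult_pos_pos)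
  qed (use assms norm_ge_zero[of w] in \<open>auto simp del: norm_ge_zero\<close>)
  then show ?thesis by simp
qed

text \<open>Multiplying the series by d shifts its index by one; this is the source of both
  Boettcher functional equations.\<close>

lemma exp_suminf_power:
  fixes u :: "nat \<Rightarrow> complex"
  assumes "d \<ge> 2" "summable (\<lambda>k. Ln (u k) / of_nat d ^ Suc k)" "u 0 \<noteq> 0"
  shows "exp (\<Sum>k. Ln (u k) / of_nat d ^ Suc k) ^ d = u 0 * exp (\<Sum>k. Ln (u (Suc k)) / of_nat d ^ Suc k)"
proof -
  have d0: "of_nat d \<noteq> (0 :: complex)" using assms(1) by simp
  have s1: "summable (\<lambda>k. Ln (u (Suc k)) / of_nat d ^ Suc (Suc k))"
    using assms(2) by (subst summable_Suc_iff)
  have "(\<Sum>k. Ln (u k) / of_nat d ^ Suc k) = Ln (u 0) / of_nat d + (\<Sum>k. Ln (u (Suc k)) / of_nat d ^ Suc (Suc k))"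
    using suminf_split_head[OF assms(2)] by (simp add: algebra_simps)
  also have "of_nat d * \<dots> = Ln (u 0) + of_nat d * (\<Sum>k. Ln (u (Suc k)) / of_nat d ^ Suc (Suc k))"
    using d0 by (simp add: distrib_left del: power_Suc)
  also have "of_nat d * (\<Sum>k. Ln (u (Suc k)) / of_nat d ^ Suc (Suc k)) = (\<Sum>k. of_nat d * (Ln (u (Suc k)) / of_nat d ^ Suc (Suc k)))"
    by (rule suminf_mult[OF s1, symmetric])
  also have "(\<lambda>k. of_nat d * (Ln (u (Suc k)) / of_nat d ^ Suc (Suc k))) = (\<lambda>k. Ln (u (Suc k)) / of_nat d ^ Suc k)"
    using d0 by (auto simp: fun_eq_iff)
  finally have "of_nat d * (\<Sum>k. Ln (u k) / of_nat d ^ Suc k) = Ln (u 0) + (\<Sum>k. Ln (u (Suc k)) / of_nat d ^ Suc k)" .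
  then show ?thesis using assms(3) by (simp add: exp_of_nat_mult[symmetric] exp_add exp_Ln)
qed

context escape_data
begin

text \<open>Chosen so that (p(x) - b y)/x^d differs from 1 by at most C1/|x| when |x| >= \<alpha>
  and |y| <= |x|: the powers of |x| beyond the first are traded for powers of \<alpha>.\<close>

definition C1 :: real where
  "C1 = (\<Sum>i\<le>degree q. norm (coeff q i) / \<alpha> ^ (d - 1 - i)) + (R + 1) / \<alpha> ^ (d - 2)"

lemma C1_nonneg: "C1 \<ge> 0"
  unfolding C1_def using alpha_pos R_pos by (intro add_nonneg_nonneg sum_nonneg) auto

lemma quot_bounds:
  assumes x: "norm x \<ge> \<alpha>" and y: "norm y \<le> norm x" and b: "norm b \<le> R + 1"
  shows "norm ((poly p x - b * y) / x ^ d - 1) < r"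
    and "norm ((poly p x - b * y) / x ^ d - 1) \<le> C1 / norm x"
proof -
  have x0: "norm x > 0" "x \<noteq> 0" using x alpha_pos by auto
  obtain e where e: "d = Suc (Suc e)" using d2 by (metis add_2_eq_Suc le_Suc_ex)
  have eq: "(poly p x - b * y) / x ^ d - 1 = poly q x / x ^ d - b * y / x ^ d"
    using x0 by (simp add: poly_p field_simps)
  have "norm (b * y / x ^ d) \<le> (R + 1) * norm x / norm x ^ d"
    unfolding norm_mult norm_divide norm_power
    using y b R_pos x0 by (intro divide_right_mono mult_mono) auto
  also have "\<dots> = (R + 1) / norm x ^ (d - 1)" using x0 by (simp add: e)
  finally have 1: "norm (b * y / x ^ d) \<le> (R + 1) / norm x ^ (d - 1)" .
  have le: "norm ((poly p x - b * y) / x ^ d - 1) \<le> norm (poly q x / x ^ d) + (R + 1) / norm x ^ (d - 1)"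
    unfolding eq using norm_triangle_ineq4[of "poly q x / x ^ d" "b * y / x ^ d"] 1 by linarith
  then show "norm ((poly p x - b * y) / x ^ d - 1) < r" using small[OF x] by linarith
  have 2: "(R + 1) / norm x ^ (d - 1) \<le> ((R + 1) / \<alpha> ^ (d - 2)) / norm x"
  proof -
    have "\<alpha> ^ e * norm x \<le> norm x ^ e * norm x"
      using x alpha_pos by (intro mult_right_mono power_mono) auto
    then have "(R + 1) / (norm x ^ e * norm x) \<le> (R + 1) / (\<alpha> ^ e * norm x)"
      using R_pos alpha_pos x0 by (intro divide_left_mono mult_pos_pos) auto
    then show ?thesis by (simp add: e mult.commute)
  qed
  have "norm (poly q x) \<le> (\<Sum>i\<le>degree q. norm (coeff q i) * norm x ^ i)"
    unfolding poly_altdef by (rule order_trans[OF norm_sum]) (simp add: norm_mult norm_power)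
  also have "\<dots> \<le> (\<Sum>i\<le>degree q. norm (coeff q i) / \<alpha> ^ (d - 1 - i) * norm x ^ (d - 1))"
  proof (rule sum_mono)
    fix i assume "i \<in> {..degree q}"
    then have i: "i \<le> d - 1" using deg_q by auto
    have "norm x ^ i * \<alpha> ^ (d - 1 - i) \<le> norm x ^ i * norm x ^ (d - 1 - i)"
      using x alpha_pos by (intro mult_left_mono power_mono) auto
    also have "\<dots> = norm x ^ (d - 1)" using i by (metis power_add le_add_diff_inverse)
    finally have "norm x ^ i \<le> norm x ^ (d - 1) / \<alpha> ^ (d - 1 - i)" using alpha_pos by (simp add: field_simps)
    then have "norm (coeff q i) * norm x ^ i \<le> norm (coeff q i) * (norm x ^ (d - 1) / \<alpha> ^ (d - 1 - i))"
      by (rule mult_left_mono) simp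
    then show "norm (coeff q i) * norm x ^ i \<le> norm (coeff q i) / \<alpha> ^ (d - 1 - i) * norm x ^ (d - 1)" by simp
  qed
  finally have "norm (poly q x) \<le> (\<Sum>i\<le>degree q. norm (coeff q i) / \<alpha> ^ (d - 1 - i)) * norm x ^ (d - 1)"
    by (simp add: sum_distrib_right)
  then have "norm (poly q x / x ^ d) \<le> (\<Sum>i\<le>degree q. norm (coeff q i) / \<alpha> ^ (d - 1 - i)) * norm x ^ (d - 1) / norm x ^ d"
    unfolding norm_divide norm_power by (rule divide_right_mono) simp
  also have "\<dots> = (\<Sum>i\<le>degree q. norm (coeff q i) / \<alpha> ^ (d - 1 - i)) / norm x" using x0 by (simp add: e)
  finally have 3: "norm (poly q x / x ^ d) \<le> (\<Sum>i\<le>degree q. norm (coeff q i) / \<alpha> ^ (d - 1 - i)) / norm x" .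
  show "norm ((poly p x - b * y) / x ^ d - 1) \<le> C1 / norm x"
    using le 2 3 unfolding C1_def add_divide_distrib by linarith
qed

definition C0 :: real where "C0 = C1 / (1 - r)"

lemma C0_nonneg: "C0 \<ge> 0"
  unfolding C0_def using C1_nonneg r_less_1 by simp

text \<open>Stated for abstract orbit coordinates \<xi>, \<eta> and a coefficient b so that it
  serves the forward series (b = a) and the backward series (b = 1) alike. The quotients stay within
  r < 1 of 1, so principal logarithms are holomorphic.\<close>

lemma boettcher_series:
  fixes \<xi> \<eta> :: "nat \<Rightarrow> complex \<times> complex \<Rightarrow> complex" and b :: complex
  assumes W: "open W" and b: "norm b \<le> R + 1"
    and hol: "\<And>k. hol2_on (\<xi> k) W" "\<And>k. hol2_on (\<eta> k) W"
    and bd: "\<And>k z. z \<in> W \<Longrightarrow> norm (\<eta> k z) \<le> norm (\<xi> k z)" "\<And>k z. z \<in> W \<Longrightarrow> \<alpha> \<le> norm (\<xi> 0 z)"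
      "\<And>k z. z \<in> W \<Longrightarrow> norm (\<xi> 0 z) \<le> norm (\<xi> k z)"
  defines "u \<equiv> \<lambda>k z. (poly p (\<xi> k z) - b * \<eta> k z) / \<xi> k z ^ d"
  shows "hol2_on (\<lambda>z. \<Sum>k. Ln (u k z) / of_nat d ^ Suc k) W"
    and "z \<in> W \<Longrightarrow> norm (\<Sum>k. Ln (u k z) / of_nat d ^ Suc k) \<le> C0 / norm (\<xi> 0 z)"
    and "z \<in> W \<Longrightarrow> summable (\<lambda>k. Ln (u k z) / of_nat d ^ Suc k)"
    and "z \<in> W \<Longrightarrow> u k z \<noteq> 0"
proof -
  have al: "\<alpha> \<le> norm (\<xi> k z)" if "z \<in> W" for k z using bd(2,3)[OF that] order_trans by metis
  have u1: "norm (u k z - 1) < r" "norm (u k z - 1) \<le> C1 / norm (\<xi> k z)" if "z \<in> W" for k z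
    unfolding u_def using quot_bounds[OF al[OF that] bd(1)[OF that] b] by auto
  have unr: "u k z \<notin> \<real>\<^sub>\<le>\<^sub>0" if "z \<in> W" for k z
  proof -
    have "\<bar>Re (u k z - 1)\<bar> < 1" using abs_Re_le_cmod[of "u k z - 1"] u1(1)[OF that, of k] r_less_1 by linarith
    then show ?thesis by (auto simp: complex_nonpos_Reals_iff)
  qed
  show "z \<in> W \<Longrightarrow> u k z \<noteq> 0" using unr[of z k] by (cases "u k z = 0") auto
  have Lnb: "norm (Ln (u k z)) \<le> C0 / norm (\<xi> 0 z)" if z: "z \<in> W" for k z
  proof -
    have "norm (Ln (1 + (u k z - 1))) \<le> norm (u k z - 1) / (1 - r)"
      using u1(1)[OF z, of k] r_less_1 by (intro norm_Ln_1p_le) auto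
    also have "\<dots> \<le> C1 / norm (\<xi> k z) / (1 - r)"
      using u1(2)[OF z] r_less_1 by (intro divide_right_mono) auto
    also have "\<dots> \<le> C1 / norm (\<xi> 0 z) / (1 - r)"
      using bd(3)[OF z, of k] bd(2)[OF z] al[OF z, of k] alpha_pos C1_nonneg r_less_1
      by (intro divide_right_mono divide_left_mono mult_pos_pos) auto
    also have "\<dots> = C0 / norm (\<xi> 0 z)" by (simp add: C0_def)
    finally show ?thesis by simp
  qed
  \<comment> \<open>As d >= 2 the weights are dominated by a geometric series of sum exactly 1, so
    the bound for one logarithm bounds the whole sum.\<close>
  have half: "(1::real) / of_nat d ^ Suc k \<le> (1/2) ^ Suc k" for k
  proof -
    have "(2::real) ^ Suc k \<le> of_nat d ^ Suc k" using d2 by (intro power_mono) auto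
    then have "(1::real) / of_nat d ^ Suc k \<le> 1 / 2 ^ Suc k" using d2 by (intro divide_left_mono mult_pos_pos zero_less_power) auto
    then show ?thesis by (simp add: power_divide)
  qed
  have tb: "norm (Ln (u k z) / of_nat d ^ Suc k) \<le> C0 / norm (\<xi> 0 z) * (1/2) ^ Suc k" if z: "z \<in> W" for k z
  proof -
    have nn: "C0 / norm (\<xi> 0 z) \<ge> 0" using C0_nonneg by simp
    have "norm (Ln (u k z) / of_nat d ^ Suc k) = norm (Ln (u k z)) * (1 / of_nat d ^ Suc k)"
      by (simp add: norm_divide norm_power norm_mult)
    also have "\<dots> \<le> C0 / norm (\<xi> 0 z) * (1/2) ^ Suc k"
      by (rule mult_mono[OF Lnb[OF z] half nn]) simp
    finally show ?thesis .
  qed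
  have geo: "(\<lambda>k. c * (1/2::real) ^ Suc k) sums c" for c :: real
    using sums_mult[OF power_half_series, of c] by simp
  show sm: "summable (\<lambda>k. Ln (u k z) / of_nat d ^ Suc k)" if "z \<in> W" for z
    by (rule summable_comparison_test'[OF sums_summable[OF geo] tb[OF that]])
  show "norm (\<Sum>k. Ln (u k z) / of_nat d ^ Suc k) \<le> C0 / norm (\<xi> 0 z)" if "z \<in> W" for z
  proof -
    have "norm (\<Sum>k. Ln (u k z) / of_nat d ^ Suc k) \<le> (\<Sum>k. C0 / norm (\<xi> 0 z) * (1/2) ^ Suc k)"
      by (rule norm_suminf_le[OF tb[OF that] sums_summable[OF geo]])
    also have "\<dots> = C0 / norm (\<xi> 0 z)" by (rule sums_unique[OF geo, symmetric])
    finally show ?thesis .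
  qed
  show "hol2_on (\<lambda>z. \<Sum>k. Ln (u k z) / of_nat d ^ Suc k) W"
  proof (rule hol2_uniform_limit[OF W])
    show "uniform_limit W (\<lambda>n z. \<Sum>k<n. Ln (u k z) / of_nat d ^ Suc k) (\<lambda>z. \<Sum>k. Ln (u k z) / of_nat d ^ Suc k) sequentially"
    proof (rule Weierstrass_m_test[OF _ sums_summable[OF geo[of "C0 / \<alpha>"]]])
      fix k z assume z: "z \<in> W"
      have "C0 / norm (\<xi> 0 z) * (1/2) ^ Suc k \<le> C0 / \<alpha> * (1/2) ^ Suc k"
        using bd(2)[OF z] alpha_pos C0_nonneg by (intro mult_right_mono divide_left_mono mult_pos_pos) auto
      then show "norm (Ln (u k z) / of_nat d ^ Suc k) \<le> C0 / \<alpha> * (1/2) ^ Suc k" using tb[OF z, of k] by linarith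
    qed
    have "hol2_on (u k) W" for k
    proof -
      have "\<xi> k z \<noteq> 0" if "z \<in> W" for z using al[OF that, of k] alpha_pos by auto
      then show ?thesis unfolding u_def by (intro hol2_intros hol b) auto
    qed
    then have L: "hol2_on (\<lambda>z. Ln (u k z)) W" for k
      using unr by (intro hol2_compose1[of Ln "- \<real>\<^sub>\<le>\<^sub>0"]) (auto intro!: holomorphic_intros)
    show "hol2_on (\<lambda>z. \<Sum>k<n. Ln (u k z) / of_nat d ^ Suc k) W" for n
    proof (induction n)
      case (Suc n)
      have "hol2_on (\<lambda>z. Ln (u n z) / of_nat d ^ Suc n) W"
        using d2 by (intro hol2_divide L hol2_const) auto
      from hol2_add[OF Suc this] show ?case by simp
    qed (simp add: hol2_const)
  qed
qed

text \<open>Cauchy on discs of radius |x|/4 in either variable, which stay inside V_+; the constants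
  16/3 and 4 are rounded up to 6.\<close>

lemma series_derivative_bounds:
  assumes S: "hol2_on S (V_plus \<alpha>)" and b: "\<And>z. z \<in> V_plus \<alpha> \<Longrightarrow> norm (S z) \<le> C0 / norm (fst z)"
    and xy: "2 * \<alpha> \<le> norm x" "norm y \<le> norm x / 4"
  shows "norm (d1 S (x, y)) \<le> 6 * C0 / norm x ^ 2" "norm (d2 S (x, y)) \<le> 6 * C0 / norm x ^ 2"
proof -
  have x0: "norm x > 0" using xy alpha_pos by linarith
  have in1: "(t, y) \<in> V_plus \<alpha>" and t34: "norm t \<ge> 3 / 4 * norm x" if "t \<in> ball x (norm x / 4)" for t
  proof -
    have "norm (x - t) < norm x / 4" using that by (simp add: dist_norm)
    then show "norm t \<ge> 3 / 4 * norm x" using norm_triangle_ineq2[of x t] by linarith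
    then show "(t, y) \<in> V_plus \<alpha>" using xy x0 alpha_pos by (auto simp: V_plus_def)
  qed
  have in2: "(x, t) \<in> V_plus \<alpha>" if "t \<in> ball y (norm x / 4)" for t
  proof -
    have "norm (t - y) < norm x / 4" using that by (simp add: dist_norm norm_minus_commute)
    then have "norm t < norm x / 2" using norm_triangle_ineq2[of t y] xy by linarith
    then show ?thesis using xy x0 alpha_pos by (auto simp: V_plus_def)
  qed
  have "norm (deriv (\<lambda>t. S (t, y)) x) \<le> (C0 / (3 / 4 * norm x)) / (norm x / 4)"
  proof (rule deriv_bound_ball)
    show "(\<lambda>t. S (t, y)) holomorphic_on ball x (norm x / 4)" by (rule hol2_holomorphic1[OF S in1])
    fix t assume t: "t \<in> ball x (norm x / 4)"
    have "norm (S (t, y)) \<le> C0 / norm t" using b[OF in1[OF t]] by simp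
    also have "\<dots> \<le> C0 / (3 / 4 * norm x)"
      using t34[OF t] x0 C0_nonneg by (intro divide_left_mono mult_pos_pos) auto
    finally show "norm (S (t, y)) \<le> C0 / (3 / 4 * norm x)" .
  qed (use x0 in auto)
  also have "\<dots> = 16 / 3 * (C0 / norm x ^ 2)" using x0 by (simp add: power2_eq_square field_simps)
  also have "\<dots> \<le> 6 * (C0 / norm x ^ 2)" using C0_nonneg by (intro mult_right_mono) auto
  finally show "norm (d1 S (x, y)) \<le> 6 * C0 / norm x ^ 2" by (simp add: d1_def)
  have "norm (deriv (\<lambda>t. S (x, t)) y) \<le> (C0 / norm x) / (norm x / 4)"
    by (rule deriv_bound_ball[OF hol2_holomorphic2[OF S in2]]) (use b in2 x0 in auto)
  also have "\<dots> = 4 * (C0 / norm x ^ 2)" using x0 by (simp add: power2_eq_square field_simps)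
  also have "\<dots> \<le> 6 * (C0 / norm x ^ 2)" using C0_nonneg by (intro mult_right_mono) auto
  finally show "norm (d2 S (x, y)) \<le> 6 * C0 / norm x ^ 2" by (simp add: d2_def)
qed

end

lemma open_V_plus: "open (V_plus \<alpha>)"
proof -
  have "V_plus \<alpha> = {z. norm (snd z) < norm (fst z)} \<inter> {z. \<alpha> < norm (fst z)}" by (auto simp: V_plus_def)
  then show ?thesis by (auto intro!: open_Int open_Collect_less continuous_intros)
qed

lemma open_V_minus: "open (V_minus \<alpha>)"
proof -
  have "V_minus \<alpha> = {z. norm (fst z) < norm (snd z)} \<inter> {z. \<alpha> < norm (snd z)}" by (auto simp: V_minus_def)
  then show ?thesis by (auto intro!: open_Int open_Collect_less continuous_intros)
qed

section \<open>Forward orbits of the Henon map and the region V_+\<close>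

locale henon_data = escape_data +
  fixes a :: complex
  assumes a_le: "norm a \<le> R"
begin

abbreviation "f \<equiv> henon p a"
abbreviation "fi \<equiv> henon_inv p a"
abbreviation "Up \<equiv> U_plus p a"
abbreviation "Um \<equiv> U_minus p a"
abbreviation "Vp \<equiv> V_plus \<alpha>"
abbreviation "Vm \<equiv> V_minus \<alpha>"

lemma f_simps: "fst (f z) = poly p (fst z) - a * snd z" "snd (f z) = fst z"
  by (simp_all add: henon_def)

lemma fi_simps: "fst (fi z) = snd z" "snd (fi z) = (poly p (snd z) - fst z) * inverse a"
  by (simp_all add: henon_inv_def divide_inverse)

lemma f_hol: "hol2_on (\<lambda>z. fst ((f ^^ n) z)) UNIV" "hol2_on (\<lambda>z. snd ((f ^^ n) z)) UNIV"
proof -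
  have "hol2_on (\<lambda>z. fst ((f ^^ n) z)) UNIV \<and> hol2_on (\<lambda>z. snd ((f ^^ n) z)) UNIV"
  proof (induction n)
    case (Suc n)
    then have "hol2_on (\<lambda>z. poly p (fst ((f ^^ n) z)) - a * snd ((f ^^ n) z)) UNIV"
      by (intro hol2_intros) auto
    then show ?case using Suc by (simp add: f_simps)
  qed (auto intro: hol2_intros)
  then show "hol2_on (\<lambda>z. fst ((f ^^ n) z)) UNIV" "hol2_on (\<lambda>z. snd ((f ^^ n) z)) UNIV" by auto
qed

lemma fi_hol: "hol2_on (\<lambda>z. fst ((fi ^^ n) z)) UNIV" "hol2_on (\<lambda>z. snd ((fi ^^ n) z)) UNIV"
proof -
  have "hol2_on (\<lambda>z. fst ((fi ^^ n) z)) UNIV \<and> hol2_on (\<lambda>z. snd ((fi ^^ n) z)) UNIV"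
  proof (induction n)
    case (Suc n)
    then have "hol2_on (\<lambda>z. (poly p (snd ((fi ^^ n) z)) - fst ((fi ^^ n) z)) * inverse a) UNIV"
      by (intro hol2_intros) auto
    then show ?case using Suc by (simp add: fi_simps)
  qed (auto intro: hol2_intros)
  then show "hol2_on (\<lambda>z. fst ((fi ^^ n) z)) UNIV" "hol2_on (\<lambda>z. snd ((fi ^^ n) z)) UNIV" by auto
qed

lemma f_cont: "continuous_on UNIV (f ^^ n)"
  using continuous_on_Pair[OF hol2_imp_continuous_on[OF f_hol(1)[of n]] hol2_imp_continuous_on[OF f_hol(2)[of n]]] by simp

lemma fi_cont: "continuous_on UNIV (fi ^^ n)"
  using continuous_on_Pair[OF hol2_imp_continuous_on[OF fi_hol(1)[of n]] hol2_imp_continuous_on[OF fi_hol(2)[of n]]] by simp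

lemma f_growth:
  assumes "norm x \<ge> \<alpha>" "norm y \<le> norm x"
  shows "norm (poly p x - a * y) > (R + 1) * norm x"
proof -
  have "norm (a * y) \<le> R * norm x" unfolding norm_mult using assms a_le R_pos by (intro mult_mono) auto
  then show ?thesis
    using large[OF assms(1)] norm_triangle_ineq2[of "poly p x" "a * y"] by (simp add: algebra_simps)
qed

lemma f_Vp':
  assumes "norm (fst z) \<ge> \<alpha>" "norm (snd z) \<le> norm (fst z)"
  shows "f z \<in> Vp" "norm (fst (f z)) \<ge> (R + 1) * norm (fst z)"
proof -
  have g: "norm (fst (f z)) > (R + 1) * norm (fst z)" using f_growth[OF assms] by (simp add: henon_def)
  then show "norm (fst (f z)) \<ge> (R + 1) * norm (fst z)" by simp
  have "(R + 1) * norm (fst z) \<ge> 1 * norm (fst z)" using R_pos by (intro mult_right_mono) auto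
  then have "norm (fst (f z)) > norm (fst z)" using g by linarith
  then show "f z \<in> Vp" using assms by (auto simp: V_plus_def henon_def split: prod.splits)
qed

lemma f_Vp: "z \<in> Vp \<Longrightarrow> f z \<in> Vp" "z \<in> Vp \<Longrightarrow> norm (fst (f z)) \<ge> (R + 1) * norm (fst z)"
  using f_Vp'[of z] by (auto simp: V_plus_def)

lemma f_iter_Vp:
  assumes "z \<in> Vp"
  shows "(f ^^ n) z \<in> Vp \<and> norm (fst ((f ^^ n) z)) \<ge> (R + 1) ^ n * norm (fst z)"
proof (induction n)
  case (Suc n)
  have "(R + 1) * ((R + 1) ^ n * norm (fst z)) \<le> (R + 1) * norm (fst ((f ^^ n) z))"
    using Suc R_pos by (intro mult_left_mono) auto
  then show ?case using Suc f_Vp[of "(f ^^ n) z"] by (auto simp: mult.assoc)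
qed (use assms in simp)

lemma R1_pow: "1 \<le> (R + 1) ^ n" using R_pos by (intro one_le_power) auto

lemma f_iter_fst_ge: "z \<in> Vp \<Longrightarrow> norm (fst z) \<le> norm (fst ((f ^^ n) z))"
  using f_iter_Vp[of z n] mult_right_mono[OF R1_pow[of n], of "norm (fst z)"] by simp

lemma Vp_unbounded:
  assumes "(f ^^ m) z \<in> Vp"
  shows "\<exists>n\<ge>m. norm (fst ((f ^^ n) z)) > B"
proof -
  obtain k where k: "max B 0 / \<alpha> < (R + 1) ^ k" using real_arch_pow[of "R + 1"] R_pos by auto
  then have "max B 0 < (R + 1) ^ k * \<alpha>" using alpha_pos by (simp add: field_simps)
  also have "\<dots> \<le> (R + 1) ^ k * norm (fst ((f ^^ m) z))"
    using assms R_pos by (intro mult_left_mono) (auto simp: V_plus_def)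
  also have "\<dots> \<le> norm (fst ((f ^^ (k + m)) z))" using f_iter_Vp[OF assms, of k] by (simp add: funpow_add)
  finally show ?thesis by (intro exI[of _ "k + m"]) auto
qed

text \<open>Each second coordinate is the preceding first coordinate. So if the orbit avoids V_+, a
  bound that is at least \<alpha> passes from both coordinates to the next point, and the orbit is
  bounded.\<close>

lemma Up_iff: "z \<in> Up \<longleftrightarrow> (\<exists>n. (f ^^ n) z \<in> Vp)"
proof
  assume "\<exists>n. (f ^^ n) z \<in> Vp"
  then obtain m where m: "(f ^^ m) z \<in> Vp" by blast
  show "z \<in> Up"
  proof (rule ccontr)
    assume "z \<notin> Up"
    then obtain B where B: "\<And>n. norm ((f ^^ n) z) \<le> B"
      unfolding U_plus_def K_plus_def bounded_iff by auto
    obtain n where "norm (fst ((f ^^ n) z)) > B" using Vp_unbounded[OF m] by blast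
    then show False using B[of n] norm_fst_le[of "fst ((f ^^ n) z)" "snd ((f ^^ n) z)"] by simp
  qed
next
  assume z: "z \<in> Up"
  show "\<exists>n. (f ^^ n) z \<in> Vp"
  proof (rule ccontr)
    assume n: "\<nexists>n. (f ^^ n) z \<in> Vp"
    define B where "B = max (max (norm (fst z)) (norm (snd z))) \<alpha>"
    have "norm (fst ((f ^^ n) z)) \<le> B \<and> norm (snd ((f ^^ n) z)) \<le> B" for n
    proof (induction n)
      case (Suc n)
      have "(f ^^ Suc n) z \<notin> Vp" using n by blast
      moreover have "snd ((f ^^ Suc n) z) = fst ((f ^^ n) z)" by (simp add: henon_def)
      moreover have "\<alpha> \<le> B" by (simp add: B_def)
      ultimately show ?case using Suc by (cases "(f ^^ Suc n) z") (auto simp: V_plus_def)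
    qed (auto simp: B_def)
    then have "norm ((f ^^ n) z) \<le> B + B" for n
      using norm_Pair_le[of "fst ((f ^^ n) z)" "snd ((f ^^ n) z)"] by (smt (verit) prod.collapse)
    then have "z \<in> K_plus p a" unfolding K_plus_def bounded_iff by auto
    then show False using z by (simp add: U_plus_def)
  qed
qed

lemma open_Up: "open Up"
proof -
  have eq: "Up = (\<Union>n. (f ^^ n) -` Vp)" using Up_iff by (simp add: set_eq_iff)
  show ?thesis unfolding eq by (intro open_UN ballI open_vimage open_V_plus f_cont)
qed

lemma f_Vp_mono: "(f ^^ n) z \<in> Vp \<Longrightarrow> n \<le> m \<Longrightarrow> (f ^^ m) z \<in> Vp"
  using f_iter_Vp[of "(f ^^ n) z" "m - n"] by (auto simp: funpow_add[symmetric, THEN fun_cong, simplified o_def])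

text \<open>The logarithm of phi_+/x, its quotients x_{k+1}/x_k^d spelled out through p to match the
  shape of \<open>boettcher_series\<close>.\<close>

definition Splus :: "complex \<times> complex \<Rightarrow> complex" where
  "Splus z = (\<Sum>k. Ln ((poly p (fst ((f ^^ k) z)) - a * snd ((f ^^ k) z)) / fst ((f ^^ k) z) ^ d) / of_nat d ^ Suc k)"

lemma phi_plus_eq: "phi_plus p a z = fst z * exp (Splus z)"
  unfolding phi_plus_def Splus_def x_fwd_def by (simp add: henon_def degree_p)

lemma a_le': "norm a \<le> R + 1" using a_le by simp

lemma Splus_props:
  shows Splus_hol: "hol2_on Splus Vp"
    and Splus_bound: "z \<in> Vp \<Longrightarrow> norm (Splus z) \<le> C0 / norm (fst z)"
    and Splus_summable: "z \<in> Vp \<Longrightarrow> summable (\<lambda>k. Ln ((poly p (fst ((f ^^ k) z)) - a * snd ((f ^^ k) z)) / fst ((f ^^ k) z) ^ d) / of_nat d ^ Suc k)"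
    and Splus_nz: "z \<in> Vp \<Longrightarrow> (poly p (fst ((f ^^ k) z)) - a * snd ((f ^^ k) z)) / fst ((f ^^ k) z) ^ d \<noteq> 0"
proof -
  have b: "norm (snd ((f ^^ k) z)) \<le> norm (fst ((f ^^ k) z))" "\<alpha> \<le> norm (fst ((f ^^ 0) z))"
    "norm (fst ((f ^^ 0) z)) \<le> norm (fst ((f ^^ k) z))" if "z \<in> Vp" for k z
    using f_iter_Vp[OF that, of k] f_iter_fst_ge[OF that, of k] that by (auto simp: V_plus_def)
  note bs = boettcher_series[where W = Vp and b = a and \<xi> = "\<lambda>k z. fst ((f ^^ k) z)" and \<eta> = "\<lambda>k z. snd ((f ^^ k) z)",
      OF open_V_plus a_le' hol2_on_subset[OF f_hol(1) subset_UNIV] hol2_on_subset[OF f_hol(2) subset_UNIV] b]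
  show "hol2_on Splus Vp" unfolding Splus_def[abs_def] using bs(1) by simp
  show "z \<in> Vp \<Longrightarrow> norm (Splus z) \<le> C0 / norm (fst z)" unfolding Splus_def using bs(2)[of z] by simp
  show "z \<in> Vp \<Longrightarrow> summable (\<lambda>k. Ln ((poly p (fst ((f ^^ k) z)) - a * snd ((f ^^ k) z)) / fst ((f ^^ k) z) ^ d) / of_nat d ^ Suc k)"
    using bs(3)[of z] by simp
  show "z \<in> Vp \<Longrightarrow> (poly p (fst ((f ^^ k) z)) - a * snd ((f ^^ k) z)) / fst ((f ^^ k) z) ^ d \<noteq> 0"
    using bs(4)[of z k] by simp
qed

lemma phi_plus_hol: "hol2_on (phi_plus p a) Vp"
proof -
  have "hol2_on (\<lambda>z. fst z * exp (Splus z)) Vp" by (intro hol2_intros Splus_hol)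
  then show ?thesis by (simp add: phi_plus_eq[abs_def])
qed

lemma phi_plus_nz: "z \<in> Vp \<Longrightarrow> phi_plus p a z \<noteq> 0"
  using alpha_pos by (auto simp: phi_plus_eq V_plus_def)

lemma phi_plus_f: "z \<in> Vp \<Longrightarrow> phi_plus p a (f z) = phi_plus p a z ^ d"
proof -
  assume z: "z \<in> Vp"
  have x: "fst z \<noteq> 0" using z alpha_pos by (auto simp: V_plus_def)
  have "exp (Splus z) ^ d = (poly p (fst z) - a * snd z) / fst z ^ d * exp (Splus (f z))"
    unfolding Splus_def using exp_suminf_power[OF d2 Splus_summable[OF z]] Splus_nz[OF z, of 0]
    by (simp add: funpow_swap1)
  then show ?thesis using x by (simp add: phi_plus_eq power_mult_distrib henon_def)
qed

lemma phi_plus_iter: "z \<in> Vp \<Longrightarrow> phi_plus p a ((f ^^ n) z) = phi_plus p a z ^ (d ^ n)"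
  by (induction n) (use f_iter_Vp phi_plus_f in \<open>auto simp: power_mult[symmetric] mult.commute\<close>)

end

section \<open>Backward dynamics and local branches\<close>

text \<open>On the neighbourhood where F w / F z lies within 1 of 1 the principal logarithm of that
  ratio is holomorphic; it carries the prescribed root c along.\<close>

lemma hol2_local_root:
  assumes F: "hol2_on F V" and V: "open V" "z \<in> V" and nz: "F z \<noteq> 0" and n: "n \<ge> 1" and c: "c ^ n = F z"
  obtains W \<psi> where "open W" "z \<in> W" "W \<subseteq> V" "hol2_on \<psi> W" "\<psi> z = c" "\<And>w. w \<in> W \<Longrightarrow> \<psi> w ^ n = F w"
    "\<And>w. w \<in> W \<Longrightarrow> norm (F w / F z - 1) < 1" "\<And>w. w \<in> W \<Longrightarrow> \<psi> w = c * exp (Ln (F w / F z) / of_nat n)"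
proof -
  define W where "W = V \<inter> (\<lambda>w. F w / F z) -` ball 1 1"
  define \<psi> where "\<psi> = (\<lambda>w. c * exp (Ln (F w / F z) / of_nat n))"
  have hF: "hol2_on (\<lambda>w. F w / F z) V" using F nz by (intro hol2_divide hol2_const) auto
  have oW: "open W" unfolding W_def
    using continuous_on_open_vimage[OF V(1), of "\<lambda>w. F w / F z"] hol2_imp_continuous_on[OF hF] by (auto simp: Int_commute)
  have b: "norm (F w / F z - 1) < 1" if "w \<in> W" for w
    using that by (simp add: W_def dist_norm norm_minus_commute)
  have np: "F w / F z \<notin> \<real>\<^sub>\<le>\<^sub>0" if "w \<in> W" for w
    using b[OF that] abs_Re_le_cmod[of "F w / F z - 1"] by (auto simp: complex_nonpos_Reals_iff)
  have "hol2_on (\<lambda>w. Ln (F w / F z)) W"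
    by (rule hol2_compose1[of Ln "- \<real>\<^sub>\<le>\<^sub>0", OF _ _ hol2_on_subset[OF hF]])
      (use np in \<open>auto simp: W_def intro!: holomorphic_intros\<close>)
  then have "hol2_on \<psi> W" unfolding \<psi>_def using n by (intro hol2_mult hol2_exp hol2_divide hol2_const) auto
  moreover have "\<psi> w ^ n = F w" if "w \<in> W" for w
  proof -
    have "F w / F z \<noteq> 0" using np[OF that] by (cases "F w / F z = 0") auto
    then have "exp (Ln (F w / F z) / of_nat n) ^ n = F w / F z"
      by (subst exp_of_nat_mult[symmetric]) (use n in simp)
    then show ?thesis using c nz by (simp add: \<psi>_def power_mult_distrib)
  qed
  moreover have "z \<in> W" "\<psi> z = c" using V nz by (auto simp: W_def \<psi>_def)
  moreover have "W \<subseteq> V" by (simp add: W_def)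
  ultimately show ?thesis using that[of W \<psi>] oW b by (simp add: \<psi>_def)
qed

lemma dlog_power:
  assumes \<phi>: "hol2_on \<phi> W" and W: "open W" "z \<in> W" and eq: "\<And>w. w \<in> W \<Longrightarrow> \<phi> w ^ N = Q w"
    and N: "N \<ge> 1" and nz: "Q z \<noteq> 0"
  shows "d1 Q z = of_nat N * Q z * (d1 \<phi> z / \<phi> z)" "d2 Q z = of_nat N * Q z * (d2 \<phi> z / \<phi> z)" "\<phi> z \<noteq> 0"
proof -
  show p0: "\<phi> z \<noteq> 0" using eq[OF W(2)] nz N by (auto simp: power_0_left)
  have D: "((\<lambda>w. w ^ N) has_field_derivative of_nat N * \<phi> z ^ (N - 1)) (at (\<phi> z))"
    by (auto intro!: derivative_eq_intros)
  have e: "\<phi> z ^ (N - 1) = Q z / \<phi> z"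
    using eq[OF W(2)] p0 N by (metis nonzero_eq_divide_eq power_minus_mult less_le_trans zero_less_one)
  have "d1 Q z = d1 (\<lambda>w. \<phi> w ^ N) z" "d2 Q z = d2 (\<lambda>w. \<phi> w ^ N) z"
    using d12_cong_open[OF W, of "\<lambda>w. \<phi> w ^ N" Q] eq by auto
  then show "d1 Q z = of_nat N * Q z * (d1 \<phi> z / \<phi> z)" "d2 Q z = of_nat N * Q z * (d2 \<phi> z / \<phi> z)"
    using d12_compose1[OF D \<phi> W(2)] by (simp_all add: e[simplified])
qed

text \<open>Replaces the argument that two branches differ by a locally constant root of unity:
  equal N-th powers already have equal logarithmic differentials.\<close>

lemma dlog_power_eq:
  assumes "hol2_on \<phi> W" "open W" "z \<in> W" "hol2_on \<phi>' W'" "open W'" "z \<in> W'"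
    and "\<And>w. w \<in> W \<Longrightarrow> w \<in> W' \<Longrightarrow> \<phi> w ^ N = \<phi>' w ^ N" and N: "N \<ge> 1" and nz: "\<phi> z \<noteq> 0"
  shows "d1 \<phi> z / \<phi> z = d1 \<phi>' z / \<phi>' z" "d2 \<phi> z / \<phi> z = d2 \<phi>' z / \<phi>' z"
proof -
  have o: "open (W \<inter> W')" "z \<in> W \<inter> W'" using assms by auto
  have h: "hol2_on \<phi> (W \<inter> W')" "hol2_on \<phi>' (W \<inter> W')" using assms hol2_on_subset by (metis Int_lower1, metis Int_lower2)
  have "\<phi>' z ^ N \<noteq> 0" using assms(7)[of z] o nz N by (auto simp: power_0_left)
  note A = dlog_power[OF h(1) o, of N "\<lambda>w. \<phi>' w ^ N", OF _ N this]
    and B = dlog_power[OF h(2) o, of N "\<lambda>w. \<phi>' w ^ N", OF _ N this]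
  have c: "of_nat N * \<phi>' z ^ N \<noteq> 0" using N \<open>\<phi>' z ^ N \<noteq> 0\<close> by simp
  show "d1 \<phi> z / \<phi> z = d1 \<phi>' z / \<phi>' z" using A(1) B(1) assms(7) c by (metis (no_types, lifting) IntD1 IntD2 mult_cancel_left)
  show "d2 \<phi> z / \<phi> z = d2 \<phi>' z / \<phi>' z" using A(2) B(2) assms(7) c by (metis (no_types, lifting) IntD1 IntD2 mult_cancel_left)
qed

lemma d12_mult:
  assumes "hol2_on F W" "hol2_on G W" "z \<in> W"
  shows "d1 (\<lambda>z. F z * G z) z = d1 F z * G z + F z * d1 G z" "d2 (\<lambda>z. F z * G z) z = d2 F z * G z + F z * d2 G z"
proof -
  obtain x y where z: "z = (x, y)" by (cases z)
  show "d1 (\<lambda>z. F z * G z) z = d1 F z * G z + F z * d1 G z"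
    unfolding z by (rule d1_eqI) (use assms z in \<open>auto intro!: derivative_eq_intros hol2_d1 simp: mult.commute\<close>)
  show "d2 (\<lambda>z. F z * G z) z = d2 F z * G z + F z * d2 G z"
    unfolding z by (rule d2_eqI) (use assms z in \<open>auto intro!: derivative_eq_intros hol2_d2 simp: mult.commute\<close>)
qed

context henon_data
begin

text \<open>The threshold 2R + 1 pays for both directions. Backward, |p(y) - x| >= 2R|y|, and
  division by |a| <= R leaves a factor 2; forward, it leaves the factor R + 1.\<close>

lemma fi_growth:
  assumes "a \<noteq> 0" "norm y \<ge> \<alpha>" "norm x \<le> norm y"
  shows "norm ((poly p y - x) * inverse a) \<ge> 2 * norm y"
proof -
  have "norm (poly p y - x) \<ge> 2 * R * norm y"
    using large[OF assms(2)] norm_triangle_ineq2[of "poly p y" x] assms(3) by (simp add: algebra_simps)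
  also have "2 * R * norm y \<ge> 2 * norm a * norm y" using a_le by (intro mult_right_mono) auto
  finally have "2 * norm a * norm y \<le> norm (poly p y - x)" .
  then show ?thesis using assms(1) by (simp add: divide_inverse[symmetric] norm_divide field_simps)
qed

lemma fi_Vm':
  assumes "a \<noteq> 0" "norm (snd z) \<ge> \<alpha>" "norm (fst z) \<le> norm (snd z)"
  shows "fi z \<in> Vm" "norm (snd (fi z)) \<ge> 2 * norm (snd z)"
proof -
  show g: "norm (snd (fi z)) \<ge> 2 * norm (snd z)" using fi_growth[OF assms] by (simp add: fi_simps)
  then have "norm (snd (fi z)) > norm (snd z)" using assms alpha_pos by linarith
  then show "fi z \<in> Vm" using assms fi_simps(1)[of z] by (cases "fi z") (auto simp: V_minus_def)
qed

lemma fi_iter_Vm: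
  assumes "a \<noteq> 0" "z \<in> Vm"
  shows "(fi ^^ n) z \<in> Vm \<and> norm (snd ((fi ^^ n) z)) \<ge> 2 ^ n * norm (snd z)"
proof (induction n)
  case (Suc n)
  then show ?case using fi_Vm'[OF assms(1), of "(fi ^^ n) z"] by (force simp: V_minus_def)
qed (use assms in simp)

lemma fi_iter_snd_ge: "a \<noteq> 0 \<Longrightarrow> z \<in> Vm \<Longrightarrow> norm (snd z) \<le> norm (snd ((fi ^^ n) z))"
  using fi_iter_Vm[of z n] mult_right_mono[of 1 "2 ^ n" "norm (snd z)"] by simp

lemma Um_iff:
  assumes a: "a \<noteq> 0"
  shows "z \<in> Um \<longleftrightarrow> (\<exists>n. (fi ^^ n) z \<in> Vm)"
proof
  assume "\<exists>n. (fi ^^ n) z \<in> Vm"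
  then obtain m where m: "(fi ^^ m) z \<in> Vm" by blast
  show "z \<in> Um"
  proof (rule ccontr)
    assume "z \<notin> Um"
    then obtain B where B: "\<And>n. norm ((fi ^^ n) z) \<le> B"
      using a unfolding U_minus_def K_minus_def bounded_iff by auto
    obtain k where k: "B / \<alpha> < 2 ^ k" using real_arch_pow[of 2] by auto
    then have "B < 2 ^ k * \<alpha>" using alpha_pos by (simp add: field_simps)
    also have "\<dots> \<le> 2 ^ k * norm (snd ((fi ^^ m) z))" using m by (intro mult_left_mono) (auto simp: V_minus_def)
    also have "\<dots> \<le> norm (snd ((fi ^^ (k + m)) z))" using fi_iter_Vm[OF a m, of k] by (simp add: funpow_add)
    also have "\<dots> \<le> norm ((fi ^^ (k + m)) z)" using norm_snd_le[of "snd ((fi ^^ (k + m)) z)" "fst ((fi ^^ (k + m)) z)"] by simp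
    finally show False using B[of "k + m"] by simp
  qed
next
  assume z: "z \<in> Um"
  show "\<exists>n. (fi ^^ n) z \<in> Vm"
  proof (rule ccontr)
    assume n: "\<nexists>n. (fi ^^ n) z \<in> Vm"
    define B where "B = max (max (norm (fst z)) (norm (snd z))) \<alpha>"
    have bb: "norm (fst ((fi ^^ n) z)) \<le> B \<and> norm (snd ((fi ^^ n) z)) \<le> B" for n
    proof (induction n)
      case (Suc n)
      have "(fi ^^ Suc n) z \<notin> Vm" using n by blast
      moreover have "fst ((fi ^^ Suc n) z) = snd ((fi ^^ n) z)" by (simp add: fi_simps)
      moreover have "\<alpha> \<le> B" by (simp add: B_def)
      ultimately show ?case using Suc by (cases "(fi ^^ Suc n) z") (auto simp: V_minus_def)
    qed (auto simp: B_def)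
    have "norm ((fi ^^ n) z) \<le> B + B" for n
    proof -
      have "norm (fst ((fi ^^ n) z), snd ((fi ^^ n) z)) \<le> norm (fst ((fi ^^ n) z)) + norm (snd ((fi ^^ n) z))"
        by (rule norm_Pair_le)
      then show ?thesis using bb[of n] by simp
    qed
    then have "z \<in> K_minus p a" using a unfolding K_minus_def bounded_iff by auto
    then show False using z by (simp add: U_minus_def)
  qed
qed

lemma open_Um: "open Um"
proof (cases "a = 0")
  case True
  have "closed {z. fst z = poly p (snd z)}" by (intro closed_Collect_eq continuous_intros)
  moreover have "K_minus p a = {z. fst z = poly p (snd z)}" using True by (auto simp: K_minus_def)
  ultimately show ?thesis by (simp add: U_minus_def closed_def)
next
  case False
  have eq: "Um = (\<Union>n. (fi ^^ n) -` Vm)" using Um_iff[OF False] by (simp add: set_eq_iff)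
  show ?thesis unfolding eq by (intro open_UN ballI open_vimage open_V_minus fi_cont)
qed

text \<open>Backward counterpart of \<open>Splus\<close>. Since a y_{-(k+1)} = p(y_{-k}) - x_{-k},
  the parameter cancels and the coefficient is 1, kept explicit to match
  \<open>boettcher_series\<close>.\<close>

definition Tm :: "complex \<times> complex \<Rightarrow> complex" where
  "Tm z = (\<Sum>k. Ln ((poly p (snd ((fi ^^ k) z)) - 1 * fst ((fi ^^ k) z)) / snd ((fi ^^ k) z) ^ d) / of_nat d ^ Suc k)"

lemma phi_minus_eq:
  assumes "a \<noteq> 0"
  shows "phi_minus p a z = snd z * exp (Tm z)"
proof -
  have ai: "a * (t * inverse a) = t" for t using assms by simp
  show ?thesis
    unfolding phi_minus_def Tm_def minus_quot_def y_bwd_def Let_def by (simp add: fi_simps degree_p ai assms)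
qed

lemma Tm_props:
  assumes a: "a \<noteq> 0"
  shows Tm_hol: "hol2_on Tm Vm"
    and Tm_bound: "z \<in> Vm \<Longrightarrow> norm (Tm z) \<le> C0 / norm (snd z)"
    and Tm_summable: "z \<in> Vm \<Longrightarrow> summable (\<lambda>k. Ln ((poly p (snd ((fi ^^ k) z)) - 1 * fst ((fi ^^ k) z)) / snd ((fi ^^ k) z) ^ d) / of_nat d ^ Suc k)"
    and Tm_nz: "z \<in> Vm \<Longrightarrow> (poly p (snd ((fi ^^ k) z)) - 1 * fst ((fi ^^ k) z)) / snd ((fi ^^ k) z) ^ d \<noteq> 0"
proof -
  have b: "norm (fst ((fi ^^ k) z)) \<le> norm (snd ((fi ^^ k) z))" "\<alpha> \<le> norm (snd ((fi ^^ 0) z))"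
    "norm (snd ((fi ^^ 0) z)) \<le> norm (snd ((fi ^^ k) z))" if "z \<in> Vm" for k z
    using fi_iter_Vm[OF a that, of k] fi_iter_snd_ge[OF a that, of k] that by (auto simp: V_minus_def)
  have 1: "norm (1::complex) \<le> R + 1" using R_pos by simp
  note bs = boettcher_series[where W = Vm and b = 1 and \<xi> = "\<lambda>k z. snd ((fi ^^ k) z)" and \<eta> = "\<lambda>k z. fst ((fi ^^ k) z)",
      OF open_V_minus 1 hol2_on_subset[OF fi_hol(2) subset_UNIV] hol2_on_subset[OF fi_hol(1) subset_UNIV] b]
  show "hol2_on Tm Vm" unfolding Tm_def[abs_def] using bs(1) by simp
  show "z \<in> Vm \<Longrightarrow> norm (Tm z) \<le> C0 / norm (snd z)" unfolding Tm_def using bs(2)[of z] by simp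
  show "z \<in> Vm \<Longrightarrow> summable (\<lambda>k. Ln ((poly p (snd ((fi ^^ k) z)) - 1 * fst ((fi ^^ k) z)) / snd ((fi ^^ k) z) ^ d) / of_nat d ^ Suc k)"
    using bs(3)[of z] by simp
  show "z \<in> Vm \<Longrightarrow> (poly p (snd ((fi ^^ k) z)) - 1 * fst ((fi ^^ k) z)) / snd ((fi ^^ k) z) ^ d \<noteq> 0"
    using bs(4)[of z k] by simp
qed

lemma phi_minus_nz: "a \<noteq> 0 \<Longrightarrow> z \<in> Vm \<Longrightarrow> phi_minus p a z \<noteq> 0"
  using alpha_pos by (auto simp: phi_minus_eq V_minus_def)

lemma phi_minus_fi: "a \<noteq> 0 \<Longrightarrow> z \<in> Vm \<Longrightarrow> phi_minus p a z ^ d = a * phi_minus p a (fi z)"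
proof -
  assume a: "a \<noteq> 0" and z: "z \<in> Vm"
  have y: "snd z \<noteq> 0" using z alpha_pos by (auto simp: V_minus_def)
  have "exp (Tm z) ^ d = (poly p (snd z) - fst z) / snd z ^ d * exp (Tm (fi z))"
    unfolding Tm_def using exp_suminf_power[OF d2 Tm_summable[OF a z]] Tm_nz[OF a z, of 0]
    by (simp add: funpow_swap1)
  then show ?thesis using y a by (simp add: phi_minus_eq power_mult_distrib fi_simps)
qed

lemma phi_minus_iter:
  assumes a: "a \<noteq> 0" and z: "z \<in> Vm"
  shows "phi_minus p a z ^ (d ^ n) = a ^ (\<Sum>i<n. d ^ i) * phi_minus p a ((fi ^^ n) z)"
proof (induction n)
  case (Suc n)
  have "phi_minus p a z ^ (d ^ Suc n) = (phi_minus p a z ^ (d ^ n)) ^ d" by (simp add: power_mult[symmetric] mult.commute)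
  also have "\<dots> = a ^ (d * (\<Sum>i<n. d ^ i)) * phi_minus p a ((fi ^^ n) z) ^ d"
    unfolding Suc power_mult_distrib by (simp add: power_mult[symmetric] mult.commute)
  also have "phi_minus p a ((fi ^^ n) z) ^ d = a * phi_minus p a ((fi ^^ Suc n) z)"
    using phi_minus_fi[OF a, of "(fi ^^ n) z"] fi_iter_Vm[OF a z, of n] by simp
  also have "a ^ (d * (\<Sum>i<n. d ^ i)) * (a * phi_minus p a ((fi ^^ Suc n) z)) =
      a ^ (Suc (d * (\<Sum>i<n. d ^ i))) * phi_minus p a ((fi ^^ Suc n) z)" by simp
  also have "Suc (d * (\<Sum>i<n. d ^ i)) = (\<Sum>i<Suc n. d ^ i)"
    unfolding sum.lessThan_Suc_shift by (simp add: sum_distrib_left)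
  finally show ?case .
qed simp

lemma f_Vp_add: "(f ^^ n) z \<in> Vp \<Longrightarrow> (f ^^ (m + n)) z \<in> Vp"
  using f_iter_Vp[of "(f ^^ n) z" m] by (simp add: funpow_add)

lemma power_tower: "x ^ (d ^ (m + n)) = (x ^ (d ^ n)) ^ (d ^ m)" for x :: complex
  by (metis power_add power_mult mult.commute)

text \<open>The two branches may be defined through different iterates n and m; the common exponent
  d^(m+n) makes their powers comparable by the functional equation.\<close>

lemma plus_branch_dlog_unique:
  assumes "plus_branch p \<alpha> a W \<phi>" "plus_branch p \<alpha> a W' \<phi>'" "z \<in> W" "z \<in> W'"
  shows "d1 \<phi> z / \<phi> z = d1 \<phi>' z / \<phi>' z" "d2 \<phi> z / \<phi> z = d2 \<phi>' z / \<phi>' z"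
proof -
  obtain n where n: "\<And>w. w \<in> W \<Longrightarrow> (f ^^ n) w \<in> Vp \<and> \<phi> w ^ (d ^ n) = phi_plus p a ((f ^^ n) w)"
    using assms(1) degree_p unfolding plus_branch_def by auto
  obtain m where m: "\<And>w. w \<in> W' \<Longrightarrow> (f ^^ m) w \<in> Vp \<and> \<phi>' w ^ (d ^ m) = phi_plus p a ((f ^^ m) w)"
    using assms(2) degree_p unfolding plus_branch_def by auto
  have eq: "\<phi> w ^ (d ^ (m + n)) = \<phi>' w ^ (d ^ (m + n))" if "w \<in> W" "w \<in> W'" for w
  proof -
    have "\<phi> w ^ (d ^ (m + n)) = phi_plus p a ((f ^^ m) ((f ^^ n) w))"
      using phi_plus_iter[of "(f ^^ n) w" m] n[OF that(1)] by (simp add: power_tower)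
    also have "(f ^^ m) ((f ^^ n) w) = (f ^^ n) ((f ^^ m) w)" by (metis add.commute comp_apply funpow_add)
    also have "phi_plus p a \<dots> = \<phi>' w ^ (d ^ (m + n))"
      using phi_plus_iter[of "(f ^^ m) w" n] m[OF that(2)] by (simp add: power_add power_mult)
    finally show ?thesis .
  qed
  have nz: "\<phi> z \<noteq> 0" using n[OF assms(3)] phi_plus_nz d2 by (metis power_0_left power_eq_0_iff not_numeral_le_zero zero_power)
  have N: "d ^ (m + n) \<ge> 1" using d2 by (intro one_le_power) auto
  show "d1 \<phi> z / \<phi> z = d1 \<phi>' z / \<phi>' z" "d2 \<phi> z / \<phi> z = d2 \<phi>' z / \<phi>' z"
    using dlog_power_eq[of \<phi> W z \<phi>' W' "d ^ (m + n)"] eq nz N assms unfolding plus_branch_def by auto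
qed

lemma minus_branch_dlog_unique:
  assumes "minus_branch p \<alpha> a W \<phi>" "minus_branch p \<alpha> a W' \<phi>'" "z \<in> W" "z \<in> W'"
  shows "d1 \<phi> z / \<phi> z = d1 \<phi>' z / \<phi>' z \<and> d2 \<phi> z / \<phi> z = d2 \<phi>' z / \<phi>' z"
proof (cases "a = 0")
  case True
  have eq: "\<phi> w ^ d = poly p (snd w) - fst w" if "w \<in> W" for w
    using assms(1) that True degree_p unfolding minus_branch_def by auto
  have eq': "\<phi>' w ^ d = poly p (snd w) - fst w" if "w \<in> W'" for w
    using assms(2) that True degree_p unfolding minus_branch_def by auto
  have "z \<in> Um" using assms unfolding minus_branch_def by auto
  then have "poly p (snd z) - fst z \<noteq> 0" using True by (auto simp: U_minus_def K_minus_def)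
  then have "\<phi> z \<noteq> 0" using eq[OF assms(3)] d2 by (auto simp: power_0_left)
  then show ?thesis
    using dlog_power_eq[of \<phi> W z \<phi>' W' d] eq eq' d2 assms unfolding minus_branch_def by auto
next
  case False
  obtain n where n: "\<And>w. w \<in> W \<Longrightarrow> (fi ^^ n) w \<in> Vm \<and> \<phi> w ^ (d ^ n) = a ^ (\<Sum>i<n. d ^ i) * phi_minus p a ((fi ^^ n) w)"
    using assms(1) degree_p False unfolding minus_branch_def by auto
  obtain m where m: "\<And>w. w \<in> W' \<Longrightarrow> (fi ^^ m) w \<in> Vm \<and> \<phi>' w ^ (d ^ m) = a ^ (\<Sum>i<m. d ^ i) * phi_minus p a ((fi ^^ m) w)"
    using assms(2) degree_p False unfolding minus_branch_def by auto
  have gen: "\<phi> w ^ (d ^ (m + n)) = a ^ (\<Sum>i<m + n. d ^ i) * phi_minus p a ((fi ^^ (m + n)) w)"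
    if "(fi ^^ n) w \<in> Vm" "\<phi> w ^ (d ^ n) = a ^ (\<Sum>i<n. d ^ i) * phi_minus p a ((fi ^^ n) w)" for \<phi> w m n
  proof -
    have "\<phi> w ^ (d ^ (m + n)) = (\<phi> w ^ (d ^ n)) ^ (d ^ m)" by (rule power_tower)
    also have "\<dots> = a ^ (d ^ m * (\<Sum>i<n. d ^ i)) * (a ^ (\<Sum>i<m. d ^ i) * phi_minus p a ((fi ^^ m) ((fi ^^ n) w)))"
      unfolding that(2) power_mult_distrib phi_minus_iter[OF False that(1)] by (simp add: power_mult[symmetric] mult.commute)
    also have "\<dots> = a ^ (d ^ m * (\<Sum>i<n. d ^ i) + (\<Sum>i<m. d ^ i)) * phi_minus p a ((fi ^^ (m + n)) w)"
      by (simp add: power_add funpow_add)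
    \<comment> \<open>The exponents of a that accumulate over n and then m backward steps add up to
      the exponent for m + n steps.\<close>
    also have "d ^ m * (\<Sum>i<n. d ^ i) + (\<Sum>i<m. d ^ i) = (\<Sum>i<m + n. d ^ i)"
      by (induction n) (simp_all add: algebra_simps power_add)
    finally show ?thesis .
  qed
  have eq: "\<phi> w ^ (d ^ (m + n)) = \<phi>' w ^ (d ^ (m + n))" if "w \<in> W" "w \<in> W'" for w
    using gen[of n w \<phi> m] gen[of m w \<phi>' n] n[OF that(1)] m[OF that(2)] by (simp add: add.commute)
  have nz: "\<phi> z \<noteq> 0"
  proof
    assume "\<phi> z = 0"
    moreover have "d ^ n > 0" using d2 by simp
    ultimately have "a ^ (\<Sum>i<n. d ^ i) * phi_minus p a ((fi ^^ n) z) = 0" using n[OF assms(3)] by (metis zero_power)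
    then show False using False phi_minus_nz n[OF assms(3)] by auto
  qed
  have N: "d ^ (m + n) \<ge> 1" using d2 by (intro one_le_power) auto
  show ?thesis
    using dlog_power_eq[of \<phi> W z \<phi>' W' "d ^ (m + n)"] eq nz N assms unfolding minus_branch_def by auto
qed

text \<open>Removes the definite description: any pair of branches computes the value, even with
  different domains, because both restrict to the intersection.\<close>

lemma w_crit_eq:
  assumes "plus_branch p \<alpha> a W \<phi>" "minus_branch p \<alpha> a W' \<psi>" "z \<in> W" "z \<in> W'"
  shows "w_crit p \<alpha> a z = dlog_wedge \<phi> \<psi> z"
proof -
  have res: "plus_branch p \<alpha> a (W \<inter> W') \<phi>" "minus_branch p \<alpha> a (W \<inter> W') \<psi>"
  proof -
    show "plus_branch p \<alpha> a (W \<inter> W') \<phi>"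
      using assms(1,2) hol2_on_subset[of \<phi> W "W \<inter> W'"] unfolding plus_branch_def minus_branch_def by auto
    show "minus_branch p \<alpha> a (W \<inter> W') \<psi>"
    proof (cases "a = 0")
      case True
      then show ?thesis
        using assms(1,2) hol2_on_subset[of \<psi> W' "W \<inter> W'"] unfolding plus_branch_def minus_branch_def by auto
    next
      case False
      then obtain n where "\<forall>z\<in>W'. (fi ^^ n) z \<in> Vm \<and> \<psi> z ^ degree p ^ n = a ^ (\<Sum>i<n. degree p ^ i) * phi_minus p a ((fi ^^ n) z)"
        using assms(2) unfolding minus_branch_def by auto
      then have "\<exists>n. \<forall>z\<in>W \<inter> W'. (fi ^^ n) z \<in> Vm \<and> \<psi> z ^ degree p ^ n = a ^ (\<Sum>i<n. degree p ^ i) * phi_minus p a ((fi ^^ n) z)"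
        by blast
      then show ?thesis
        using False assms(1,2) hol2_on_subset[of \<psi> W' "W \<inter> W'"] unfolding plus_branch_def minus_branch_def by auto
    qed
  qed
  show ?thesis
    unfolding w_crit_def
  proof (rule the_equality)
    show "\<exists>W \<phi>' \<psi>'. z \<in> W \<and> plus_branch p \<alpha> a W \<phi>' \<and> minus_branch p \<alpha> a W \<psi>' \<and> dlog_wedge \<phi> \<psi> z = dlog_wedge \<phi>' \<psi>' z"
      using res assms(3,4) by blast
    fix w assume "\<exists>W \<phi> \<psi>. z \<in> W \<and> plus_branch p \<alpha> a W \<phi> \<and> minus_branch p \<alpha> a W \<psi> \<and> w = dlog_wedge \<phi> \<psi> z"
    then obtain V \<phi>' \<psi>' where V: "z \<in> V" "plus_branch p \<alpha> a V \<phi>'" "minus_branch p \<alpha> a V \<psi>'" "w = dlog_wedge \<phi>' \<psi>' z" by blast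
    show "w = dlog_wedge \<phi> \<psi> z"
      unfolding V(4) dlog_wedge_def
      using plus_branch_dlog_unique[OF V(2) assms(1) V(1) assms(3)] minus_branch_dlog_unique[OF V(3) assms(2) V(1) assms(4)] by simp
  qed
qed

section \<open>Tangencies with the backward foliation\<close>

text \<open>The summand 4\<alpha> puts (ww, y) into the range |y| <= |ww|/4 of the derivative
  bounds; 12 C0 makes 6 C0/|ww| at most 1/2.\<close>

definition W0 :: real where "W0 = 4 * \<alpha> + 12 * C0"

text \<open>On \<open>Om\<close> the preimage under \<^term>\<open>f\<close> lies deep inside \<^term>\<open>Vm\<close>, hence
  \<open>\<phi>\<^sub>-\<^sup>d\<close> is a small perturbation of \<open>p(y) - x\<close>.\<close>

definition Om :: "(complex \<times> complex) set" where
  "Om = {z. norm (snd z) < \<alpha> \<and> norm a * W0 < norm (poly p (snd z) - fst z)}"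

text \<open>\<open>Tm\<close> with its coordinates exchanged, so that estimates stated on V_+ apply
  to it.\<close>

definition T' :: "complex \<times> complex \<Rightarrow> complex" where "T' = (\<lambda>z. Tm (snd z, fst z))"

text \<open>For a != 0 the second coordinate of the preimage of z; for a = 0 the convention for
  \<open>inverse\<close> makes it 0.\<close>

definition ww :: "complex \<times> complex \<Rightarrow> complex" where "ww z = (poly p (snd z) - fst z) * inverse a"

text \<open>For \<open>v = p(y) - x\<close> and \<open>\<phi>\<^sub>-\<^sup>d = v exp (T'(v/a, y))\<close> the differential of \<open>\<phi>\<^sub>-\<^sup>d\<close> is
  proportional to \<open>dv + kap dy\<close>.\<close>

definition kap :: "complex \<times> complex \<Rightarrow> complex" where
  "kap z = (if a = 0 then 0 else
     (poly p (snd z) - fst z) * d2 T' (ww z, snd z) / (1 + ww z * d1 T' (ww z, snd z)))"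

abbreviation "G \<equiv> phi_minus_pow p a"

lemma W0_pos: "W0 > 0" "4 * \<alpha> \<le> W0" "12 * C0 \<le> W0"
  using alpha_pos C0_nonneg by (auto simp: W0_def)

lemma open_Om: "open Om"
  unfolding Om_def by (intro open_Collect_conj open_Collect_less continuous_intros)

lemma T'_hol: "a \<noteq> 0 \<Longrightarrow> hol2_on T' Vp"
proof -
  assume a: "a \<noteq> 0"
  have "prod.swap -` Vm = Vp" by (auto simp: V_plus_def V_minus_def)
  then show ?thesis using hol2_swap[OF Tm_hol[OF a]] by (simp add: T'_def)
qed

lemma T'_bound: "a \<noteq> 0 \<Longrightarrow> z \<in> Vp \<Longrightarrow> norm (T' z) \<le> C0 / norm (fst z)"
  using Tm_bound[of "(snd z, fst z)"] by (auto simp: T'_def V_plus_def V_minus_def)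

lemma Om_ww:
  assumes "a \<noteq> 0" "z \<in> Om"
  shows "norm (ww z) > W0" "(ww z, snd z) \<in> Vp" "fi z \<in> Vm" "fi z = (snd z, ww z)"
    "2 * \<alpha> \<le> norm (ww z)" "norm (snd z) \<le> norm (ww z) / 4"
proof -
  show w: "norm (ww z) > W0"
    unfolding ww_def divide_inverse[symmetric] norm_divide using assms
    by (simp add: Om_def pos_less_divide_eq mult.commute[of W0])
  have y: "norm (snd z) < \<alpha>" using assms by (simp add: Om_def)
  show "(ww z, snd z) \<in> Vp" using w y W0_pos alpha_pos by (auto simp: V_plus_def)
  show e: "fi z = (snd z, ww z)" using fi_simps[of z] by (simp add: prod_eq_iff ww_def)
  show "fi z \<in> Vm" unfolding e using w y W0_pos alpha_pos by (auto simp: V_minus_def)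
  show "2 * \<alpha> \<le> norm (ww z)" "norm (snd z) \<le> norm (ww z) / 4" using w y W0_pos alpha_pos by auto
qed

lemma Om_nz: "z \<in> Om \<Longrightarrow> poly p (snd z) - fst z \<noteq> 0"
proof -
  assume "z \<in> Om"
  then have "norm a * W0 < norm (poly p (snd z) - fst z)" by (simp add: Om_def)
  moreover have "0 \<le> norm a * W0" using W0_pos by simp
  ultimately have "0 < norm (poly p (snd z) - fst z)" by linarith
  then show ?thesis by auto
qed

lemma Om_Um: "Om \<subseteq> Um"
proof
  fix z assume z: "z \<in> Om"
  show "z \<in> Um"
  proof (cases "a = 0")
    case True
    then show ?thesis using Om_nz[OF z] by (auto simp: U_minus_def K_minus_def)
  next
    case False
    then show ?thesis using Om_ww(3)[OF False z] by (auto simp: Um_iff[OF False] intro!: exI[of _ 1])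
  qed
qed

text \<open>In the last bound v = p(y) - x equals a ww, so the factor 1/|ww| becomes |a|/|v| and a
  second |a| comes from v itself: the correction is quadratic in a.\<close>

lemma Om_small:
  assumes "a \<noteq> 0" "z \<in> Om"
  shows "norm (ww z * d1 T' (ww z, snd z)) \<le> 1 / 2" "norm (T' (ww z, snd z)) \<le> 1 / 12"
    "norm ((poly p (snd z) - fst z) * d2 T' (ww z, snd z)) \<le> 6 * C0 * norm a ^ 2 / norm (poly p (snd z) - fst z)"
proof -
  note w = Om_ww[OF assms]
  have w0: "norm (ww z) > 0" using w(1) W0_pos by linarith
  have c: "C0 / norm (ww z) \<le> 1 / 12" using w(1) W0_pos w0 by (simp add: field_simps)
  note D = series_derivative_bounds[OF T'_hol[OF assms(1)] T'_bound[OF assms(1)] w(5,6)]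
  have "norm (ww z * d1 T' (ww z, snd z)) \<le> norm (ww z) * (6 * C0 / norm (ww z) ^ 2)"
    unfolding norm_mult by (rule mult_left_mono[OF D(1) norm_ge_zero])
  also have "\<dots> = 6 * (C0 / norm (ww z))" using w0 by (simp add: power2_eq_square)
  finally show "norm (ww z * d1 T' (ww z, snd z)) \<le> 1 / 2" using c by linarith
  show "norm (T' (ww z, snd z)) \<le> 1 / 12"
    by (rule order_trans[OF _ c]) (use T'_bound[OF assms(1) w(2)] in simp)
  have v: "poly p (snd z) - fst z = a * ww z" using assms(1) by (simp add: ww_def)
  have "norm (a * ww z * d2 T' (ww z, snd z)) \<le> norm (a * ww z) * (6 * C0 / norm (ww z) ^ 2)"
    unfolding norm_mult[of "a * ww z"] by (rule mult_left_mono[OF D(2) norm_ge_zero])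
  also have "\<dots> = 6 * C0 * norm a ^ 2 / norm (a * ww z)"
    using w0 assms(1) by (simp add: power2_eq_square norm_mult field_simps)
  finally show "norm ((poly p (snd z) - fst z) * d2 T' (ww z, snd z)) \<le> 6 * C0 * norm a ^ 2 / norm (poly p (snd z) - fst z)"
    unfolding v .
qed

lemma one_plus_nz: "norm t \<le> 1 / 2 \<Longrightarrow> norm (1 + t) \<ge> 1 / 2" "norm t \<le> 1 / 2 \<Longrightarrow> norm (1 + t) \<le> 3 / 2" for t :: complex
  using norm_triangle_ineq2[of 1 "- t"] norm_triangle_ineq[of 1 t] by auto

lemma ww_hol: "hol2_on ww S"
  unfolding ww_def[abs_def] by (intro hol2_intros)

lemma kap_0: "a = 0 \<Longrightarrow> kap z = 0"
  unfolding kap_def by simp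

lemma kap_hol: "hol2_on kap Om"
proof (cases "a = 0")
  case True
  then have "kap = (\<lambda>_. 0)" by (intro ext kap_0)
  then show ?thesis by (simp only: hol2_const)
next
  case False
  have h: "hol2_on (\<lambda>z. d1 T' (ww z, snd z)) Om" "hol2_on (\<lambda>z. d2 T' (ww z, snd z)) Om"
    using hol2_compose2[OF hol2_d1_hol2[OF T'_hol[OF False] open_V_plus] ww_hol hol2_snd]
      hol2_compose2[OF hol2_d2_hol2[OF T'_hol[OF False] open_V_plus] ww_hol hol2_snd] Om_ww(2)[OF False] by auto
  have nz: "1 + ww z * d1 T' (ww z, snd z) \<noteq> 0" if "z \<in> Om" for z
    using one_plus_nz(1)[OF Om_small(1)[OF False that]] by auto
  have "hol2_on (\<lambda>z. (poly p (snd z) - fst z) * d2 T' (ww z, snd z) / (1 + ww z * d1 T' (ww z, snd z))) Om"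
    by (intro hol2_divide hol2_mult hol2_add hol2_const hol2_diff hol2_poly hol2_fst hol2_snd h ww_hol nz)
  then show ?thesis using False by (simp add: kap_def[abs_def])
qed

lemma kap_bound:
  assumes "z \<in> Om"
  shows "norm (kap z) \<le> 12 * C0 * norm a ^ 2 / norm (poly p (snd z) - fst z)"
proof (cases "a = 0")
  case True
  show ?thesis unfolding kap_0[OF True]
    using C0_nonneg by (simp only: norm_zero) (intro divide_nonneg_nonneg mult_nonneg_nonneg, auto)
next
  case False
  have "norm (kap z) = norm ((poly p (snd z) - fst z) * d2 T' (ww z, snd z)) / norm (1 + ww z * d1 T' (ww z, snd z))"
    using False by (simp add: kap_def norm_divide)
  also have "\<dots> \<le> (6 * C0 * norm a ^ 2 / norm (poly p (snd z) - fst z)) / (1 / 2)"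
    using one_plus_nz(1)[OF Om_small(1)[OF False assms]] Om_small(3)[OF False assms] C0_nonneg
    by (intro frac_le) auto
  finally show ?thesis by simp
qed

lemma G_eq: "a \<noteq> 0 \<Longrightarrow> z \<in> Om \<Longrightarrow> G z = (poly p (snd z) - fst z) * exp (T' (ww z, snd z))"
  using Om_ww(4)[of z] by (simp add: phi_minus_pow_def phi_minus_eq T'_def) (simp add: ww_def)

lemma G_hol: "hol2_on G Om"
proof (cases "a = 0")
  case True
  have "hol2_on (\<lambda>z. poly p (snd z) - fst z) Om" by (intro hol2_intros)
  then show ?thesis using True by (simp add: phi_minus_pow_def[abs_def])
next
  case False
  have "hol2_on (\<lambda>z. T' (ww z, snd z)) Om"
    by (rule hol2_compose2[OF T'_hol[OF False] ww_hol hol2_snd Om_ww(2)[OF False]])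
  then have "hol2_on (\<lambda>z. (poly p (snd z) - fst z) * exp (T' (ww z, snd z))) Om" by (intro hol2_intros)
  then show ?thesis by (rule hol2_cong[OF _ open_Om]) (simp add: G_eq[OF False])
qed

lemma G_nz: "z \<in> Om \<Longrightarrow> G z \<noteq> 0"
  using Om_nz[of z] G_eq[of z] by (cases "a = 0") (auto simp: phi_minus_pow_def)

lemma d12_v: "d1 (\<lambda>z. poly p (snd z) - fst z) z = - 1" "d2 (\<lambda>z. poly p (snd z) - fst z) z = poly (pderiv p) (snd z)"
  by (cases z, simp, rule d1_eqI, auto intro!: derivative_eq_intros)
    (cases z, simp, rule d2_eqI, auto intro!: derivative_eq_intros)

lemma d12_ww: "d1 ww z = - inverse a" "d2 ww z = poly (pderiv p) (snd z) * inverse a"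
  unfolding ww_def[abs_def]
  by (cases z, simp, rule d1_eqI, auto intro!: derivative_eq_intros)
    (cases z, simp, rule d2_eqI, auto intro!: derivative_eq_intros)

lemma d12_proj: "d1 snd z = 0" "d2 snd z = 1" "d1 fst z = 1" "d2 fst z = 0"
  by (auto simp: d1_def d2_def)

text \<open>Pairs dG with an arbitrary covector (A, B) and treats a = 0 and a != 0 together. The
  factor U = exp(T') (1 + ww d1 T') is a unit; the bounds on U and G serve the estimate of
  \<open>w_tilde\<close> at infinity.\<close>

lemma G_wedge:
  assumes z: "z \<in> Om"
  obtains U where "U \<noteq> 0" "norm U \<le> 3" "norm (G z) \<ge> norm (poly p (snd z) - fst z) / 3"
    "\<And>A B. A * d2 G z - B * d1 G z = U * (A * (poly (pderiv p) (snd z) + kap z) + B)"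
proof (cases "a = 0")
  case True
  have "G = (\<lambda>z. poly p (snd z) - fst z)" using True by (simp add: phi_minus_pow_def[abs_def])
  then have "d1 G z = - 1" "d2 G z = poly (pderiv p) (snd z)" "G z = poly p (snd z) - fst z" using d12_v by metis+
  then show ?thesis by (intro that[of 1]) (simp_all add: kap_0[OF True])
next
  case False
  define E where "E = (\<lambda>z. T' (ww z, snd z))"
  define e where "e = exp (E z)"
  define P where "P = 1 + ww z * d1 T' (ww z, snd z)"
  define y where "y = snd z"
  define v where "v = (\<lambda>z. poly p (snd z) - fst z)"
  have vz: "v z = a * ww z" using False by (simp add: v_def ww_def)
  note wz = Om_ww(2)[OF False z]
  have hE: "hol2_on E Om" unfolding E_def
    by (rule hol2_compose2[OF T'_hol[OF False] ww_hol hol2_snd Om_ww(2)[OF False]])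
  have dE: "d1 E z = - d1 T' (ww z, y) * inverse a" "d2 E z = d1 T' (ww z, y) * (poly (pderiv p) y * inverse a) + d2 T' (ww z, y)"
    unfolding E_def y_def using d12_compose2[OF T'_hol[OF False] ww_hol hol2_snd UNIV_I wz]
    by (auto simp: d12_ww d12_proj)
  have dex: "d1 (\<lambda>z. exp (E z)) z = e * d1 E z" "d2 (\<lambda>z. exp (E z)) z = e * d2 E z"
    unfolding e_def using d12_compose1[OF DERIV_exp hE z] by auto
  have hv: "hol2_on v Om" unfolding v_def by (intro hol2_intros)
  have dG': "d1 (\<lambda>z. v z * exp (E z)) z = d1 v z * e + v z * (e * d1 E z)" "d2 (\<lambda>z. v z * exp (E z)) z = d2 v z * e + v z * (e * d2 E z)"
    using d12_mult[OF hv hol2_exp[OF hE] z] by (simp_all add: dex e_def[symmetric])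
  have "d1 G z = d1 (\<lambda>z. v z * exp (E z)) z" "d2 G z = d2 (\<lambda>z. v z * exp (E z)) z"
    using d12_cong_open[OF open_Om z, of G "\<lambda>z. v z * exp (E z)"] G_eq[OF False] by (auto simp: v_def E_def)
  note dG'' = this[unfolded dG']
  have dv: "d1 v z = - 1" "d2 v z = poly (pderiv p) y" unfolding v_def y_def by (rule d12_v)+
  then have dG: "d1 G z = - e * P" "d2 G z = e * (poly (pderiv p) y * P + v z * d2 T' (ww z, y))"
    unfolding dG'' dv dE vz P_def y_def[symmetric] using False by (simp_all add: field_simps)
  have P: "norm P \<ge> 1 / 2" "norm P \<le> 3 / 2" unfolding P_def using one_plus_nz Om_small(1)[OF False z] by auto
  then have P0: "P \<noteq> 0" by auto
  have en: "norm e \<le> 2" "norm e \<ge> 1 / 3"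
  proof -
    have E: "norm (E z) \<le> 1 / 12" unfolding E_def by (rule Om_small(2)[OF False z])
    have R: "\<bar>Re (E z)\<bar> \<le> 1 / 12" using abs_Re_le_cmod[of "E z"] E by linarith
    have ne: "norm e = exp (Re (E z))" by (simp add: e_def)
    have "exp (Re (E z)) \<ge> 1 + Re (E z)" by (rule exp_ge_add_one_self)
    then show "norm e \<ge> 1 / 3" using R ne by linarith
    have "exp (- Re (E z)) \<ge> 1 / 2" using exp_ge_add_one_self[of "- Re (E z)"] R by linarith
    then have "exp (Re (E z)) \<le> 2" by (simp add: exp_minus field_simps)
    then show "norm e \<le> 2" using ne by simp
  qed
  show ?thesis
  proof (rule that[of "e * P"])
    show "e * P \<noteq> 0" using P0 by (simp add: e_def)
    have "norm e * norm P \<le> 2 * (3 / 2)" using en(1) P(2) by (intro mult_mono) auto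
    then show "norm (e * P) \<le> 3" by (simp add: norm_mult)
    have "norm (G z) = norm (v z) * norm e" using G_eq[OF False z] by (simp add: v_def E_def e_def norm_mult)
    moreover have "norm (v z) * norm e \<ge> norm (v z) * (1 / 3)" using en(2) by (intro mult_left_mono) auto
    ultimately show "norm (G z) \<ge> norm (poly p (snd z) - fst z) / 3" by (simp add: v_def)
    have k: "kap z * P = v z * d2 T' (ww z, y)" using False P0 by (simp add: kap_def P_def v_def y_def)
    show "A * d2 G z - B * d1 G z = e * P * (A * (poly (pderiv p) (snd z) + kap z) + B)" for A B
    proof -
      have "A * d2 G z - B * d1 G z = e * (A * (poly (pderiv p) y * P + kap z * P) + B * P)"
        unfolding dG k by (simp add: algebra_simps)
      then show ?thesis by (simp add: y_def algebra_simps)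
    qed
  qed
qed

text \<open>A local d-th root of G is a branch of phi_-: one backward step reaches V_- when a != 0,
  and for a = 0 it is the defining equation.\<close>

lemma minus_branch_Om:
  assumes z: "z \<in> Om"
  obtains W \<psi> where "minus_branch p \<alpha> a W \<psi>" "z \<in> W" "W \<subseteq> Om"
    "d1 \<psi> z / \<psi> z = d1 G z / (of_nat d * G z)" "d2 \<psi> z / \<psi> z = d2 G z / (of_nat d * G z)"
proof -
  have d1: "d \<ge> 1" using d2 by simp
  obtain c where c: "c ^ d = G z" using d1 by (metis exists_complex_root[of d "G z"] less_le_trans zero_less_one not_less_zero neq0_conv)
  obtain W \<psi> where W: "open W" "z \<in> W" "W \<subseteq> Om" "hol2_on \<psi> W" "\<And>w. w \<in> W \<Longrightarrow> \<psi> w ^ d = G w"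
    using hol2_local_root[OF G_hol open_Om z G_nz[OF z] d1 c] by metis
  have "minus_branch p \<alpha> a W \<psi>"
  proof (cases "a = 0")
    case True
    then show ?thesis using W Om_Um by (auto simp: minus_branch_def degree_p phi_minus_pow_def)
  next
    case False
    have "\<forall>z\<in>W. (fi ^^ 1) z \<in> Vm \<and> \<psi> z ^ (degree p ^ 1) = a ^ (\<Sum>i<1. degree p ^ i) * phi_minus p a ((fi ^^ 1) z)"
      using W Om_ww(3)[OF False] False by (auto simp: degree_p phi_minus_pow_def)
    then have "\<exists>n. \<forall>z\<in>W. (fi ^^ n) z \<in> Vm \<and> \<psi> z ^ (degree p ^ n) = a ^ (\<Sum>i<n. degree p ^ i) * phi_minus p a ((fi ^^ n) z)"
      by blast
    then show ?thesis using W Om_Um False unfolding minus_branch_def by auto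
  qed
  moreover have "of_nat d * G z \<noteq> 0" using d2 G_nz[OF z] by simp
  ultimately show ?thesis
    using that[of W \<psi>] W dlog_power[OF W(4,1,2,5) d1 G_nz[OF z]] by (simp add: field_simps)
qed

end

section \<open>Coverings and the straightening coordinate\<close>

text \<open>A proper locally injective map between domains of equal dimension is a covering: fibres
  are finite, points of a fibre have disjoint injective neighbourhoods, and properness excludes
  further preimages of a small disc.\<close>

lemma proper_local_homeo_covering:
  fixes \<Theta> :: "'a::euclidean_space \<Rightarrow> 'a"
  assumes W: "open W" "W \<noteq> {}" and cont: "continuous_on W \<Theta>" and im: "\<Theta> ` W \<subseteq> Z" and Z: "open Z" "connected Z"
    and loc: "\<And>x. x \<in> W \<Longrightarrow> \<exists>U. open U \<and> x \<in> U \<and> U \<subseteq> W \<and> inj_on \<Theta> U"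
    and proper: "\<And>C. compact C \<Longrightarrow> C \<subseteq> Z \<Longrightarrow> compact (W \<inter> \<Theta> -` C)"
  shows "covering_space W \<Theta> Z"
proof
  show "continuous_on W \<Theta>" by fact
  have opn: "open (\<Theta> ` V)" if V: "open V" "V \<subseteq> W" for V
    unfolding open_contains_ball[of "\<Theta> ` V"]
  proof
    fix y assume "y \<in> \<Theta> ` V"
    then obtain x where x: "x \<in> V" "y = \<Theta> x" by blast
    then obtain U where U: "open U" "x \<in> U" "U \<subseteq> W" "inj_on \<Theta> U" using loc V by blast
    have "open (\<Theta> ` (U \<inter> V))"
    proof (rule invariance_of_domain)
      show "continuous_on (U \<inter> V) \<Theta>" by (rule continuous_on_subset[OF cont]) (use U(3) in blast)
      show "inj_on \<Theta> (U \<inter> V)" by (rule inj_on_subset[OF U(4)]) blast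
    qed (use U(1) V(1) in blast)
    moreover have "y \<in> \<Theta> ` (U \<inter> V)" using x U by blast
    ultimately obtain e where "e > 0" "ball y e \<subseteq> \<Theta> ` (U \<inter> V)"
      using open_contains_ball[of "\<Theta> ` (U \<inter> V)"] by blast
    then show "\<exists>e>0. ball y e \<subseteq> \<Theta> ` V" by blast
  qed
  have img: "\<Theta> ` W = Z"
  proof -
    have "openin (top_of_set Z) (\<Theta> ` W)" using opn[OF W(1) order_refl] im by (simp add: Z open_openin_trans)
    \<comment> \<open>Properness makes the image closed: near an omitted y only the compact preimage
      of a closed ball matters.\<close>
    moreover have "closedin (top_of_set Z) (\<Theta> ` W)"
    proof -
      have "open (Z - \<Theta> ` W)"
        unfolding open_contains_ball[of "Z - \<Theta> ` W"]
      proof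
        fix y assume y: "y \<in> Z - \<Theta> ` W"
        obtain e where e: "e > 0" "cball y e \<subseteq> Z" using Z(1) y open_contains_cball[of Z] by blast
        have "closed (\<Theta> ` (W \<inter> \<Theta> -` cball y e))"
          by (intro compact_imp_closed compact_continuous_image proper e compact_cball continuous_on_subset[OF cont]) auto
        then have "open (- (\<Theta> ` (W \<inter> \<Theta> -` cball y e)))" by (simp add: closed_def)
        moreover have "y \<in> - (\<Theta> ` (W \<inter> \<Theta> -` cball y e))" using y by auto
        ultimately obtain e1 where e1: "e1 > 0" "ball y e1 \<subseteq> - (\<Theta> ` (W \<inter> \<Theta> -` cball y e))"
          using open_contains_ball[of "- (\<Theta> ` (W \<inter> \<Theta> -` cball y e))"] by blast
        have "ball y (min e e1) \<subseteq> Z - \<Theta> ` W"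
        proof
          fix w assume w: "w \<in> ball y (min e e1)"
          then have "w \<in> cball y e" "w \<in> ball y e1" by auto
          then show "w \<in> Z - \<Theta> ` W" using e(2) e1(2) by blast
        qed
        then show "\<exists>e>0. ball y e \<subseteq> Z - \<Theta> ` W" using e(1) e1(1) by (intro exI[of _ "min e e1"]) auto
      qed
      then have "openin (top_of_set Z) (Z - \<Theta> ` W)" using Z(1) by (intro open_openin_trans) auto
      then show ?thesis using im by (simp add: closedin_def)
    qed
    ultimately show ?thesis using Z(2) W(2) unfolding connected_clopen by blast
  qed
  from img show "\<Theta> ` W = Z" .
  fix y assume y: "y \<in> Z"
  define T where "T = W \<inter> \<Theta> -` {y}"
  have cT: "compact T" unfolding T_def by (rule proper) (use y in auto)
  have TW: "T \<subseteq> W" by (auto simp: T_def)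
  obtain U where U: "\<And>x. x \<in> W \<Longrightarrow> open (U x) \<and> x \<in> U x \<and> U x \<subseteq> W \<and> inj_on \<Theta> (U x)"
    using loc by metis
  have finT: "finite T"
  proof -
    obtain F where F: "F \<subseteq> T" "finite F" "T \<subseteq> (\<Union>x\<in>F. U x)"
    proof (rule compactE_image[OF cT, of T U])
      show "open (U x)" if "x \<in> T" for x using U TW that by blast
      show "T \<subseteq> (\<Union>x\<in>T. U x)" using U TW by blast
    qed (rule that)
    have "x \<in> F" if x: "x \<in> T" for x
    proof -
      obtain x' where x': "x' \<in> F" "x \<in> U x'" using F(3) x by blast
      have "\<Theta> x = \<Theta> x'" using x x' F(1) by (auto simp: T_def)
      moreover have "x' \<in> W" using x' F(1) TW by blast
      ultimately have "x = x'" using inj_onD[of \<Theta> "U x'" x x'] U[of x'] x'(2) by simp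
      then show ?thesis using x' by simp
    qed
    then have "T \<subseteq> F" by blast
    then show ?thesis by (rule finite_subset[OF _ F(2)])
  qed
  obtain \<delta> where \<delta>: "\<And>x. x \<in> T \<Longrightarrow> \<delta> x > 0 \<and> (\<forall>x'\<in>T. x' \<noteq> x \<longrightarrow> \<delta> x \<le> dist x x')"
    using finite_set_avoid[OF finT] by metis
  define V where "V = (\<lambda>x. U x \<inter> ball x (\<delta> x / 2))"
  have V: "open (V x)" "x \<in> V x" "V x \<subseteq> W" "inj_on \<Theta> (V x)" if "x \<in> T" for x
  proof -
    have x: "x \<in> W" using that TW by blast
    show "open (V x)" "x \<in> V x" "V x \<subseteq> W" using U[OF x] \<delta>[OF that] by (auto simp: V_def)
    show "inj_on \<Theta> (V x)" by (rule inj_on_subset[of \<Theta> "U x"]) (use U[OF x] in \<open>auto simp: V_def\<close>)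
  qed
  have Vd: "V x \<inter> V x' = {}" if "x \<in> T" "x' \<in> T" "x \<noteq> x'" for x x'
  proof (rule ccontr)
    assume "V x \<inter> V x' \<noteq> {}"
    then obtain w where w: "dist x w < \<delta> x / 2" "dist x' w < \<delta> x' / 2" by (auto simp: V_def)
    have "\<delta> x \<le> dist x x'" "\<delta> x' \<le> dist x' x" using \<delta>[OF that(1)] \<delta>[OF that(2)] that by auto
    moreover have "dist x' x = dist x x'" by (rule dist_commute)
    ultimately show False using w dist_triangle2[of x x' w] by linarith
  qed
  obtain e where e: "e > 0" "cball y e \<subseteq> Z" using Z(1) y open_contains_cball[of Z] by blast
  \<comment> \<open>The part of the preimage of a closed ball not caught by the chosen sheets. It is
    compact and its image omits y, so shrinking the ball removes it.\<close>
  define Q where "Q = (W \<inter> \<Theta> -` cball y e) - (\<Union>x\<in>T. V x)"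
  have cQ: "compact Q" unfolding Q_def
    by (intro compact_diff proper compact_cball e open_UN ballI V)
  have "closed (\<Theta> ` Q)"
    by (intro compact_imp_closed compact_continuous_image cQ continuous_on_subset[OF cont]) (auto simp: Q_def)
  moreover have "y \<notin> \<Theta> ` Q" using V(2) by (auto simp: Q_def T_def)
  ultimately have "open (- (\<Theta> ` Q))" "y \<in> - (\<Theta> ` Q)" by (auto simp: closed_def)
  then obtain e1 where "e1 > 0" "ball y e1 \<subseteq> - (\<Theta> ` Q)" using open_contains_ball[of "- (\<Theta> ` Q)"] by blast
  then have e1: "e1 > 0" "ball y e1 \<inter> \<Theta> ` Q = {}" by auto
  define O' where "O' = ball y (min e e1) \<inter> (\<Inter>x\<in>T. \<Theta> ` V x)"
  have oO: "open O'" unfolding O'_def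
    by (intro open_Int open_ball open_INT finT ballI opn V)
  have yO: "y \<in> O'" using e e1 V(2) by (auto simp: O'_def T_def)
  have OZ: "O' \<subseteq> Z" using e by (auto simp: O'_def)
  have cover: "W \<inter> \<Theta> -` O' = (\<Union>x\<in>T. V x \<inter> \<Theta> -` O')"
  proof
    show "(\<Union>x\<in>T. V x \<inter> \<Theta> -` O') \<subseteq> W \<inter> \<Theta> -` O'" using V(3) by blast
    show "W \<inter> \<Theta> -` O' \<subseteq> (\<Union>x\<in>T. V x \<inter> \<Theta> -` O')"
    proof
      fix w assume w: "w \<in> W \<inter> \<Theta> -` O'"
      then have "\<Theta> w \<in> cball y e" "\<Theta> w \<in> ball y e1" by (auto simp: O'_def)
      then have "w \<notin> Q" using e1(2) by blast
      then show "w \<in> (\<Union>x\<in>T. V x \<inter> \<Theta> -` O')" using w \<open>\<Theta> w \<in> cball y e\<close> by (auto simp: Q_def)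
    qed
  qed
  have oV: "open (V x \<inter> \<Theta> -` O')" if "x \<in> T" for x
    using continuous_on_open_vimage[OF V(1)[OF that]] continuous_on_subset[OF cont V(3)[OF that]] oO by (auto simp: Int_commute)
  have homeo: "\<exists>q. homeomorphism (V x \<inter> \<Theta> -` O') O' \<Theta> q" if x: "x \<in> T" for x
  proof -
    have im': "\<Theta> ` (V x \<inter> \<Theta> -` O') = O'"
    proof
      show "O' \<subseteq> \<Theta> ` (V x \<inter> \<Theta> -` O')"
      proof
        fix w assume w: "w \<in> O'"
        then have "w \<in> \<Theta> ` V x" using x unfolding O'_def by blast
        then show "w \<in> \<Theta> ` (V x \<inter> \<Theta> -` O')" using w by blast
      qed
    qed blast
    have c': "continuous_on (V x \<inter> \<Theta> -` O') \<Theta>" by (rule continuous_on_subset[OF cont]) (use V(3)[OF x] in blast)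
    have i': "inj_on \<Theta> (V x \<inter> \<Theta> -` O')" by (rule inj_on_subset[OF V(4)[OF x]]) blast
    obtain q where "homeomorphism (V x \<inter> \<Theta> -` O') (\<Theta> ` (V x \<inter> \<Theta> -` O')) \<Theta> q"
      by (rule invariance_of_domain_homeomorphism[OF oV[OF x] c' order_refl i'])
    then show ?thesis unfolding im' by blast
  qed
  show "\<exists>T. y \<in> T \<and> openin (top_of_set Z) T \<and>
      (\<exists>v. \<Union>v = W \<inter> \<Theta> -` T \<and> (\<forall>u\<in>v. openin (top_of_set W) u) \<and> pairwise disjnt v \<and> (\<forall>u\<in>v. \<exists>q. homeomorphism u T \<Theta> q))"
  proof (intro exI[of _ O'] conjI exI[of _ "(\<lambda>x. V x \<inter> \<Theta> -` O') ` T"] ballI)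
    show "openin (top_of_set Z) O'" using oO OZ by (simp add: Z open_openin_trans)
    show "pairwise disjnt ((\<lambda>x. V x \<inter> \<Theta> -` O') ` T)"
      unfolding pairwise_def disjnt_def using Vd by blast
    fix u assume "u \<in> (\<lambda>x. V x \<inter> \<Theta> -` O') ` T"
    then obtain x where x: "x \<in> T" "u = V x \<inter> \<Theta> -` O'" by blast
    show "openin (top_of_set W) u" using oV[OF x(1)] V(3)[OF x(1)] W(1) unfolding x(2) by (intro open_openin_trans) auto
    show "\<exists>q. homeomorphism u O' \<Theta> q" using homeo x by blast
  qed (use yO cover in auto)
qed

text \<open>F(t, y) - c t has derivative at most |c|/2 near z, so F is injective on every small
  horizontal slice, and the second component separates slices. Injectivity suffices since invariance
  of domain supplies the rest.\<close>

lemma hol2_locally_injective: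
  assumes F: "hol2_on F W" and W: "open W" "z \<in> W" and nz: "d1 F z \<noteq> 0"
  shows "\<exists>U. open U \<and> z \<in> U \<and> U \<subseteq> W \<and> inj_on (\<lambda>z. (F z, snd z)) U"
proof -
  obtain x0 y0 where z: "z = (x0, y0)" by (cases z)
  define c where "c = d1 F z"
  have "isCont (d1 F) z" by (rule hol2_imp_isCont[OF hol2_d1_hol2[OF F W(1)] W(2)])
  then have "open (W \<inter> d1 F -` ball c (norm c / 2))"
    using continuous_on_open_vimage[OF W(1)] hol2_d1_continuous[OF F W(1)] by (auto simp: Int_commute)
  moreover have "(x0, y0) \<in> W \<inter> d1 F -` ball c (norm c / 2)" using W nz by (simp add: z c_def)
  ultimately obtain r where r: "r > 0" "cball x0 r \<times> cball y0 r \<subseteq> W \<inter> d1 F -` ball c (norm c / 2)"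
    using polydisc_in_open by blast
  have inj: "x = x'" if x: "x \<in> ball x0 r" "x' \<in> ball x0 r" and y: "y \<in> ball y0 r" and eq: "F (x, y) = F (x', y)" for x x' y
  proof -
    define g where "g = (\<lambda>t. F (t, y) - t * c)"
    have in': "(t, y) \<in> W" "norm (d1 F (t, y) - c) \<le> norm c / 2" if "t \<in> ball x0 r" for t
    proof -
      have "(t, y) \<in> cball x0 r \<times> cball y0 r" using that y by auto
      then have in0: "(t, y) \<in> W \<inter> d1 F -` ball c (norm c / 2)" using r(2) by blast
      then show "(t, y) \<in> W" by blast
      have "d1 F (t, y) \<in> ball c (norm c / 2)" using in0 by blast
      then show "norm (d1 F (t, y) - c) \<le> norm c / 2" unfolding mem_ball dist_norm norm_minus_commute[of c] by (rule less_imp_le)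
    qed
    have A: "norm (g x - g x') \<le> norm c / 2 * norm (x - x')"
    proof (rule field_differentiable_bound[of "ball x0 r" g "\<lambda>t. d1 F (t, y) - c"])
      fix t assume t: "t \<in> ball x0 r"
      have "(g has_field_derivative d1 F (t, y) - c) (at t)"
        unfolding g_def by (auto intro!: derivative_eq_intros hol2_d1[OF F in'(1)[OF t]])
      then show "(g has_field_derivative d1 F (t, y) - c) (at t within ball x0 r)" by (rule has_field_derivative_at_within)
      show "norm (d1 F (t, y) - c) \<le> norm c / 2" by (rule in'(2)[OF t])
    qed (use x in \<open>simp_all only: convex_ball\<close>)
    have B: "g x - g x' = c * (x' - x)" unfolding g_def eq by (simp add: right_diff_distrib mult.commute)
    have "norm (c * (x' - x)) \<le> norm c / 2 * norm (x - x')" using A unfolding B .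
    then have "norm c * norm (x' - x) \<le> norm c / 2 * norm (x' - x)" unfolding norm_mult norm_minus_commute[of x x'] .
    moreover have "norm c / 2 * norm (x' - x) = (norm c * norm (x' - x)) / 2" by (rule times_divide_eq_left)
    ultimately have "norm c * norm (x' - x) \<le> 0" by linarith
    moreover have "norm c > 0" using nz unfolding c_def by (rule zero_less_norm_iff[THEN iffD2])
    ultimately have "norm (x' - x) \<le> 0" using mult_left_le_imp_le[of "norm c" "norm (x' - x)" 0] by simp
    then show "x = x'" by simp
  qed
  show ?thesis
  proof (intro exI[of _ "ball x0 r \<times> ball y0 r"] conjI)
    show "inj_on (\<lambda>z. (F z, snd z)) (ball x0 r \<times> ball y0 r)"
    proof (rule inj_onI)
      fix w w' assume w: "w \<in> ball x0 r \<times> ball y0 r" "w' \<in> ball x0 r \<times> ball y0 r" "(F w, snd w) = (F w', snd w')"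
      obtain x y x' where [simp]: "w = (x, y)" "w' = (x', y)" using w(3) by (cases w, cases w') simp
      show "w = w'" using inj[of x x' y] w by simp
    qed
    show "ball x0 r \<times> ball y0 r \<subseteq> W"
      using Sigma_mono[OF ball_subset_cball[of x0 r], of "\<lambda>_. ball y0 r" "\<lambda>_. cball y0 r"] r(2) ball_subset_cball[of y0 r] by blast
    show "z \<in> ball x0 r \<times> ball y0 r" unfolding z using r(1) by simp
    show "open (ball x0 r \<times> ball y0 r)" by (intro open_Times open_ball)
  qed
qed

lemma henon_proj: "fst (henon p a z) = poly p (fst z) - a * snd z" "snd (henon p a z) = fst z"
  by (simp_all add: henon_def)

text \<open>For a = 0 the N-th iterate maps the compact bidisc L x {|y| <= \<alpha>} into its
  interior; the tube lemma keeps this for all small a. The remaining times are covered by N compact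
  images.\<close>

lemma (in escape_data) trap_perturb:
  assumes L: "compact L" "L \<subseteq> K" "N \<ge> 1" "iter N ` L \<subseteq> interior L"
  obtains \<epsilon> where "\<epsilon> > 0" "\<And>a z. norm a < \<epsilon> \<Longrightarrow> fst z \<in> L \<Longrightarrow> norm (snd z) \<le> \<alpha> \<Longrightarrow> z \<in> K_plus p a"
proof -
  have cont: "continuous_on UNIV (\<lambda>(a, z). (henon p a ^^ n) z)" for n
  proof (induction n)
    case (Suc n)
    define g where "g = (\<lambda>(a, z). (henon p a ^^ n) z)"
    have g: "continuous_on UNIV g" using Suc by (simp add: g_def)
    have "continuous_on UNIV (\<lambda>w. (poly p (fst (g w)) - fst w * snd (g w), fst (g w)))"
      by (intro continuous_intros g continuous_on_fst[OF g] continuous_on_snd[OF g])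
    also have "(\<lambda>w. (poly p (fst (g w)) - fst w * snd (g w), fst (g w))) = (\<lambda>(a, z). (henon p a ^^ Suc n) z)"
      by (rule ext) (simp add: g_def case_prod_unfold prod_eq_iff henon_proj)
    finally show ?case .
  qed (simp add: case_prod_unfold continuous_on_snd)
  define C :: "(complex \<times> complex) set" where "C = L \<times> cball 0 \<alpha>"
  have cC: "compact C" unfolding C_def by (intro compact_Times L compact_cball)
  \<comment> \<open>At a = 0 the initial y is forgotten after one step, and the new second
    coordinate is an earlier point of an orbit in K, hence of modulus below \<alpha>. This is where
    N >= 1 matters.\<close>
  have it0: "(henon p 0 ^^ n) (x, y) = (iter n x, if n = 0 then y else iter (n - 1) x)" for n x y
    by (induction n) (simp_all add: prod_eq_iff henon_proj)
  define Ob where "Ob = (\<lambda>(a, z). (henon p a ^^ N) z) -` (interior L \<times> ball 0 \<alpha>)"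
  have oOb: "open Ob" unfolding Ob_def by (intro open_vimage[OF _ cont] open_Times open_interior open_ball)
  have COb: "{0} \<times> C \<subseteq> Ob"
  proof clarify
    fix x y assume "(x, y) \<in> C"
    then have x: "x \<in> L" by (simp add: C_def)
    have "iter N x \<in> interior L" by (rule subsetD[OF L(4) imageI[OF x]])
    moreover have "norm (iter (N - 1) x) < \<alpha>" by (rule K_iter_less[OF subsetD[OF L(2) x]])
    ultimately show "(0, x, y) \<in> Ob" using L(3) by (simp add: Ob_def it0)
  qed
  obtain X where X: "0 \<in> X" "open X" "X \<times> C \<subseteq> Ob" using Elementary_Topology.tube_lemma[OF cC oOb COb] by blast
  then obtain \<epsilon> where "\<epsilon> > 0" "ball 0 \<epsilon> \<subseteq> X" using open_contains_ball[of X] by blast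
  then have \<epsilon>: "\<epsilon> > 0" "\<And>a z. norm a < \<epsilon> \<Longrightarrow> z \<in> C \<Longrightarrow> (a, z) \<in> Ob" using X(3) by (auto simp: subset_iff)
  show ?thesis
  proof (rule that[OF \<epsilon>(1)])
    fix a :: complex and z :: "complex \<times> complex" assume a: "norm a < \<epsilon>" and z: "fst z \<in> L" "norm (snd z) \<le> \<alpha>"
    have step: "(henon p a ^^ N) w \<in> C" if "w \<in> C" for w
    proof -
      have "(henon p a ^^ N) w \<in> interior L \<times> ball 0 \<alpha>" using \<epsilon>(2)[OF a that] by (simp add: Ob_def)
      then show ?thesis using interior_subset[of L] by (auto simp: C_def)
    qed
    have stepk: "(henon p a ^^ (N * k)) z \<in> C" for k
    proof (induction k)
      case 0 then show ?case using z by (cases z) (auto simp: C_def)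
    next
      case (Suc k) then show ?case using step by (simp add: funpow_add)
    qed
    have "compact (\<Union>j<N. (henon p a ^^ j) ` C)"
    proof (intro compact_UN compact_continuous_image cC finite_lessThan)
      show "continuous_on C (henon p a ^^ j)" for j
        using continuous_on_compose2[OF cont[of j], of C "\<lambda>w. (a, w)"] by (simp add: continuous_on_Pair)
    qed
    moreover have "range (\<lambda>n. (henon p a ^^ n) z) \<subseteq> (\<Union>j<N. (henon p a ^^ j) ` C)"
    proof
      fix w assume "w \<in> range (\<lambda>n. (henon p a ^^ n) z)"
      then obtain n where w: "w = (henon p a ^^ n) z" by blast
      have "(henon p a ^^ (n mod N + N * (n div N))) z = (henon p a ^^ (n mod N)) ((henon p a ^^ (N * (n div N))) z)"
        by (simp only: funpow_add comp_apply)
      then have "w = (henon p a ^^ (n mod N)) ((henon p a ^^ (N * (n div N))) z)"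
        unfolding w by (simp only: mod_mult_div_eq)
      moreover have "n mod N < N" using L(3) by simp
      ultimately show "w \<in> (\<Union>j<N. (henon p a ^^ j) ` C)" using stepk[of "n div N"] by blast
    qed
    ultimately have "bounded (range (\<lambda>n. (henon p a ^^ n) z))" by (rule bounded_subset[OF compact_imp_bounded])
    then show "z \<in> K_plus p a" unfolding K_plus_def by simp
  qed
qed

lemma norm_exp_minus_1_le: "norm (t::complex) \<le> 1 / 2 \<Longrightarrow> norm (exp t - 1) \<le> 2 * norm t"
proof -
  assume t: "norm t \<le> 1 / 2"
  have "norm (exp t - exp 0) \<le> 2 * norm (t - 0)"
  proof (rule field_differentiable_bound[of "cball 0 (1/2)" exp exp])
    show "(exp has_field_derivative exp z) (at z within cball 0 (1/2))" for z :: complex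
      by (rule has_field_derivative_at_within[OF DERIV_exp])
    show "norm (exp z) \<le> 2" if "z \<in> cball 0 (1/2)" for z :: complex
      using exp_bound_half[of z] that by (simp del: norm_exp_eq_Re)
  qed (use t in auto)
  then show ?thesis by simp
qed

context henon_data
begin

lemma phi_plus_d12:
  assumes x: "2 * \<alpha> \<le> norm x" "norm y \<le> norm x / 4" "x \<noteq> 0"
  shows "d1 (phi_plus p a) (x, y) = exp (Splus (x, y)) * (1 + x * d1 Splus (x, y))"
    and "d2 (phi_plus p a) (x, y) = exp (Splus (x, y)) * (x * d2 Splus (x, y))"
    and "norm (x * d1 Splus (x, y)) \<le> 6 * C0 / norm x" "norm (x * d2 Splus (x, y)) \<le> 6 * C0 / norm x"
proof -
  have z: "(x, y) \<in> Vp" using x alpha_pos by (auto simp: V_plus_def)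
  have ph: "phi_plus p a = (\<lambda>z. fst z * exp (Splus z))" by (rule ext) (rule phi_plus_eq)
  note D = d12_mult[OF hol2_fst hol2_exp[OF Splus_hol] z] d12_compose1[OF DERIV_exp Splus_hol z]
  show "d1 (phi_plus p a) (x, y) = exp (Splus (x, y)) * (1 + x * d1 Splus (x, y))"
    "d2 (phi_plus p a) (x, y) = exp (Splus (x, y)) * (x * d2 Splus (x, y))"
    unfolding ph D d12_proj by (simp_all add: algebra_simps)
  note B = series_derivative_bounds[OF Splus_hol Splus_bound x(1,2)]
  have "norm (x * d1 Splus (x, y)) \<le> norm x * (6 * C0 / norm x ^ 2)"
    unfolding norm_mult by (rule mult_left_mono[OF B(1) norm_ge_zero])
  also have e: "norm x * (6 * C0 / norm x ^ 2) = 6 * C0 / norm x" using x(3) by (simp add: power2_eq_square)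
  finally show "norm (x * d1 Splus (x, y)) \<le> 6 * C0 / norm x" .
  have "norm (x * d2 Splus (x, y)) \<le> norm x * (6 * C0 / norm x ^ 2)"
    unfolding norm_mult by (rule mult_left_mono[OF B(2) norm_ge_zero])
  then show "norm (x * d2 Splus (x, y)) \<le> 6 * C0 / norm x" unfolding e .
qed

text \<open>Large enough that a disc of radius 4 C0 about a point beyond T1 stays beyond T1/2, where
  phi_+ is close to x together with its derivative.\<close>

definition T1 :: real where "T1 = 8 * \<alpha> + 64 * C0 + 8"

lemma T1_props: "T1 > 0" "T1 \<ge> 8 * \<alpha>" "T1 \<ge> 64 * C0" "T1 \<ge> 8"
  unfolding T1_def using alpha_pos C0_nonneg by linarith+

text \<open>h = phi_+ - x is bounded by 2 C0, so points with equal values are at most 4 C0 apart; on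
  that disc |h'| <= 1/2, which forces them to coincide.\<close>

lemma phi_plus_inj_infinity:
  assumes x: "norm x > T1" "norm x' > T1" and y: "norm y < \<alpha>" and eq: "phi_plus p a (x, y) = phi_plus p a (x', y)"
  shows "x = x'"
proof -
  define h where "h = (\<lambda>t. phi_plus p a (t, y) - t)"
  have big: "norm (h t) \<le> 2 * C0" "norm (d1 (phi_plus p a) (t, y) - 1) \<le> 1 / 2" "(t, y) \<in> Vp" if t: "norm t \<ge> T1 / 2" for t
  proof -
    have "norm t > 0" using t T1_props(1) by linarith
    then have t0: "norm t > 0" "t \<noteq> 0" by simp_all
    have ta: "norm t \<ge> 4 * \<alpha>" "norm t \<ge> 32 * C0" using t T1_props(2,3) by linarith+
    have "norm y < norm t" "\<alpha> < norm t" using ta(1) y alpha_pos by linarith+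
    then show tV: "(t, y) \<in> Vp" unfolding V_plus_def by blast
    have S: "norm (Splus (t, y)) \<le> C0 / norm t" using Splus_bound[OF tV] unfolding fst_conv .
    have c: "C0 / norm t \<le> 1 / 32" using t0 ta(2) by (simp add: pos_divide_le_eq)
    have e1: "norm (exp (Splus (t, y)) - 1) \<le> 2 * (C0 / norm t)"
      using norm_exp_minus_1_le[of "Splus (t, y)"] S c by linarith
    have "norm (h t) = norm t * norm (exp (Splus (t, y)) - 1)"
      unfolding h_def phi_plus_eq norm_mult[symmetric] by (simp add: algebra_simps)
    also have "\<dots> \<le> norm t * (2 * (C0 / norm t))" using e1 by (rule mult_left_mono) simp
    finally show "norm (h t) \<le> 2 * C0" using t0 by simp
    define E where "E = exp (Splus (t, y))"
    define D where "D = t * d1 Splus (t, y)"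
    have d: "d1 (phi_plus p a) (t, y) = E * (1 + D)" "norm D \<le> 6 * C0 / norm t"
    proof -
      have "2 * \<alpha> \<le> norm t" "norm y \<le> norm t / 4" using ta(1) y alpha_pos by linarith+
      then show "d1 (phi_plus p a) (t, y) = E * (1 + D)" "norm D \<le> 6 * C0 / norm t"
        unfolding E_def D_def using phi_plus_d12(1,3)[of t y] t0(2) by blast+
    qed
    have nE: "norm E \<le> 2" using norm_triangle_ineq2[of E 1] e1[folded E_def] c norm_one[where 'a = complex] by linarith
    have eqE: "E * (1 + D) - 1 = (E - 1) + E * D" by (simp add: algebra_simps)
    have "norm (E * (1 + D) - 1) \<le> norm (E - 1) + norm E * norm D"
      unfolding eqE norm_mult[symmetric] by (rule norm_triangle_ineq)
    also have "\<dots> \<le> 2 * (C0 / norm t) + 2 * (6 * C0 / norm t)"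
      using e1 by (intro add_mono mult_mono nE d(2)) (simp_all add: E_def[symmetric])
    also have "\<dots> = 14 * (C0 / norm t)" by simp
    also have "\<dots> \<le> 1 / 2" using c by linarith
    finally show "norm (d1 (phi_plus p a) (t, y) - 1) \<le> 1 / 2" unfolding d .
  qed
  have hx: "norm (h x) \<le> 2 * C0" "norm (h x') \<le> 2 * C0" using big(1)[of x] big(1)[of x'] x T1_props(1) by linarith+
  have xx: "x - x' = h x' - h x" using eq by (simp add: h_def)
  have "norm (x - x') \<le> 4 * C0" unfolding xx using norm_triangle_ineq4[of "h x'" "h x"] hx by linarith
  then have x'b: "x' \<in> cball x (4 * C0)" by (simp add: dist_norm)
  have "norm (h x' - h x) \<le> 1 / 2 * norm (x' - x)"
  proof (rule field_differentiable_bound[of "cball x (4 * C0)" h "\<lambda>t. d1 (phi_plus p a) (t, y) - 1"])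
    have tb: "norm t \<ge> T1 / 2" if "t \<in> cball x (4 * C0)" for t
    proof -
      have "norm (x - t) \<le> 4 * C0" using that by (simp add: dist_norm)
      then show ?thesis using x(1) T1_props(1,3) norm_triangle_ineq2[of x t] by linarith
    qed
    show "norm (d1 (phi_plus p a) (t, y) - 1) \<le> 1 / 2" if "t \<in> cball x (4 * C0)" for t
      by (rule big(2)[OF tb[OF that]])
    fix t assume t: "t \<in> cball x (4 * C0)"
    have "(h has_field_derivative d1 (phi_plus p a) (t, y) - 1) (at t)"
      unfolding h_def by (auto intro!: derivative_eq_intros hol2_d1[OF phi_plus_hol big(3)[OF tb[OF t]]])
    then show "(h has_field_derivative d1 (phi_plus p a) (t, y) - 1) (at t within cball x (4 * C0))"
      by (rule has_field_derivative_at_within)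
  qed (use x'b C0_nonneg in auto)
  then have "norm (x - x') \<le> 1 / 2 * norm (x - x')" unfolding xx[symmetric] by (simp add: norm_minus_commute)
  then show "x = x'" by simp
qed

text \<open>A single-valued substitute for the d^n-th power of phi_+ on the n-th preimage of
  V_+.\<close>

definition F :: "nat \<Rightarrow> complex \<times> complex \<Rightarrow> complex" where "F n z = phi_plus p a ((f ^^ n) z)"

lemma F_hol: "hol2_on (F n) ((f ^^ n) -` Vp)"
proof -
  have "hol2_on (\<lambda>z. phi_plus p a (fst ((f ^^ n) z), snd ((f ^^ n) z))) ((f ^^ n) -` Vp)"
    by (rule hol2_compose2[OF phi_plus_hol hol2_on_subset[OF f_hol(1) subset_UNIV] hol2_on_subset[OF f_hol(2) subset_UNIV]]) simp
  then show ?thesis by (simp add: F_def[abs_def])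
qed

lemma open_fVp: "open ((f ^^ n) -` Vp)" by (rule open_vimage[OF open_V_plus f_cont])

lemma F_nz: "(f ^^ n) z \<in> Vp \<Longrightarrow> F n z \<noteq> 0" by (simp add: F_def phi_plus_nz)

lemma F_add: "(f ^^ n) z \<in> Vp \<Longrightarrow> F (k + n) z = F n z ^ (d ^ k)"
  using phi_plus_iter[of "(f ^^ n) z" k] by (simp add: F_def funpow_add)

lemma F_Suc: "F (Suc n) z = F n (fst (f z), snd (f z))" by (simp add: F_def funpow_swap1)

lemma phi_plus_bounds:
  assumes "z \<in> Vp"
  shows "norm (phi_plus p a z) \<le> norm (fst z) * exp (C0 / \<alpha>)" "norm (fst z) * exp (- (C0 / \<alpha>)) \<le> norm (phi_plus p a z)"
proof -
  have "norm (fst z) > \<alpha>" using assms by (auto simp: V_plus_def)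
  moreover have "0 < norm (fst z) * \<alpha>" using calculation alpha_pos by (intro mult_pos_pos) linarith+
  ultimately have "C0 / norm (fst z) \<le> C0 / \<alpha>" using C0_nonneg by (intro divide_left_mono) linarith+
  then have "\<bar>Re (Splus z)\<bar> \<le> C0 / \<alpha>" using Splus_bound[OF assms] abs_Re_le_cmod[of "Splus z"] by linarith
  then have R: "Re (Splus z) \<le> C0 / \<alpha>" "- (C0 / \<alpha>) \<le> Re (Splus z)" by auto
  have n: "norm (phi_plus p a z) = norm (fst z) * exp (Re (Splus z))" by (simp add: phi_plus_eq norm_mult)
  show "norm (phi_plus p a z) \<le> norm (fst z) * exp (C0 / \<alpha>)" "norm (fst z) * exp (- (C0 / \<alpha>)) \<le> norm (phi_plus p a z)"

    unfolding n by (intro mult_left_mono; use R in simp)+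
qed

text \<open>Besides size, the cone estimate needs |y| <= |x|/4. One step from a large x gives it,
  since the new first coordinate is at least (1 - r)|x|^d and the new second one is x.\<close>

lemma reach_far:
  assumes "z \<in> Up"
  obtains k where "k \<ge> n" "(f ^^ k) z \<in> Vp" "norm (fst ((f ^^ k) z)) > B" "norm (snd ((f ^^ k) z)) \<le> norm (fst ((f ^^ k) z)) / 4"
proof -
  obtain m0 where m0: "(f ^^ m0) z \<in> Vp" using assms Up_iff by blast
  then have "(f ^^ (max m0 n)) z \<in> Vp" using f_Vp_mono by (metis max.cobounded1)
  \<comment> \<open>|x| > 4/(1 - r) makes (1 - r)|x|^2 at least 4|x|; |x| > 1 allows the exponent d
    to be lowered to 2.\<close>
  then obtain m where m: "m \<ge> max m0 n" "norm (fst ((f ^^ m) z)) > max (max B 1) (4 / (1 - r))"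
    using Vp_unbounded by blast
  define x where "x = fst ((f ^^ m) z)"
  have mV: "(f ^^ m) z \<in> Vp" using f_Vp_mono[OF m0] m(1) by simp
  have xb: "norm x > B" "norm x > 1" "norm x > 4 / (1 - r)" using m(2) by (auto simp: x_def)
  have xa: "norm x \<ge> \<alpha>" "norm (snd ((f ^^ m) z)) \<le> norm x" using mV by (auto simp: V_plus_def x_def)
  define x1 where "x1 = fst ((f ^^ Suc m) z)"
  have x1: "x1 = poly p x - a * snd ((f ^^ m) z)" by (simp add: x1_def x_def f_simps)
  have "norm (x1 / x ^ d - 1) < r" using quot_bounds(1)[OF xa a_le'] by (simp add: x1)
  then have "norm (x1 / x ^ d) \<ge> 1 - r" using norm_triangle_ineq2[of 1 "1 - x1 / x ^ d"] by (simp add: norm_minus_commute)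
  then have "1 - r \<le> norm x1 / norm x ^ d" unfolding norm_divide norm_power .
  moreover have "0 < norm x ^ d" using xb(2) by (intro zero_less_power) linarith
  ultimately have "norm x1 \<ge> (1 - r) * norm x ^ d" by (simp add: pos_le_divide_eq)
  moreover have "norm x ^ d \<ge> norm x ^ 2" using xb d2 by (intro power_increasing) auto
  moreover have "(1 - r) * norm x ^ 2 \<ge> 4 * norm x"
  proof -
    have "(1 - r) * norm x \<ge> 4" using xb(3) r_less_1 by (simp add: field_simps)
    then have "(1 - r) * norm x * norm x \<ge> 4 * norm x" by (rule mult_right_mono) simp
    then show ?thesis by (simp add: power2_eq_square mult.assoc)
  qed
  moreover have "(1 - r) * norm x ^ d \<ge> (1 - r) * norm x ^ 2" using r_less_1 calculation(2) by (intro mult_left_mono) auto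
  ultimately have g: "norm x1 \<ge> 4 * norm x" by linarith
  show ?thesis
  proof (rule that[of "Suc m"])
    show "(f ^^ Suc m) z \<in> Vp" using f_Vp(1)[OF mV] by simp
    show "norm (fst ((f ^^ Suc m) z)) > B" using g xb(1) norm_ge_zero[of x] unfolding x1_def[symmetric] by linarith
    show "norm (snd ((f ^^ Suc m) z)) \<le> norm (fst ((f ^^ Suc m) z)) / 4"
      using g unfolding x1_def[symmetric] by (simp add: x_def f_simps)
  qed (use m in auto)
qed

end

text \<open>The bound |a| <= m^2/4 is what keeps the cone of slope m/2 invariant: pulling back
  replaces the slope by at most |a|/(m/2).\<close>

locale henon_trap = henon_data +
  fixes L :: "complex set" and m :: real
  assumes L_K: "L \<subseteq> K" and trap: "\<And>z. fst z \<in> L \<Longrightarrow> norm (snd z) \<le> \<alpha> \<Longrightarrow> z \<in> K_plus p a"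
    and m_pos: "m > 0" and deriv_ge: "\<And>x. x \<notin> L \<Longrightarrow> m \<le> norm (poly (pderiv p) x)"
    and a_small: "norm a \<le> m\<^sup>2 / 4"
begin

section \<open>The invariant cone field and coverings of the strip\<close>

lemma f_iter_Suc: "(f ^^ Suc n) z = f ((f ^^ n) z)" by simp

text \<open>The next second coordinate is the present first one, so an orbit can leave the bidisc of
  radius \<alpha> only into V_+.\<close>

lemma strip_cases:
  assumes "norm (snd z) \<le> \<alpha>"
  shows "(f ^^ n) z \<in> Vp \<or> norm (fst ((f ^^ n) z)) \<le> \<alpha> \<and> norm (snd ((f ^^ n) z)) \<le> \<alpha>"
proof (induction n)
  case 0
  show ?case using assms by (cases z) (auto simp: V_plus_def)
next
  case (Suc n)
  show ?case
  proof (cases "(f ^^ n) z \<in> Vp")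
    case True
    then show ?thesis using f_Vp(1) unfolding f_iter_Suc by blast
  next
    case False
    then have "norm (snd ((f ^^ Suc n) z)) \<le> \<alpha>" using Suc unfolding f_iter_Suc f_simps by blast
    then show ?thesis by (cases "(f ^^ Suc n) z") (auto simp: V_plus_def)
  qed
qed

lemma strip_Vp: "norm (snd z) \<le> \<alpha> \<Longrightarrow> norm (fst ((f ^^ n) z)) > \<alpha> \<Longrightarrow> (f ^^ n) z \<in> Vp"
  using strip_cases[of z n] by linarith

text \<open>An orbit point over L still lies in the bidisc, since L sits inside |x| < \<alpha>.
  There the trap makes its forward orbit bounded, against escape.\<close>

lemma not_L:
  assumes z: "z \<in> Up" "norm (snd z) \<le> \<alpha>"
  shows "fst ((f ^^ n) z) \<notin> L"
proof
  assume xL: "fst ((f ^^ n) z) \<in> L"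
  then have "norm (fst ((f ^^ n) z)) < \<alpha>" using L_K K_less by blast
  then have "(f ^^ n) z \<notin> Vp" by (auto simp: V_plus_def)
  then have "norm (snd ((f ^^ n) z)) \<le> \<alpha>" using strip_cases[OF z(2)] by blast
  then have "(f ^^ n) z \<in> K_plus p a" using trap xL by blast
  moreover have "(f ^^ n) z \<in> Up"
  proof -
    obtain k where "(f ^^ k) z \<in> Vp" using z(1) Up_iff by blast
    then have "(f ^^ (n + k)) z \<in> Vp" by (rule f_Vp_add)
    then have "(f ^^ k) ((f ^^ n) z) \<in> Vp" by (metis add.commute comp_apply funpow_add)
    then show ?thesis using Up_iff by blast
  qed
  ultimately show False by (simp add: U_plus_def)
qed

text \<open>Beyond B0 the derivative formula for phi_+ applies (2\<alpha>), 1 + x d1 Splus has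
  modulus at least 1/2 (12 C0), and x d2 Splus is at most m/4 (24 C0/m).\<close>

definition B0 :: real where "B0 = 2 * \<alpha> + 12 * C0 + 24 * C0 / m"

lemma cone_base:
  assumes x: "norm x > B0" "norm y \<le> norm x / 4"
  shows "d1 (phi_plus p a) (x, y) \<noteq> 0" "norm (d2 (phi_plus p a) (x, y)) \<le> m / 2 * norm (d1 (phi_plus p a) (x, y))"
proof -
  have "24 * C0 / m \<ge> 0" using C0_nonneg m_pos by simp
  then have b: "norm x > 2 * \<alpha>" "norm x > 12 * C0" "norm x > 24 * C0 / m"
    using x(1) C0_nonneg alpha_pos unfolding B0_def by linarith+
  have x0: "norm x > 0" using b(1) alpha_pos by linarith
  have x0': "x \<noteq> 0" using x0 by simp
  define E where "E = exp (Splus (x, y))"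
  define P where "P = x * d1 Splus (x, y)"
  define Q where "Q = x * d2 Splus (x, y)"
  have D: "d1 (phi_plus p a) (x, y) = E * (1 + P)" "d2 (phi_plus p a) (x, y) = E * Q"
    and PQ: "norm P \<le> 6 * C0 / norm x" "norm Q \<le> 6 * C0 / norm x"
    unfolding E_def P_def Q_def using phi_plus_d12[OF _ x(2) x0'] b(1) by auto
  have "6 * C0 / norm x \<le> 1 / 2" using b(2) x0 by (simp add: pos_divide_le_eq)
  then have P2: "norm P \<le> 1 / 2" using PQ(1) by linarith
  have "6 * C0 / norm x \<le> m / 4" using b(3) x0 m_pos by (simp add: pos_divide_le_eq pos_divide_less_eq mult.commute)
  then have Q2: "norm Q \<le> m / 4" using PQ(2) by linarith
  have n1: "norm (1 + P) \<ge> 1 / 2" by (rule one_plus_nz(1)[OF P2])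
  have E0: "E \<noteq> 0" by (simp add: E_def)
  have "1 + P \<noteq> 0" using n1 by auto
  then show "d1 (phi_plus p a) (x, y) \<noteq> 0" unfolding D using E0 by simp
  have "norm Q \<le> m / 2 * norm (1 + P)"
  proof -
    have "m / 2 * (1 / 2) \<le> m / 2 * norm (1 + P)" using n1 m_pos by (intro mult_left_mono) auto
    then show ?thesis using Q2 by linarith
  qed
  then have "norm E * norm Q \<le> norm E * (m / 2 * norm (1 + P))" by (rule mult_left_mono) simp
  then show "norm (d2 (phi_plus p a) (x, y)) \<le> m / 2 * norm (d1 (phi_plus p a) (x, y))"
    unfolding D norm_mult by (simp add: mult.left_commute)
qed

lemma d12_f: "d1 (\<lambda>z. fst (f z)) z = poly (pderiv p) (fst z)" "d2 (\<lambda>z. fst (f z)) z = - a"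
  "d1 (\<lambda>z. snd (f z)) z = 1" "d2 (\<lambda>z. snd (f z)) z = 0"
proof -
  have e: "(\<lambda>z. fst (f z)) = (\<lambda>z. poly p (fst z) - a * snd z)" "(\<lambda>z. snd (f z)) = fst"
    using f_simps by (auto simp: fun_eq_iff)
  obtain x y where z: "z = (x, y)" by (cases z)
  show "d1 (\<lambda>z. fst (f z)) z = poly (pderiv p) (fst z)"
    unfolding e z by (rule d1_eqI) (auto intro!: derivative_eq_intros)
  show "d2 (\<lambda>z. fst (f z)) z = - a"
    unfolding e z by (rule d2_eqI) (auto intro!: derivative_eq_intros)
  show "d1 (\<lambda>z. snd (f z)) z = 1" "d2 (\<lambda>z. snd (f z)) z = 0" unfolding e by (rule d12_proj)+
qed

lemma d12_F_Suc:
  assumes "(f ^^ Suc n) z \<in> Vp"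
  shows "d1 (F (Suc n)) z = d1 (F n) (f z) * poly (pderiv p) (fst z) + d2 (F n) (f z)"
    and "d2 (F (Suc n)) z = - a * d1 (F n) (f z)"
proof -
  have e: "F (Suc n) = (\<lambda>z. F n (fst (f z), snd (f z)))" by (rule ext) (rule F_Suc)
  have h: "hol2_on (\<lambda>z. fst (f z)) UNIV" "hol2_on (\<lambda>z. snd (f z)) UNIV" using f_hol[of 1] by simp_all
  have "(f ^^ n) (f z) \<in> Vp" using assms by (simp add: funpow_swap1)
  then have i: "(fst (f z), snd (f z)) \<in> (f ^^ n) -` Vp" by simp
  show "d1 (F (Suc n)) z = d1 (F n) (f z) * poly (pderiv p) (fst z) + d2 (F n) (f z)"
    "d2 (F (Suc n)) z = - a * d1 (F n) (f z)"
    unfolding e d12_compose2[OF F_hol h UNIV_I i] d12_f by simp_all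
qed

text \<open>Pulling back by \<^term>\<open>f\<close> contracts the cone of almost vertical directions as long as the
  orbit avoids the critical points.\<close>

lemma cone_step:
  fixes A B P :: complex
  assumes "A \<noteq> 0" "norm B \<le> m / 2 * norm A" "m \<le> norm P"
  shows "A * P + B \<noteq> 0" "norm (- a * A) * (norm P - m / 2) \<le> norm a * norm (A * P + B)"
    "norm (- a * A) \<le> m / 2 * norm (A * P + B)"
proof -
  have A: "norm A > 0" using assms(1) by simp
  have *: "norm A * (norm P - m / 2) \<le> norm (A * P + B)"
  proof -
    have "norm (A * P) - norm B \<le> norm (A * P + B)" using norm_triangle_ineq2[of "A * P" "- B"] by simp
    then show ?thesis using assms(2) by (simp add: norm_mult right_diff_distrib mult.commute)
  qed
  have pm: "norm P - m / 2 \<ge> m / 2" using assms(3) by simp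
  then have am: "norm A * (m / 2) \<le> norm A * (norm P - m / 2)" by (rule mult_left_mono) simp
  have "0 < norm A * (m / 2)" using A m_pos by simp
  then have "0 < norm (A * P + B)" using * am by linarith
  then show "A * P + B \<noteq> 0" by auto
  have "norm a * (norm A * (norm P - m / 2)) \<le> norm a * norm (A * P + B)" using * by (rule mult_left_mono) simp
  then show "norm (- a * A) * (norm P - m / 2) \<le> norm a * norm (A * P + B)" by (simp add: norm_mult mult.assoc)
  have "norm a * norm A \<le> m\<^sup>2 / 4 * norm A" using a_small by (rule mult_right_mono) simp
  also have "\<dots> = m / 2 * (norm A * (m / 2))" by (simp add: power2_eq_square)
  also have "\<dots> \<le> m / 2 * norm (A * P + B)" using * am m_pos by (intro mult_left_mono) linarith+
  finally show "norm (- a * A) \<le> m / 2 * norm (A * P + B)" by (simp add: norm_mult)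
qed

lemma cone_pullback:
  assumes "\<And>k. k < n \<Longrightarrow> fst ((f ^^ k) z) \<notin> L" "(f ^^ n) z \<in> Vp" "norm (fst ((f ^^ n) z)) > B0"
    "norm (snd ((f ^^ n) z)) \<le> norm (fst ((f ^^ n) z)) / 4"
  shows "d1 (F n) z \<noteq> 0 \<and> norm (d2 (F n) z) \<le> m / 2 * norm (d1 (F n) z)"
  using assms
proof (induction n arbitrary: z)
  case 0
  have "F 0 = phi_plus p a" by (rule ext) (simp add: F_def)
  then show ?case using cone_base[of "fst z" "snd z"] 0 by simp
next
  case (Suc n)
  have sw: "(f ^^ k) (f z) = (f ^^ Suc k) z" for k by (simp add: funpow_swap1)
  have "d1 (F n) (f z) \<noteq> 0 \<and> norm (d2 (F n) (f z)) \<le> m / 2 * norm (d1 (F n) (f z))"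
  proof (rule Suc.IH)
    show "fst ((f ^^ k) (f z)) \<notin> L" if "k < n" for k unfolding sw using Suc.prems(1)[of "Suc k"] that by simp
  qed (use Suc.prems(2-4) in \<open>simp_all only: sw\<close>)
  moreover have "m \<le> norm (poly (pderiv p) (fst z))" using Suc.prems(1)[of 0] deriv_ge by simp
  ultimately show ?case unfolding d12_F_Suc[OF Suc.prems(2)] using cone_step by blast
qed

text \<open>The cone is checked at a late time k and pulled back; the last step is kept in sharp
  form, which yields the factor |a|. Passing from F k to F n is free, because their differentials
  are proportional.\<close>

lemma cone:
  assumes z: "z \<in> Up" "norm (snd z) \<le> \<alpha>" and n: "(f ^^ n) z \<in> Vp"
  shows "d1 (F n) z \<noteq> 0"
    and "norm (d2 (F n) z) * (norm (poly (pderiv p) (fst z)) - m / 2) \<le> norm a * norm (d1 (F n) z)"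
proof -
  obtain k where k: "k \<ge> Suc n" "(f ^^ k) z \<in> Vp" "norm (fst ((f ^^ k) z)) > B0"
      "norm (snd ((f ^^ k) z)) \<le> norm (fst ((f ^^ k) z)) / 4"
    using reach_far[OF z(1)] by metis
  obtain j where j: "k = Suc j" using k(1) by (cases k) auto
  have sw: "(f ^^ i) (f z) = (f ^^ Suc i) z" for i by (simp add: funpow_swap1)
  have "d1 (F j) (f z) \<noteq> 0 \<and> norm (d2 (F j) (f z)) \<le> m / 2 * norm (d1 (F j) (f z))"
  proof (rule cone_pullback)
    show "fst ((f ^^ i) (f z)) \<notin> L" for i unfolding sw by (rule not_L[OF z])
  qed (use k(2-4) in \<open>simp_all only: sw j\<close>)
  moreover have "m \<le> norm (poly (pderiv p) (fst z))" using not_L[OF z, of 0] deriv_ge by simp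
  ultimately have kc: "d1 (F k) z \<noteq> 0"
      "norm (d2 (F k) z) * (norm (poly (pderiv p) (fst z)) - m / 2) \<le> norm a * norm (d1 (F k) z)"
    unfolding j using d12_F_Suc[of j z] k(2) j cone_step[of "d1 (F j) (f z)" "d2 (F j) (f z)" "poly (pderiv p) (fst z)"] by simp_all
  \<comment> \<open>F k is the N-th power of F n, so both have the same leaves and c is the
    proportionality factor of the differentials.\<close>
  define N where "N = d ^ (k - n)"
  have N: "N \<ge> 1" unfolding N_def using d2 by (intro one_le_power) auto
  define c where "c = of_nat N * F k z / F n z"
  have eq: "F n w ^ N = F k w" if "w \<in> (f ^^ n) -` Vp" for w
    using F_add[of n w "k - n"] that k(1) by (simp add: N_def)
  have nz: "F k z \<noteq> 0" "F n z \<noteq> 0" using F_nz k(2) n by auto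
  have zi: "z \<in> (f ^^ n) -` Vp" using n by simp
  have "d1 (F k) z = c * d1 (F n) z" "d2 (F k) z = c * d2 (F n) z"
    using dlog_power[OF F_hol open_fVp zi eq N nz(1)] by (simp_all add: c_def)
  moreover have "c \<noteq> 0" using nz N by (simp add: c_def)
  ultimately show "d1 (F n) z \<noteq> 0"
    "norm (d2 (F n) z) * (norm (poly (pderiv p) (fst z)) - m / 2) \<le> norm a * norm (d1 (F n) z)"
  proof -
    assume A: "d1 (F k) z = c * d1 (F n) z" "d2 (F k) z = c * d2 (F n) z" "c \<noteq> 0"
    show "d1 (F n) z \<noteq> 0" using kc(1) A(1) by auto
    have X: "norm c * (norm (d2 (F n) z) * (norm (poly (pderiv p) (fst z)) - m / 2)) \<le> norm c * (norm a * norm (d1 (F n) z))"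
      using kc(2) unfolding A(1,2) norm_mult by (simp only: mult.assoc mult.left_commute)
    show "norm (d2 (F n) z) * (norm (poly (pderiv p) (fst z)) - m / 2) \<le> norm a * norm (d1 (F n) z)"
      by (rule mult_left_le_imp_le[OF X]) (use A(3) in simp)
  qed
qed

text \<open>|F n| > MM forces |x_n| > 2\<alpha> + 1. This margin beyond \<alpha> is what prevents
  limits in the properness proof from slipping onto the boundary of V_+.\<close>

definition MM :: real where "MM = (2 * \<alpha> + 1) * exp (C0 / \<alpha>)"

lemma MM_gt_1: "MM > 1"
proof -
  have "1 \<le> exp (C0 / \<alpha>)" using C0_nonneg alpha_pos by simp
  then have "(2 * \<alpha> + 1) * 1 \<le> MM" unfolding MM_def using alpha_pos by (intro mult_left_mono) auto
  then have "2 * \<alpha> + 1 \<le> MM" by simp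
  then show ?thesis using alpha_pos by linarith
qed

text \<open>Increasing domains that exhaust the escaping part of the strip; on each of them (F n, y)
  is a covering.\<close>

definition W :: "nat \<Rightarrow> (complex \<times> complex) set" where
  "W n = {z. norm (snd z) < \<alpha> \<and> (f ^^ n) z \<in> Vp \<and> norm (F n z) > MM}"

definition Zs :: "(complex \<times> complex) set" where "Zs = (- cball 0 MM) \<times> ball 0 \<alpha>"

lemma open_W: "open (W n)"
proof -
  have "open (F n -` (- cball 0 MM) \<inter> (f ^^ n) -` Vp)"
    using continuous_on_open_vimage[OF open_fVp, THEN iffD1, OF hol2_imp_continuous_on[OF F_hol]] by blast
  moreover have "open {z :: complex \<times> complex. norm (snd z) < \<alpha>}" by (intro open_Collect_less continuous_intros)
  ultimately have "open ({z. norm (snd z) < \<alpha>} \<inter> (F n -` (- cball 0 MM) \<inter> (f ^^ n) -` Vp))" by (rule open_Int[rotated])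
  also have "{z. norm (snd z) < \<alpha>} \<inter> (F n -` (- cball 0 MM) \<inter> (f ^^ n) -` Vp) = W n"
    unfolding W_def by auto
  finally show ?thesis .
qed

lemma W_sub: "W n \<subseteq> (f ^^ n) -` Vp" "W n \<subseteq> Up"
  unfolding W_def using Up_iff by blast+

lemma F_W_hol: "hol2_on (F n) (W n)" by (rule hol2_on_subset[OF F_hol W_sub(1)])

lemma phi_gt_imp_fst_gt: "z \<in> Vp \<Longrightarrow> norm (phi_plus p a z) > B * exp (C0 / \<alpha>) \<Longrightarrow> norm (fst z) > B"
proof -
  assume "z \<in> Vp" "norm (phi_plus p a z) > B * exp (C0 / \<alpha>)"
  then have "B * exp (C0 / \<alpha>) < norm (fst z) * exp (C0 / \<alpha>)" using phi_plus_bounds(1)[of z] by linarith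
  then show "norm (fst z) > B" by simp
qed

lemma fst_gt_imp_phi_gt: "z \<in> Vp \<Longrightarrow> norm (fst z) > B * exp (C0 / \<alpha>) \<Longrightarrow> norm (phi_plus p a z) > B"
proof -
  assume z: "z \<in> Vp" "norm (fst z) > B * exp (C0 / \<alpha>)"
  have "B = B * exp (C0 / \<alpha>) * exp (- (C0 / \<alpha>))" by (simp add: exp_minus)
  also have "\<dots> < norm (fst z) * exp (- (C0 / \<alpha>))" using z(2) by simp
  also have "\<dots> \<le> norm (phi_plus p a z)" by (rule phi_plus_bounds(2)[OF z(1)])
  finally show ?thesis .
qed

lemma dn_ge_1: "d ^ n \<ge> 1" using d2 by (intro one_le_power) auto

lemma power_gt: "(x::real) \<ge> 1 \<Longrightarrow> x \<le> x ^ (d ^ n)"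
  using power_increasing[OF dn_ge_1[of n], of x] by simp

lemma W_mono: "n \<le> k \<Longrightarrow> W n \<subseteq> W k"
proof
  fix z assume nk: "n \<le> k" and z: "z \<in> W n"
  then have zz: "norm (snd z) < \<alpha>" "(f ^^ n) z \<in> Vp" "norm (F n z) > MM" by (auto simp: W_def)
  have "F k z = F n z ^ (d ^ (k - n))" using F_add[OF zz(2), of "k - n"] nk by simp
  then have "norm (F k z) \<ge> norm (F n z)"
    using power_gt[of "norm (F n z)" "k - n"] zz(3) MM_gt_1 by (simp add: norm_power)
  then show "z \<in> W k" using zz f_Vp_mono[OF zz(2) nk] unfolding W_def by simp
qed

lemma W_ex:
  assumes "z \<in> Up" "norm (snd z) < \<alpha>"
  obtains n where "z \<in> W n"
proof -
  obtain m0 where m0: "(f ^^ m0) z \<in> Vp" using assms(1) Up_iff by blast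
  obtain n where n: "n \<ge> m0" "norm (fst ((f ^^ n) z)) > MM * exp (C0 / \<alpha>)" using Vp_unbounded[OF m0] by blast
  have "(f ^^ n) z \<in> Vp" by (rule f_Vp_mono[OF m0 n(1)])
  then have "z \<in> W n" using fst_gt_imp_phi_gt[OF _ n(2)] assms(2) unfolding W_def F_def by simp
  then show ?thesis by (rule that)
qed

lemma Vp_W0: "z \<in> Vp \<Longrightarrow> norm (snd z) < \<alpha> \<Longrightarrow> norm (phi_plus p a z) > MM \<Longrightarrow> z \<in> W n"
  using W_mono[of 0 n] unfolding W_def F_def by auto

lemma F_W_Vp: "z \<in> Vp \<Longrightarrow> F n z = phi_plus p a z ^ (d ^ n)"
  unfolding F_def by (rule phi_plus_iter)

text \<open>Closedness rests on the margin in \<open>MM\<close>, boundedness on the growth of phi_+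
  in x.\<close>

lemma W_proper:
  assumes C: "compact C" "C \<subseteq> Zs"
  shows "compact (W n \<inter> (\<lambda>z. (F n z, snd z)) -` C)"
proof -
  define Q where "Q = W n \<inter> (\<lambda>z. (F n z, snd z)) -` C"
  have contF: "isCont (F n) z" if "z \<in> (f ^^ n) -` Vp" for z by (rule hol2_imp_isCont[OF F_hol that])
  have cs: "compact (snd ` C)" by (intro compact_continuous_image C(1) continuous_on_snd continuous_on_id)
  have sC: "snd ` C \<subseteq> ball 0 \<alpha>" using C(2) by (auto simp: Zs_def)
  have "closed Q"
    unfolding closed_sequential_limits
  proof (intro allI impI)
    fix s l assume sl: "(\<forall>i. s i \<in> Q) \<and> s \<longlonglongrightarrow> l"
    then have sQ: "s i \<in> W n" "(F n (s i), snd (s i)) \<in> C" for i by (auto simp: Q_def)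
    have lim: "s \<longlonglongrightarrow> l" using sl by simp
    have "snd l \<in> snd ` C"
    proof (rule closed_sequentially[OF compact_imp_closed[OF cs]])
      show "(\<lambda>i. snd (s i)) \<longlonglongrightarrow> snd l" by (rule tendsto_snd[OF lim])
      show "snd (s i) \<in> snd ` C" for i using imageI[OF sQ(2)[of i], of snd] by simp
    qed
    then have l2: "norm (snd l) < \<alpha>" using sC by auto
    \<comment> \<open>A closed condition, hence inherited by the limit l; it brings the n-th image
      of l back into V_+, where F n is continuous.\<close>
    have "2 * \<alpha> + 1 \<le> norm (fst ((f ^^ n) (s i)))" for i
    proof -
      have "(f ^^ n) (s i) \<in> Vp" "norm (phi_plus p a ((f ^^ n) (s i))) > (2 * \<alpha> + 1) * exp (C0 / \<alpha>)"
        using sQ(1)[of i] by (auto simp: W_def F_def MM_def)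
      from phi_gt_imp_fst_gt[OF this] show ?thesis by simp
    qed
    moreover have "(\<lambda>i. norm (fst ((f ^^ n) (s i)))) \<longlonglongrightarrow> norm (fst ((f ^^ n) l))"
      using continuous_on_eq_continuous_at[OF open_UNIV, THEN iffD1, OF f_cont[of n]]
      by (intro tendsto_norm tendsto_fst isCont_tendsto_compose[OF _ lim]) blast
    ultimately have "2 * \<alpha> + 1 \<le> norm (fst ((f ^^ n) l))" by (intro LIMSEQ_le_const) auto
    then have lV: "(f ^^ n) l \<in> Vp" using l2 alpha_pos by (intro strip_Vp) linarith+
    have "(\<lambda>i. (F n (s i), snd (s i))) \<longlonglongrightarrow> (F n l, snd l)"
      using lV by (intro tendsto_Pair tendsto_snd lim isCont_tendsto_compose[OF contF lim]) simp
    then have lC: "(F n l, snd l) \<in> C"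
      by (rule closed_sequentially[OF compact_imp_closed[OF C(1)] sQ(2)])
    then have "norm (F n l) > MM" using C(2) by (auto simp: Zs_def)
    then show "l \<in> Q" using lC lV l2 by (simp add: Q_def W_def)
  qed
  moreover have "bounded Q"
  proof -
    obtain B where B: "\<And>c. c \<in> C \<Longrightarrow> norm c \<le> B" using compact_imp_bounded[OF C(1)] unfolding bounded_iff by blast
    define b where "b = max 1 B"
    define D where "D = max \<alpha> (b * exp (C0 / \<alpha>))"
    have "norm z \<le> D + \<alpha>" if z: "z \<in> Q" for z
    proof -
      have zW: "norm (snd z) < \<alpha>" and zC: "(F n z, snd z) \<in> C" using z by (auto simp: Q_def W_def)
      \<comment> \<open>Points of the strip with large x lie in V_+ at time 0, where F n is a power
        of phi_+ and |phi_+| > 1; so |F n| >= |phi_+| would exceed the bound of C.\<close>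
      have "norm (fst z) \<le> D"
      proof (rule ccontr)
        assume "\<not> norm (fst z) \<le> D"
        then have g: "norm (fst z) > \<alpha>" "norm (fst z) > b * exp (C0 / \<alpha>)" by (auto simp: D_def)
        have zV: "z \<in> Vp" using strip_Vp[of z 0] zW g(1) by simp
        have pb: "norm (phi_plus p a z) > b" by (rule fst_gt_imp_phi_gt[OF zV g(2)])
        then have "norm (phi_plus p a z) \<le> norm (F n z)"
          unfolding F_W_Vp[OF zV] norm_power by (intro power_gt) (simp add: b_def)
        also have "norm (F n z) \<le> norm (F n z, snd z)" by (rule norm_fst_le)
        also have "\<dots> \<le> B" by (rule B[OF zC])
        finally show False using pb by (simp add: b_def)
      qed
      then show ?thesis using norm_Pair_le[of "fst z" "snd z"] zW by simp
    qed
    then show ?thesis unfolding bounded_iff by blast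
  qed
  ultimately show ?thesis by (simp add: compact_eq_bounded_closed Q_def)
qed

lemma far_point:
  assumes "B \<ge> 0"
  obtains x :: complex where "(x, 0) \<in> Vp" "norm x > B" "norm (phi_plus p a (x, 0)) > B"
proof -
  define s where "s = (B + \<alpha> + 1) * exp (C0 / \<alpha>)"
  have e1: "1 \<le> exp (C0 / \<alpha>)" using C0_nonneg alpha_pos by simp
  have s1: "B + \<alpha> + 1 \<le> s" unfolding s_def using mult_left_mono[OF e1, of "B + \<alpha> + 1"] assms alpha_pos by simp
  have ns: "norm (complex_of_real s) = s" using s1 assms alpha_pos by simp
  have V: "(complex_of_real s, 0) \<in> Vp" using s1 assms alpha_pos by (simp add: V_plus_def ns)
  have "B * exp (C0 / \<alpha>) < s" unfolding s_def using alpha_pos by (intro mult_strict_right_mono) auto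
  then have "norm (phi_plus p a (complex_of_real s, 0)) > B" using fst_gt_imp_phi_gt[OF V] by (simp add: ns)
  then show ?thesis using that[OF V] s1 alpha_pos by (simp add: ns)
qed

text \<open>The cone estimate rules out vertical degeneration: d1 F n never vanishes, so (F n, y) is
  locally injective.\<close>

lemma W_covering: "covering_space (W n) (\<lambda>z. (F n z, snd z)) Zs"
proof (rule proper_local_homeo_covering[OF open_W])
  obtain x where x: "(x, 0) \<in> Vp" "norm (phi_plus p a (x, 0)) > MM" using far_point[of MM] MM_gt_1 by auto
  then show "W n \<noteq> {}" using Vp_W0[of "(x, 0)" n] alpha_pos by auto
  show "continuous_on (W n) (\<lambda>z. (F n z, snd z))"
    by (intro continuous_on_Pair hol2_imp_continuous_on[OF F_W_hol] continuous_on_snd continuous_on_id)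
  show "(\<lambda>z. (F n z, snd z)) ` W n \<subseteq> Zs" by (auto simp: W_def Zs_def)
  show "open Zs" unfolding Zs_def by (intro open_Times open_ball) (simp add: open_Compl)
  show "connected Zs" unfolding Zs_def
    by (intro connected_Times connected_ball connected_complement_bounded_convex) auto
  show "\<exists>U. open U \<and> z \<in> U \<and> U \<subseteq> W n \<and> inj_on (\<lambda>z. (F n z, snd z)) U" if z: "z \<in> W n" for z
  proof (rule hol2_locally_injective[OF F_W_hol open_W z])
    show "d1 (F n) z \<noteq> 0" using z W_sub(2) by (intro cone(1)) (auto simp: W_def)
  qed
qed (rule W_proper)

end

section \<open>Lifting the exponential map and the single-valued continuation of phi_+\<close>

context henon_trap
begin

definition lam :: "nat \<Rightarrow> real" where "lam n = ln MM / d ^ n"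

text \<open>The variable \<zeta> plays the role of log phi_+, and F n that of exp(d^n \<zeta>); this
  half-plane is where |exp(d^n \<zeta>)| > MM.\<close>

definition HP :: "nat \<Rightarrow> complex set" where "HP n = {\<zeta>. lam n < Re \<zeta>}"

lemma lam_pos: "lam n > 0"
  unfolding lam_def using MM_gt_1 d2 by (intro divide_pos_pos) auto

lemma lam_mono: "n \<le> k \<Longrightarrow> lam k \<le> lam n"
  unfolding lam_def using MM_gt_1 d2 by (intro divide_left_mono power_increasing mult_pos_pos) auto

lemma HP_mono: "n \<le> k \<Longrightarrow> HP n \<subseteq> HP k"
  using lam_mono[of n k] by (auto simp: HP_def)

lemma HP_ex: assumes "Re \<zeta> > 0" obtains n where "\<zeta> \<in> HP n"
proof -
  obtain n where "ln MM / Re \<zeta> < real d ^ n" using real_arch_pow[of "real d"] d2 by auto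
  then have "ln MM / real d ^ n < Re \<zeta>" using assms d2 by (simp add: pos_divide_less_eq mult.commute)
  then show ?thesis by (intro that[of n]) (simp add: HP_def lam_def)
qed

lemma open_HP: "open (HP n)" unfolding HP_def by (rule open_halfspace_Re_gt)

lemma convex_HP: "convex (HP n)" unfolding HP_def by (rule convex_halfspace_Re_gt)

lemma norm_exp_HP: "norm (exp (of_nat (d ^ n) * \<zeta>)) > MM \<longleftrightarrow> \<zeta> \<in> HP n"
proof -
  have dn: "0 < real d ^ n" using d2 by simp
  have "norm (exp (of_nat (d ^ n) * \<zeta>)) = exp (real d ^ n * Re \<zeta>)" by simp
  moreover have "MM < exp (real d ^ n * Re \<zeta>) \<longleftrightarrow> ln MM < real d ^ n * Re \<zeta>"
    using MM_gt_1 ln_less_cancel_iff[of MM "exp (real d ^ n * Re \<zeta>)"] by simp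
  moreover have "ln MM < real d ^ n * Re \<zeta> \<longleftrightarrow> lam n < Re \<zeta>"
    unfolding lam_def using dn by (simp add: pos_divide_less_eq mult.commute)
  ultimately show ?thesis unfolding HP_def by simp
qed

lemma k_in_Zs: "\<zeta> \<in> HP n \<Longrightarrow> norm y < \<alpha> \<Longrightarrow> (exp (of_nat (d ^ n) * \<zeta>), y) \<in> Zs"
proof -
  assume "\<zeta> \<in> HP n" and y: "norm y < \<alpha>"
  then have "MM < norm (exp (of_nat (d ^ n) * \<zeta>))" using norm_exp_HP[of n \<zeta>] by blast
  then show ?thesis using y unfolding Zs_def by (simp del: norm_exp_eq_Re of_nat_power)
qed

text \<open>F n is bounded over the part of W n with |x| <= T1, while |exp(d^n \<zeta>)| exceeds Re
  \<zeta>; so lifts of far right points lie where phi_+ is injective.\<close>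

lemma far_re:
  obtains \<sigma> where "\<sigma> \<ge> 0"
    "\<And>z \<zeta>. z \<in> W n \<Longrightarrow> F n z = exp (of_nat (d ^ n) * \<zeta>) \<Longrightarrow> Re \<zeta> > \<sigma> \<Longrightarrow> norm (fst z) > T1"
proof -
  have "compact ((f ^^ n) ` (cball 0 T1 \<times> cball 0 \<alpha>))"
    by (intro compact_continuous_image compact_Times compact_cball continuous_on_subset[OF f_cont]) blast
  then have "bounded ((f ^^ n) ` (cball 0 T1 \<times> cball 0 \<alpha>))" by (rule compact_imp_bounded)
  then obtain B where B: "\<And>w. w \<in> (f ^^ n) ` (cball 0 T1 \<times> cball 0 \<alpha>) \<Longrightarrow> norm w \<le> B"
    unfolding bounded_iff by blast
  define \<sigma> where "\<sigma> = \<bar>B\<bar> * exp (C0 / \<alpha>)"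
  have s0: "\<sigma> \<ge> 0" by (simp add: \<sigma>_def)
  show ?thesis
  proof (rule that[OF s0])
    fix z \<zeta> assume z: "z \<in> W n" and F: "F n z = exp (of_nat (d ^ n) * \<zeta>)" and s: "Re \<zeta> > \<sigma>"
    show "norm (fst z) > T1"
    proof (rule ccontr)
      assume "\<not> ?thesis"
      then have "z \<in> cball 0 T1 \<times> cball 0 \<alpha>" using z by (cases z) (auto simp: W_def)
      then have "norm ((f ^^ n) z) \<le> B" by (intro B imageI)
      moreover have "norm (fst ((f ^^ n) z)) \<le> norm ((f ^^ n) z)"
        using norm_fst_le[of "fst ((f ^^ n) z)" "snd ((f ^^ n) z)"] by simp
      ultimately have fb: "norm (fst ((f ^^ n) z)) \<le> \<bar>B\<bar>" by linarith
      have "(f ^^ n) z \<in> Vp" using z by (simp add: W_def)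
      then have "norm (F n z) \<le> norm (fst ((f ^^ n) z)) * exp (C0 / \<alpha>)" unfolding F_def by (rule phi_plus_bounds(1))
      also have "\<dots> \<le> \<sigma>" unfolding \<sigma>_def using fb by (rule mult_right_mono) simp
      finally have le: "norm (F n z) \<le> \<sigma>" .
      have "\<sigma> < Re \<zeta>" by (rule s)
      also have "Re \<zeta> = 1 * Re \<zeta>" by simp
      also have "1 * Re \<zeta> \<le> real (d ^ n) * Re \<zeta>"
        using s s0 dn_ge_1[of n] by (intro mult_right_mono) (auto simp del: of_nat_power)
      also have "\<dots> \<le> exp (real (d ^ n) * Re \<zeta>)" using exp_ge_add_one_self[of "real (d ^ n) * Re \<zeta>"] by linarith
      also have "\<dots> = norm (F n z)" unfolding F by (simp only: norm_exp_eq_Re) simp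
      finally show False using le by linarith
    qed
  qed
qed

lemma T1_Vp: "norm (fst z) > T1 \<Longrightarrow> norm (snd z) < \<alpha> \<Longrightarrow> z \<in> Vp"
  using T1_props(2) alpha_pos strip_Vp[of z 0] by simp

text \<open>Lifting F n alone leaves an ambiguity by d^n-th roots of unity of phi_+. The last clause
  removes it by prescribing phi_+ = exp \<zeta> near infinity.\<close>

definition is_lift :: "nat \<Rightarrow> (complex \<times> complex \<Rightarrow> complex \<times> complex) \<Rightarrow> bool" where
  "is_lift n g \<longleftrightarrow> continuous_on (HP n \<times> ball 0 \<alpha>) g \<and>
     (\<forall>w \<in> HP n \<times> ball 0 \<alpha>. g w \<in> W n \<and> F n (g w) = exp (of_nat (d ^ n) * fst w) \<and> snd (g w) = snd w) \<and>
     (\<exists>\<sigma>. \<forall>w \<in> HP n \<times> ball 0 \<alpha>. Re (fst w) > \<sigma> \<longrightarrow> norm (fst (g w)) > T1 \<and> phi_plus p a (g w) = exp (fst w))"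

lemma lift_ex: "\<exists>g. is_lift n g"
proof -
  define U where "U = HP n \<times> (ball 0 \<alpha> :: complex set)"
  define k where "k = (\<lambda>w :: complex \<times> complex. (exp (of_nat (d ^ n) * fst w), snd w))"
  obtain \<sigma> where \<sigma>: "\<sigma> \<ge> 0"
    "\<And>z \<zeta>. z \<in> W n \<Longrightarrow> F n z = exp (of_nat (d ^ n) * \<zeta>) \<Longrightarrow> Re \<zeta> > \<sigma> \<Longrightarrow> norm (fst z) > T1"
    using far_re[of n] by metis
  define s where "s = max \<sigma> (lam n)"
  obtain x where x: "(x, 0) \<in> Vp" "norm (phi_plus p a (x, 0)) > max MM (exp s)"
    using far_point[of "max MM (exp s)"] by (auto simp: le_max_iff_disj)
  \<comment> \<open>The base point of the lift is the logarithm of the actual value of phi_+, so the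
    lift starts on the correct branch.\<close>
  define \<zeta>0 where "\<zeta>0 = Ln (phi_plus p a (x, 0))"
  have ph0: "phi_plus p a (x, 0) \<noteq> 0" by (rule phi_plus_nz[OF x(1)])
  have e0: "exp \<zeta>0 = phi_plus p a (x, 0)" unfolding \<zeta>0_def using ph0 by simp
  have "exp s < exp (Re \<zeta>0)" using x(2) e0 norm_exp_eq_Re[of \<zeta>0] by simp
  then have Re0: "Re \<zeta>0 > s" by simp
  have xW: "(x, 0) \<in> W n" using Vp_W0[OF x(1)] x(2) alpha_pos by simp
  have z0U: "(\<zeta>0, 0) \<in> U" using Re0 alpha_pos by (simp add: U_def HP_def s_def)
  have keq: "k (\<zeta>0, 0) = (F n (x, 0), snd (x, 0 :: complex))"
    unfolding k_def F_W_Vp[OF x(1)] e0[symmetric] by (simp add: exp_of_nat_mult del: of_nat_power)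
  have cvU: "convex U" unfolding U_def by (intro convex_Times convex_HP convex_ball)
  have ck: "continuous_on U k" unfolding k_def by (intro continuous_intros)
  have kZ: "k \<in> U \<rightarrow> Zs"
    using k_in_Zs by (auto simp: k_def U_def)
  obtain g where g: "continuous_on U g" "g \<in> U \<rightarrow> W n" "g (\<zeta>0, 0) = (x, 0)" "\<And>w. w \<in> U \<Longrightarrow> (F n (g w), snd (g w)) = k w"
    using covering_space_lift_strong[OF W_covering xW z0U convex_imp_simply_connected[OF cvU]
        convex_imp_locally_path_connected[OF cvU] ck kZ keq] by blast
  define U' where "U' = {\<zeta>. s < Re \<zeta>} \<times> (ball 0 \<alpha> :: complex set)"
  have U'U: "U' \<subseteq> U" by (auto simp: U'_def U_def HP_def s_def)
  have cU': "connected U'" unfolding U'_def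
    by (intro connected_Times connected_ball convex_connected convex_halfspace_Re_gt)
  \<comment> \<open>Far to the right this ratio is a d^n-th root of unity; continuity and
    connectedness make it constant, and it is 1 at the base point.\<close>
  define \<rho> where "\<rho> = (\<lambda>w. phi_plus p a (g w) / exp (fst w))"
  have far: "norm (fst (g w)) > T1" "g w \<in> Vp" if w: "w \<in> U'" for w
  proof -
    have gW: "g w \<in> W n" using g(2) U'U w by blast
    have "F n (g w) = exp (of_nat (d ^ n) * fst w)" using g(4)[of w] U'U w by (auto simp: k_def)
    moreover have "Re (fst w) > \<sigma>" using w by (auto simp: U'_def s_def)
    ultimately show t: "norm (fst (g w)) > T1" using \<sigma>(2)[OF gW] by blast
    show "g w \<in> Vp" using T1_Vp[OF t] gW by (simp add: W_def)
  qed
  have gV: "g ` U' \<subseteq> Vp" using far(2) by blast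
  have "continuous_on U' (\<lambda>w. phi_plus p a (g w))"
    by (rule continuous_on_compose2[OF hol2_imp_continuous_on[OF phi_plus_hol] continuous_on_subset[OF g(1) U'U] gV])
  then have "continuous_on U' \<rho>" unfolding \<rho>_def by (intro continuous_intros) auto
  moreover have "finite (\<rho> ` U')"
  proof (rule finite_subset)
    show "finite {w :: complex. w ^ (d ^ n) = 1}" by (rule finite_roots_unity[OF dn_ge_1])
    show "\<rho> ` U' \<subseteq> {w. w ^ (d ^ n) = 1}"
    proof
      fix v assume "v \<in> \<rho> ` U'"
      then obtain w where w: "w \<in> U'" "v = \<rho> w" by blast
      have "phi_plus p a (g w) ^ (d ^ n) = exp (of_nat (d ^ n) * fst w)"
        using F_W_Vp[OF far(2)[OF w(1)], of n] g(4)[of w] U'U w by (auto simp: k_def)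
      then show "v \<in> {w. w ^ (d ^ n) = 1}" unfolding w(2) \<rho>_def
        by (simp add: power_divide exp_of_nat_mult[symmetric])
    qed
  qed
  ultimately have "\<rho> constant_on U'" using continuous_finite_range_constant[OF cU'] by blast
  then obtain c where c: "\<And>w. w \<in> U' \<Longrightarrow> \<rho> w = c" unfolding constant_on_def by blast
  have "(\<zeta>0, 0) \<in> U'" using Re0 alpha_pos by (simp add: U'_def)
  then have "c = 1" using c[of "(\<zeta>0, 0)"] g(3) e0 ph0 by (simp add: \<rho>_def)
  then have ph: "phi_plus p a (g w) = exp (fst w)" if "w \<in> U'" for w using c[OF that] by (simp add: \<rho>_def)
  have "is_lift n g" unfolding is_lift_def U_def[symmetric]
  proof (intro conjI ballI exI[of _ s] impI)
    show "continuous_on U g" by (rule g(1))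
    fix w assume w: "w \<in> U"
    show "g w \<in> W n" using g(2) w by blast
    show "F n (g w) = exp (of_nat (d ^ n) * fst w)" "snd (g w) = snd w" using g(4)[OF w] by (simp_all add: k_def)
    assume "s < Re (fst w)"
    then have "w \<in> U'" using w by (auto simp: U'_def U_def)
    then show "norm (fst (g w)) > T1" "phi_plus p a (g w) = exp (fst w)" using far(1) ph by auto
  qed
  then show ?thesis by blast
qed

definition lift :: "nat \<Rightarrow> complex \<times> complex \<Rightarrow> complex \<times> complex" where "lift n = (SOME g. is_lift n g)"

lemma is_lift: "is_lift n (lift n)"
  unfolding lift_def by (rule someI_ex[OF lift_ex])

lemma lift_props:
  shows lift_cont: "continuous_on (HP n \<times> ball 0 \<alpha>) (lift n)"
    and lift_W: "\<zeta> \<in> HP n \<Longrightarrow> norm y < \<alpha> \<Longrightarrow> lift n (\<zeta>, y) \<in> W n"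
    and lift_F: "\<zeta> \<in> HP n \<Longrightarrow> norm y < \<alpha> \<Longrightarrow> F n (lift n (\<zeta>, y)) = exp (of_nat (d ^ n) * \<zeta>)"
    and lift_snd: "\<zeta> \<in> HP n \<Longrightarrow> norm y < \<alpha> \<Longrightarrow> snd (lift n (\<zeta>, y)) = y"
    and lift_inf: "\<exists>\<sigma>. \<forall>\<zeta> y. Re \<zeta> > \<sigma> \<longrightarrow> norm y < \<alpha> \<longrightarrow>
      norm (fst (lift n (\<zeta>, y))) > T1 \<and> phi_plus p a (lift n (\<zeta>, y)) = exp \<zeta>"
proof -
  note il = is_lift[of n, unfolded is_lift_def]
  have mem: "(\<zeta>, y) \<in> HP n \<times> ball 0 \<alpha>" if "\<zeta> \<in> HP n" "norm y < \<alpha>" for \<zeta> y :: complex using that by simp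
  show "continuous_on (HP n \<times> ball 0 \<alpha>) (lift n)" using il by blast
  show "\<zeta> \<in> HP n \<Longrightarrow> norm y < \<alpha> \<Longrightarrow> lift n (\<zeta>, y) \<in> W n" using il mem by blast
  show "\<zeta> \<in> HP n \<Longrightarrow> norm y < \<alpha> \<Longrightarrow> F n (lift n (\<zeta>, y)) = exp (of_nat (d ^ n) * \<zeta>)"
    using conjunct1[OF conjunct2[OF il]] mem[of \<zeta> y] by fastforce
  show "\<zeta> \<in> HP n \<Longrightarrow> norm y < \<alpha> \<Longrightarrow> snd (lift n (\<zeta>, y)) = y"
    using conjunct1[OF conjunct2[OF il]] mem[of \<zeta> y] by fastforce
  obtain \<sigma> where s: "\<And>w. w \<in> HP n \<times> ball 0 \<alpha> \<Longrightarrow> Re (fst w) > \<sigma> \<Longrightarrow>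
      norm (fst (lift n w)) > T1 \<and> phi_plus p a (lift n w) = exp (fst w)" using il by blast
  show "\<exists>\<sigma>. \<forall>\<zeta> y. Re \<zeta> > \<sigma> \<longrightarrow> norm y < \<alpha> \<longrightarrow>
      norm (fst (lift n (\<zeta>, y))) > T1 \<and> phi_plus p a (lift n (\<zeta>, y)) = exp \<zeta>"
  proof (intro exI[of _ "max \<sigma> (lam n)"] allI impI)
    fix \<zeta> y :: complex assume "max \<sigma> (lam n) < Re \<zeta>" "norm y < \<alpha>"
    then show "norm (fst (lift n (\<zeta>, y))) > T1 \<and> phi_plus p a (lift n (\<zeta>, y)) = exp \<zeta>"
      using s[of "(\<zeta>, y)"] by (simp add: HP_def)
  qed
qed

text \<open>Uniqueness of covering lifts with y frozen; comparisons of lifts then reduce to one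
  point far to the right.\<close>

lemma slice_unique:
  assumes S: "connected S" "S \<subseteq> HP n" and y: "norm y < \<alpha>"
    and g: "continuous_on S g1" "continuous_on S g2"
      "\<And>\<zeta>. \<zeta> \<in> S \<Longrightarrow> g1 \<zeta> \<in> W n \<and> F n (g1 \<zeta>) = exp (of_nat (d ^ n) * \<zeta>) \<and> snd (g1 \<zeta>) = y"
      "\<And>\<zeta>. \<zeta> \<in> S \<Longrightarrow> g2 \<zeta> \<in> W n \<and> F n (g2 \<zeta>) = exp (of_nat (d ^ n) * \<zeta>) \<and> snd (g2 \<zeta>) = y"
    and z: "\<zeta>0 \<in> S" "g1 \<zeta>0 = g2 \<zeta>0" and w: "\<zeta> \<in> S"
  shows "g1 \<zeta> = g2 \<zeta>"
proof (rule covering_space_lift_unique[where c = "W n" and p = "\<lambda>z. (F n z, snd z)" and S = Zs and ?g1.0 = g1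
      and ?g2.0 = g2 and a = \<zeta>0 and T = S and f = "\<lambda>\<zeta>. (exp (of_nat (d ^ n) * \<zeta>), y)"])
  show "covering_space (W n) (\<lambda>z. (F n z, snd z)) Zs" by (rule W_covering)
  show "continuous_on S (\<lambda>\<zeta>. (exp (of_nat (d ^ n) * \<zeta>), y))" by (intro continuous_intros)
  show "(\<lambda>\<zeta>. (exp (of_nat (d ^ n) * \<zeta>), y)) \<in> S \<rightarrow> Zs" using k_in_Zs[OF _ y] S(2) by blast
qed (use g z w S in auto)

lemma same_at_infinity:
  assumes "norm (fst z) > T1" "norm (fst z') > T1" "norm (snd z) < \<alpha>" "snd z' = snd z" "phi_plus p a z = phi_plus p a z'"
  shows "z = z'"
proof -
  have "fst z = fst z'" by (rule phi_plus_inj_infinity[OF assms(1-3)]) (use assms(4,5) in \<open>metis prod.collapse\<close>)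
  then show ?thesis using assms(4) by (simp add: prod_eq_iff)
qed

lemma slice_lift_cont:
  assumes "continuous_on S h" "h ` S \<subseteq> HP n" "norm y < \<alpha>"
  shows "continuous_on S (\<lambda>\<zeta>. lift n (h \<zeta>, y))"
proof (rule continuous_on_compose2[OF lift_cont])
  show "continuous_on S (\<lambda>\<zeta>. (h \<zeta>, y))" by (intro continuous_intros assms(1))
qed (use assms in auto)

lemma root_Re_0:
  assumes "exp (of_nat (d ^ n) * c) = 1"
  shows "Re c = 0"
proof -
  have "norm (exp (of_nat (d ^ n) * c)) = 1" using assms by simp
  then have "real (d ^ n) * Re c = 0" by simp
  then show ?thesis using d2 by simp
qed

lemma shift_HP: "Re c = 0 \<Longrightarrow> \<zeta> \<in> HP n \<Longrightarrow> \<zeta> + c \<in> HP n" by (simp add: HP_def)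

lemma exp_shift:
  fixes c \<zeta> :: complex
  assumes "exp (of_nat (d ^ n) * c) = 1"
  shows "exp (of_nat (d ^ n) * (\<zeta> + c)) = exp (of_nat (d ^ n) * \<zeta>)"
  unfolding distrib_left exp_add assms by simp

lemma lift_shift_all:
  assumes c: "exp (of_nat (d ^ n) * c) = 1" and y: "norm y < \<alpha>"
    and z: "\<zeta>0 \<in> HP n" "lift n (\<zeta>0 + c, y) = lift n (\<zeta>0, y)" and w: "\<zeta> \<in> HP n"
  shows "lift n (\<zeta> + c, y) = lift n (\<zeta>, y)"
proof (rule slice_unique[OF convex_connected[OF convex_HP] order_refl y,
      where ?g1.0 = "\<lambda>\<zeta>. lift n (\<zeta> + c, y)" and ?g2.0 = "\<lambda>\<zeta>. lift n (\<zeta>, y)" and ?\<zeta>0.0 = \<zeta>0])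
  note sh = shift_HP[OF root_Re_0[OF c]]
  show "continuous_on (HP n) (\<lambda>\<zeta>. lift n (\<zeta> + c, y))"
    using sh by (intro slice_lift_cont y continuous_intros) auto
  show "continuous_on (HP n) (\<lambda>\<zeta>. lift n (\<zeta>, y))"
    by (intro slice_lift_cont y continuous_intros) auto
  fix \<zeta> assume z: "\<zeta> \<in> HP n"
  show "lift n (\<zeta> + c, y) \<in> W n \<and> F n (lift n (\<zeta> + c, y)) = exp (of_nat (d ^ n) * \<zeta>) \<and> snd (lift n (\<zeta> + c, y)) = y"
    using lift_W[OF sh[OF z] y] lift_F[OF sh[OF z] y] lift_snd[OF sh[OF z] y] exp_shift[OF c] by simp
  show "lift n (\<zeta>, y) \<in> W n \<and> F n (lift n (\<zeta>, y)) = exp (of_nat (d ^ n) * \<zeta>) \<and> snd (lift n (\<zeta>, y)) = y"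
    using lift_W[OF z y] lift_F[OF z y] lift_snd[OF z y] by simp
qed (use z w in auto)

text \<open>Whether a period c identifies points does not depend on \<zeta>, so it is decided near
  infinity, where phi_+ = exp \<zeta> is injective on slices.\<close>

lemma lift_shift_iff:
  assumes c: "exp (of_nat (d ^ n) * c) = 1" and y: "norm y < \<alpha>" and z: "\<zeta> \<in> HP n"
  shows "lift n (\<zeta> + c, y) = lift n (\<zeta>, y) \<longleftrightarrow> exp c = 1"
proof -
  obtain \<sigma> where s: "\<And>\<zeta> y. Re \<zeta> > \<sigma> \<Longrightarrow> norm y < \<alpha> \<Longrightarrow>
      norm (fst (lift n (\<zeta>, y))) > T1 \<and> phi_plus p a (lift n (\<zeta>, y)) = exp \<zeta>" using lift_inf by blast
  define \<zeta>1 where "\<zeta>1 = complex_of_real (max \<sigma> (lam n) + 1)"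
  have R1: "Re \<zeta>1 > \<sigma>" "\<zeta>1 \<in> HP n" by (simp_all add: \<zeta>1_def HP_def)
  have R2: "Re (\<zeta>1 + c) > \<sigma>" "\<zeta>1 + c \<in> HP n" using R1 root_Re_0[OF c] by (simp_all add: HP_def)
  note A = s[OF R1(1) y] and B = s[OF R2(1) y]
  have sn: "snd (lift n (\<zeta>1, y)) = y" "snd (lift n (\<zeta>1 + c, y)) = y"
    by (rule lift_snd[OF R1(2) y], rule lift_snd[OF R2(2) y])
  show ?thesis
  proof
    assume "lift n (\<zeta> + c, y) = lift n (\<zeta>, y)"
    then have "lift n (\<zeta>1 + c, y) = lift n (\<zeta>1, y)" using lift_shift_all[OF c y z _ R1(2)] by blast
    then have "exp \<zeta>1 = exp (\<zeta>1 + c)" using A B by metis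
    then show "exp c = 1" by (simp add: exp_add)
  next
    assume "exp c = 1"
    then have "phi_plus p a (lift n (\<zeta>1 + c, y)) = phi_plus p a (lift n (\<zeta>1, y))" using A B by (simp add: exp_add)
    then have "lift n (\<zeta>1 + c, y) = lift n (\<zeta>1, y)"
      using A B sn y by (intro same_at_infinity) auto
    then show "lift n (\<zeta> + c, y) = lift n (\<zeta>, y)" using lift_shift_all[OF c y R1(2) _ z] by blast
  qed
qed

text \<open>Lift the exponential so that it passes through z; near infinity this lift agrees with a
  translate of \<open>lift n\<close>, hence everywhere on the slice.\<close>

lemma lift_surj:
  assumes z: "z \<in> W n"
  obtains \<zeta> where "\<zeta> \<in> HP n" "lift n (\<zeta>, snd z) = z"
proof -
  define y where "y = snd z"
  have y: "norm y < \<alpha>" and Fz: "norm (F n z) > MM" using z by (auto simp: W_def y_def)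
  define \<zeta>1 where "\<zeta>1 = Ln (F n z) / of_nat (d ^ n)"
  have dn0: "of_nat (d ^ n) \<noteq> (0 :: complex)" using d2 by simp
  have "F n z \<noteq> 0" using Fz MM_gt_1 by auto
  then have e1: "exp (of_nat (d ^ n) * \<zeta>1) = F n z" unfolding \<zeta>1_def using dn0 by simp
  have H1: "\<zeta>1 \<in> HP n" using norm_exp_HP[of n \<zeta>1] Fz unfolding e1 by simp
  define k where "k = (\<lambda>\<zeta> :: complex. (exp (of_nat (d ^ n) * \<zeta>), y))"
  have ck: "continuous_on (HP n) k" unfolding k_def by (intro continuous_intros)
  have kZ: "k \<in> HP n \<rightarrow> Zs" unfolding k_def using k_in_Zs[OF _ y] by blast
  have keq: "k \<zeta>1 = (F n z, snd z)" unfolding k_def e1 y_def ..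
  obtain g where g: "continuous_on (HP n) g" "g \<in> HP n \<rightarrow> W n" "g \<zeta>1 = z" "\<And>\<zeta>. \<zeta> \<in> HP n \<Longrightarrow> (F n (g \<zeta>), snd (g \<zeta>)) = k \<zeta>"
    using covering_space_lift_strong[OF W_covering z H1 convex_imp_simply_connected[OF convex_HP]
        convex_imp_locally_path_connected[OF convex_HP] ck kZ keq] by blast
  obtain \<sigma> where s: "\<And>\<zeta> y. Re \<zeta> > \<sigma> \<Longrightarrow> norm y < \<alpha> \<Longrightarrow>
      norm (fst (lift n (\<zeta>, y))) > T1 \<and> phi_plus p a (lift n (\<zeta>, y)) = exp \<zeta>" using lift_inf by blast
  obtain \<tau> where t: "\<And>z \<zeta>. z \<in> W n \<Longrightarrow> F n z = exp (of_nat (d ^ n) * \<zeta>) \<Longrightarrow> Re \<zeta> > \<tau> \<Longrightarrow> norm (fst z) > T1"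
    using far_re[of n] by metis
  define \<zeta>2 where "\<zeta>2 = complex_of_real (max (max \<sigma> \<tau>) (lam n) + 1)"
  have R2: "Re \<zeta>2 > \<sigma>" "Re \<zeta>2 > \<tau>" "\<zeta>2 \<in> HP n" by (simp_all add: \<zeta>2_def HP_def)
  have gW: "g \<zeta>2 \<in> W n" using g(2) R2(3) by blast
  have gk: "F n (g \<zeta>2) = exp (of_nat (d ^ n) * \<zeta>2)" "snd (g \<zeta>2) = y" using g(4)[OF R2(3)] by (simp_all add: k_def)
  have gT: "norm (fst (g \<zeta>2)) > T1" by (rule t[OF gW gk(1) R2(2)])
  have gV: "g \<zeta>2 \<in> Vp" using T1_Vp[OF gT] gk(2) y by simp
  have gph: "phi_plus p a (g \<zeta>2) ^ (d ^ n) = exp (of_nat (d ^ n) * \<zeta>2)" using F_W_Vp[OF gV, of n] gk(1) by simp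
  \<comment> \<open>The discrepancy between the branch of g and the normalized branch. It satisfies
    exp(d^n c) = 1, so translating by c respects the covering equation.\<close>
  define c where "c = Ln (phi_plus p a (g \<zeta>2)) - \<zeta>2"
  have ec: "exp (\<zeta>2 + c) = phi_plus p a (g \<zeta>2)" unfolding c_def using phi_plus_nz[OF gV] by simp
  have "exp (of_nat (d ^ n) * (\<zeta>2 + c)) = exp (of_nat (d ^ n) * \<zeta>2)" unfolding exp_of_nat_mult[of "d ^ n" "\<zeta>2 + c"] ec gph ..
  then have c1: "exp (of_nat (d ^ n) * c) = 1" by (simp add: distrib_left exp_add)
  note sh = shift_HP[OF root_Re_0[OF c1]]
  have "Re (\<zeta>2 + c) > \<sigma>" using R2(1) root_Re_0[OF c1] by simp
  note B = s[OF this y]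
  have sn: "snd (lift n (\<zeta>2 + c, y)) = y" by (rule lift_snd[OF sh[OF R2(3)] y])
  have eq2: "g \<zeta>2 = lift n (\<zeta>2 + c, y)"
    by (rule same_at_infinity) (use B gT gk(2) sn y ec in auto)
  have "g \<zeta>1 = lift n (\<zeta>1 + c, y)"
  proof (rule slice_unique[OF convex_connected[OF convex_HP] order_refl y g(1),
      where ?g2.0 = "\<lambda>\<zeta>. lift n (\<zeta> + c, y)" and ?\<zeta>0.0 = \<zeta>2])
    show "continuous_on (HP n) (\<lambda>\<zeta>. lift n (\<zeta> + c, y))"
      using sh by (intro slice_lift_cont y continuous_intros) auto
    fix \<zeta> assume z: "\<zeta> \<in> HP n"
    show "g \<zeta> \<in> W n \<and> F n (g \<zeta>) = exp (of_nat (d ^ n) * \<zeta>) \<and> snd (g \<zeta>) = y"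
      using g(2) g(4)[OF z] z by (auto simp: k_def)
    show "lift n (\<zeta> + c, y) \<in> W n \<and> F n (lift n (\<zeta> + c, y)) = exp (of_nat (d ^ n) * \<zeta>) \<and> snd (lift n (\<zeta> + c, y)) = y"
      using lift_W[OF sh[OF z] y] lift_F[OF sh[OF z] y] lift_snd[OF sh[OF z] y] exp_shift[OF c1] by simp
  qed (use R2 H1 eq2 in auto)
  then show ?thesis using that[OF sh[OF H1]] g(3) by (simp add: y_def)
qed

lemma lift_compat_Suc:
  assumes z: "\<zeta> \<in> HP n" and y: "norm y < \<alpha>"
  shows "lift (Suc n) (\<zeta>, y) = lift n (\<zeta>, y)"
proof -
  have sub: "HP n \<subseteq> HP (Suc n)" by (rule HP_mono) simp
  obtain \<sigma> where s: "\<And>\<zeta> y. Re \<zeta> > \<sigma> \<Longrightarrow> norm y < \<alpha> \<Longrightarrow>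
      norm (fst (lift n (\<zeta>, y))) > T1 \<and> phi_plus p a (lift n (\<zeta>, y)) = exp \<zeta>" using lift_inf by blast
  obtain \<tau> where t: "\<And>\<zeta> y. Re \<zeta> > \<tau> \<Longrightarrow> norm y < \<alpha> \<Longrightarrow>
      norm (fst (lift (Suc n) (\<zeta>, y))) > T1 \<and> phi_plus p a (lift (Suc n) (\<zeta>, y)) = exp \<zeta>" using lift_inf by blast
  define \<zeta>2 where "\<zeta>2 = complex_of_real (max (max \<sigma> \<tau>) (lam n) + 1)"
  have R2: "Re \<zeta>2 > \<sigma>" "Re \<zeta>2 > \<tau>" "\<zeta>2 \<in> HP n" by (simp_all add: \<zeta>2_def HP_def)
  have R3: "\<zeta>2 \<in> HP (Suc n)" using R2(3) sub by blast
  have eq: "lift (Suc n) (\<zeta>2, y) = lift n (\<zeta>2, y)"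
    by (rule same_at_infinity)
      (use s[OF R2(1) y] t[OF R2(2) y] lift_snd[OF R2(3) y] lift_snd[OF R3 y] y in simp_all)
  show ?thesis
  proof (rule slice_unique[OF convex_connected[OF convex_HP] sub y,
      where ?g1.0 = "\<lambda>\<zeta>. lift (Suc n) (\<zeta>, y)" and ?g2.0 = "\<lambda>\<zeta>. lift n (\<zeta>, y)" and ?\<zeta>0.0 = \<zeta>2])
    show "continuous_on (HP n) (\<lambda>\<zeta>. lift (Suc n) (\<zeta>, y))" using sub by (intro slice_lift_cont y continuous_intros) auto
    show "continuous_on (HP n) (\<lambda>\<zeta>. lift n (\<zeta>, y))" by (intro slice_lift_cont y continuous_intros) auto
    fix \<zeta> assume z: "\<zeta> \<in> HP n"
    then have z': "\<zeta> \<in> HP (Suc n)" using sub by blast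
    show "lift (Suc n) (\<zeta>, y) \<in> W (Suc n) \<and> F (Suc n) (lift (Suc n) (\<zeta>, y)) = exp (of_nat (d ^ Suc n) * \<zeta>) \<and> snd (lift (Suc n) (\<zeta>, y)) = y"
      using lift_W[OF z' y] lift_F[OF z' y] lift_snd[OF z' y] by blast
    have lW: "lift n (\<zeta>, y) \<in> W n" by (rule lift_W[OF z y])
    then have "(f ^^ n) (lift n (\<zeta>, y)) \<in> Vp" by (simp add: W_def)
    then have "F (1 + n) (lift n (\<zeta>, y)) = F n (lift n (\<zeta>, y)) ^ (d ^ 1)" by (rule F_add)
    also have "\<dots> = exp (of_nat d * (of_nat (d ^ n) * \<zeta>))" unfolding lift_F[OF z y] by (simp only: power_one_right exp_of_nat_mult)
    finally have "F (Suc n) (lift n (\<zeta>, y)) = exp (of_nat (d ^ Suc n) * \<zeta>)" by (simp add: mult.assoc)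
    moreover have "lift n (\<zeta>, y) \<in> W (Suc n)" using lW W_mono[of n "Suc n"] by auto
    ultimately show "lift n (\<zeta>, y) \<in> W (Suc n) \<and> F (Suc n) (lift n (\<zeta>, y)) = exp (of_nat (d ^ Suc n) * \<zeta>) \<and> snd (lift n (\<zeta>, y)) = y"
      using lift_snd[OF z y] by blast
  qed (use R2 z eq in auto)
qed

lemma lift_compat:
  assumes "n \<le> k" "\<zeta> \<in> HP n" "norm y < \<alpha>"
  shows "lift k (\<zeta>, y) = lift n (\<zeta>, y)"
  using assms(1)
proof (induction k rule: dec_induct)
  case (step k)
  have "\<zeta> \<in> HP k" using HP_mono[OF step(1)] assms(2) by blast
  then show ?case using lift_compat_Suc[OF _ assms(3)] step.IH by simp
qed simp

text \<open>The lifts for different n agree where both are defined, so the least admissible n merely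
  selects a representative of their union.\<close>

definition gl :: "complex \<times> complex \<Rightarrow> complex \<times> complex" where
  "gl w = lift (LEAST n. fst w \<in> HP n) w"

lemma gl_eq: "\<zeta> \<in> HP n \<Longrightarrow> norm y < \<alpha> \<Longrightarrow> gl (\<zeta>, y) = lift n (\<zeta>, y)"
  unfolding gl_def fst_conv
  by (rule lift_compat[symmetric]) (auto intro: Least_le LeastI)

definition HS :: "(complex \<times> complex) set" where "HS = {\<zeta>. 0 < Re \<zeta>} \<times> ball 0 \<alpha>"

definition US :: "(complex \<times> complex) set" where "US = {z \<in> Up. norm (snd z) < \<alpha>}"

lemma open_US: "open US"
proof -
  have "open (Up \<inter> {z. norm (snd z) < \<alpha>})" by (intro open_Int open_Up open_Collect_less continuous_intros)
  then show ?thesis by (simp add: US_def Int_def)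
qed

lemma gl_isCont:
  assumes "Re \<zeta> > 0" "norm y < \<alpha>"
  shows "isCont gl (\<zeta>, y)"
proof -
  obtain n where n: "\<zeta> \<in> HP n" using HP_ex[OF assms(1)] .
  have o: "open (HP n \<times> ball 0 \<alpha>)" by (intro open_Times open_HP open_ball)
  have "isCont (lift n) (\<zeta>, y)"
    using lift_cont[of n] n assms(2) by (simp only: continuous_on_eq_continuous_at[OF o]) simp
  moreover have "eventually (\<lambda>w. gl w = lift n w) (nhds (\<zeta>, y))"
  proof (rule eventually_mono[OF eventually_nhds_in_open[OF o]])
    show "(\<zeta>, y) \<in> HP n \<times> ball 0 \<alpha>" using n assms by simp
    show "gl w = lift n w" if "w \<in> HP n \<times> ball 0 \<alpha>" for w
      using gl_eq[of "fst w" n "snd w"] that by (cases w) simp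
  qed
  ultimately show ?thesis using isCont_cong by blast
qed

lemma gl_US:
  assumes "Re \<zeta> > 0" "norm y < \<alpha>"
  shows "gl (\<zeta>, y) \<in> US" "snd (gl (\<zeta>, y)) = y"
proof -
  obtain n where n: "\<zeta> \<in> HP n" using HP_ex[OF assms(1)] .
  show s: "snd (gl (\<zeta>, y)) = y" unfolding gl_eq[OF n assms(2)] by (rule lift_snd[OF n assms(2)])
  have "gl (\<zeta>, y) \<in> W n" unfolding gl_eq[OF n assms(2)] by (rule lift_W[OF n assms(2)])
  then show "gl (\<zeta>, y) \<in> US" using W_sub(2)[of n] s assms(2) by (auto simp: US_def)
qed

text \<open>This makes exp \<zeta> a well-defined function of the point, injective on horizontal
  slices.\<close>

lemma gl_eq_iff:
  assumes "Re \<zeta> > 0" "Re \<zeta>' > 0" "norm y < \<alpha>"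
  shows "gl (\<zeta>, y) = gl (\<zeta>', y) \<longleftrightarrow> exp \<zeta> = exp \<zeta>'"
proof -
  obtain i j where "\<zeta> \<in> HP i" "\<zeta>' \<in> HP j" using HP_ex assms(1,2) by metis
  then have n: "\<zeta> \<in> HP (max i j)" "\<zeta>' \<in> HP (max i j)" using HP_mono by (meson max.cobounded1 max.cobounded2 subsetD)+
  define n where "n = max i j"
  define c where "c = \<zeta>' - \<zeta>"
  have z': "\<zeta>' = \<zeta> + c" by (simp add: c_def)
  note n = n[folded n_def]
  note e = gl_eq[OF n(1) assms(3)] gl_eq[OF n(2) assms(3)]
  have ec: "exp \<zeta> = exp \<zeta>' \<longleftrightarrow> exp c = 1" by (auto simp: z' exp_add)
  show ?thesis
  proof (cases "exp (of_nat (d ^ n) * c) = 1")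
    case True
    show ?thesis unfolding e ec using lift_shift_iff[OF True assms(3) n(1)] unfolding z' by metis
  next
    case False
    have "lift n (\<zeta>, y) \<noteq> lift n (\<zeta>', y)"
    proof
      assume "lift n (\<zeta>, y) = lift n (\<zeta>', y)"
      then have "exp (of_nat (d ^ n) * \<zeta>) = exp (of_nat (d ^ n) * \<zeta>')"
        using lift_F[OF n(1) assms(3)] lift_F[OF n(2) assms(3)] by metis
      then have "exp (of_nat (d ^ n) * c) = 1" unfolding z' by (simp add: distrib_left exp_add)
      then show False using False by blast
    qed
    moreover have "exp c \<noteq> 1" using False exp_of_nat_mult[of "d ^ n" c] by (auto simp del: of_nat_power)
    ultimately show ?thesis unfolding e ec by blast
  qed
qed

lemma gl_surj:
  assumes "z \<in> US"
  obtains \<zeta> n where "Re \<zeta> > 0" "gl (\<zeta>, snd z) = z" "z \<in> W n" "F n z = exp (of_nat (d ^ n) * \<zeta>)"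
proof -
  obtain n where n: "z \<in> W n" using W_ex[of z] assms by (auto simp: US_def)
  obtain \<zeta> where z: "\<zeta> \<in> HP n" "lift n (\<zeta>, snd z) = z" using lift_surj[OF n] .
  have y: "norm (snd z) < \<alpha>" using n by (simp add: W_def)
  show ?thesis
  proof (rule that[of \<zeta> n])
    show "Re \<zeta> > 0" using z(1) lam_pos[of n] by (simp add: HP_def)
    show "gl (\<zeta>, snd z) = z" unfolding gl_eq[OF z(1) y] by (rule z(2))
    show "F n z = exp (of_nat (d ^ n) * \<zeta>)" using lift_F[OF z(1) y] unfolding z(2) .
  qed (rule n)
qed

text \<open>\<open>Phi\<close> is the single-valued continuation of \<open>\<phi>\<^sub>+\<close> and \<open>X\<close> its inverse on horizontal slices.\<close>

definition Phi :: "complex \<times> complex \<Rightarrow> complex" where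
  "Phi z = exp (SOME \<zeta>. Re \<zeta> > 0 \<and> gl (\<zeta>, snd z) = z)"

definition X :: "complex \<times> complex \<Rightarrow> complex" where "X w = fst (gl (Ln (fst w), snd w))"

lemma Phi_gl:
  assumes "Re \<zeta> > 0" "norm y < \<alpha>"
  shows "Phi (gl (\<zeta>, y)) = exp \<zeta>"
proof -
  define z where "z = gl (\<zeta>, y)"
  have s: "snd z = y" unfolding z_def by (rule gl_US(2)[OF assms])
  define \<xi> where "\<xi> = (SOME \<zeta>. Re \<zeta> > 0 \<and> gl (\<zeta>, snd z) = z)"
  have "Re \<xi> > 0 \<and> gl (\<xi>, snd z) = z" unfolding \<xi>_def by (rule someI[of _ \<zeta>]) (use assms s in \<open>simp add: z_def\<close>)
  then have "exp \<xi> = exp \<zeta>" using gl_eq_iff[OF _ assms(1,2), of \<xi>] s by (auto simp: z_def)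
  then show ?thesis unfolding Phi_def z_def[symmetric] \<xi>_def[symmetric] .
qed

lemma Phi_F: "z \<in> W n \<Longrightarrow> Phi z ^ (d ^ n) = F n z"
proof -
  assume z: "z \<in> W n"
  obtain \<zeta> where h: "\<zeta> \<in> HP n" "lift n (\<zeta>, snd z) = z" using lift_surj[OF z] .
  have y: "norm (snd z) < \<alpha>" using z by (simp add: W_def)
  have r: "Re \<zeta> > 0" using h(1) lam_pos[of n] by (simp add: HP_def)
  have "Phi z = exp \<zeta>" using Phi_gl[OF r y] unfolding gl_eq[OF h(1) y] h(2) .
  then show "Phi z ^ (d ^ n) = F n z" using lift_F[OF h(1) y] h(2) by (simp add: exp_of_nat_mult del: of_nat_power)
qed

abbreviation "TT \<equiv> - cball (0::complex) 1"

lemma Ln_TT: "t \<in> TT \<Longrightarrow> Re (Ln t) > 0 \<and> exp (Ln t) = t"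
proof -
  assume t: "t \<in> TT"
  then have "norm t > 1" "t \<noteq> 0" by auto
  then show ?thesis by simp
qed

lemma X_pair: "t \<in> TT \<Longrightarrow> norm y < \<alpha> \<Longrightarrow> (X (t, y), y) = gl (Ln t, y)"
  using gl_US(2)[of "Ln t" y] Ln_TT[of t] by (simp add: X_def prod_eq_iff)

lemma X_US: "t \<in> TT \<Longrightarrow> norm y < \<alpha> \<Longrightarrow> (X (t, y), y) \<in> US"
  using X_pair[of t y] gl_US(1)[of "Ln t" y] Ln_TT[of t] by simp

lemma Phi_X: "t \<in> TT \<Longrightarrow> norm y < \<alpha> \<Longrightarrow> Phi (X (t, y), y) = t"
  using X_pair[of t y] Phi_gl[of "Ln t" y] Ln_TT[of t] by simp

lemma Phi_TT: "z \<in> US \<Longrightarrow> Phi z \<in> TT"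
  and X_Phi: "z \<in> US \<Longrightarrow> X (Phi z, snd z) = fst z"
proof -
  assume z: "z \<in> US"
  then have y: "norm (snd z) < \<alpha>" by (simp add: US_def)
  obtain \<zeta> n where h: "Re \<zeta> > 0" "gl (\<zeta>, snd z) = z" using gl_surj[OF z] by metis
  have P: "Phi z = exp \<zeta>" using Phi_gl[OF h(1) y] h(2) by simp
  show t: "Phi z \<in> TT" unfolding P using h(1) by simp
  have "gl (Ln (Phi z), snd z) = gl (\<zeta>, snd z)"
    using gl_eq_iff[OF _ h(1) y, of "Ln (Phi z)"] Ln_TT[OF t] P by simp
  then show "X (Phi z, snd z) = fst z" unfolding X_def using h(2) by simp
qed

definition XP :: "complex \<times> complex \<Rightarrow> complex \<times> complex" where "XP w = gl (Ln (fst w), snd w)"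

lemma open_TTb: "open (TT \<times> ball (0::complex) \<alpha>)"
  by (intro open_Times open_ball) (simp add: open_Compl)

lemma XP_cont: "continuous_on (TT \<times> ball 0 \<alpha>) XP"
  unfolding continuous_on_eq_continuous_at[OF open_TTb]
proof clarify
  fix t y :: complex assume t: "t \<notin> cball 0 1" and y: "y \<in> ball 0 \<alpha>"
  then have tT: "t \<in> TT" and y': "norm y < \<alpha>" by auto
  \<comment> \<open>The principal logarithm jumps on the negative axis. There Ln(-t) + i pi is used
    instead; any logarithm of t gives the same point under \<open>gl\<close>.\<close>
  define c where "c = (if t \<in> \<real>\<^sub>\<le>\<^sub>0 then - 1 else 1 :: complex)"
  define k where "k = (if t \<in> \<real>\<^sub>\<le>\<^sub>0 then \<i> * of_real pi else 0)"
  have ck: "norm c = 1" "exp k * c = 1" "Re k = 0" by (auto simp: c_def k_def exp_Euler)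
  have ct: "c * t \<notin> \<real>\<^sub>\<le>\<^sub>0"
  proof (cases "t \<in> \<real>\<^sub>\<le>\<^sub>0")
    case True
    then have "Re t \<le> 0" "Im t = 0" by (auto simp: complex_nonpos_Reals_iff)
    moreover have "t \<noteq> 0" using tT by auto
    ultimately show ?thesis using True by (auto simp: c_def complex_nonpos_Reals_iff complex_eq_iff)
  qed (simp add: c_def)
  define h where "h = (\<lambda>w. (Ln (c * fst w) + k, snd w :: complex))"
  have R: "Re (Ln (c * s) + k) > 0 \<and> exp (Ln (c * s) + k) = s" if s: "s \<in> TT" for s
  proof -
    have cs: "c * s \<in> TT" using s ck(1) by (simp add: norm_mult)
    have "exp (Ln (c * s) + k) = (exp k * c) * s" using Ln_TT[OF cs] by (simp add: exp_add mult_ac)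
    then show ?thesis using Ln_TT[OF cs] ck by simp
  qed
  have "isCont (\<lambda>w. Ln (c * fst w) + k) (t, y)"
    using ct by (intro continuous_intros) auto
  then have "isCont h (t, y)" unfolding h_def by (intro continuous_Pair) (auto intro: continuous_intros)
  moreover have "isCont gl (h (t, y))" unfolding h_def using gl_isCont[of "Ln (c * t) + k" y] R[OF tT] y' by simp
  ultimately have "isCont (\<lambda>w. gl (h w)) (t, y)" by (rule isCont_o2)
  moreover have "eventually (\<lambda>w. XP w = gl (h w)) (nhds (t, y))"
  proof (rule eventually_mono[OF eventually_nhds_in_open[OF open_TTb]])
    show "(t, y) \<in> TT \<times> ball 0 \<alpha>" using tT y by simp
    fix w :: "complex \<times> complex" assume w: "w \<in> TT \<times> ball 0 \<alpha>"
    then have w': "fst w \<in> TT" "norm (snd w) < \<alpha>" by auto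
    show "XP w = gl (h w)" unfolding XP_def h_def
      using gl_eq_iff[of "Ln (fst w)" "Ln (c * fst w) + k" "snd w"] R[OF w'(1)] Ln_TT[OF w'(1)] w'(2) by simp
  qed
  ultimately show "isCont XP (t, y)" using isCont_cong[of XP "\<lambda>w. gl (h w)"] by simp
qed

lemma XP_X: "t \<in> TT \<Longrightarrow> norm y < \<alpha> \<Longrightarrow> XP (t, y) = (X (t, y), y)"
  using X_pair by (simp add: XP_def)

lemma XP_image: "XP ` (TT \<times> ball 0 \<alpha>) = US"
proof
  show "XP ` (TT \<times> ball 0 \<alpha>) \<subseteq> US"
    using XP_X X_US by auto
  show "US \<subseteq> XP ` (TT \<times> ball 0 \<alpha>)"
  proof
    fix z assume z: "z \<in> US"
    have y: "norm (snd z) < \<alpha>" using z by (simp add: US_def)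
    have "z = XP (Phi z, snd z)" unfolding XP_X[OF Phi_TT[OF z] y] X_Phi[OF z] by simp
    moreover have "(Phi z, snd z) \<in> TT \<times> ball 0 \<alpha>" using Phi_TT[OF z] y by simp
    ultimately show "z \<in> XP ` (TT \<times> ball 0 \<alpha>)" by blast
  qed
qed

text \<open>Continuity of the inverse comes from invariance of domain.\<close>

lemma Phi_cont: "continuous_on US Phi"
proof -
  have inv: "(Phi (XP w), snd (XP w)) = w" if w: "w \<in> TT \<times> ball 0 \<alpha>" for w
  proof -
    obtain t y where [simp]: "w = (t, y)" by (cases w)
    have ty: "t \<in> TT" "norm y < \<alpha>" using w by auto
    show ?thesis using XP_X[OF ty] Phi_X[OF ty] by simp
  qed
  have "continuous_on (XP ` (TT \<times> ball 0 \<alpha>)) (\<lambda>z. (Phi z, snd z))"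
    by (rule continuous_on_inverse_open[OF open_TTb XP_cont order_refl inv])
  then have "continuous_on US (\<lambda>z. fst (Phi z, snd z))" unfolding XP_image by (rule continuous_on_fst)
  then show ?thesis by simp
qed

lemma Phi_nz: "z \<in> US \<Longrightarrow> Phi z \<noteq> 0"
  using Phi_TT[of z] by auto

text \<open>Phi and a holomorphic local root of F n are continuous and differ by d^n-th roots of
  unity, hence by a constant, which is 1 at the centre.\<close>

lemma Phi_hol: "hol2_on Phi US"
  unfolding hol2_on_def
proof
  fix z assume z: "z \<in> US"
  then obtain n where n: "z \<in> W n" using W_ex[of z] by (auto simp: US_def)
  have Fnz: "F n z \<noteq> 0" using n F_nz[of n z] by (simp add: W_def)
  obtain V \<psi> where V: "open V" "z \<in> V" "V \<subseteq> W n" "hol2_on \<psi> V" "\<psi> z = Phi z" "\<And>w. w \<in> V \<Longrightarrow> \<psi> w ^ (d ^ n) = F n w"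
    using hol2_local_root[OF F_W_hol open_W n Fnz dn_ge_1 Phi_F[OF n]] by metis
  obtain e where e: "e > 0" "ball z e \<subseteq> V" using V(1,2) open_contains_ball[of V] by blast
  have WU: "W n \<subseteq> US" using W_sub(2)[of n] by (auto simp: US_def W_def)
  have bU: "ball z e \<subseteq> US" using e(2) V(3) WU by blast
  have psinz: "\<psi> w \<noteq> 0" if "w \<in> ball z e" for w
  proof -
    have "w \<in> W n" using that e(2) V(3) by blast
    then have "F n w \<noteq> 0" using F_nz[of n w] by (simp add: W_def)
    moreover have "\<psi> w ^ (d ^ n) = F n w" using V(6) that e(2) by blast
    moreover have "d ^ n > 0" using d2 by simp
    ultimately show ?thesis by (metis zero_power)
  qed
  define \<rho> where "\<rho> = (\<lambda>w. Phi w / \<psi> w)"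
  have "continuous_on (ball z e) \<rho>" unfolding \<rho>_def
    using psinz by (intro continuous_on_divide continuous_on_subset[OF Phi_cont bU]
      continuous_on_subset[OF hol2_imp_continuous_on[OF V(4)] e(2)]) blast
  moreover have "finite (\<rho> ` ball z e)"
  proof (rule finite_subset)
    show "finite {w :: complex. w ^ (d ^ n) = 1}" by (rule finite_roots_unity[OF dn_ge_1])
    show "\<rho> ` ball z e \<subseteq> {w. w ^ (d ^ n) = 1}"
    proof
      fix v assume "v \<in> \<rho> ` ball z e"
      then obtain w where w: "w \<in> ball z e" "v = \<rho> w" by blast
      have "w \<in> W n" "\<psi> w ^ (d ^ n) = F n w" using w(1) e(2) V(3,6) by blast+
      then have "Phi w ^ (d ^ n) = \<psi> w ^ (d ^ n)" using Phi_F by simp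
      then show "v \<in> {w. w ^ (d ^ n) = 1}" unfolding w(2) \<rho>_def using psinz[OF w(1)] by (simp add: power_divide)
    qed
  qed
  ultimately have "\<rho> constant_on ball z e" using continuous_finite_range_constant[OF connected_ball] by blast
  then obtain c where c: "\<And>w. w \<in> ball z e \<Longrightarrow> \<rho> w = c" unfolding constant_on_def by blast
  have "c = 1" using c[of z] e(1) V(5) Phi_nz[OF z] by (simp add: \<rho>_def)
  then have eq: "\<psi> w = Phi w" if "w \<in> ball z e" for w using c[OF that] psinz[OF that] by (simp add: \<rho>_def)
  have "hol2_on Phi (ball z e)"
    by (rule hol2_cong[OF hol2_on_subset[OF V(4) e(2)] open_ball eq])
  then show "\<exists>A B. (Phi has_derivative (\<lambda>h. A * fst h + B * snd h)) (at z)"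
    unfolding hol2_on_def using e(1) by simp
qed

text \<open>The differential of F n is a nonzero multiple of that of Phi, and the cone estimate is
  homogeneous.\<close>

lemma Phi_cone:
  assumes z: "z \<in> US"
  shows "d1 Phi z \<noteq> 0"
    and "norm (d2 Phi z) * (norm (poly (pderiv p) (fst z)) - m / 2) \<le> norm a * norm (d1 Phi z)"
proof -
  obtain n where n: "z \<in> W n" using W_ex[of z] z by (auto simp: US_def)
  have Fnz: "F n z \<noteq> 0" "(f ^^ n) z \<in> Vp" using n F_nz[of n z] by (simp_all add: W_def)
  have WU: "W n \<subseteq> US" using W_sub(2)[of n] by (auto simp: US_def W_def)
  define c where "c = of_nat (d ^ n) * F n z / Phi z"
  have c0: "c \<noteq> 0" using Fnz Phi_nz[OF z] d2 by (simp add: c_def)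
  have D: "d1 (F n) z = c * d1 Phi z" "d2 (F n) z = c * d2 Phi z"
    using dlog_power[OF hol2_on_subset[OF Phi_hol WU] open_W n Phi_F dn_ge_1 Fnz(1)] by (simp_all add: c_def)
  have zz: "z \<in> Up" "norm (snd z) \<le> \<alpha>" using z by (auto simp: US_def)
  note C = cone[OF zz Fnz(2)]
  show "d1 Phi z \<noteq> 0" using C(1) D(1) by auto
  have A: "norm c * (norm (d2 Phi z) * (norm (poly (pderiv p) (fst z)) - m / 2)) \<le> norm c * (norm a * norm (d1 Phi z))"
    using C(2) unfolding D norm_mult by (simp only: mult.assoc mult.left_commute)
  show "norm (d2 Phi z) * (norm (poly (pderiv p) (fst z)) - m / 2) \<le> norm a * norm (d1 Phi z)"
    by (rule mult_left_le_imp_le[OF A]) (use c0 in simp)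
qed

text \<open>Inverse function theorem with the continuous inverse already at hand: the differential
  of (Phi, y) is triangular and invertible because d1 Phi is not 0.\<close>

lemma X_hol: "hol2_on X (TT \<times> ball 0 \<alpha>)"
  unfolding hol2_on_def
proof clarify
  fix t y :: complex assume "t \<notin> cball 0 1" and y: "y \<in> ball 0 \<alpha>"
  then have t: "t \<in> TT" and y': "norm y < \<alpha>" by auto
  define z where "z = (X (t, y), y)"
  have z: "z \<in> US" unfolding z_def by (rule X_US[OF t y'])
  define A where "A = d1 Phi z"
  define B where "B = d2 Phi z"
  have A0: "A \<noteq> 0" unfolding A_def by (rule Phi_cone(1)[OF z])
  have dP: "(Phi has_derivative (\<lambda>h. A * fst h + B * snd h)) (at z)"
    using hol2_has_derivative[OF Phi_hol, of "fst z" "snd z"] z by (simp add: A_def B_def)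
  have df: "((\<lambda>z. (Phi z, snd z)) has_derivative (\<lambda>h. (A * fst h + B * snd h, snd h))) (at (XP (t, y)))"
    unfolding XP_X[OF t y'] z_def[symmetric]
    by (intro has_derivative_Pair dP bounded_linear_imp_has_derivative bounded_linear_snd)
  have bl: "bounded_linear (\<lambda>k. ((fst k - B * snd k) / A, snd k))"
    unfolding divide_inverse
    by (rule bounded_linear_Pair[OF bounded_linear_mult_const[OF bounded_linear_sub[OF bounded_linear_fst
          bounded_linear_const_mult[OF bounded_linear_snd]]] bounded_linear_snd])
  have dX: "(XP has_derivative (\<lambda>k. ((fst k - B * snd k) / A, snd k))) (at (t, y))"
  proof (rule has_derivative_inverse_basic[where T = "TT \<times> ball 0 \<alpha>" and f = "\<lambda>z. (Phi z, snd z)" and g = XP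
      and f' = "\<lambda>h. (A * fst h + B * snd h, snd h)" and g' = "\<lambda>k. ((fst k - B * snd k) / A, snd k)" and y = "(t, y)"])
    show "((\<lambda>z. (Phi z, snd z)) has_derivative (\<lambda>h. (A * fst h + B * snd h, snd h))) (at (XP (t, y)))" by (rule df)
    show "bounded_linear (\<lambda>k. ((fst k - B * snd k) / A, snd k))" by (rule bl)
    show "open (TT \<times> ball (0::complex) \<alpha>)" by (rule open_TTb)
    show "(\<lambda>k. ((fst k - B * snd k) / A, snd k)) \<circ> (\<lambda>h. (A * fst h + B * snd h, snd h)) = id"
      using A0 by (auto simp: fun_eq_iff)
    show "continuous (at (t, y)) XP"
    proof -
      have "(t, y) \<in> TT \<times> ball 0 \<alpha>" using t y by simp
      then show ?thesis using XP_cont continuous_on_eq_continuous_at[OF open_TTb, of XP] by blast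
    qed
    show "(t, y) \<in> TT \<times> ball 0 \<alpha>" using t y by simp
    show "(Phi (XP w), snd (XP w)) = w" if w: "w \<in> TT \<times> ball 0 \<alpha>" for w
    proof -
      obtain s u :: complex where [simp]: "w = (s, u)" by (cases w)
      have su: "s \<in> TT" "norm u < \<alpha>" using w by auto
      show ?thesis using XP_X[OF su] Phi_X[OF su] by simp
    qed
  qed
  have "X = (\<lambda>w. fst (XP w))" by (rule ext) (simp add: X_def XP_def)
  then have "(X has_derivative (\<lambda>k. (fst k - B * snd k) / A)) (at (t, y))"
    using has_derivative_fst[OF dX] by simp
  moreover have "(fst k - B * snd k) / A = (1 / A) * fst k + (- B / A) * snd k" for k :: "complex \<times> complex"
    by (simp add: diff_divide_distrib)
  ultimately have "(X has_derivative (\<lambda>h. (1 / A) * fst h + (- B / A) * snd h)) (at (t, y))" by (simp only:)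
  then show "\<exists>A B. (X has_derivative (\<lambda>h. A * fst h + B * snd h)) (at (t, y))" by (intro exI)
qed

text \<open>Both functions have equal d^n-th powers locally, but n varies with the point, so the
  ratio is only known to be locally constant. Connectedness of {|x| > \<alpha>, |y| < \<alpha>} and
  one point near infinity settle it.\<close>

lemma Phi_phi_plus:
  assumes z: "z \<in> Vp" "norm (snd z) < \<alpha>"
  shows "Phi z = phi_plus p a z"
proof -
  define A where "A = (- cball (0::complex) \<alpha>) \<times> ball (0::complex) \<alpha>"
  have cA: "connected A" unfolding A_def
    by (intro connected_Times connected_ball connected_complement_bounded_convex) auto
  have oA: "open A" unfolding A_def by (intro open_Times open_ball) (simp add: open_Compl)
  have AV: "A \<subseteq> Vp" unfolding A_def by (auto simp: V_plus_def)
  have AU: "A \<subseteq> US"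
  proof
    fix w assume w: "w \<in> A"
    then have "w \<in> Vp" using AV by blast
    then have "(f ^^ 0) w \<in> Vp" by simp
    then have "w \<in> Up" unfolding Up_iff by (rule exI)
    moreover have "norm (snd w) < \<alpha>" using w by (auto simp: A_def)
    ultimately show "w \<in> US" by (simp add: US_def)
  qed
  define \<rho> where "\<rho> = (\<lambda>w. Phi w / phi_plus p a w)"
  have c\<rho>: "continuous_on A \<rho>" unfolding \<rho>_def
    using AV phi_plus_nz by (intro continuous_on_divide continuous_on_subset[OF Phi_cont AU]
      continuous_on_subset[OF hol2_imp_continuous_on[OF phi_plus_hol] AV]) blast
  have loc: "\<exists>e>0. ball w e \<subseteq> A \<and> (\<forall>w'\<in>ball w e. \<rho> w' = \<rho> w)" if w: "w \<in> A" for w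
  proof -
    obtain n where n: "w \<in> W n" using W_ex[of w] AU w by (auto simp: US_def)
    have "open (A \<inter> W n)" "w \<in> A \<inter> W n" using oA open_W w n by auto
    then obtain e where e: "e > 0" "ball w e \<subseteq> A \<inter> W n" using open_contains_ball[of "A \<inter> W n"] by blast
    have "finite (\<rho> ` ball w e)"
    proof (rule finite_subset)
      show "finite {w :: complex. w ^ (d ^ n) = 1}" by (rule finite_roots_unity[OF dn_ge_1])
      show "\<rho> ` ball w e \<subseteq> {w. w ^ (d ^ n) = 1}"
      proof
        fix v assume "v \<in> \<rho> ` ball w e"
        then obtain w' where w': "w' \<in> ball w e" "v = \<rho> w'" by blast
        then have i: "w' \<in> Vp" "w' \<in> W n" using e(2) AV by blast+
        have "Phi w' ^ (d ^ n) = phi_plus p a w' ^ (d ^ n)" using Phi_F[OF i(2)] F_W_Vp[OF i(1)] by simp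
        then show "v \<in> {w. w ^ (d ^ n) = 1}" unfolding w'(2) \<rho>_def using phi_plus_nz[OF i(1)] by (simp add: power_divide)
      qed
    qed
    moreover have "continuous_on (ball w e) \<rho>" using e(2) by (intro continuous_on_subset[OF c\<rho>]) blast
    ultimately have "\<rho> constant_on ball w e" using continuous_finite_range_constant[OF connected_ball] by blast
    then obtain c where c: "\<And>w'. w' \<in> ball w e \<Longrightarrow> \<rho> w' = c" unfolding constant_on_def by blast
    have "\<rho> w' = \<rho> w" if "w' \<in> ball w e" for w' using c[OF that] c[of w] e(1) by simp
    then show ?thesis using e by blast
  qed
  have one: "\<exists>w\<in>A. \<rho> w = 1"
  proof -
    obtain \<sigma> where s: "\<And>\<zeta> y. Re \<zeta> > \<sigma> \<Longrightarrow> norm y < \<alpha> \<Longrightarrow>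
      norm (fst (lift 0 (\<zeta>, y))) > T1 \<and> phi_plus p a (lift 0 (\<zeta>, y)) = exp \<zeta>" using lift_inf by blast
    define \<zeta> where "\<zeta> = complex_of_real (max \<sigma> (lam 0) + 1)"
    have h: "Re \<zeta> > \<sigma>" "\<zeta> \<in> HP 0" by (simp_all add: \<zeta>_def HP_def)
    have y0: "norm (0::complex) < \<alpha>" using alpha_pos by simp
    define w where "w = lift 0 (\<zeta>, 0)"
    have w: "norm (fst w) > T1" "phi_plus p a w = exp \<zeta>" "snd w = 0"
      using s[OF h(1) y0] lift_snd[OF h(2) y0] by (simp_all add: w_def)
    have r: "Re \<zeta> > 0" using h(2) lam_pos[of 0] by (simp add: HP_def)
    have "Phi w = exp \<zeta>" using Phi_gl[OF r y0] unfolding gl_eq[OF h(2) y0] w_def .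
    then have "\<rho> w = 1" using w(2) by (simp add: \<rho>_def)
    moreover have "norm (fst w) > \<alpha>" using w(1) T1_props(2) alpha_pos by linarith
    then have "w \<in> A" using w(3) alpha_pos unfolding A_def by (simp add: mem_Times_iff)
    ultimately show ?thesis by blast
  qed
  \<comment> \<open>Local constancy makes both this set and its complement in A open.\<close>
  define E where "E = {w \<in> A. \<rho> w = 1}"
  have "open E" unfolding open_contains_ball[of E]
  proof
    fix w assume "w \<in> E"
    then have w: "w \<in> A" "\<rho> w = 1" by (simp_all add: E_def)
    obtain e where e: "e > 0" "ball w e \<subseteq> A" "\<forall>w'\<in>ball w e. \<rho> w' = \<rho> w" using loc[OF w(1)] by blast
    have "ball w e \<subseteq> E" unfolding E_def using e(2,3) w(2) by (simp add: subset_eq)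
    then show "\<exists>e>0. ball w e \<subseteq> E" using e(1) by blast
  qed
  moreover have "open (A - E)" unfolding open_contains_ball[of "A - E"]
  proof
    fix w assume "w \<in> A - E"
    then have w: "w \<in> A" "\<rho> w \<noteq> 1" by (simp_all add: E_def)
    obtain e where e: "e > 0" "ball w e \<subseteq> A" "\<forall>w'\<in>ball w e. \<rho> w' = \<rho> w" using loc[OF w(1)] by blast
    have "ball w e \<subseteq> A - E" unfolding E_def using e(2,3) w(2) by (simp add: subset_eq)
    then show "\<exists>e>0. ball w e \<subseteq> A - E" using e(1) by blast
  qed
  moreover have "E \<inter> (A - E) \<inter> A = {}" "A \<subseteq> E \<union> (A - E)" "E \<inter> A = E" "(A - E) \<inter> A = A - E" unfolding E_def by blast+
  ultimately have "E = {} \<or> A - E = {}"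
    using connectedD[OF cA, of E "A - E"] by argo
  then have "A \<subseteq> E" using one by (auto simp: E_def)
  moreover have "z \<in> A" using z unfolding A_def V_plus_def mem_Times_iff by auto
  ultimately have "\<rho> z = 1" by (auto simp: E_def)
  then show ?thesis using phi_plus_nz[OF z(1)] by (simp add: \<rho>_def)
qed

lemma plus_branch_US:
  assumes z: "z \<in> US"
  obtains V where "plus_branch p \<alpha> a V Phi" "z \<in> V" "V \<subseteq> US"
proof -
  obtain n where n: "z \<in> W n" using W_ex[of z] z by (auto simp: US_def)
  have WU: "W n \<subseteq> US" using W_sub(2)[of n] by (auto simp: US_def W_def)
  have "\<forall>z\<in>W n. (f ^^ n) z \<in> Vp \<and> Phi z ^ (degree p ^ n) = phi_plus p a ((f ^^ n) z)"
    using Phi_F[of _ n] unfolding degree_p F_def by (auto simp: W_def)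
  then have "plus_branch p \<alpha> a (W n) Phi"
    unfolding plus_branch_def using open_W W_sub(2) hol2_on_subset[OF Phi_hol WU] by blast
  then show ?thesis using that n WU by blast
qed

end

section \<open>Analytic subsets and parametrized curves\<close>

lemma analytic_subsetD:
  assumes "analytic_subset D A"
  shows "A \<subseteq> D"
    and "z \<in> D \<Longrightarrow> \<exists>W Fs. open W \<and> z \<in> W \<and> W \<subseteq> D \<and> finite Fs \<and> (\<forall>F\<in>Fs. hol2_on F W) \<and>
        A \<inter> W = {z' \<in> W. \<forall>F\<in>Fs. F z' = 0}"
  using assms unfolding analytic_subset_def by blast+

text \<open>S0 and S1 cut the same part out of A, so this part is open and closed in A; near any
  point of D either the old equations or the constant 1 describe it.\<close>

lemma analytic_subset_clopen:
  assumes A: "analytic_subset D A" and S0: "open S0" and S1: "closed S1"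
    and eq: "A \<inter> S0 = A \<inter> S1"
  shows "analytic_subset D (A \<inter> S0)" "analytic_subset D (A - S0)"
proof -
  note AD = analytic_subsetD(1)[OF A]
  have loc: "\<exists>W. open W \<and> z \<in> W \<and> W \<subseteq> D \<and>
     (\<exists>Fs. finite Fs \<and> (\<forall>F\<in>Fs. hol2_on F W) \<and> A \<inter> W = {z' \<in> W. \<forall>F\<in>Fs. F z' = 0}) \<and>
     (A \<inter> W \<subseteq> S0 \<or> A \<inter> W \<inter> S0 = {})" if z: "z \<in> D" for z
  proof -
    obtain W Fs where W: "open W" "z \<in> W" "W \<subseteq> D" "finite Fs" "\<forall>F\<in>Fs. hol2_on F W"
        "A \<inter> W = {z' \<in> W. \<forall>F\<in>Fs. F z' = 0}"
      using analytic_subsetD(2)[OF A z] by blast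
    show ?thesis
    proof (cases "z \<in> S1")
      case False
      have "open (W - S1)" using W(1) S1 by (rule open_Diff)
      moreover have "\<forall>F\<in>Fs. hol2_on F (W - S1)" using W(5) hol2_on_subset[of _ W "W - S1"] by blast
      moreover have "A \<inter> (W - S1) = {z' \<in> W - S1. \<forall>F\<in>Fs. F z' = 0}" using W(6) by blast
      moreover have "A \<inter> (W - S1) \<inter> S0 = {}" using eq by blast
      ultimately show ?thesis using W(2,3,4) False by (intro exI[of _ "W - S1"]) blast
    next
      case True
      show ?thesis
      proof (cases "z \<in> S0")
        case True
        have "open (W \<inter> S0)" using W(1) S0 by (rule open_Int)
        moreover have "\<forall>F\<in>Fs. hol2_on F (W \<inter> S0)" using W(5) hol2_on_subset[of _ W "W \<inter> S0"] by blast
        moreover have "A \<inter> (W \<inter> S0) = {z' \<in> W \<inter> S0. \<forall>F\<in>Fs. F z' = 0}" using W(6) by blast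
        ultimately show ?thesis using W(2,3,4) True by (intro exI[of _ "W \<inter> S0"]) blast
      next
        case F: False
        \<comment> \<open>On S1 outside S0 there are no points of A, so some defining function is
          nonzero at z and A avoids a whole neighbourhood.\<close>
        then have "z \<notin> A" using eq True by blast
        then obtain F where F: "F \<in> Fs" "F z \<noteq> 0" using W(2,6) by blast
        have "isCont F z" by (rule hol2_imp_isCont[of F W]) (use W(2,5) F in blast)+
        then have "eventually (\<lambda>w. F w \<noteq> 0) (nhds z)"
          using tendsto_imp_eventually_ne[of F "F z" "nhds z" 0] F(2)
          by (simp add: isCont_def tendsto_at_iff_tendsto_nhds)
        then obtain V where V: "open V" "z \<in> V" "\<And>w. w \<in> V \<Longrightarrow> F w \<noteq> 0" unfolding eventually_nhds by blast
        have "open (W \<inter> V)" using W(1) V(1) by (rule open_Int)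
        moreover have "\<forall>F\<in>Fs. hol2_on F (W \<inter> V)" using W(5) hol2_on_subset[of _ W "W \<inter> V"] by blast
        moreover have "A \<inter> (W \<inter> V) = {z' \<in> W \<inter> V. \<forall>F\<in>Fs. F z' = 0}" using W(6) by blast
        moreover have "A \<inter> (W \<inter> V) \<inter> S0 = {}" using W(6) V(3) F(1) by blast
        ultimately show ?thesis using W(2,3,4) V(2) by (intro exI[of _ "W \<inter> V"]) blast
      qed
    qed
  qed
  have one: "hol2_on (\<lambda>_. 1) W" "hol2_on (\<lambda>_. 1) W \<and> {} = {z'\<in>W. (\<lambda>_. 1 :: complex) z' = 0}" for W
    using hol2_const by auto
  have *: "analytic_subset D (A \<inter> Q)" if Q: "\<And>z W. A \<inter> W \<subseteq> S0 \<or> A \<inter> W \<inter> S0 = {} \<Longrightarrow> A \<inter> Q \<inter> W = A \<inter> W \<or> A \<inter> Q \<inter> W = {}" for Q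
    unfolding analytic_subset_def
  proof (intro conjI ballI)
    show "A \<inter> Q \<subseteq> D" using AD by blast
    fix z assume z: "z \<in> D"
    obtain W Fs where W: "open W" "z \<in> W" "W \<subseteq> D" "finite Fs" "\<forall>F\<in>Fs. hol2_on F W" "A \<inter> W = {z' \<in> W. \<forall>F\<in>Fs. F z' = 0}"
      "A \<inter> W \<subseteq> S0 \<or> A \<inter> W \<inter> S0 = {}" using loc[OF z] by blast
    consider "A \<inter> Q \<inter> W = A \<inter> W" | "A \<inter> Q \<inter> W = {}" using Q[OF W(7)] by blast
    then show "\<exists>W Fs. open W \<and> z \<in> W \<and> W \<subseteq> D \<and> finite Fs \<and> (\<forall>F\<in>Fs. hol2_on F W) \<and>
        A \<inter> Q \<inter> W = {z' \<in> W. \<forall>F\<in>Fs. F z' = 0}"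
    proof cases
      case 1
      then show ?thesis using W(1-6) by (intro exI[of _ W] exI[of _ Fs]) simp
    next
      case 2
      then show ?thesis using W(1-3) one(1)[of W] by (intro exI[of _ W] exI[of _ "{\<lambda>_. 1}"]) simp
    qed
  qed
  show "analytic_subset D (A \<inter> S0)" by (rule *) blast
  have "analytic_subset D (A \<inter> - S0)" by (rule *) blast
  then show "analytic_subset D (A - S0)" by (simp add: Diff_eq)
qed

lemma irreducible_clopen:
  assumes A: "irreducible_analytic D A" and S: "open S0" "closed S1" "A \<inter> S0 = A \<inter> S1" and ne: "A \<inter> S0 \<noteq> {}"
  shows "A \<subseteq> S0"
proof -
  have an: "analytic_subset D A" using A by (simp add: irreducible_analytic_def)
  note B = analytic_subset_clopen[OF an S]
  have "A = (A \<inter> S0) \<union> (A - S0)" by blast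
  then have "A = A \<inter> S0 \<or> A = A - S0" using A B unfolding irreducible_analytic_def by blast
  then show ?thesis using ne by blast
qed

text \<open>Defining functions pulled back to the curve are holomorphic in one variable: all vanish
  near t, or one of them has at most an isolated zero there.\<close>

lemma analytic_along_curve:
  assumes B: "analytic_subset D B" and T: "open T" "t \<in> T"
    and g: "g1 holomorphic_on T" "g2 holomorphic_on T" "(g1 t, g2 t) \<in> D"
  shows "(\<forall>\<^sub>F s in nhds t. (g1 s, g2 s) \<in> B) \<or> (\<forall>\<^sub>F s in at t. (g1 s, g2 s) \<notin> B)"
proof -
  obtain W Fs where W: "open W" "(g1 t, g2 t) \<in> W" "W \<subseteq> D" "finite Fs" "\<forall>F\<in>Fs. hol2_on F W"
      "B \<inter> W = {z' \<in> W. \<forall>F\<in>Fs. F z' = 0}"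
    using analytic_subsetD(2)[OF B g(3)] by blast
  have c: "continuous_on T (\<lambda>s. (g1 s, g2 s))"
    using g(1,2) by (intro continuous_on_Pair holomorphic_on_imp_continuous_on)
  have "open (T \<inter> (\<lambda>s. (g1 s, g2 s)) -` W)" using continuous_on_open_vimage[OF T(1)] c W(1) by (metis Int_commute)
  then obtain e where e: "e > 0" "ball t e \<subseteq> T \<inter> (\<lambda>s. (g1 s, g2 s)) -` W"
    using W(2) T(2) open_contains_ball[of "T \<inter> (\<lambda>s. (g1 s, g2 s)) -` W"] by blast
  have inW: "(g1 s, g2 s) \<in> W" "s \<in> T" if "s \<in> ball t e" for s using e(2) that by blast+
  have evb: "\<forall>\<^sub>F s in nhds t. s \<in> ball t e" using e(1) by (intro eventually_nhds_in_open) auto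
  show ?thesis
  proof (cases "\<forall>F\<in>Fs. \<forall>s\<in>ball t e. F (g1 s, g2 s) = 0")
    case True
    then have "(g1 s, g2 s) \<in> B" if "s \<in> ball t e" for s using W(6) inW[OF that] that by blast
    then show ?thesis using evb by (auto elim: eventually_mono)
  next
    case False
    then obtain F s0 where F: "F \<in> Fs" "s0 \<in> ball t e" "F (g1 s0, g2 s0) \<noteq> 0" by blast
    have hF: "(\<lambda>s. F (g1 s, g2 s)) holomorphic_on ball t e"
    proof (rule hol2_compose_curve[of F W])
      show "hol2_on F W" using W(5) F(1) by blast
      show "g1 holomorphic_on ball t e" "g2 holomorphic_on ball t e"
        using g(1,2) inW(2) holomorphic_on_subset[of _ T "ball t e"] by blast+
    qed (use inW in auto)
    have "\<forall>\<^sub>F s in at t. F (g1 s, g2 s) \<noteq> 0"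
    proof (cases "F (g1 t, g2 t) = 0")
      case True
      obtain r where r: "0 < r" "ball t r \<subseteq> ball t e" "\<And>z. z \<in> ball t r - {t} \<Longrightarrow> F (g1 z, g2 z) \<noteq> 0"
        using isolated_zeros[OF hF open_ball connected_ball _ _ F(2,3), of t] True e(1) by auto
      then show ?thesis unfolding eventually_at by (intro exI[of _ r]) (auto simp: dist_commute)
    next
      case False
      have "isCont (\<lambda>s. F (g1 s, g2 s)) t"
        using holomorphic_on_imp_continuous_on[OF hF] e(1) continuous_on_eq_continuous_at[OF open_ball] by force
      then show ?thesis using tendsto_imp_eventually_ne[of "\<lambda>s. F (g1 s, g2 s)" _ "at t" 0] False by (simp add: isCont_def)
    qed
    moreover have "\<forall>\<^sub>F s in at t. s \<in> ball t e" using evb by (simp add: eventually_nhds_conv_at)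
    ultimately have "\<forall>\<^sub>F s in at t. (g1 s, g2 s) \<notin> B"
    proof eventually_elim
      case (elim s)
      then show ?case using W(6) inW(1)[of s] F(1) by blast
    qed
    then show ?thesis by blast
  qed
qed

text \<open>The parameters where B contains the curve locally form an open set, and so do those
  where B is met at most in isolated points. Connectedness of T makes one of them
  everything.\<close>

lemma irreducible_curve:
  assumes T: "open T" "connected T" "T \<noteq> {}" and g: "g1 holomorphic_on T" "g2 holomorphic_on T"
    and H: "H = (\<lambda>t. (g1 t, g2 t)) ` T" and an: "analytic_subset D H"
  shows "irreducible_analytic D H"
  unfolding irreducible_analytic_def
proof (intro conjI allI impI)
  show "analytic_subset D H" by (rule an)
  show "H \<noteq> {}" using T(3) H by blast
  fix B C assume B: "analytic_subset D B" and C: "analytic_subset D C" and BC: "H = B \<union> C"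
  have gD: "(g1 t, g2 t) \<in> D" if "t \<in> T" for t using that H analytic_subsetD(1)[OF an] by blast
  define E where "E = (\<lambda>B. {t \<in> T. \<forall>\<^sub>F s in nhds t. (g1 s, g2 s) \<in> B})"
  have full: "H \<subseteq> B" if B: "analytic_subset D B" and "E B \<noteq> {}" for B
  proof -
    define N where "N = {t \<in> T. \<forall>\<^sub>F s in at t. (g1 s, g2 s) \<notin> B}"
    have "E B = T \<inter> interior {s. (g1 s, g2 s) \<in> B}"
      unfolding E_def interior_def eventually_nhds by blast
    then have oE: "open (E B)" using T(1) by auto
    have oN: "open N"
      unfolding open_contains_ball[of N]
    proof
      fix t assume "t \<in> N"
      then have t: "t \<in> T" "\<forall>\<^sub>F s in at t. (g1 s, g2 s) \<notin> B" by (auto simp: N_def)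
      obtain e1 where e1: "e1 > 0" "ball t e1 \<subseteq> T" using T(1) t(1) open_contains_ball[of T] by blast
      obtain e2 where e2: "e2 > 0" "\<And>s. s \<noteq> t \<Longrightarrow> dist s t < e2 \<Longrightarrow> (g1 s, g2 s) \<notin> B"
        using t(2) unfolding eventually_at by auto
      have "ball t (min e1 e2) \<subseteq> N"
      proof
        fix s assume s: "s \<in> ball t (min e1 e2)"
        have sT: "s \<in> T" using s e1(2) by auto
        show "s \<in> N"
        proof (cases "s = t")
          case True then show ?thesis using \<open>t \<in> N\<close> by simp
        next
          case False
          have "open (ball t e2 - {t})" by (intro open_Diff) auto
          moreover have "s \<in> ball t e2 - {t}" using s False by simp
          ultimately have "\<forall>\<^sub>F s' in nhds s. s' \<in> ball t e2 - {t}" by (rule eventually_nhds_in_open)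
          then have "\<forall>\<^sub>F s' in nhds s. (g1 s', g2 s') \<notin> B"
            by (rule eventually_mono) (use e2(2) in \<open>auto simp: dist_commute\<close>)
          then show ?thesis using sT by (simp add: N_def eventually_nhds_conv_at)
        qed
      qed
      then show "\<exists>e>0. ball t e \<subseteq> N" using e1(1) e2(1) by (intro exI[of _ "min e1 e2"]) simp
    qed
    have cov: "T \<subseteq> E B \<union> N"
      using analytic_along_curve[OF B T(1) _ g gD] unfolding E_def N_def by blast
    have dis: "E B \<inter> N \<inter> T = {}"
    proof -
      have False if "\<forall>\<^sub>F s in nhds t. (g1 s, g2 s) \<in> B" "\<forall>\<^sub>F s in at t. (g1 s, g2 s) \<notin> B" for t
      proof -
        have "\<forall>\<^sub>F s in at t. (g1 s, g2 s) \<in> B" using that(1) by (simp add: eventually_nhds_conv_at)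
        with that(2) have "\<forall>\<^sub>F s in at t. False" by eventually_elim blast
        then show False by simp
      qed
      then show ?thesis unfolding E_def N_def by blast
    qed
    have "N \<inter> T = {}" using connectedD[OF T(2) oE oN dis cov] that(2) by (auto simp: E_def)
    then have TE: "T \<subseteq> E B" using cov by blast
    show "H \<subseteq> B"
    proof
      fix z assume "z \<in> H"
      then obtain t where t: "t \<in> T" "z = (g1 t, g2 t)" unfolding H by blast
      then have "\<forall>\<^sub>F s in nhds t. (g1 s, g2 s) \<in> B" using TE by (auto simp: E_def)
      then show "z \<in> B" unfolding t(2) by (rule eventually_nhds_x_imp_x)
    qed
  qed
  obtain t where t: "t \<in> T" using T(3) by blast
  \<comment> \<open>Otherwise punctured neighbourhoods of t would be mapped outside both B and C,
    although the curve lies in their union.\<close>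
  have "t \<in> E B \<or> t \<in> E C"
  proof (rule ccontr)
    assume "\<not> ?thesis"
    then have "\<forall>\<^sub>F s in at t. (g1 s, g2 s) \<notin> B" "\<forall>\<^sub>F s in at t. (g1 s, g2 s) \<notin> C"
      using analytic_along_curve[OF B T(1) t g gD[OF t]] analytic_along_curve[OF C T(1) t g gD[OF t]] t
      by (auto simp: E_def)
    moreover have "\<forall>\<^sub>F s in at t. s \<in> T" using eventually_nhds_in_open[OF T(1) t] by (simp add: eventually_nhds_conv_at)
    ultimately have "\<forall>\<^sub>F s in at t. False"
    proof eventually_elim
      case (elim s)
      then have "(g1 s, g2 s) \<in> H" unfolding H by blast
      then show ?case using BC elim by blast
    qed
    then show False by simp
  qed
  then show "H = B \<or> H = C" using full[OF B] full[OF C] BC by blast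
qed

lemma biholomorphismI:
  assumes "smooth_curve H" "open T" and H: "H = \<gamma> ` T" and inv: "\<And>t. t \<in> T \<Longrightarrow> \<Phi> (\<gamma> t) = t"
    and "curve_holomorphic \<Phi> H"
    and hol: "(\<lambda>t. fst (\<gamma> t)) holomorphic_on T" "(\<lambda>t. snd (\<gamma> t)) holomorphic_on T"
  shows "biholomorphism H T \<Phi>"
proof -
  have bij: "bij_betw \<Phi> H T"
    unfolding H by (rule bij_betw_byWitness[of _ \<gamma>]) (use inv in auto)
  have eq: "inv_into H \<Phi> t = \<gamma> t" if "t \<in> T" for t
    using inv_into_f_f[OF bij_betw_imp_inj_on[OF bij], of "\<gamma> t"] inv[OF that] that H by simp
  have "(\<lambda>t. fst (inv_into H \<Phi> t)) holomorphic_on T" "(\<lambda>t. snd (inv_into H \<Phi> t)) holomorphic_on T"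
    by (rule holomorphic_transform[OF hol(1)], simp add: eq) (rule holomorphic_transform[OF hol(2)], simp add: eq)
  then show ?thesis using assms(1,2,5) bij unfolding biholomorphism_def by blast
qed

section \<open>Perturbations of a simple zero\<close>

text \<open>Later applied with P = p', so P'(c) is p''(c). The bound 1/4 is half of the contraction
  constant 1/2; the perturbation takes 1/8 of the rest.\<close>

locale simple_zero =
  fixes P :: "complex poly" and c :: complex and \<delta> :: real
  assumes P_c: "poly P c = 0" and P'_c: "poly (pderiv P) c \<noteq> 0" and delta_pos: "\<delta> > 0"
    and quad: "\<And>y. norm (y - c) < 2 * \<delta> \<Longrightarrow> norm (1 - poly (pderiv P) y / poly (pderiv P) c) \<le> 1 / 4"
begin

text \<open>The factor 1/8 bounds the derivative of h by |P'(c)|/8 after Cauchy on discs of radius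
  \<delta>, and moves c by at most \<delta>/8.\<close>

definition pert :: "(complex \<Rightarrow> complex) \<Rightarrow> bool" where
  "pert h \<longleftrightarrow> h holomorphic_on ball c (2 * \<delta>) \<and>
     (\<forall>y \<in> ball c (2 * \<delta>). norm (h y) \<le> norm (poly (pderiv P) c) * \<delta> / 8)"

text \<open>Newton's map with the derivative frozen at c, for which a contraction estimate is
  immediate.\<close>

definition nw :: "(complex \<Rightarrow> complex) \<Rightarrow> complex \<Rightarrow> complex" where
  "nw h y = y - (poly P y + h y) / poly (pderiv P) c"

lemma nw_fix_iff: "nw h y = y \<longleftrightarrow> poly P y + h y = 0"
  using P'_c by (simp add: nw_def)

lemma nw_contracts:
  assumes h: "pert h" and y: "y \<in> ball c \<delta>" "y' \<in> ball c \<delta>"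
  shows "norm (nw h y - nw h y') \<le> 1 / 2 * norm (y - y')"
proof (rule field_differentiable_bound[OF convex_ball _ _ y])
  define A where "A = poly (pderiv P) c"
  have A: "norm A > 0" using P'_c by (simp add: A_def)
  fix z assume z: "z \<in> ball c \<delta>"
  have z2: "z \<in> ball c (2 * \<delta>)" using z delta_pos by simp
  have hh: "h holomorphic_on ball c (2 * \<delta>)" using h by (simp add: pert_def)
  have dh: "(h has_field_derivative deriv h z) (at z)"
    by (rule holomorphic_derivI[OF hh open_ball z2])
  show "(nw h has_field_derivative (1 - (poly (pderiv P) z + deriv h z) / A)) (at z within ball c \<delta>)"
    unfolding nw_def[abs_def] A_def[symmetric]
    by (rule has_field_derivative_at_within)
       (intro DERIV_diff DERIV_ident DERIV_cdivide DERIV_add poly_DERIV dh)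
  have sub: "ball z \<delta> \<subseteq> ball c (2 * \<delta>)"
  proof
    fix w assume "w \<in> ball z \<delta>"
    then show "w \<in> ball c (2 * \<delta>)" using z dist_triangle[of c w z] by simp
  qed
  have "norm (deriv h z) \<le> (norm A * \<delta> / 8) / \<delta>"
  proof (rule deriv_bound_ball[OF _ delta_pos])
    show "h holomorphic_on ball z \<delta>" using hh sub by (rule holomorphic_on_subset)
    show "norm (h w) \<le> norm A * \<delta> / 8" if "w \<in> ball z \<delta>" for w
      using h that sub unfolding pert_def A_def by blast
  qed
  then have d: "norm (deriv h z) \<le> norm A / 8" using delta_pos by simp
  have "1 - (poly (pderiv P) z + deriv h z) / A = (1 - poly (pderiv P) z / A) - deriv h z / A"
    by (simp add: add_divide_distrib)
  also have "norm \<dots> \<le> norm (1 - poly (pderiv P) z / A) + norm (deriv h z / A)" by (rule norm_triangle_ineq4)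
  also have "norm (1 - poly (pderiv P) z / A) \<le> 1 / 4"
    unfolding A_def using z2 by (intro quad) (simp add: dist_norm norm_minus_commute)
  also have "norm (deriv h z / A) \<le> 1 / 8" using d A by (simp add: norm_divide field_simps)
  finally show "norm (1 - (poly (pderiv P) z + deriv h z) / A) \<le> 1 / 2" by simp
qed

lemma nw_c:
  assumes "pert h"
  shows "norm (nw h c - c) \<le> \<delta> / 8"
proof -
  have "norm (h c) \<le> norm (poly (pderiv P) c) * \<delta> / 8" using assms delta_pos by (simp add: pert_def)
  then show ?thesis using P'_c by (simp add: nw_def P_c norm_divide field_simps)
qed

lemma nw_cball:
  assumes h: "pert h" and y: "y \<in> cball c (\<delta> / 2)"
  shows "nw h y \<in> cball c (\<delta> / 2)"
proof -
  have "norm (nw h y - nw h c) \<le> 1 / 2 * norm (y - c)"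
    using y delta_pos by (intro nw_contracts[OF h]) auto
  then have "norm (nw h y - c) \<le> 1 / 2 * norm (y - c) + \<delta> / 8"
    using nw_c[OF h] norm_triangle_ineq[of "nw h y - nw h c" "nw h c - c"] by simp
  then show ?thesis using y delta_pos by (simp add: dist_norm norm_minus_commute)
qed

lemma pert_zero_ex:
  assumes h: "pert h"
  obtains y where "y \<in> cball c (\<delta> / 2)" "poly P y + h y = 0"
proof -
  have "\<exists>!y. y \<in> cball c (\<delta> / 2) \<and> nw h y = y"
  proof (rule Banach_fix[of "cball c (\<delta> / 2)" "1 / 2" "nw h"])
    show "complete (cball c (\<delta> / 2))" by (simp add: complete_eq_closed)
    show "cball c (\<delta> / 2) \<noteq> {}" using delta_pos by auto
    show "nw h ` cball c (\<delta> / 2) \<subseteq> cball c (\<delta> / 2)" using nw_cball[OF h] by blast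
    show "dist (nw h x) (nw h y) \<le> 1 / 2 * dist x y" if "x \<in> cball c (\<delta> / 2)" "y \<in> cball c (\<delta> / 2)" for x y
      unfolding dist_norm using that delta_pos by (intro nw_contracts[OF h]) auto
  qed auto
  then show ?thesis using that nw_fix_iff[of h] by blast
qed

lemma pert_zero_unique:
  assumes h: "pert h" and y: "norm (y - c) < \<delta>" "poly P y + h y = 0" and y': "norm (y' - c) < \<delta>" "poly P y' + h y' = 0"
  shows "y = y'"
proof -
  have "norm (nw h y - nw h y') \<le> 1 / 2 * norm (y - y')"
    using y(1) y'(1) by (intro nw_contracts[OF h]) (auto simp: dist_norm norm_minus_commute)
  then show ?thesis using nw_fix_iff[of h y] nw_fix_iff[of h y'] y(2) y'(2) by simp
qed

text \<open>Since P(c) = 0, one Newton step moves c only by h(c)/P'(c). Small h at the single point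
  c thus locates the zero, which is what the asymptotics at infinity need.\<close>

lemma pert_zero_dist:
  assumes h: "pert h" and y: "norm (y - c) < \<delta>" "poly P y + h y = 0"
  shows "norm (y - c) \<le> 2 * norm (h c) / norm (poly (pderiv P) c)"
proof -
  have "norm (nw h y - nw h c) \<le> 1 / 2 * norm (y - c)"
    using y(1) delta_pos by (intro nw_contracts[OF h]) (auto simp: dist_norm norm_minus_commute)
  moreover have "norm (nw h c - c) = norm (h c) / norm (poly (pderiv P) c)" by (simp add: nw_def P_c norm_divide)
  moreover have "norm (y - c) \<le> norm (nw h y - nw h c) + norm (nw h c - c)"
    using nw_fix_iff[of h y] y(2) norm_triangle_ineq[of "nw h y - nw h c" "nw h c - c"] by simp
  ultimately show ?thesis by simp
qed

text \<open>The Newton iterates starting at c are holomorphic in t and converge at the rate (1/2)^n,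
  the same for all t; so the zero depends holomorphically on t.\<close>

lemma pert_zero_holomorphic:
  assumes T: "open T" and h2: "hol2_on h (T \<times> ball c (2 * \<delta>))" and h: "\<And>t. t \<in> T \<Longrightarrow> pert (\<lambda>y. h (t, y))"
  obtains Y where "Y holomorphic_on T" "\<And>t. t \<in> T \<Longrightarrow> norm (Y t - c) \<le> \<delta> / 2"
    "\<And>t y. t \<in> T \<Longrightarrow> norm (y - c) < \<delta> \<Longrightarrow> poly P y + h (t, y) = 0 \<longleftrightarrow> y = Y t"
proof -
  have "\<exists>y. t \<in> T \<longrightarrow> y \<in> cball c (\<delta> / 2) \<and> poly P y + h (t, y) = 0" for t
    using pert_zero_ex[OF h, of t] by blast
  then obtain Y where Y: "\<And>t. t \<in> T \<Longrightarrow> Y t \<in> cball c (\<delta> / 2) \<and> poly P (Y t) + h (t, Y t) = 0" by metis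
  have Yc: "norm (Y t - c) \<le> \<delta> / 2" if "t \<in> T" for t using Y[OF that] by (simp add: dist_norm norm_minus_commute)
  define I where "I = (\<lambda>n. ((\<lambda>u t. nw (\<lambda>y. h (t, y)) (u t)) ^^ n) (\<lambda>_. c))"
  have I0: "I 0 t = c" and IS: "I (Suc n) t = nw (\<lambda>y. h (t, y)) (I n t)" for n t by (simp_all add: I_def)
  have Ic: "I n t \<in> cball c (\<delta> / 2)" if "t \<in> T" for n t
    by (induction n) (use delta_pos nw_cball[OF h[OF that]] in \<open>auto simp: I0 IS simp del: mem_cball\<close>)
  have Ih: "I n holomorphic_on T" for n
  proof (induction n)
    case 0
    have "I 0 = (\<lambda>_. c)" using I0 by blast
    then show ?case by simp
  next
    case (Suc n)
    have "(\<lambda>t. h (t, I n t)) holomorphic_on T"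
    proof (rule hol2_compose_curve[OF h2 _ Suc T])
      show "(\<lambda>t. t) holomorphic_on T" by (rule holomorphic_on_ident)
      show "(t, I n t) \<in> T \<times> ball c (2 * \<delta>)" if "t \<in> T" for t using Ic[OF that, of n] that delta_pos by simp
    qed
    then have "(\<lambda>t. I n t - (poly P (I n t) + h (t, I n t)) / poly (pderiv P) c) holomorphic_on T"
      using Suc P'_c by (intro holomorphic_intros) auto
    moreover have "I (Suc n) = (\<lambda>t. I n t - (poly P (I n t) + h (t, I n t)) / poly (pderiv P) c)"
      by (rule ext) (simp add: IS nw_def)
    ultimately show ?case by simp
  qed
  have bd: "norm (I n t - Y t) \<le> \<delta> * (1 / 2) ^ n" if t: "t \<in> T" for n t
  proof (induction n)
    case 0
    have "norm (c - Y t) \<le> \<delta> / 2" using Yc[OF t] by (simp add: norm_minus_commute)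
    then show ?case using delta_pos by (simp add: I0)
  next
    case (Suc n)
    have "norm (nw (\<lambda>y. h (t, y)) (I n t) - nw (\<lambda>y. h (t, y)) (Y t)) \<le> 1 / 2 * norm (I n t - Y t)"
      using Ic[OF t, of n] Y[OF t] delta_pos by (intro nw_contracts[OF h[OF t]]) auto
    moreover have "nw (\<lambda>y. h (t, y)) (Y t) = Y t" using Y[OF t] nw_fix_iff[of "\<lambda>y. h (t, y)" "Y t"] by simp
    ultimately show ?case using Suc by (simp add: IS)
  qed
  have "Y holomorphic_on T"
  proof (rule holomorphic_uniform_sequence[OF T Ih])
    fix t assume t: "t \<in> T"
    obtain e where e: "e > 0" "cball t e \<subseteq> T" using T t open_contains_cball[of T] by blast
    have "uniform_limit (cball t e) I Y sequentially"
      unfolding uniform_limit_iff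
    proof (intro allI impI)
      fix \<epsilon> :: real assume \<epsilon>: "\<epsilon> > 0"
      have "(\<lambda>n. \<delta> * (1 / 2) ^ n) \<longlonglongrightarrow> \<delta> * 0" by (intro tendsto_intros LIMSEQ_power_zero) auto
      then have "\<forall>\<^sub>F n in sequentially. \<delta> * (1 / 2) ^ n < \<epsilon>" using \<epsilon> by (intro order_tendstoD(2)) auto
      then show "\<forall>\<^sub>F n in sequentially. \<forall>s\<in>cball t e. dist (I n s) (Y s) < \<epsilon>"
      proof (rule eventually_mono, intro ballI)
        fix n s assume n: "\<delta> * (1 / 2) ^ n < \<epsilon>" and s: "s \<in> cball t e"
        show "dist (I n s) (Y s) < \<epsilon>" unfolding dist_norm using bd[of s n] s e(2) n by (meson le_less_trans subsetD)
      qed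
    qed
    then show "\<exists>d>0. cball t d \<subseteq> T \<and> uniform_limit (cball t d) I Y sequentially" using e by blast
  qed
  moreover have "poly P y + h (t, y) = 0 \<longleftrightarrow> y = Y t" if t: "t \<in> T" and y: "norm (y - c) < \<delta>" for t y
  proof -
    have "norm (Y t - c) < \<delta>" using Yc[OF t] delta_pos by simp
    then show ?thesis using pert_zero_unique[OF h[OF t] y _ _, of "Y t"] Y[OF t] by blast
  qed
  ultimately show ?thesis using that[of Y] Yc by blast
qed

end

section \<open>The primary horizontal component\<close>

text \<open>The signs of the two reciprocals cancel; the remaining sign and the factor 1/v^2 come
  from dx = -du/u^2.\<close>

lemma wedge_inverse_chart:
  assumes F: "hol2_on F W" and G: "hol2_on G W" and z: "(1 / v, y) \<in> W" and v: "v \<noteq> 0"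
    and nz: "F (1 / v, y) \<noteq> 0" "G (1 / v, y) \<noteq> 0"
  shows "wedge (\<lambda>(s, t). inverse (F (1 / s, t))) (\<lambda>(s, t). inverse (G (1 / s, t))) (v, y) =
    - wedge F G (1 / v, y) / (v\<^sup>2 * (F (1 / v, y))\<^sup>2 * (G (1 / v, y))\<^sup>2)"
proof -
  have D: "deriv (\<lambda>t. inverse (F (1 / t, y))) v = d1 F (1 / v, y) / (v\<^sup>2 * (F (1 / v, y))\<^sup>2)"
    "deriv (\<lambda>t. inverse (F (1 / v, t))) y = - d2 F (1 / v, y) / (F (1 / v, y))\<^sup>2"
    if F: "hol2_on F W" and nz: "F (1 / v, y) \<noteq> 0" for F
  proof -
    have "((\<lambda>t. 1 / t) has_field_derivative (- 1 / v\<^sup>2)) (at v)"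
      using v by (auto intro!: derivative_eq_intros simp: power2_eq_square)
    then have "((\<lambda>t. F (1 / t, y)) has_field_derivative d1 F (1 / v, y) * (- 1 / v\<^sup>2)) (at v)"
      by (rule DERIV_chain2[of "\<lambda>s. F (s, y)" _ "\<lambda>t. 1 / t", OF hol2_d1[OF F z]])
    from DERIV_inverse_fun[OF this nz]
    show "deriv (\<lambda>t. inverse (F (1 / t, y))) v = d1 F (1 / v, y) / (v\<^sup>2 * (F (1 / v, y))\<^sup>2)"
      using v nz by (intro DERIV_imp_deriv) (simp add: field_simps power2_eq_square)
    from DERIV_inverse_fun[OF hol2_d2[OF F z] nz]
    show "deriv (\<lambda>t. inverse (F (1 / v, t))) y = - d2 F (1 / v, y) / (F (1 / v, y))\<^sup>2"
      using nz by (intro DERIV_imp_deriv) (simp add: field_simps power2_eq_square)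
  qed
  have e: "d1 (\<lambda>(s, t). inverse (F (1 / s, t))) (v, y) = deriv (\<lambda>t. inverse (F (1 / t, y))) v"
    "d2 (\<lambda>(s, t). inverse (F (1 / s, t))) (v, y) = deriv (\<lambda>t. inverse (F (1 / v, t))) y" for F
    by (simp_all add: d1_def d2_def)
  show ?thesis
    unfolding wedge_def e D[OF F nz(1)] D[OF G nz(2)] using v nz by (simp add: field_simps)
qed

text \<open>\<open>a_kappa\<close> puts the strip around c into \<open>Om\<close>. In
  \<open>a_delta\<close> the summand 2/m bounds the slope of the forward leaves and 12 C0/\<kappa>
  bounds \<open>kap\<close>; their sum meets the threshold in \<open>pert\<close>.\<close>

locale henon_crit = henon_trap p q d R r \<alpha> a L m + simple_zero "pderiv p" c \<delta>
  for p q d R r \<alpha> a L m c \<delta> +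
  fixes \<kappa> :: real
  assumes kappa_pos: "\<kappa> > 0" and c_strip: "norm c + 2 * \<delta> < \<alpha>"
    and far_L: "\<And>x y. norm (y - c) < 2 * \<delta> \<Longrightarrow> x \<notin> L \<Longrightarrow> \<kappa> \<le> norm (poly p y - x)"
    and a_le_1: "norm a \<le> 1" and a_kappa: "norm a * (4 * \<alpha> + 12 * C0) < \<kappa>"
    and a_delta: "norm a * (2 / m + 12 * C0 / \<kappa>) \<le> norm (poly (pderiv (pderiv p)) c) * \<delta> / 8"
begin

text \<open>The error term of the tangency equation: the slope of the forward foliation plus the
  deviation of the backward foliation from the fibres of p(y) - x.\<close>

definition ee :: "complex \<times> complex \<Rightarrow> complex" where "ee z = d2 Phi z / d1 Phi z + kap z"

text \<open>Zeros in the open strip S0 automatically lie in the closed strip S1. This pair shows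
  that the graph is open and closed in the critical locus.\<close>

definition S0 :: "(complex \<times> complex) set" where "S0 = {z. norm (snd z - c) < \<delta>}"

definition S1 :: "(complex \<times> complex) set" where "S1 = {z. norm (snd z - c) \<le> \<delta> / 2}"

lemma open_S0: "open S0"
  unfolding S0_def by (intro open_Collect_less continuous_intros)

lemma closed_S1: "closed S1"
  unfolding S1_def by (intro closed_Collect_le continuous_intros)

lemma S1_S0: "S1 \<subseteq> S0"
  using delta_pos by (auto simp: S0_def S1_def)

lemma strip_alpha: "norm (y - c) < 2 * \<delta> \<Longrightarrow> norm y < \<alpha>"
  using c_strip norm_triangle_ineq[of "y - c" c] by simp

lemma US_not_L: "z \<in> US \<Longrightarrow> fst z \<notin> L"
  using not_L[of z 0] by (simp add: US_def)

lemma US_far: "z \<in> US \<Longrightarrow> norm (snd z - c) < 2 * \<delta> \<Longrightarrow> \<kappa> \<le> norm (poly p (snd z) - fst z)"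
  using far_L[of "snd z" "fst z"] US_not_L[of z] by blast

lemma US_Om: "z \<in> US \<Longrightarrow> norm (snd z - c) < 2 * \<delta> \<Longrightarrow> z \<in> Om"
  using US_far[of z] strip_alpha[of "snd z"] a_kappa by (simp add: Om_def W0_def)

lemma ee_hol: "hol2_on ee (US \<inter> Om)"
proof -
  have "hol2_on (\<lambda>z. d2 Phi z / d1 Phi z) (US \<inter> Om)"
    by (rule hol2_divide) (use hol2_on_subset[OF hol2_d2_hol2[OF Phi_hol open_US]]
      hol2_on_subset[OF hol2_d1_hol2[OF Phi_hol open_US]] Phi_cone(1) in blast)+
  then have "hol2_on (\<lambda>z. d2 Phi z / d1 Phi z + kap z) (US \<inter> Om)"
    by (rule hol2_add) (rule hol2_on_subset[OF kap_hol], blast)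
  then show ?thesis by (simp add: ee_def[abs_def])
qed

lemma ee_bound:
  assumes z: "z \<in> US" "norm (snd z - c) < 2 * \<delta>"
  shows "norm (ee z) \<le> norm (poly (pderiv (pderiv p)) c) * \<delta> / 8"
proof -
  have A: "norm (d1 Phi z) > 0" using Phi_cone(1)[OF z(1)] by simp
  have "m / 2 \<le> norm (poly (pderiv p) (fst z)) - m / 2" using deriv_ge[OF US_not_L[OF z(1)]] by simp
  then have "norm (d2 Phi z) * (m / 2) \<le> norm (d2 Phi z) * (norm (poly (pderiv p) (fst z)) - m / 2)"
    by (intro mult_left_mono) auto
  then have "norm (d2 Phi z) * (m / 2) \<le> norm a * norm (d1 Phi z)" using Phi_cone(2)[OF z(1)] by simp
  then have 1: "norm (d2 Phi z / d1 Phi z) \<le> norm a * (2 / m)" using A m_pos by (simp add: norm_divide field_simps)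
  have "norm (kap z) \<le> 12 * C0 * norm a ^ 2 / norm (poly p (snd z) - fst z)" by (rule kap_bound[OF US_Om[OF z]])
  also have "\<dots> \<le> 12 * C0 * norm a ^ 2 / \<kappa>"
    using US_far[OF z] kappa_pos C0_nonneg by (intro divide_left_mono mult_pos_pos) auto
  also have "\<dots> \<le> 12 * C0 * norm a / \<kappa>"
  proof -
    have "norm a ^ 2 \<le> norm a" using a_le_1 by (simp add: power2_eq_square mult_left_le)
    then show ?thesis using kappa_pos C0_nonneg by (intro divide_right_mono mult_left_mono) auto
  qed
  finally have "norm (kap z) \<le> norm a * (12 * C0 / \<kappa>)" by (simp add: mult_ac)
  then have "norm (ee z) \<le> norm a * (2 / m) + norm a * (12 * C0 / \<kappa>)"
    unfolding ee_def using 1 norm_triangle_ineq[of "d2 Phi z / d1 Phi z" "kap z"] by simp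
  then show ?thesis using a_delta by (simp add: distrib_left)
qed

text \<open>\<open>G_wedge\<close> with the differential of Phi as covector: dividing by d1 Phi
  turns the wedge into a nonzero multiple of p'(y) + ee.\<close>

lemma tangency:
  assumes z: "z \<in> US" "norm (snd z - c) < 2 * \<delta>"
  shows "z \<in> crit_locus p \<alpha> a \<longleftrightarrow> poly (pderiv p) (snd z) + ee z = 0"
proof -
  note Om = US_Om[OF z]
  obtain V where V: "plus_branch p \<alpha> a V Phi" "z \<in> V" using plus_branch_US[OF z(1)] .
  obtain W \<psi> where W: "minus_branch p \<alpha> a W \<psi>" "z \<in> W"
    "d1 \<psi> z / \<psi> z = d1 G z / (of_nat d * G z)" "d2 \<psi> z / \<psi> z = d2 G z / (of_nat d * G z)"
    using minus_branch_Om[OF Om] by metis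
  obtain U where U: "U \<noteq> 0" "\<And>A B. A * d2 G z - B * d1 G z = U * (A * (poly (pderiv p) (snd z) + kap z) + B)"
    using G_wedge[OF Om] by metis
  have nz: "Phi z \<noteq> 0" "G z \<noteq> 0" "d1 Phi z \<noteq> 0" "of_nat d \<noteq> (0::complex)"
    using Phi_nz[OF z(1)] G_nz[OF Om] Phi_cone(1)[OF z(1)] d2 by auto
  have "w_crit p \<alpha> a z = dlog_wedge Phi \<psi> z" by (rule w_crit_eq[OF V(1) W(1) V(2) W(2)])
  also have "\<dots> = (d1 Phi z * d2 G z - d2 Phi z * d1 G z) / (Phi z * of_nat d * G z)"
    unfolding dlog_wedge_def W(3,4) using nz by (simp add: field_simps)
  also have "\<dots> = U * d1 Phi z * (poly (pderiv p) (snd z) + ee z) / (Phi z * of_nat d * G z)"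
    unfolding U(2) ee_def using nz by (simp add: field_simps)
  finally have "w_crit p \<alpha> a z = 0 \<longleftrightarrow> poly (pderiv p) (snd z) + ee z = 0" using nz U(1) by simp
  moreover have "z \<in> Up \<inter> Um" using z(1) Om Om_Um by (auto simp: US_def)
  ultimately show ?thesis by (simp add: crit_locus_def)
qed

lemma ex_Y:
  "\<exists>Y. Y holomorphic_on TT \<and> (\<forall>t\<in>TT. norm (Y t - c) \<le> \<delta> / 2) \<and>
    (\<forall>t\<in>TT. \<forall>y. norm (y - c) < \<delta> \<longrightarrow> (poly (pderiv p) y + ee (X (t, y), y) = 0 \<longleftrightarrow> y = Y t))"
proof -
  define h where "h = (\<lambda>w. ee (X w, snd w))"
  have sub: "TT \<times> ball c (2 * \<delta>) \<subseteq> TT \<times> ball 0 \<alpha>"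
    using strip_alpha by (auto simp: dist_norm norm_minus_commute)
  have inU: "(X (t, y), y) \<in> US" "norm (y - c) < 2 * \<delta>" if "t \<in> TT" "y \<in> ball c (2 * \<delta>)" for t y
  proof -
    show y: "norm (y - c) < 2 * \<delta>" using that(2) by (simp add: dist_norm norm_minus_commute)
    show "(X (t, y), y) \<in> US" by (rule X_US[OF that(1) strip_alpha[OF y]])
  qed
  have h2: "hol2_on h (TT \<times> ball c (2 * \<delta>))"
    unfolding h_def
  proof (rule hol2_compose2[OF ee_hol hol2_on_subset[OF X_hol sub] hol2_snd])
    fix w assume "w \<in> TT \<times> ball c (2 * \<delta>)"
    then obtain t y where w: "w = (t, y)" "t \<in> TT" "y \<in> ball c (2 * \<delta>)" by blast
    show "(X w, snd w) \<in> US \<inter> Om" unfolding w(1) using inU[OF w(2,3)] US_Om[of "(X (t, y), y)"] by simp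
  qed
  have oT: "open TT" by (simp add: open_Compl)
  have pt: "pert (\<lambda>y. h (t, y))" if t: "t \<in> TT" for t
    unfolding pert_def
  proof
    show "(\<lambda>y. h (t, y)) holomorphic_on ball c (2 * \<delta>)"
      by (rule hol2_holomorphic2[OF h2]) (use t in blast)
    show "\<forall>y\<in>ball c (2 * \<delta>). norm (h (t, y)) \<le> norm (poly (pderiv (pderiv p)) c) * \<delta> / 8"
    proof
      fix y assume y: "y \<in> ball c (2 * \<delta>)"
      show "norm (h (t, y)) \<le> norm (poly (pderiv (pderiv p)) c) * \<delta> / 8"
        using ee_bound[of "(X (t, y), y)"] inU[OF t y] by (simp add: h_def)
    qed
  qed
  obtain Y where Y: "Y holomorphic_on TT" "\<And>t. t \<in> TT \<Longrightarrow> norm (Y t - c) \<le> \<delta> / 2"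
    "\<And>t y. t \<in> TT \<Longrightarrow> norm (y - c) < \<delta> \<Longrightarrow> poly (pderiv p) y + h (t, y) = 0 \<longleftrightarrow> y = Y t"
    using pert_zero_holomorphic[OF oT h2 pt] by blast
  show ?thesis using Y unfolding h_def by (intro exI[of _ Y]) simp
qed

definition Y :: "complex \<Rightarrow> complex" where
  "Y = (SOME Y. Y holomorphic_on TT \<and> (\<forall>t\<in>TT. norm (Y t - c) \<le> \<delta> / 2) \<and>
    (\<forall>t\<in>TT. \<forall>y. norm (y - c) < \<delta> \<longrightarrow> (poly (pderiv p) y + ee (X (t, y), y) = 0 \<longleftrightarrow> y = Y t)))"

lemma Y_hol: "Y holomorphic_on TT"
  and Y_near: "t \<in> TT \<Longrightarrow> norm (Y t - c) \<le> \<delta> / 2"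
  and Y_iff: "t \<in> TT \<Longrightarrow> norm (y - c) < \<delta> \<Longrightarrow> poly (pderiv p) y + ee (X (t, y), y) = 0 \<longleftrightarrow> y = Y t"
  using someI_ex[OF ex_Y, folded Y_def] by blast+

definition H0 :: "(complex \<times> complex) set" where "H0 = (\<lambda>t. (X (t, Y t), Y t)) ` TT"

lemma Y_strip: "t \<in> TT \<Longrightarrow> norm (Y t) < \<alpha>"
  using Y_near[of t] delta_pos by (intro strip_alpha) simp

lemma H0_sub: "H0 \<subseteq> US" "H0 \<subseteq> S1"
  using X_US Y_strip Y_near by (auto simp: H0_def S1_def)

lemma H0_iff:
  assumes z: "z \<in> US"
  shows "z \<in> H0 \<longleftrightarrow> snd z = Y (Phi z)"
proof
  assume "z \<in> H0"
  then obtain t where t: "t \<in> TT" "z = (X (t, Y t), Y t)" by (auto simp: H0_def)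
  then show "snd z = Y (Phi z)" using Phi_X[OF t(1) Y_strip[OF t(1)]] by simp
next
  assume eq: "snd z = Y (Phi z)"
  have "X (Phi z, Y (Phi z)) = fst z" using X_Phi[OF z] eq by simp
  then have "z = (X (Phi z, Y (Phi z)), Y (Phi z))" using eq by (simp add: prod_eq_iff)
  then show "z \<in> H0" unfolding H0_def using Phi_TT[OF z] by blast
qed

lemma S0_US: "z \<in> Up \<Longrightarrow> z \<in> S0 \<Longrightarrow> z \<in> US"
  using strip_alpha[of "snd z"] delta_pos by (simp add: US_def S0_def)

text \<open>In the coordinates (Phi, y) a point of S0 is critical exactly when its y solves the
  perturbed equation at t = Phi z, and Y(t) is the only solution in the strip.\<close>

lemma H0_eq: "H0 = crit_locus p \<alpha> a \<inter> S0"
proof -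
  have "z \<in> H0 \<longleftrightarrow> z \<in> crit_locus p \<alpha> a" if z: "z \<in> US" "z \<in> S0" for z
  proof -
    have y: "norm (snd z - c) < \<delta>" using z(2) by (simp add: S0_def)
    have "z \<in> crit_locus p \<alpha> a \<longleftrightarrow> poly (pderiv p) (snd z) + ee (X (Phi z, snd z), snd z) = 0"
      using tangency[OF z(1)] y delta_pos by (simp add: X_Phi[OF z(1)])
    also have "\<dots> \<longleftrightarrow> snd z = Y (Phi z)" by (rule Y_iff[OF Phi_TT[OF z(1)] y])
    also have "\<dots> \<longleftrightarrow> z \<in> H0" using H0_iff[OF z(1)] by simp
    finally show ?thesis by simp
  qed
  moreover have "H0 \<subseteq> US \<inter> S0" using H0_sub S1_S0 by blast
  moreover have "crit_locus p \<alpha> a \<inter> S0 \<subseteq> US" using S0_US by (auto simp: crit_locus_def)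
  ultimately show ?thesis by blast
qed

lemma crit_S0_S1: "A \<subseteq> crit_locus p \<alpha> a \<Longrightarrow> A \<inter> S0 = A \<inter> S1"
  using H0_eq H0_sub(2) S1_S0 by blast

lemma defining_hol: "hol2_on (\<lambda>z. snd z - Y (Phi z)) US"
  by (rule hol2_diff[OF hol2_snd hol2_compose1[OF Y_hol _ Phi_hol]]) (use Phi_TT in \<open>auto simp: open_Compl\<close>)

text \<open>Analyticity has to hold at every point of the domain: in S0 the graph equation describes
  \<open>H0\<close>, elsewhere a neighbourhood misses S1 and so misses \<open>H0\<close>.\<close>

lemma H0_analytic: "analytic_subset (Up \<inter> Um) H0"
  unfolding analytic_subset_def
proof (intro conjI ballI)
  have oD: "open (Up \<inter> Um)" using open_Up open_Um by (rule open_Int)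
  show "H0 \<subseteq> Up \<inter> Um" using H0_eq by (auto simp: crit_locus_def)
  fix z assume z: "z \<in> Up \<inter> Um"
  show "\<exists>W Fs. open W \<and> z \<in> W \<and> W \<subseteq> Up \<inter> Um \<and> finite Fs \<and> (\<forall>F\<in>Fs. hol2_on F W) \<and>
        H0 \<inter> W = {z' \<in> W. \<forall>F\<in>Fs. F z' = 0}"
  proof (cases "z \<in> S0")
    case True
    define W where "W = Up \<inter> Um \<inter> S0"
    have WU: "W \<subseteq> US" unfolding W_def using S0_US by blast
    have "open W" unfolding W_def using oD open_S0 by (rule open_Int)
    moreover have "z \<in> W" "W \<subseteq> Up \<inter> Um" using z True by (auto simp: W_def)
    moreover have "hol2_on (\<lambda>z. snd z - Y (Phi z)) W" by (rule hol2_on_subset[OF defining_hol WU])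
    moreover have "H0 \<inter> W = {z' \<in> W. snd z' - Y (Phi z') = 0}" using H0_iff WU by auto
    ultimately show ?thesis by (intro exI[of _ W] exI[of _ "{\<lambda>z. snd z - Y (Phi z)}"]) simp
  next
    case False
    define W where "W = Up \<inter> Um - S1"
    have "open W" unfolding W_def using oD closed_S1 by (rule open_Diff)
    moreover have "z \<in> W" "W \<subseteq> Up \<inter> Um" using z False S1_S0 by (auto simp: W_def)
    moreover have "H0 \<inter> W = {}" using H0_sub(2) by (auto simp: W_def)
    ultimately show ?thesis
      by (intro exI[of _ W] exI[of _ "{\<lambda>z. 1}"]) (simp add: hol2_const)
  qed
qed

lemma curve_hol: "(\<lambda>t. X (t, Y t)) holomorphic_on TT"
  by (rule hol2_compose_curve[OF X_hol holomorphic_on_ident Y_hol]) (use Y_strip in \<open>auto simp: open_Compl\<close>)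

lemma open_TT: "open TT"
  by (simp add: open_Compl)

lemma H0_irreducible: "irreducible_analytic (Up \<inter> Um) H0"
proof (rule irreducible_curve[OF open_TT _ _ curve_hol Y_hol H0_def H0_analytic])
  show "connected TT" by (rule connected_complement_bounded_convex) auto
  have "(2::complex) \<in> TT" by simp
  then show "TT \<noteq> {}" by blast
qed

text \<open>An irreducible subset of the critical locus cannot be split by the clopen pair S0, S1,
  so touching the strip means lying in it.\<close>

lemma H0_maximal:
  assumes H: "irreducible_analytic (Up \<inter> Um) H" "H \<subseteq> crit_locus p \<alpha> a" "H \<inter> S0 \<noteq> {}"
  shows "H \<subseteq> H0"
  using irreducible_clopen[OF H(1) open_S0 closed_S1 crit_S0_S1[OF H(2)] H(3)] H(2) H0_eq by blast

lemma H0_component: "irreducible_component (Up \<inter> Um) (crit_locus p \<alpha> a) H0"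
  unfolding irreducible_component_def
proof (intro conjI allI impI)
  show "irreducible_analytic (Up \<inter> Um) H0" by (rule H0_irreducible)
  show "H0 \<subseteq> crit_locus p \<alpha> a" using H0_eq by blast
  fix H' assume H': "irreducible_analytic (Up \<inter> Um) H'" "H0 \<subseteq> H'" "H' \<subseteq> crit_locus p \<alpha> a"
  have "H0 \<noteq> {}" using H0_irreducible by (simp add: irreducible_analytic_def)
  then have "H' \<inter> S0 \<noteq> {}" using H'(2) H0_eq by blast
  then show "H' = H0" using H0_maximal[OF H'(1,3)] H'(2) by blast
qed

text \<open>For E = y - Y(Phi) either Y' vanishes and d2 E = 1, or d1 E is a nonzero multiple of d1
  Phi.\<close>

lemma H0_smooth: "smooth_curve H0"
  unfolding smooth_curve_def
proof
  fix z assume z: "z \<in> H0"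
  then have zU: "z \<in> US" using H0_sub by blast
  obtain x y where xy: "z = (x, y)" by (cases z)
  define E where "E = (\<lambda>z. snd z - Y (Phi z))"
  have hE: "hol2_on E US" unfolding E_def by (rule defining_hol)
  define D where "D = deriv Y (Phi z)"
  have DY: "(Y has_field_derivative D) (at (Phi z))" unfolding D_def
    by (rule holomorphic_derivI[OF Y_hol open_TT Phi_TT[OF zU]])
  have "(E has_derivative (\<lambda>h. snd h - D * (d1 Phi z * fst h + d2 Phi z * snd h))) (at z)"
    unfolding E_def
  proof (rule has_derivative_diff)
    show "(snd has_derivative snd) (at z)" by (rule bounded_linear_imp_has_derivative[OF bounded_linear_snd])
    have "(Phi has_derivative (\<lambda>h. d1 Phi z * fst h + d2 Phi z * snd h)) (at z)"
      using hol2_has_derivative[OF Phi_hol] zU unfolding xy by blast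
    moreover have "(Y has_derivative (\<lambda>h. D * h)) (at (Phi z))" using DY by (simp add: has_field_derivative_def)
    ultimately show "((\<lambda>z. Y (Phi z)) has_derivative (\<lambda>h. D * (d1 Phi z * fst h + d2 Phi z * snd h))) (at z)"
      by (rule has_derivative_compose)
  qed
  moreover have "(\<lambda>h. snd h - D * (d1 Phi z * fst h + d2 Phi z * snd h)) =
      (\<lambda>h. (- D * d1 Phi z) * fst h + (1 - D * d2 Phi z) * snd h)"
    by (rule ext) (simp add: algebra_simps)
  ultimately have "(E has_derivative (\<lambda>h. (- D * d1 Phi z) * fst h + (1 - D * d2 Phi z) * snd h)) (at (x, y))"
    unfolding xy by simp
  then have "d1 E z = - D * d1 Phi z" "d2 E z = 1 - D * d2 Phi z" unfolding xy by (rule d12_eqI)+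
  then have "d1 E z \<noteq> 0 \<or> d2 E z \<noteq> 0" using Phi_cone(1)[OF zU] by auto
  moreover have "H0 \<inter> US = {z' \<in> US. E z' = 0}" using H0_iff by (auto simp: E_def)
  ultimately show "\<exists>W F. open W \<and> z \<in> W \<and> hol2_on F W \<and> (d1 F z \<noteq> 0 \<or> d2 F z \<noteq> 0) \<and>
        H0 \<inter> W = {z' \<in> W. F z' = 0}"
    using open_US zU hE by (intro exI[of _ US] exI[of _ E]) simp
qed

lemma H0_biholomorphism: "biholomorphism H0 TT Phi"
proof (rule biholomorphismI[OF H0_smooth open_TT H0_def])
  show "Phi (X (t, Y t), Y t) = t" if "t \<in> TT" for t by (rule Phi_X[OF that Y_strip[OF that]])
  show "curve_holomorphic Phi H0"
    unfolding curve_holomorphic_def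
    by (intro ballI exI[of _ US] exI[of _ Phi]) (use open_US H0_sub Phi_hol in auto)
  show "(\<lambda>t. fst (X (t, Y t), Y t)) holomorphic_on TT" using curve_hol by simp
  show "(\<lambda>t. snd (X (t, Y t), Y t)) holomorphic_on TT" using Y_hol by simp
qed

lemma H0_punctured_disk: "conformally_punctured_disk H0"
proof -
  define B where "B = ball (0::complex) 1 - {0}"
  have inv: "inverse s \<in> TT" if "s \<in> B" for s
    using that one_less_inverse[of "norm s"] by (simp add: B_def norm_inverse)
  have inv': "inverse t \<in> B" if "t \<in> TT" for t
    using that by (auto simp: B_def norm_inverse inverse_less_1_iff)
  have TB: "TT = inverse ` B"
  proof
    show "TT \<subseteq> inverse ` B" using inv' by (metis imageI inverse_inverse_eq subsetI)
    show "inverse ` B \<subseteq> TT" using inv by blast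
  qed
  have hi: "inverse holomorphic_on B" unfolding B_def by (rule holomorphic_on_inverse[of "\<lambda>z. z", simplified]) auto
  have "biholomorphism H0 B (\<lambda>z. inverse (Phi z))"
  proof (rule biholomorphismI[OF H0_smooth, where \<gamma> = "\<lambda>s. (X (inverse s, Y (inverse s)), Y (inverse s))"])
    show "open B" unfolding B_def by (intro open_Diff) auto
    show "H0 = (\<lambda>s. (X (inverse s, Y (inverse s)), Y (inverse s))) ` B"
      unfolding H0_def TB by (simp add: image_image)
    show "inverse (Phi (X (inverse s, Y (inverse s)), Y (inverse s))) = s" if "s \<in> B" for s
      using Phi_X[OF inv[OF that] Y_strip[OF inv[OF that]]] by simp
    show "curve_holomorphic (\<lambda>z. inverse (Phi z)) H0"
      unfolding curve_holomorphic_def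
    proof
      fix z assume "z \<in> H0"
      then have "z \<in> US" using H0_sub by blast
      moreover have "hol2_on (\<lambda>z. inverse (Phi z)) US" by (rule hol2_inverse[OF Phi_hol Phi_nz])
      ultimately show "\<exists>W F. open W \<and> z \<in> W \<and> hol2_on F W \<and> (\<forall>z'\<in>H0 \<inter> W. F z' = inverse (Phi z'))"
        using open_US by (intro exI[of _ US] exI[of _ "\<lambda>z. inverse (Phi z)"]) simp
    qed
    have "(\<lambda>t. X (t, Y t)) \<circ> inverse holomorphic_on B"
      by (rule holomorphic_on_compose_gen[OF hi curve_hol]) (use inv in blast)
    then show "(\<lambda>s. fst (X (inverse s, Y (inverse s)), Y (inverse s))) holomorphic_on B" by (simp add: o_def)
    have "Y \<circ> inverse holomorphic_on B"
      by (rule holomorphic_on_compose_gen[OF hi Y_hol]) (use inv in blast)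
    then show "(\<lambda>s. snd (X (inverse s, Y (inverse s)), Y (inverse s))) holomorphic_on B" by (simp add: o_def)
  qed
  then show ?thesis unfolding conformally_punctured_disk_def B_def by blast
qed

section \<open>The extended locus at x = infinity\<close>

definition XB :: real where "XB = 4 * \<alpha> + 12 * C0 + 2 * norm (poly p c) + 1"

lemma far_x:
  assumes x: "norm x \<ge> XB"
  shows "norm x > 0" "norm x > \<alpha>" "norm x \<ge> 2 * \<alpha>" "norm c \<le> norm x / 4" "norm c < \<alpha>" "12 * C0 \<le> norm x"
    "norm x / 2 \<le> norm (poly p c - x)"
proof -
  note n = alpha_pos C0_nonneg delta_pos c_strip norm_ge_zero[of "poly p c"]
  show "norm x > 0" "norm x > \<alpha>" "norm x \<ge> 2 * \<alpha>" "norm c \<le> norm x / 4" "norm c < \<alpha>" "12 * C0 \<le> norm x"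
    using x n unfolding XB_def by linarith+
  have "norm x - norm (poly p c) \<le> norm (poly p c - x)" using norm_triangle_ineq2[of x "poly p c"] by (simp add: norm_minus_commute)
  moreover have "norm (poly p c) \<le> norm x / 2" using x n unfolding XB_def by linarith
  ultimately show "norm x / 2 \<le> norm (poly p c - x)" by linarith
qed

lemma Vp_US: "norm x > \<alpha> \<Longrightarrow> norm y < \<alpha> \<Longrightarrow> (x, y) \<in> Vp \<and> (x, y) \<in> US"
proof -
  assume x: "norm x > \<alpha>" and y: "norm y < \<alpha>"
  then have V: "(x, y) \<in> Vp" by (simp add: V_plus_def)
  then have "(f ^^ 0) (x, y) \<in> Vp" by simp
  then have "(x, y) \<in> Up" unfolding Up_iff by (rule exI)
  then show ?thesis using V y by (simp add: US_def)
qed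

lemma kap_far:
  assumes x: "norm x \<ge> XB"
  shows "(x, c) \<in> Om" "norm (kap (x, c)) \<le> 24 * C0 / norm x"
proof -
  note f = far_x[OF x]
  have "(x, c) \<in> US" using Vp_US[OF f(2,5)] by blast
  then show O: "(x, c) \<in> Om" using US_Om[of "(x, c)"] delta_pos by simp
  have "norm (kap (x, c)) \<le> 12 * C0 * norm a ^ 2 / norm (poly p c - x)" using kap_bound[OF O] by simp
  also have "\<dots> \<le> 12 * C0 * norm a ^ 2 / (norm x / 2)"
    using f(1,7) C0_nonneg by (intro divide_left_mono mult_pos_pos) auto
  also have "\<dots> \<le> 12 * C0 * 1 / (norm x / 2)"
    using f(1) C0_nonneg a_le_1 by (intro divide_right_mono mult_left_mono power_le_one) auto
  finally show "norm (kap (x, c)) \<le> 24 * C0 / norm x" by simp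
qed

lemma phi_far:
  assumes x: "norm x \<ge> XB"
  shows "norm (d1 (phi_plus p a) (x, c)) \<le> 2 * exp (C0 / \<alpha>)"
    "norm (d2 (phi_plus p a) (x, c)) \<le> exp (C0 / \<alpha>) * (6 * C0 / norm x)"
    "norm (d2 (phi_plus p a) (x, c) / d1 (phi_plus p a) (x, c)) \<le> 12 * C0 / norm x"
proof -
  note f = far_x[OF x]
  have x0: "x \<noteq> 0" using f(1) by auto
  note D = phi_plus_d12[OF f(3,4) x0]
  define s where "s = exp (Splus (x, c))"
  have V: "(x, c) \<in> Vp" using Vp_US[OF f(2,5)] by blast
  have "norm x * norm s \<le> norm x * exp (C0 / \<alpha>)"
    using phi_plus_bounds(1)[OF V] unfolding phi_plus_eq s_def by (simp add: norm_mult)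
  then have s: "norm s \<le> exp (C0 / \<alpha>)" using f(1) by simp
  have half: "6 * C0 / norm x \<le> 1 / 2" using f(1,6) by (simp add: field_simps)
  have t1: "norm (1 + x * d1 Splus (x, c)) \<le> 2"
    using norm_triangle_ineq[of 1 "x * d1 Splus (x, c)"] D(3) half by simp
  have t2: "norm (1 + x * d1 Splus (x, c)) \<ge> 1 / 2"
    using norm_diff_ineq[of 1 "x * d1 Splus (x, c)"] D(3) half by simp
  show "norm (d1 (phi_plus p a) (x, c)) \<le> 2 * exp (C0 / \<alpha>)"
    unfolding D(1) s_def[symmetric] norm_mult
    using mult_mono[OF s t1] by (simp add: mult.commute)
  show "norm (d2 (phi_plus p a) (x, c)) \<le> exp (C0 / \<alpha>) * (6 * C0 / norm x)"
    unfolding D(2) s_def[symmetric] norm_mult[of s]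
    by (rule mult_mono[OF s D(4)]) auto
  have "d2 (phi_plus p a) (x, c) / d1 (phi_plus p a) (x, c) = x * d2 Splus (x, c) / (1 + x * d1 Splus (x, c))"
    unfolding D(1,2) by simp
  also have "norm \<dots> \<le> (6 * C0 / norm x) / (1 / 2)"
    unfolding norm_divide by (rule frac_le) (use D(4) t2 C0_nonneg in auto)
  finally show "norm (d2 (phi_plus p a) (x, c) / d1 (phi_plus p a) (x, c)) \<le> 12 * C0 / norm x" by simp
qed

text \<open>Far out Phi is phi_+ itself, so the explicit derivative bounds apply and the error
  decays like 1/|x| along y = c.\<close>

lemma ee_far:
  assumes x: "norm x \<ge> XB"
  shows "norm (ee (x, c)) \<le> 36 * C0 / norm x"
proof -
  note f = far_x[OF x]
  define V where "V = Vp \<inter> {z. norm (snd z) < \<alpha>}"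
  have oV: "open V" unfolding V_def
    by (intro open_Int open_V_plus open_Collect_less continuous_intros)
  have xV: "(x, c) \<in> V" unfolding V_def using Vp_US[OF f(2,5)] f(5) by simp
  have eq: "Phi z = phi_plus p a z" if "z \<in> V" for z using Phi_phi_plus that by (simp add: V_def)
  have "ee (x, c) = d2 (phi_plus p a) (x, c) / d1 (phi_plus p a) (x, c) + kap (x, c)"
    unfolding ee_def using d12_cong_open(1)[OF oV xV eq] d12_cong_open(2)[OF oV xV eq] by simp
  then have "norm (ee (x, c)) \<le> 12 * C0 / norm x + 24 * C0 / norm x"
    using phi_far(3)[OF x] kap_far(2)[OF x] norm_triangle_ineq[of "d2 (phi_plus p a) (x, c) / d1 (phi_plus p a) (x, c)" "kap (x, c)"] by simp
  then show ?thesis by (simp add: add_divide_distrib[symmetric])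
qed

text \<open>The tangency equation is solved for y at a fixed large x instead of a fixed t; the error
  at (x, c) then controls the distance of the solution from c.\<close>

lemma H0_asymptotic:
  assumes e: "e > 0"
  obtains x y where "(x, y) \<in> H0" "norm (1 / x) < e" "norm (y - c) < e" "x \<noteq> 0"
proof -
  define P'' where "P'' = norm (poly (pderiv (pderiv p)) c)"
  have P: "P'' > 0" using P'_c by (simp add: P''_def)
  \<comment> \<open>2/e makes |1/x| < e; the last entry makes the distance bound 72 C0/(|p''(c)|
    \<rho>) smaller than e.\<close>
  define \<rho> where "\<rho> = max XB (max (2 / e) (1 + 144 * C0 / (P'' * e)))"
  define x where "x = complex_of_real \<rho>"
  have \<rho>: "\<rho> \<ge> XB" "\<rho> \<ge> 2 / e" "\<rho> \<ge> 1 + 144 * C0 / (P'' * e)" unfolding \<rho>_def by auto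
  have r0: "\<rho> > 0" using \<rho>(2) e by (meson divide_pos_pos less_le_trans zero_less_numeral)
  have nx: "norm x = \<rho>" using r0 by (simp add: x_def)
  have xB: "norm x \<ge> XB" using \<rho>(1) nx by simp
  note f = far_x[OF xB]
  have inU: "(x, y) \<in> US" "norm (y - c) < 2 * \<delta>" if "y \<in> ball c (2 * \<delta>)" for y
  proof -
    show y: "norm (y - c) < 2 * \<delta>" using that by (simp add: dist_norm norm_minus_commute)
    show "(x, y) \<in> US" using Vp_US[OF f(2) strip_alpha[OF y]] by blast
  qed
  have pt: "pert (\<lambda>y. ee (x, y))"
    unfolding pert_def
  proof
    show "(\<lambda>y. ee (x, y)) holomorphic_on ball c (2 * \<delta>)"
    proof (rule hol2_holomorphic2[OF ee_hol])
      show "(x, y) \<in> US \<inter> Om" if "y \<in> ball c (2 * \<delta>)" for y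
        using inU[OF that] US_Om[of "(x, y)"] by simp
    qed
    show "\<forall>y\<in>ball c (2 * \<delta>). norm (ee (x, y)) \<le> norm (poly (pderiv (pderiv p)) c) * \<delta> / 8"
    proof
      fix y assume y: "y \<in> ball c (2 * \<delta>)"
      show "norm (ee (x, y)) \<le> norm (poly (pderiv (pderiv p)) c) * \<delta> / 8"
        using ee_bound[of "(x, y)"] inU[OF y] by simp
    qed
  qed
  obtain y where y: "y \<in> cball c (\<delta> / 2)" "poly (pderiv p) y + ee (x, y) = 0"
    using pert_zero_ex[OF pt] by blast
  have yd: "norm (y - c) < \<delta>" using y(1) delta_pos by (simp add: dist_norm norm_minus_commute)
  have yU: "(x, y) \<in> US" using inU(1)[of y] yd delta_pos by (simp add: dist_norm norm_minus_commute)
  have "(x, y) \<in> crit_locus p \<alpha> a" using tangency[OF yU] yd delta_pos y(2) by simp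
  then have 1: "(x, y) \<in> H0" using yd by (simp add: H0_eq S0_def)
  have "norm (1 / x) = 1 / \<rho>" using nx by (simp add: norm_divide)
  also have "\<dots> < e"
  proof -
    have "2 \<le> \<rho> * e" using \<rho>(2) e by (simp add: pos_divide_le_eq)
    then show ?thesis using r0 by (simp add: pos_divide_less_eq mult.commute)
  qed
  finally have 2: "norm (1 / x) < e" .
  have "norm (y - c) \<le> 2 * norm (ee (x, c)) / P''"
    unfolding P''_def by (rule pert_zero_dist[OF pt yd y(2)])
  also have "\<dots> \<le> 2 * (36 * C0 / norm x) / P''" using ee_far[OF xB] P by (intro divide_right_mono) auto
  also have "\<dots> = 72 * C0 / (P'' * \<rho>)" unfolding nx by simp
  also have "\<dots> < e"
  proof -
    have "144 * C0 / (P'' * e) < \<rho>" using \<rho>(3) by linarith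
    then have "144 * C0 < \<rho> * (P'' * e)" using P e by (simp add: pos_divide_less_eq)
    then have "72 * C0 < e * (P'' * \<rho>)" using C0_nonneg by (simp add: mult_ac)
    then show ?thesis using P r0 by (simp add: pos_divide_less_eq)
  qed
  finally have 3: "norm (y - c) < e" .
  have "x \<noteq> 0" using nx r0 by auto
  then show ?thesis using that 1 2 3 by blast
qed

text \<open>At y = c the term p'(c) drops out, so the wedge is O(1/|x|). The chart and the division
  by v^2 contribute v^(-4), compensated by phi_+^2 G^2, which grows like x^4; hence h = O(|v|) and
  the limit is 0.\<close>

lemma w_tilde_0: "w_tilde p a 0 c = 0"
proof -
  define h where "h = (\<lambda>v. wedge (\<lambda>(s, t). inverse (phi_plus p a (1 / s, t)))
                         (\<lambda>(s, t). inverse (G (1 / s, t))) (v, c) / v\<^sup>2)"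
  define E where "E = exp (C0 / \<alpha>)"
  have E: "E > 0" "exp (- (C0 / \<alpha>)) = inverse E" by (simp_all add: E_def exp_minus)
  have bd: "norm (h v) \<le> 5832 * E ^ 3 * C0 * norm v" if v: "v \<noteq> 0" "norm v < 1 / XB" for v
  proof -
    define x where "x = 1 / v"
    have XB: "XB > 0" using alpha_pos C0_nonneg by (simp add: XB_def add_pos_nonneg add_nonneg_pos)
    have vx: "norm v = 1 / norm x" using v(1) by (simp add: x_def norm_divide)
    have "norm x \<ge> XB" using v XB by (simp add: x_def norm_divide field_simps)
    note x = this
    note f = far_x[OF x]
    have V: "(x, c) \<in> Vp" using Vp_US[OF f(2,5)] by blast
    have O: "(x, c) \<in> Om" by (rule kap_far(1)[OF x])
    define \<phi> where "\<phi> = phi_plus p a (x, c)"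
    have hh: "hol2_on (phi_plus p a) (Vp \<inter> Om)" "hol2_on G (Vp \<inter> Om)"
      using hol2_on_subset[OF phi_plus_hol, of "Vp \<inter> Om"] hol2_on_subset[OF G_hol, of "Vp \<inter> Om"] by auto
    have nz: "\<phi> \<noteq> 0" "G (x, c) \<noteq> 0" using phi_plus_nz[OF V] G_nz[OF O] by (simp_all add: \<phi>_def)
    define A where "A = d1 (phi_plus p a) (x, c)"
    define B where "B = d2 (phi_plus p a) (x, c)"
    obtain U where U: "norm U \<le> 3" "norm (G (x, c)) \<ge> norm (poly p c - x) / 3"
      "\<And>A B. A * d2 G (x, c) - B * d1 G (x, c) = U * (A * (poly (pderiv p) c + kap (x, c)) + B)"
      using G_wedge[OF O] by (metis fst_conv snd_conv)
    have wd: "wedge (phi_plus p a) G (x, c) = U * (A * kap (x, c) + B)"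
      unfolding wedge_def A_def[symmetric] B_def[symmetric] U(3) P_c by simp
    have "h v = - wedge (phi_plus p a) G (x, c) / (v\<^sup>2 * \<phi>\<^sup>2 * (G (x, c))\<^sup>2) / v\<^sup>2"
      unfolding h_def \<phi>_def x_def
      by (subst wedge_inverse_chart[OF hh]) (use V O nz v in \<open>auto simp: x_def \<phi>_def\<close>)
    then have hv: "norm (h v) = norm (wedge (phi_plus p a) G (x, c)) / (norm v ^ 4 * (norm \<phi>)\<^sup>2 * (norm (G (x, c)))\<^sup>2)"
      by (simp add: norm_divide norm_mult norm_power power4_eq_xxxx power2_eq_square mult_ac)
    have A: "norm A \<le> 2 * E" and B: "norm B \<le> E * (6 * C0 / norm x)"
      using phi_far(1,2)[OF x] by (simp_all add: A_def B_def E_def)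
    have "norm (A * kap (x, c)) \<le> (2 * E) * (24 * C0 / norm x)"
      unfolding norm_mult by (rule mult_mono[OF A kap_far(2)[OF x]]) (use E in auto)
    moreover have "(2 * E) * (24 * C0 / norm x) + E * (6 * C0 / norm x) = 54 * E * C0 / norm x" by (simp add: field_simps)
    ultimately have "norm (A * kap (x, c) + B) \<le> 54 * E * C0 / norm x"
      using B norm_triangle_ineq[of "A * kap (x, c)" B] by linarith
    then have "norm U * norm (A * kap (x, c) + B) \<le> 3 * (54 * E * C0 / norm x)"
      by (intro mult_mono U(1)) auto
    then have num: "norm (wedge (phi_plus p a) G (x, c)) \<le> 162 * E * C0 / norm x"
      unfolding wd norm_mult by simp
    have p1: "norm x / E \<le> norm \<phi>" using phi_plus_bounds(2)[OF V] unfolding E(2) \<phi>_def by (simp add: divide_inverse)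
    have g1: "norm x / 6 \<le> norm (G (x, c))" using U(2) f(7) by simp
    have den: "norm v ^ 4 * (norm x / E)\<^sup>2 * (norm x / 6)\<^sup>2 \<le> norm v ^ 4 * (norm \<phi>)\<^sup>2 * (norm (G (x, c)))\<^sup>2"
      by (intro mult_mono power_mono p1 g1 order_refl) (use E in auto)
    have dp: "norm v ^ 4 * (norm x / E)\<^sup>2 * (norm x / 6)\<^sup>2 > 0" using f(1) E v(1) by simp
    have "norm (h v) \<le> (162 * E * C0 / norm x) / (norm v ^ 4 * (norm x / E)\<^sup>2 * (norm x / 6)\<^sup>2)"
      unfolding hv by (rule frac_le[OF _ num dp den]) (use E C0_nonneg in auto)
    \<comment> \<open>5832 is 162 times 36, the square of the 6 in |G| >= |x|/6; two of the three
      factors E come from the lower bound for phi_+.\<close>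
    also have "\<dots> = 5832 * E ^ 3 * C0 * norm v"
      unfolding vx using f(1) E by (simp add: field_simps power2_eq_square power3_eq_cube power4_eq_xxxx)
    finally show ?thesis .
  qed
  have XB: "XB > 0" using alpha_pos C0_nonneg by (simp add: XB_def add_pos_nonneg add_nonneg_pos)
  have "((\<lambda>v::complex. 5832 * E ^ 3 * C0 * norm v) \<longlongrightarrow> 5832 * E ^ 3 * C0 * norm (0::complex)) (at 0)"
    by (rule tendsto_mult[OF tendsto_const tendsto_norm[OF tendsto_ident_at]])
  then have t0: "((\<lambda>v::complex. 5832 * E ^ 3 * C0 * norm v) \<longlongrightarrow> 0) (at 0)" by simp
  have "\<forall>\<^sub>F v in at 0. norm (h v) \<le> 5832 * E ^ 3 * C0 * norm v"
    unfolding eventually_at by (rule exI[of _ "1 / XB"]) (use bd XB in auto)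
  then have "(h \<longlongrightarrow> 0) (at 0)" by (rule Lim_null_comparison[OF _ t0])
  then have "Lim (at 0) h = 0" by (intro tendsto_Lim) auto
  then show ?thesis by (simp add: w_tilde_def h_def)
qed

lemma H0_primary: "is_primary_component p \<alpha> a c H0"
  unfolding is_primary_component_def component_ext_def
proof (intro conjI IntI)
  show "irreducible_component (Up \<inter> Um) (crit_locus p \<alpha> a) H0" by (rule H0_component)
  show "(0, c) \<in> crit_locus_ext p \<alpha> a" by (simp add: crit_locus_ext_def w_tilde_0)
  show "(0, c) \<in> closure {(u, y). u \<noteq> 0 \<and> (1 / u, y) \<in> H0}"
    unfolding closure_approachable
  proof (intro allI impI)
    fix e :: real assume e: "e > 0"
    then obtain x y where xy: "(x, y) \<in> H0" "norm (1 / x) < e / 2" "norm (y - c) < e / 2" "x \<noteq> 0"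
      using H0_asymptotic[of "e / 2"] by auto
    have "dist (1 / x, y) (0, c) \<le> norm (1 / x) + norm (y - c)"
      unfolding dist_Pair_Pair unfolding dist_norm using sqrt_sum_squares_le_sum_abs[of "norm (1 / x)" "norm (y - c)"] by simp
    then have "dist (1 / x, y) (0, c) < e" using xy(2,3) by linarith
    moreover have "(1 / x, y) \<in> {(u, y). u \<noteq> 0 \<and> (1 / u, y) \<in> H0}" using xy(1,4) by simp
    ultimately show "\<exists>w\<in>{(u, y). u \<noteq> 0 \<and> (1 / u, y) \<in> H0}. dist w (0, c) < e" by blast
  qed
qed

text \<open>A component whose closure contains (0, c) has points with y within \<delta> of c, so it
  meets S0 and lies in \<open>H0\<close>; maximality gives equality.\<close>

lemma primary_component_eq: "primary_component p \<alpha> a c = H0"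
  unfolding primary_component_def
proof (rule the_equality)
  show "is_primary_component p \<alpha> a c H0" by (rule H0_primary)
next
  fix H assume H: "is_primary_component p \<alpha> a c H"
  then have Hc: "irreducible_analytic (Up \<inter> Um) H" "H \<subseteq> crit_locus p \<alpha> a"
    "\<And>H'. irreducible_analytic (Up \<inter> Um) H' \<Longrightarrow> H \<subseteq> H' \<Longrightarrow> H' \<subseteq> crit_locus p \<alpha> a \<Longrightarrow> H' = H"
    and cl: "(0, c) \<in> closure {(u, y). u \<noteq> 0 \<and> (1 / u, y) \<in> H}"
    unfolding is_primary_component_def irreducible_component_def component_ext_def by blast+
  obtain w where w: "w \<in> {(u, y). u \<noteq> 0 \<and> (1 / u, y) \<in> H}" "dist w (0, c) < \<delta>"
    using cl delta_pos unfolding closure_approachable by blast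
  obtain u y where uy: "w = (u, y)" by (cases w)
  have "dist y c \<le> dist w (0, c)" unfolding uy using dist_snd_le[of "(u, y)" "(0, c)"] by simp
  then have "(1 / u, y) \<in> S0" using w(2) by (simp add: S0_def dist_norm)
  moreover have "(1 / u, y) \<in> H" using w(1) uy by simp
  ultimately have "H \<inter> S0 \<noteq> {}" by blast
  then have "H \<subseteq> H0" by (rule H0_maximal[OF Hc(1,2)])
  then show "H = H0" using Hc(3)[OF H0_irreducible] H0_eq by blast
qed

lemma primary_component_biholomorphic:
  "is_primary_component p \<alpha> a c (primary_component p \<alpha> a c) \<and>
   conformally_punctured_disk (primary_component p \<alpha> a c) \<and>
   (\<exists>\<Phi>. (\<forall>z \<in> primary_component p \<alpha> a c \<inter> V_plus \<alpha>. \<Phi> z = phi_plus p a z) \<and>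
        biholomorphism (primary_component p \<alpha> a c) (- cball 0 1) \<Phi>)"
  unfolding primary_component_eq
proof (intro conjI exI[of _ Phi] ballI)
  show "is_primary_component p \<alpha> a c H0" by (rule H0_primary)
  show "conformally_punctured_disk H0" by (rule H0_punctured_disk)
  show "biholomorphism H0 TT Phi" by (rule H0_biholomorphism)
  show "Phi z = phi_plus p a z" if "z \<in> H0 \<inter> Vp" for z
    using that H0_sub(1) by (intro Phi_phi_plus) (auto simp: US_def)
qed

end

text \<open>With a ball of radius \<rho> about p(c) inside L, continuity keeps p(y) within \<rho>/2
  of p(c), hence at distance at least \<kappa> = \<rho>/2 from every x outside L. Continuity of p''
  gives the Newton bound.\<close>

lemma (in escape_data) critical_strip:
  assumes c: "poly (pderiv p) c = 0" "poly (pderiv (pderiv p)) c \<noteq> 0" "norm c < \<alpha>" "poly p c \<in> interior L"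
  obtains \<delta> \<kappa> where "\<kappa> > 0" "norm c + 2 * \<delta> < \<alpha>" "simple_zero (pderiv p) c \<delta>"
    "\<And>x y. norm (y - c) < 2 * \<delta> \<Longrightarrow> x \<notin> L \<Longrightarrow> \<kappa> \<le> norm (poly p y - x)"
proof -
  obtain \<rho> where \<rho>: "\<rho> > 0" "ball (poly p c) \<rho> \<subseteq> L" using c(4) unfolding mem_interior by blast
  have "isCont (poly p) c" by simp
  then obtain e1 where e1: "e1 > 0" "\<And>y. dist y c < e1 \<Longrightarrow> dist (poly p y) (poly p c) < \<rho> / 2"
    using \<rho>(1) unfolding continuous_at_eps_delta by (meson half_gt_zero)
  define A where "A = poly (pderiv (pderiv p)) c"
  have A: "norm A > 0" using c(2) by (simp add: A_def)
  have "isCont (poly (pderiv (pderiv p))) c" by simp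
  then obtain e2 where e2: "e2 > 0" "\<And>y. dist y c < e2 \<Longrightarrow> dist (poly (pderiv (pderiv p)) y) A < norm A / 4"
    using A unfolding continuous_at_eps_delta A_def by (metis divide_pos_pos zero_less_numeral)
  define \<delta> where "\<delta> = min (min e1 e2) (\<alpha> - norm c) / 4"
  have "4 * \<delta> \<le> e1" "4 * \<delta> \<le> e2" "4 * \<delta> \<le> \<alpha> - norm c" "\<delta> > 0"
    using e1(1) e2(1) c(3) unfolding \<delta>_def by auto
  then have \<delta>: "\<delta> > 0" "2 * \<delta> < e1" "2 * \<delta> < e2" "norm c + 2 * \<delta> < \<alpha>"
    using c(3) by linarith+
  have "simple_zero (pderiv p) c \<delta>"
  proof
    fix y assume y: "norm (y - c) < 2 * \<delta>"
    then have "norm (poly (pderiv (pderiv p)) y - A) < norm A / 4" using e2(2)[of y] \<delta>(3) by (simp add: dist_norm)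
    moreover have "norm (1 - poly (pderiv (pderiv p)) y / A) = norm (poly (pderiv (pderiv p)) y - A) / norm A"
      using A by (subst norm_divide[symmetric], subst norm_minus_commute) (simp add: diff_divide_distrib)
    ultimately show "norm (1 - poly (pderiv (pderiv p)) y / poly (pderiv (pderiv p)) c) \<le> 1 / 4"
      unfolding A_def[symmetric] using A by (simp add: pos_divide_le_eq)
  qed (use c \<delta>(1) in auto)
  moreover have "\<rho> / 2 \<le> norm (poly p y - x)" if "norm (y - c) < 2 * \<delta>" "x \<notin> L" for x y
  proof -
    have "dist (poly p y) (poly p c) < \<rho> / 2" using e1(2)[of y] that(1) \<delta>(2) by (simp add: dist_norm)
    moreover have "\<rho> \<le> dist (poly p c) x" using \<rho>(2) that(2) by (meson mem_ball not_le subsetD)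
    ultimately show ?thesis using dist_triangle[of "poly p c" x "poly p y"] by (simp add: dist_norm norm_minus_commute)
  qed
  ultimately show ?thesis using that[of "\<rho> / 2" \<delta>] \<rho>(1) \<delta>(4) by simp
qed

theorem theorem4p5:
  fixes p q :: "complex poly" and d :: nat and R r \<alpha> :: real
  assumes "d \<ge> 2"
    and "p = monom 1 d + q" and "degree q < d"
    and "R > 0" and "0 < r" and "r < 1" and "\<alpha> > 0"
    and "\<And>y::complex. norm y \<ge> \<alpha> \<Longrightarrow>
           norm (poly q y / y ^ d) + (R + 1) / norm y ^ (d - 1) < r"
    and "\<And>y::complex. norm y \<ge> \<alpha> \<Longrightarrow> norm (poly p y) > (2 * R + 1) * norm y"
    and "hyperbolic_poly p" and "connected (julia p)"
    and "\<And>c. critical_point p c \<Longrightarrow> simple_critical_point p c"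
  shows "\<exists>\<epsilon>. 0 < \<epsilon> \<and> \<epsilon> \<le> R \<and>
    (\<forall>a c. norm a < \<epsilon> \<longrightarrow> critical_point p c \<longrightarrow>
       is_primary_component p \<alpha> a c (primary_component p \<alpha> a c) \<and>
       conformally_punctured_disk (primary_component p \<alpha> a c) \<and>
       (\<exists>\<Phi>. (\<forall>z \<in> primary_component p \<alpha> a c \<inter> V_plus \<alpha>. \<Phi> z = phi_plus p a z) \<and>
            biholomorphism (primary_component p \<alpha> a c) (- cball 0 1) \<Phi>))"
proof -
  interpret escape_data p q d R r \<alpha>
    by unfold_locales (use assms in auto)
  obtain L N m where L: "compact L" "L \<subseteq> filled_julia p" "N \<ge> 1" "(poly p ^^ N) ` L \<subseteq> interior L" "m > 0"
    and mL: "\<And>x. x \<notin> L \<Longrightarrow> m \<le> norm (poly (pderiv p) x)"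
    and cL: "\<And>c. poly (pderiv p) c = 0 \<Longrightarrow> poly p c \<in> interior L"
    using hyperbolic_trap[OF assms(10,11)] by metis
  obtain \<epsilon>1 where e1: "\<epsilon>1 > 0" "\<And>a z. norm a < \<epsilon>1 \<Longrightarrow> fst z \<in> L \<Longrightarrow> norm (snd z) \<le> \<alpha> \<Longrightarrow> z \<in> K_plus p a"
    using trap_perturb[OF L(1-4)] by metis
  let ?Q = "\<lambda>a c. is_primary_component p \<alpha> a c (primary_component p \<alpha> a c) \<and>
       conformally_punctured_disk (primary_component p \<alpha> a c) \<and>
       (\<exists>\<Phi>. (\<forall>z \<in> primary_component p \<alpha> a c \<inter> V_plus \<alpha>. \<Phi> z = phi_plus p a z) \<and>
            biholomorphism (primary_component p \<alpha> a c) (- cball 0 1) \<Phi>)"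
  \<comment> \<open>k + 1 instead of k avoids division by zero; the factor 2 leaves room for strict
    inequalities.\<close>
  have small_mult: "b * k \<le> e / 2" if "b < e / (2 * (k + 1))" "b \<ge> 0" "k \<ge> 0" "e > 0" for b k e :: real
  proof -
    have "b * (2 * (k + 1)) < e" using that by (simp add: pos_less_divide_eq)
    then show ?thesis using that by (simp add: algebra_simps)
  qed
  have ex: "\<exists>\<epsilon>>0. \<epsilon> \<le> R \<and> (\<forall>a. norm a < \<epsilon> \<longrightarrow> ?Q a c)" if c: "poly (pderiv p) c = 0" for c
  proof -
    have c2: "poly (pderiv (pderiv p)) c \<noteq> 0"
      using assms(12)[of c] c by (simp add: critical_point_def simple_critical_point_def)
    have "poly p c \<in> filled_julia p" using cL[OF c] L(2) interior_subset by blast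
    then have "norm c < \<alpha>" using p_in_K_iff K_less by blast
    then obtain \<delta> \<kappa> where dk: "\<kappa> > 0" "norm c + 2 * \<delta> < \<alpha>" "simple_zero (pderiv p) c \<delta>"
      "\<And>x y. norm (y - c) < 2 * \<delta> \<Longrightarrow> x \<notin> L \<Longrightarrow> \<kappa> \<le> norm (poly p y - x)"
      using critical_strip[OF c c2 _ cL[OF c]] by metis
    have \<delta>: "\<delta> > 0" using dk(3) by (simp add: simple_zero_def)
    \<comment> \<open>The size of perturbation that the simple zero c of p' tolerates.\<close>
    define e2 where "e2 = norm (poly (pderiv (pderiv p)) c) * \<delta> / 8"
    have e2: "e2 > 0" using c2 \<delta> by (simp add: e2_def)
    define k1 where "k1 = 4 * \<alpha> + 12 * C0"
    define k2 where "k2 = 2 / m + 12 * C0 / \<kappa>"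
    have k: "k1 \<ge> 0" "k2 \<ge> 0" using alpha_pos C0_nonneg L(5) dk(1) by (simp_all add: k1_def k2_def)
    \<comment> \<open>One entry for each smallness condition on a: the range of the parameter, the
      trap, the cone, |a|^2 <= |a|, the inclusion of the strip in \<open>Om\<close>, and the Newton
      threshold.\<close>
    define \<epsilon> where "\<epsilon> = Min {R, \<epsilon>1, m\<^sup>2 / 4, 1, \<kappa> / (2 * (k1 + 1)), e2 / (2 * (k2 + 1))}"
    have "\<epsilon> > 0" unfolding \<epsilon>_def using R_pos e1(1) L(5) dk(1) e2 k by simp
    moreover have "\<epsilon> \<le> R" unfolding \<epsilon>_def by simp
    moreover have "?Q a c" if "norm a < \<epsilon>" for a
    proof -
      have a: "norm a < R" "norm a < \<epsilon>1" "norm a < m\<^sup>2 / 4" "norm a < 1"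
        "norm a < \<kappa> / (2 * (k1 + 1))" "norm a < e2 / (2 * (k2 + 1))"
        using that unfolding \<epsilon>_def by simp_all
      have ka: "norm a * k1 \<le> \<kappa> / 2" "norm a * k2 \<le> e2 / 2"
        using small_mult[OF a(5) norm_ge_zero k(1) dk(1)] small_mult[OF a(6) norm_ge_zero k(2) e2] by auto
      interpret simple_zero "pderiv p" c \<delta> by (rule dk(3))
      interpret henon_crit p q d R r \<alpha> a L m c \<delta> \<kappa>
      proof unfold_locales
        show "norm a \<le> R" "norm a \<le> m\<^sup>2 / 4" "norm a \<le> 1" using a by simp_all
        show "L \<subseteq> filled_julia p" "m > 0" "\<kappa> > 0" "norm c + 2 * \<delta> < \<alpha>" using L dk by auto
        show "z \<in> K_plus p a" if "fst z \<in> L" "norm (snd z) \<le> \<alpha>" for z using e1(2)[OF a(2) that] .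
        show "m \<le> norm (poly (pderiv p) x)" if "x \<notin> L" for x using mL[OF that] .
        show "\<kappa> \<le> norm (poly p y - x)" if "norm (y - c) < 2 * \<delta>" "x \<notin> L" for x y using dk(4)[OF that] .
        show "norm a * (4 * \<alpha> + 12 * C0) < \<kappa>" using ka(1) dk(1) unfolding k1_def by linarith
        show "norm a * (2 / m + 12 * C0 / \<kappa>) \<le> norm (poly (pderiv (pderiv p)) c) * \<delta> / 8"
          using ka(2) e2 unfolding k2_def e2_def by linarith
      qed
      show ?thesis by (rule primary_component_biholomorphic)
    qed
    ultimately show ?thesis by blast
  qed
  \<comment> \<open>There are finitely many critical points, so the individual thresholds have a
    positive minimum; R is inserted to enforce the upper bound.\<close>
  define Cr where "Cr = {c. poly (pderiv p) c = 0}"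
  have "pderiv p \<noteq> 0" using degree_p d2 by (simp add: pderiv_eq_0_iff)
  then have fin: "finite Cr" unfolding Cr_def by (rule poly_roots_finite)
  have "\<forall>c\<in>Cr. \<exists>\<epsilon>>0. \<epsilon> \<le> R \<and> (\<forall>a. norm a < \<epsilon> \<longrightarrow> ?Q a c)"
    using ex unfolding Cr_def by simp
  then have "\<exists>E. \<forall>c\<in>Cr. E c > 0 \<and> E c \<le> R \<and> (\<forall>a. norm a < E c \<longrightarrow> ?Q a c)" by (rule bchoice)
  then obtain E where E: "\<And>c. c \<in> Cr \<Longrightarrow> E c > 0 \<and> E c \<le> R \<and> (\<forall>a. norm a < E c \<longrightarrow> ?Q a c)"
    by (elim exE) (rule that, erule bspec)
  define \<epsilon> where "\<epsilon> = Min (insert R (E ` Cr))"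
  have "0 < \<epsilon>" unfolding \<epsilon>_def using fin E R_pos by (subst Min_gr_iff) auto
  moreover have "\<epsilon> \<le> R" unfolding \<epsilon>_def using fin by simp
  moreover have "?Q a c" if "norm a < \<epsilon>" "critical_point p c" for a c
  proof -
    have c: "c \<in> Cr" using that(2) by (simp add: Cr_def critical_point_def)
    have "\<epsilon> \<le> E c" unfolding \<epsilon>_def using fin c by simp
    then show ?thesis using E[OF c] that(1) by (meson less_le_trans)
  qed
  ultimately show ?thesis by blast
qed

end
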